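(* For every $n\ge 3$ the following hold (where $\cong$ denotes isomorphism of real Lie algebras and $=$ equality of subalgebras of $\mathfrak{su}(2^n)$): $\mathfrak a_0(n)\cong\mathfrak u(1)^{\oplus(n-1)}$; $\mathfrak a_1(n)\cong\mathfrak{so}(n)$; $\mathfrak a_2(n)\cong\mathfrak a_4(n)\cong\mathfrak{so}(n)\oplus\mathfrak{so}(n)$; $\mathfrak a_3(n)\cong \mathfrak{so}(2^{n-2})^{\oplus4}$ if $n\equiv0 \pmod 8$, $\cong\mathfrak{so}(2^{n-1})$ if $n\equiv\pm1\pmod 8$, $\cong\mathfrak{su}(2^{n-2})^{\oplus2}$ if $n\equiv\pm2\pmod 8$, $\cong\mathfrak{sp}(2^{n-2})$ if $n\equiv\pm3\pmod 8$, $\cong\mathfrak{sp}(2^{n-3})^{\oplus4}$ if $n\equiv4\pmod 8$; $\mathfrak a_5(n)\cong\mathfrak{so}(2^{n-2})^{\oplus4}$ if $n\equiv0\pmod 6$, $\cong\mathfrak{so}(2^{n-1})$ if $n\equiv\pm1\pmod 6$, $\cong\mathfrak{su}(2^{n-2})^{\oplus2}$ if $n\equiv\pm2\pmod 6$, $\cong\mathfrak{sp}(2^{n-2})$ if $n\equiv3\pmod 6$; $\mathfrak a_6(n)\cong\mathfrak a_7(n)\cong\mathfrak a_{10}(n)\cong\mathfrak{su}(2^{n-1})$ if $n$ is odd and $\cong\mathfrak{su}(2^{n-2})^{\oplus4}$ if $n\ge4$ is even; $\mathfrak a_8(n)\cong\mathfrak{so}(2n-1)$; $\mathfrak a_9(n)\cong\mathfrak{sp}(2^{n-2})$;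 $\mathfrak a_{11}(n)=\mathfrak a_{16}(n)=\mathfrak{so}(2^n)$ for $n\ge4$; $\mathfrak a_k(n)=\mathfrak{su}(2^n)$ for $k\in\{12,17,18,19,21,22\}$ and $n\ge4$; $\mathfrak a_{13}(n)=\mathfrak a_{20}(n)\cong\mathfrak a_{15}(n)\cong\mathfrak{su}(2^{n-1})\oplus\mathfrak{su}(2^{n-1})$; $\mathfrak a_{14}(n)\cong\mathfrak{so}(2n)$; $\mathfrak b_0(n)\cong\mathfrak u(1)^{\oplus n}$; $\mathfrak b_1(n)\cong\mathfrak u(1)^{\oplus(2n-1)}$; $\mathfrak b_2(n)\cong\mathfrak{sp}(2^{n-2})\oplus\mathfrak u(1)$; $\mathfrak b_3(n)\cong\mathfrak{su}(2)^{\oplus n}$; $\mathfrak b_4(n)\cong\mathfrak{su}(2^{n-1})\oplus\mathfrak{su}(2^{n-1})\oplus\mathfrak u(1)$.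
   Context: Pauli matrices $I,X,Y,Z$ are the standard $2\times2$ matrices. A length-$n$ Pauli string is $A^1\otimes\cdots\otimes A^n$ with $A^j\in\{I,X,Y,Z\}$, written $A^1A^2\cdots A^n$. For two-qubit strings $AB$ and $1\le i\ne j\le n$, $A_iB_j$ denotes the length-$n$ string with $A$ in position $i$, $B$ in position $j$ and $I$ elsewhere (so e.g. $XI$ placed at $(j,j+1)$ gives $X_j$). $\mathfrak{su}(N)$ is the real Lie algebra of traceless skew-Hermitian $N\times N$ matrices under the commutator; $\mathfrak{so}(N)$ is the real skew-symmetric matrices; $\mathfrak{sp}(N)=\{a\in\mathfrak{su}(2N): a^TJ=-Ja\}$ with $J=\begin{pmatrix}0&I_N\\-I_N&0\end{pmatrix}$; $\mathfrak u(1)$ is the one-dimensional real Lie algebra; $\mathfrak g^{\oplus m}$ is a direct sum of $m$ commuting copies. For a set $S$ of Pauli strings, $\mathrm{Lie}\langle S\rangle$ is the smallest real Lie subalgebra of $\mathfrak{u}(2^n)$ containing $\{iP: P\in S\}$. For a set $G$ of two-qubit Pauli strings $AB\neq II$ and $n\ge2$, the open-chain algebra is $G(n)=\mathrm{Lie}\langle A_jB_{j+1}: AB\in G,\ 1\le j\le n-1\rangle\subseteq\mathfrak{su}(2^n)$. Generating sets: $\mathfrak a_0=\{XX\}$, $\mathfrak a_1=\{XY\}$, $\mathfrak a_2=\{XY,YX\}$, $\mathfrak a_3=\{XX,YZ\}$, $\mathfrak a_4=\{XX,YY\}$, $\mathfrak a_5=\{XY,YZ\}$, $\mathfrak a_6=\{XX,YZ,ZY\}$,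 $\mathfrak a_7=\{XX,YY,ZZ\}$, $\mathfrak a_8=\{XX,XZ\}$, $\mathfrak a_9=\{XY,XZ\}$, $\mathfrak a_{10}=\{XY,YZ,ZX\}$, $\mathfrak a_{11}=\{XY,YX,YZ\}$, $\mathfrak a_{12}=\{XX,XY,YZ\}$, $\mathfrak a_{13}=\{XX,YY,YZ\}$, $\mathfrak a_{14}=\{XX,YY,XY\}$, $\mathfrak a_{15}=\{XX,XY,XZ\}$, $\mathfrak a_{16}=\{XY,YX,YZ,ZY\}$, $\mathfrak a_{17}=\{XX,XY,ZX\}$, $\mathfrak a_{18}=\{XX,XZ,YY,ZY\}$, $\mathfrak a_{19}=\{XX,XY,ZX,YZ\}$, $\mathfrak a_{20}=\{XX,YY,ZZ,ZY\}$, $\mathfrak a_{21}=\{XX,YY,XY,ZX\}$, $\mathfrak a_{22}=\{XX,XY,XZ,YX\}$, $\mathfrak b_0=\{XI,IX\}$, $\mathfrak b_1=\{XX,XI,IX\}$, $\mathfrak b_2=\{XY,XI,IX\}$, $\mathfrak b_3=\{XI,YI,IX,IY\}$, $\mathfrak b_4=\{XX,XY,XI,IX\}$. We write $\mathfrak a_k(n)$, $\mathfrak b_l(n)$ for the open-chain algebras of these generating sets. *)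

theory Defs
  imports Complex_Main "Jordan_Normal_Form.Matrix"
begin

datatype pauli = PI | PX | PY | PZ

definition pmat :: "pauli \<Rightarrow> complex mat" where
  "pmat p = (case p of
     PI \<Rightarrow> mat_of_rows_list 2 [[1, 0], [0, 1]]
   | PX \<Rightarrow> mat_of_rows_list 2 [[0, 1], [1, 0]]
   | PY \<Rightarrow> mat_of_rows_list 2 [[0, -\<i>], [\<i>, 0]]
   | PZ \<Rightarrow> mat_of_rows_list 2 [[1, 0], [0, -1]])"

definition kron :: "complex mat \<Rightarrow> complex mat \<Rightarrow> complex mat" where
  "kron A B = mat (dim_row A * dim_row B) (dim_col A * dim_col B)
     (\<lambda>(i, j). A $$ (i div dim_row B, j div dim_col B) * B $$ (i mod dim_row B, j mod dim_col B))"

fun pstring :: "pauli list \<Rightarrow> complex mat" where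
  "pstring [] = 1\<^sub>m 1"
| "pstring (p # ps) = kron (pmat p) (pstring ps)"

text \<open>A_i B_j for 1-based positions i, j: length-n string, A at i, B at j, I elsewhere.\<close>
definition placed :: "nat \<Rightarrow> nat \<Rightarrow> pauli \<Rightarrow> nat \<Rightarrow> pauli \<Rightarrow> pauli list" where
  "placed n i A j B = (replicate n PI)[i - 1 := A, j - 1 := B]"

definition comm :: "complex mat \<Rightarrow> complex mat \<Rightarrow> complex mat" where
  "comm A B = A * B - B * A"

definition real_lie_subalg :: "nat \<Rightarrow> complex mat set \<Rightarrow> bool" where
  "real_lie_subalg N L \<longleftrightarrow> L \<subseteq> carrier_mat N N \<and> 0\<^sub>m N N \<in> L
     \<and> (\<forall>A\<in>L. \<forall>B\<in>L. A + B \<in> L \<and> comm A B \<in> L)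
     \<and> (\<forall>A\<in>L. \<forall>r::real. complex_of_real r \<cdot>\<^sub>m A \<in> L)"

definition lie_gen :: "nat \<Rightarrow> complex mat set \<Rightarrow> complex mat set" where
  "lie_gen N S = \<Inter> {L. real_lie_subalg N L \<and> S \<subseteq> L}"

definition lie_iso :: "complex mat set \<Rightarrow> complex mat set \<Rightarrow> bool" (infix "\<cong>\<^sub>L" 50) where
  "L1 \<cong>\<^sub>L L2 \<longleftrightarrow> (\<exists>f. bij_betw f L1 L2 \<and>
     (\<forall>A\<in>L1. \<forall>B\<in>L1. f (A + B) = f A + f B \<and> f (comm A B) = comm (f A) (f B)) \<and>
     (\<forall>A\<in>L1. \<forall>r::real. f (complex_of_real r \<cdot>\<^sub>m A) = complex_of_real r \<cdot>\<^sub>m f A))"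

definition u_alg :: "nat \<Rightarrow> complex mat set" where
  "u_alg N = {A \<in> carrier_mat N N. \<forall>i<N. \<forall>j<N. A $$ (i, j) = - cnj (A $$ (j, i))}"

definition su_alg :: "nat \<Rightarrow> complex mat set" where
  "su_alg N = {A \<in> u_alg N. (\<Sum>i<N. A $$ (i, i)) = 0}"

definition so_alg :: "nat \<Rightarrow> complex mat set" where
  "so_alg N = {A \<in> carrier_mat N N. (\<forall>i<N. \<forall>j<N. A $$ (i, j) \<in> \<real>) \<and> transpose_mat A = - A}"

definition Jmat :: "nat \<Rightarrow> complex mat" where
  "Jmat N = four_block_mat (0\<^sub>m N N) (1\<^sub>m N) (- 1\<^sub>m N) (0\<^sub>m N N)"

definition sp_alg :: "nat \<Rightarrow> complex mat set" where
  "sp_alg N = {A \<in> su_alg (2 * N). transpose_mat A * Jmat N = - (Jmat N * A)}"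

definition u1 :: "complex mat set" where
  "u1 = u_alg 1"

definition dsum :: "complex mat set \<Rightarrow> complex mat set \<Rightarrow> complex mat set" (infixr "\<oplus>\<^sub>L" 65) where
  "L1 \<oplus>\<^sub>L L2 = {four_block_mat A (0\<^sub>m (dim_row A) (dim_col B)) (0\<^sub>m (dim_row B) (dim_col A)) B
                 | A B. A \<in> L1 \<and> B \<in> L2}"

fun dpow :: "complex mat set \<Rightarrow> nat \<Rightarrow> complex mat set" where
  "dpow L 0 = {0\<^sub>m 0 0}"
| "dpow L (Suc 0) = L"
| "dpow L (Suc (Suc m)) = L \<oplus>\<^sub>L dpow L (Suc m)"

definition chain_alg :: "(pauli \<times> pauli) set \<Rightarrow> nat \<Rightarrow> complex mat set" where
  "chain_alg G n = lie_gen (2 ^ n)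
     {\<i> \<cdot>\<^sub>m pstring (placed n j A (j + 1) B) | A B j. (A, B) \<in> G \<and> 1 \<le> j \<and> j \<le> n - 1}"

definition a_gens :: "nat \<Rightarrow> (pauli \<times> pauli) set" where
  "a_gens k = [
     {(PX,PX)},
     {(PX,PY)},
     {(PX,PY),(PY,PX)},
     {(PX,PX),(PY,PZ)},
     {(PX,PX),(PY,PY)},
     {(PX,PY),(PY,PZ)},
     {(PX,PX),(PY,PZ),(PZ,PY)},
     {(PX,PX),(PY,PY),(PZ,PZ)},
     {(PX,PX),(PX,PZ)},
     {(PX,PY),(PX,PZ)},
     {(PX,PY),(PY,PZ),(PZ,PX)},
     {(PX,PY),(PY,PX),(PY,PZ)},
     {(PX,PX),(PX,PY),(PY,PZ)},
     {(PX,PX),(PY,PY),(PY,PZ)},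
     {(PX,PX),(PY,PY),(PX,PY)},
     {(PX,PX),(PX,PY),(PX,PZ)},
     {(PX,PY),(PY,PX),(PY,PZ),(PZ,PY)},
     {(PX,PX),(PX,PY),(PZ,PX)},
     {(PX,PX),(PX,PZ),(PY,PY),(PZ,PY)},
     {(PX,PX),(PX,PY),(PZ,PX),(PY,PZ)},
     {(PX,PX),(PY,PY),(PZ,PZ),(PZ,PY)},
     {(PX,PX),(PY,PY),(PX,PY),(PZ,PX)},
     {(PX,PX),(PX,PY),(PX,PZ),(PY,PX)}] ! k"

definition b_gens :: "nat \<Rightarrow> (pauli \<times> pauli) set" where
  "b_gens l = [
     {(PX,PI),(PI,PX)},
     {(PX,PX),(PX,PI),(PI,PX)},
     {(PX,PY),(PX,PI),(PI,PX)},
     {(PX,PI),(PY,PI),(PI,PX),(PI,PY)},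
     {(PX,PX),(PX,PY),(PX,PI),(PI,PX)}] ! l"

definition aa :: "nat \<Rightarrow> nat \<Rightarrow> complex mat set" where
  "aa k n = chain_alg (a_gens k) n"

definition bb :: "nat \<Rightarrow> nat \<Rightarrow> complex mat set" where
  "bb l n = chain_alg (b_gens l) n"

end

theory Submission
  imports Defs
begin

text \<open>Up to a nonzero real factor the commutator of two anticommuting Pauli strings is their product,
  so a chain algebra is the real span of the closure \<open>cl\<close> of its generators under products of
  anticommuting strings. Modulo phases a string is a vector over the field with two elements, and anticommutation
  is a symplectic form; a linear map preserving this form and injective on a closed set of strings lifts to an isomorphism of the
  spans, because the signs form a cocycle that splits.

  For the small algebras \<open>cl\<close> is a set of products of pairs of anticommuting (Majorana) strings, or
  consists of commuting pieces. For the large ones \<open>cl\<close> consists of all strings that satisfy the evident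
  invariants (a linear constraint, a quadratic form) and anticommute with some generator: the generators move the
  first letter of such a string to the identity, so only finitely many short strings need to be searched.
  Relabelling the letters site by site turns these invariants into vanishing total letter and a
  quadratic form; folding away the constraint leaves a nondegenerate form, whose Arf invariant separates
  \<open>so\<close> from \<open>sp\<close> and is periodic in the length of the chain.\<close>

section \<open>Pauli strings as vectors over the field with two elements\<close>

text \<open>Product of Pauli matrices up to the phase \<open>ph\<close>.\<close>

fun pm :: "pauli \<Rightarrow> pauli \<Rightarrow> pauli" where
  "pm PI q = q" | "pm p PI = p"
| "pm PX PX = PI" | "pm PX PY = PZ" | "pm PX PZ = PY"
| "pm PY PX = PZ" | "pm PY PY = PI" | "pm PY PZ = PX"
| "pm PZ PX = PY" | "pm PZ PY = PX" | "pm PZ PZ = PI"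

fun ph :: "pauli \<Rightarrow> pauli \<Rightarrow> complex" where
  "ph PX PY = \<i>" | "ph PY PX = - \<i>"
| "ph PY PZ = \<i>" | "ph PZ PY = - \<i>"
| "ph PZ PX = \<i>" | "ph PX PZ = - \<i>"
| "ph _ _ = 1"

definition an :: "pauli \<Rightarrow> pauli \<Rightarrow> bool" where
  "an p q \<longleftrightarrow> p \<noteq> PI \<and> q \<noteq> PI \<and> p \<noteq> q"

lemma UNIV_pauli: "(UNIV :: pauli set) = {PI, PX, PY, PZ}"
  using pauli.exhaust by auto

lemma pm_PI [simp]: "pm p PI = p" and pm_self [simp]: "pm p p = PI"
  by (cases p; simp)+

lemma pm_comm: "pm p q = pm q p"
  by (cases p; cases q; simp)

lemma pm_assoc: "pm (pm p q) r = pm p (pm q r)"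
  by (cases p; cases q; cases r; simp)

lemma pm_cancel [simp]: "pm p (pm p q) = q"
  by (cases p; cases q; simp)

lemma pm_left_comm: "pm p (pm q r) = pm q (pm p r)"
  by (cases p; cases q; cases r; simp)

lemmas pm_ac = pm_assoc pm_comm pm_left_comm

lemma pm_eq_PI [simp]: "pm p q = PI \<longleftrightarrow> p = q"
  by (cases p; cases q; simp)

lemma pm_inj [simp]: "pm p q = pm p r \<longleftrightarrow> q = r" "pm q p = pm r p \<longleftrightarrow> q = r"
  by (cases p; cases q; cases r; simp)+

lemma an_simps [simp]: "\<not> an PI q" "\<not> an q PI" "\<not> an p p"
  "an PX PY" "an PY PX" "an PX PZ" "an PZ PX" "an PY PZ" "an PZ PY"
  by (auto simp: an_def)

lemma an_sym: "an p q = an q p"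
  by (auto simp: an_def)

lemma an_pm: "an (pm p q) r = (an p r \<noteq> an q r)" "an r (pm p q) = (an r p \<noteq> an r q)"
  by (cases p; cases q; cases r; simp)+

lemma ph_PI [simp]: "ph PI q = 1" "ph p PI = 1" "ph p p = 1"
  by (cases q; simp) (cases p; simp)+

lemma ph_cocycle: "ph p q * ph (pm p q) r = ph q r * ph p (pm q r)"
  by (cases p; cases q; cases r; simp)

lemma ph_square: "ph p q * ph p q = (if an p q then - 1 else 1)"
  by (cases p; cases q; simp)

lemma ph_swap: "ph q p = (if an p q then - ph p q else ph p q)"
  by (cases p; cases q; simp)

abbreviation pzero :: "nat \<Rightarrow> pauli list" where
  "pzero n \<equiv> replicate n PI"

definition strs :: "nat \<Rightarrow> pauli list set" where
  "strs n = {v. length v = n}"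

definition vadd :: "pauli list \<Rightarrow> pauli list \<Rightarrow> pauli list" where
  "vadd v w = map2 pm v w"

fun anti :: "pauli list \<Rightarrow> pauli list \<Rightarrow> bool" where
  "anti (p # v) (q # w) \<longleftrightarrow> an p q \<noteq> anti v w"
| "anti _ _ \<longleftrightarrow> False"

fun phs :: "pauli list \<Rightarrow> pauli list \<Rightarrow> complex" where
  "phs (p # v) (q # w) = ph p q * phs v w"
| "phs _ _ = 1"

lemma strs_iff [simp]: "v \<in> strs n \<longleftrightarrow> length v = n"
  by (simp add: strs_def)

lemma strs_0: "strs 0 = {[]}"
  by (auto simp: strs_def)

lemma strs_Suc: "strs (Suc n) = (\<lambda>(p, v). p # v) ` (UNIV \<times> strs n)"
  by (auto simp: strs_def length_Suc_conv image_iff)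

lemma finite_strs [simp, intro]: "finite (strs n)"
  by (induct n) (auto simp: strs_0 strs_Suc UNIV_pauli)

lemma sum_strs_Suc: "(\<Sum>v\<in>strs (Suc n). f v) = (\<Sum>p\<in>UNIV. \<Sum>v\<in>strs n. f (p # v))"
proof -
  have "(\<Sum>v\<in>strs (Suc n). f v) = (\<Sum>x\<in>UNIV \<times> strs n. f (fst x # snd x))"
    unfolding strs_Suc by (subst sum.reindex) (auto simp: inj_on_def case_prod_beta)
  then show ?thesis
    by (simp add: sum.cartesian_product case_prod_beta)
qed

lemma sum_pauli: "(\<Sum>p\<in>UNIV. f p) = f PI + (f PX + (f PY + f PZ))"
  unfolding UNIV_pauli by simp

lemma vadd_simps [simp]: "vadd [] w = []" "vadd v [] = []"
  "vadd (p # v) (q # w) = pm p q # vadd v w"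
  by (auto simp: vadd_def)

lemma length_vadd [simp]: "length (vadd v w) = min (length v) (length w)"
  by (simp add: vadd_def)

lemma vadd_comm: "vadd v w = vadd w v"
  by (induct v w rule: list_induct2') (auto simp: pm_comm)

lemma vadd_assoc: "vadd (vadd u v) w = vadd u (vadd v w)"
proof (induct u v arbitrary: w rule: list_induct2')
  case (4 x xs y ys)
  then show ?case by (cases w) (auto simp: pm_assoc)
qed auto

lemma vadd_left_comm: "vadd u (vadd v w) = vadd v (vadd u w)"
  by (metis vadd_assoc vadd_comm)

lemmas vadd_ac = vadd_assoc vadd_comm vadd_left_comm

lemma vadd_self [simp]: "vadd v v = pzero (length v)"
  by (induct v) auto

lemma vadd_zero: "length v = n \<Longrightarrow> vadd v (pzero n) = v" "length v = n \<Longrightarrow> vadd (pzero n) v = v"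
  by (induct v arbitrary: n) auto

lemma vadd_cancel: "length v = length w \<Longrightarrow> vadd v (vadd v w) = w"
  by (induct v w rule: list_induct2) auto

lemma vadd_cancel_right: "length v = length w \<Longrightarrow> vadd (vadd w v) v = w"
  by (metis vadd_cancel vadd_comm)

lemma vadd_eq_zero: "length v = length w \<Longrightarrow> vadd v w = pzero (length v) \<longleftrightarrow> v = w"
  by (induct v w rule: list_induct2) auto

lemma anti_sym: "anti v w = anti w v"
  by (induct v w rule: list_induct2') (auto simp: an_sym)

lemma anti_self [simp]: "\<not> anti v v"
  by (induct v) auto

lemma anti_zero [simp]: "\<not> anti v (pzero n)" "\<not> anti (pzero n) v"
proof -
  show "\<not> anti v (pzero n)"
  proof (induct v arbitrary: n)
    case (Cons a v)
    then show ?case by (cases n) auto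
  qed simp
  then show "\<not> anti (pzero n) v" by (simp add: anti_sym)
qed

lemma anti_vadd: "length u = length v \<Longrightarrow> length v = length w \<Longrightarrow> anti (vadd u v) w = (anti u w \<noteq> anti v w)"
  by (induct u v w rule: list_induct3) (auto simp: an_pm)

lemma anti_vadd2: "length u = length v \<Longrightarrow> length v = length w \<Longrightarrow> anti w (vadd u v) = (anti w u \<noteq> anti w v)"
  by (metis anti_vadd anti_sym)

lemma anti_append: "length a = length b \<Longrightarrow> anti (a @ v) (b @ w) = (anti a b \<noteq> anti v w)"
  by (induct a b rule: list_induct2) auto

lemma vadd_append: "length a = length b \<Longrightarrow> vadd (a @ v) (b @ w) = vadd a b @ vadd v w"
  by (induct a b rule: list_induct2) auto

lemma phs_cocycle: "length u = length v \<Longrightarrow> length v = length w \<Longrightarrow>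
   phs u v * phs (vadd u v) w = phs v w * phs u (vadd v w)"
proof (induct u v w rule: list_induct3)
  case (Cons x xs y ys z zs)
  have "phs (x # xs) (y # ys) * phs (vadd (x # xs) (y # ys)) (z # zs)
      = (ph x y * ph (pm x y) z) * (phs xs ys * phs (vadd xs ys) zs)" by simp
  also have "\<dots> = (ph y z * ph x (pm y z)) * (phs ys zs * phs xs (vadd ys zs))"
    using Cons by (simp add: ph_cocycle)
  finally show ?case by simp
qed simp

lemma phs_square: "length u = length v \<Longrightarrow> phs u v * phs u v = (if anti u v then - 1 else 1)"
proof (induct u v rule: list_induct2)
  case (Cons x xs y ys)
  have "phs (x # xs) (y # ys) * phs (x # xs) (y # ys) = (ph x y * ph x y) * (phs xs ys * phs xs ys)" by simp
  also have "\<dots> = (if anti (x # xs) (y # ys) then - 1 else 1)"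
    using Cons(2) ph_square[of x y] by (cases "an x y"; cases "anti xs ys") simp_all
  finally show ?case .
qed simp

lemma phs_nonzero: "length u = length v \<Longrightarrow> phs u v \<noteq> 0"
  using phs_square[of u v] by (auto split: if_splits)

lemma phs_swap: "length u = length v \<Longrightarrow> phs v u = (if anti u v then - phs u v else phs u v)"
proof (induct u v rule: list_induct2)
  case (Cons x xs y ys)
  then show ?case using ph_swap[of y x] by (auto simp: an_sym[of y x])
qed simp

lemma phs_self [simp]: "phs v v = 1"
  by (induct v) auto

lemma phs_zero [simp]: "phs (pzero n) v = 1" "phs v (pzero n) = 1"
proof -
  show "phs (pzero n) v = 1"
  proof (induct v arbitrary: n)
    case (Cons a v)
    then show ?case by (cases n) auto
  qed simp
  show "phs v (pzero n) = 1"
  proof (induct v arbitrary: n)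
    case (Cons a v)
    then show ?case by (cases n) auto
  qed simp
qed

lemma phs_anti: assumes "length u = length v" "anti u v" shows "phs u v = of_real (Im (phs u v)) * \<i>" "Im (phs u v) \<noteq> 0"
proof -
  have "phs u v * phs u v = \<i> * \<i>" using phs_square[of u v] assms by simp
  then have "phs u v = \<i> \<or> phs u v = - \<i>" by (metis square_eq_iff)
  then show "phs u v = of_real (Im (phs u v)) * \<i>" "Im (phs u v) \<noteq> 0" by auto
qed

text \<open>The strings of the Lie algebra generated by \<open>G\<close>: commutators of anticommuting
  strings are nonzero multiples of their product.\<close>

inductive_set cl :: "pauli list set \<Rightarrow> pauli list set" for G where
  base: "g \<in> G \<Longrightarrow> g \<in> cl G"
| step: "v \<in> cl G \<Longrightarrow> w \<in> cl G \<Longrightarrow> anti v w \<Longrightarrow> vadd v w \<in> cl G"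

definition aclosed :: "pauli list set \<Rightarrow> bool" where
  "aclosed S \<longleftrightarrow> (\<forall>v\<in>S. \<forall>w\<in>S. anti v w \<longrightarrow> vadd v w \<in> S)"

lemma aclosed_cl [simp]: "aclosed (cl G)"
  by (auto simp: aclosed_def intro: cl.step)

lemma cl_least:
  assumes "G \<subseteq> S" "aclosed S"
  shows "cl G \<subseteq> S"
proof
  fix v assume "v \<in> cl G"
  then show "v \<in> S"
    by (induct rule: cl.induct) (use assms in \<open>auto simp: aclosed_def\<close>)
qed

lemma cl_mono: "G \<subseteq> cl H \<Longrightarrow> cl G \<subseteq> cl H"
  by (simp add: cl_least)

lemma cl_strs: "G \<subseteq> strs n \<Longrightarrow> cl G \<subseteq> strs n"
  by (rule cl_least) (auto simp: aclosed_def)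

lemma cl_image:
  assumes "G \<subseteq> V" "\<And>v w. v \<in> V \<Longrightarrow> w \<in> V \<Longrightarrow> vadd v w \<in> V"
    "\<And>v w. v \<in> V \<Longrightarrow> w \<in> V \<Longrightarrow> \<phi> (vadd v w) = vadd (\<phi> v) (\<phi> w)"
    "\<And>v w. v \<in> V \<Longrightarrow> w \<in> V \<Longrightarrow> anti (\<phi> v) (\<phi> w) = anti v w"
  shows "cl (\<phi> ` G) = \<phi> ` cl G"
proof
  have clV: "cl G \<subseteq> V" using assms(1,2) by (intro cl_least) (auto simp: aclosed_def)
  show "cl (\<phi> ` G) \<subseteq> \<phi> ` cl G"
  proof (rule cl_least)
    show "\<phi> ` G \<subseteq> \<phi> ` cl G" by (auto intro: cl.base)
    show "aclosed (\<phi> ` cl G)"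
      unfolding aclosed_def
    proof (intro ballI impI)
      fix x y assume "x \<in> \<phi> ` cl G" "y \<in> \<phi> ` cl G" and a: "anti x y"
      then obtain v w where vw: "v \<in> cl G" "w \<in> cl G" "x = \<phi> v" "y = \<phi> w" by auto
      moreover have "v \<in> V" "w \<in> V" using vw clV by auto
      ultimately have "anti v w" "vadd x y = \<phi> (vadd v w)" using a assms by simp_all
      then show "vadd x y \<in> \<phi> ` cl G" using vw by (auto intro: cl.step)
    qed
  qed
  show "\<phi> ` cl G \<subseteq> cl (\<phi> ` G)"
  proof
    fix x assume "x \<in> \<phi> ` cl G"
    then obtain v where v: "v \<in> cl G" "x = \<phi> v" by auto
    from v(1) have "\<phi> v \<in> cl (\<phi> ` G)"
    proof (induct rule: cl.induct)
      case (step v w)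
      have "v \<in> V" "w \<in> V" using step clV by auto
      then have "\<phi> (vadd v w) = vadd (\<phi> v) (\<phi> w)" "anti (\<phi> v) (\<phi> w)" using assms step by simp_all
      then show ?case using step by (auto intro: cl.step)
    qed (auto intro: cl.base)
    then show "x \<in> cl (\<phi> ` G)" using v by simp
  qed
qed

section \<open>Matrices of Pauli strings\<close>

abbreviation pe :: "pauli list \<Rightarrow> nat \<Rightarrow> nat \<Rightarrow> complex" where
  "pe v i j \<equiv> pstring v $$ (i, j)"

lemma pmat_dim [simp]: "dim_row (pmat p) = 2" "dim_col (pmat p) = 2"
  by (cases p; simp add: pmat_def mat_of_rows_list_def)+

lemma pmat_entries [simp]:
  "pmat PI $$ (0, 0) = 1" "pmat PI $$ (0, Suc 0) = 0" "pmat PI $$ (Suc 0, 0) = 0" "pmat PI $$ (Suc 0, Suc 0) = 1"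
  "pmat PX $$ (0, 0) = 0" "pmat PX $$ (0, Suc 0) = 1" "pmat PX $$ (Suc 0, 0) = 1" "pmat PX $$ (Suc 0, Suc 0) = 0"
  "pmat PY $$ (0, 0) = 0" "pmat PY $$ (0, Suc 0) = - \<i>" "pmat PY $$ (Suc 0, 0) = \<i>" "pmat PY $$ (Suc 0, Suc 0) = 0"
  "pmat PZ $$ (0, 0) = 1" "pmat PZ $$ (0, Suc 0) = 0" "pmat PZ $$ (Suc 0, 0) = 0" "pmat PZ $$ (Suc 0, Suc 0) = - 1"
  by (simp_all add: pmat_def mat_of_rows_list_def)

lemma pstring_dim [simp]: "dim_row (pstring v) = 2 ^ length v" "dim_col (pstring v) = 2 ^ length v"
  by (induct v) (simp_all add: kron_def)

lemma pstring_carrier [simp, intro]: "length v = n \<Longrightarrow> pstring v \<in> carrier_mat (2 ^ n) (2 ^ n)"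
  by (intro carrier_matI) simp_all

lemma pe_Cons: "i < 2 * 2 ^ length v \<Longrightarrow> j < 2 * 2 ^ length v \<Longrightarrow>
   pe (p # v) i j = pmat p $$ (i div 2 ^ length v, j div 2 ^ length v) * pe v (i mod 2 ^ length v) (j mod 2 ^ length v)"
  by (simp add: kron_def)

lemma div_less_two: "i < 2 * N \<Longrightarrow> i div N = 0 \<or> i div N = Suc 0" for i N :: nat
proof -
  assume "i < 2 * N"
  then have "i div N < 2" by (simp add: less_mult_imp_div_less)
  then show ?thesis by linarith
qed

lemma sum_lessThan_double:
  fixes f :: "nat \<Rightarrow> 'a :: comm_monoid_add"
  shows "(\<Sum>k<2 * N. f k) = (\<Sum>b<N. f b) + (\<Sum>b<N. f (N + b))"
proof -
  have "(\<Sum>k<2 * N. f k) = (\<Sum>m<2. sum f {m * N..<m * N + N})"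
    by (simp only: sum.nat_group)
  also have "\<dots> = sum f {0..<N} + sum f {N..<N + N}"
    by (simp add: numeral_2_eq_2)
  also have "sum f {N..<N + N} = (\<Sum>b<N. f (N + b))"
    using sum.shift_bounds_nat_ivl[of f 0 N N] by (simp add: add.commute lessThan_atLeast0)
  finally show ?thesis by (simp add: lessThan_atLeast0)
qed

lemma sum_split2:
  fixes f :: "nat \<Rightarrow> nat \<Rightarrow> 'a :: comm_monoid_add"
  shows "(\<Sum>k<2 * N. f (k div N) (k mod N)) = (\<Sum>b<N. f 0 b) + (\<Sum>b<N. f (Suc 0) b)"
  by (simp add: sum_lessThan_double)

lemma sum_split22:
  fixes f :: "nat \<Rightarrow> nat \<Rightarrow> nat \<Rightarrow> nat \<Rightarrow> 'a :: comm_monoid_add"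
  shows "(\<Sum>k<2 * N. \<Sum>l<2 * N. f (k div N) (l div N) (k mod N) (l mod N)) =
    (\<Sum>a<N. \<Sum>b<N. f 0 0 a b) + (\<Sum>a<N. \<Sum>b<N. f 0 (Suc 0) a b)
  + ((\<Sum>a<N. \<Sum>b<N. f (Suc 0) 0 a b) + (\<Sum>a<N. \<Sum>b<N. f (Suc 0) (Suc 0) a b))"
  by (simp add: sum_lessThan_double sum.distrib add_ac)

lemma pmat_mult_entry: "a = 0 \<or> a = Suc 0 \<Longrightarrow> b = 0 \<or> b = Suc 0 \<Longrightarrow>
   pmat p $$ (a, 0) * pmat q $$ (0, b) + pmat p $$ (a, Suc 0) * pmat q $$ (Suc 0, b) = ph p q * pmat (pm p q) $$ (a, b)"
  by (cases p; cases q) auto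

lemma pstring_mult_entry:
  "length v = length w \<Longrightarrow> i < 2 ^ length v \<Longrightarrow> j < 2 ^ length v \<Longrightarrow>
   (\<Sum>k<2 ^ length v. pe v i k * pe w k j) = phs v w * pe (vadd v w) i j"
proof (induct v w arbitrary: i j rule: list_induct2)
  case (Cons p v q w)
  let ?N = "2 ^ length v :: nat"
  let ?F = "\<lambda>a b. pmat p $$ (i div ?N, a) * pmat q $$ (a, j div ?N) * (pe v (i mod ?N) b * pe w b (j mod ?N))"
  have ij: "i < 2 * ?N" "j < 2 * ?N" using Cons by auto
  have "(\<Sum>k<2 ^ length (p # v). pe (p # v) i k * pe (q # w) k j) = (\<Sum>k<2 * ?N. ?F (k div ?N) (k mod ?N))"
  proof (rule sum.cong)
    fix k assume "k \<in> {..<2 * ?N}"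
    then show "pe (p # v) i k * pe (q # w) k j = ?F (k div ?N) (k mod ?N)"
      using ij Cons(1) by (simp add: pe_Cons del: pstring.simps)
  qed simp
  also have "\<dots> = (\<Sum>b<?N. ?F 0 b) + (\<Sum>b<?N. ?F (Suc 0) b)" by (rule sum_split2)
  also have "\<dots> = (pmat p $$ (i div ?N, 0) * pmat q $$ (0, j div ?N) + pmat p $$ (i div ?N, Suc 0) * pmat q $$ (Suc 0, j div ?N))
      * (\<Sum>b<?N. pe v (i mod ?N) b * pe w b (j mod ?N))"
    by (simp add: sum_distrib_left distrib_right sum.distrib)
  also have "\<dots> = ph p q * pmat (pm p q) $$ (i div ?N, j div ?N) * (phs v w * pe (vadd v w) (i mod ?N) (j mod ?N))"
    using Cons(2) div_less_two[OF ij(1)] div_less_two[OF ij(2)] by (simp add: pmat_mult_entry)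
  also have "\<dots> = phs (p # v) (q # w) * pe (vadd (p # v) (q # w)) i j"
    using ij Cons(1) by (simp add: pe_Cons del: pstring.simps)
  finally show ?case .
qed simp

lemma pstring_mult:
  assumes "length v = n" "length w = n"
  shows "pstring v * pstring w = phs v w \<cdot>\<^sub>m pstring (vadd v w)"
proof (rule eq_matI)
  fix i j assume "i < dim_row (phs v w \<cdot>\<^sub>m pstring (vadd v w))" "j < dim_col (phs v w \<cdot>\<^sub>m pstring (vadd v w))"
  then have ij: "i < 2 ^ n" "j < 2 ^ n" using assms by auto
  then show "(pstring v * pstring w) $$ (i, j) = (phs v w \<cdot>\<^sub>m pstring (vadd v w)) $$ (i, j)"
    using pstring_mult_entry[of v w i j] assms
    by (simp add: scalar_prod_def lessThan_atLeast0)
qed (use assms in auto)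

lemma pmat_cnj: "a = 0 \<or> a = Suc 0 \<Longrightarrow> b = 0 \<or> b = Suc 0 \<Longrightarrow> cnj (pmat p $$ (a, b)) = pmat p $$ (b, a)"
  by (cases p) auto

lemma pe_cnj: "i < 2 ^ length v \<Longrightarrow> j < 2 ^ length v \<Longrightarrow> cnj (pe v i j) = pe v j i"
proof (induct v arbitrary: i j)
  case (Cons p v)
  then have ij: "i < 2 * 2 ^ length v" "j < 2 * 2 ^ length v" by auto
  show ?case using ij Cons(1) div_less_two[OF ij(1)] div_less_two[OF ij(2)]
    by (simp add: pe_Cons pmat_cnj del: pstring.simps)
qed simp

fun oddY :: "pauli list \<Rightarrow> bool" where
  "oddY [] \<longleftrightarrow> False"
| "oddY (p # v) \<longleftrightarrow> (p = PY) \<noteq> oddY v"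

lemma pmat_transpose: "a = 0 \<or> a = Suc 0 \<Longrightarrow> b = 0 \<or> b = Suc 0 \<Longrightarrow>
   pmat p $$ (b, a) = (if p = PY then - pmat p $$ (a, b) else pmat p $$ (a, b))"
  by (cases p) auto

lemma pe_transpose: "i < 2 ^ length v \<Longrightarrow> j < 2 ^ length v \<Longrightarrow> pe v j i = (if oddY v then - pe v i j else pe v i j)"
proof (induct v arbitrary: i j)
  case (Cons p v)
  then have ij: "i < 2 * 2 ^ length v" "j < 2 * 2 ^ length v" by auto
  have "pe v (j mod 2 ^ length v) (i mod 2 ^ length v)
      = (if oddY v then - pe v (i mod 2 ^ length v) (j mod 2 ^ length v) else pe v (i mod 2 ^ length v) (j mod 2 ^ length v))"
    by (rule Cons(1)) auto
  then show ?case using ij pmat_transpose[OF div_less_two[OF ij(1)] div_less_two[OF ij(2)], of p]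
    by (auto simp: pe_Cons simp del: pstring.simps)
qed simp

lemma pstring_zero: "pstring (pzero n) = 1\<^sub>m (2 ^ n)"
proof (induct n)
  case 0
  then show ?case by (auto intro: eq_matI)
next
  case (Suc n)
  show ?case
  proof (rule eq_matI)
    fix i j assume "i < dim_row (1\<^sub>m (2 ^ Suc n) :: complex mat)" "j < dim_col (1\<^sub>m (2 ^ Suc n) :: complex mat)"
    then have ij: "i < 2 * 2 ^ n" "j < 2 * 2 ^ n" by auto
    have "i = j \<longleftrightarrow> i div 2 ^ n = j div 2 ^ n \<and> i mod 2 ^ n = j mod 2 ^ n"
      by (metis div_mult_mod_eq)
    then show "pe (pzero (Suc n)) i j = 1\<^sub>m (2 ^ Suc n) $$ (i, j)"
      using ij Suc div_less_two[OF ij(1)] div_less_two[OF ij(2)]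
      by (auto simp: pe_Cons simp del: pstring.simps)
  qed (simp_all del: pstring.simps)
qed

lemma pe_orthogonal:
  "length v = length w \<Longrightarrow>
   (\<Sum>i<2 ^ length v. \<Sum>j<2 ^ length v. cnj (pe v i j) * pe w i j) = (if v = w then 2 ^ length v else 0)"
proof (induct v w rule: list_induct2)
  case (Cons p v q w)
  let ?N = "2 ^ length v :: nat"
  let ?P = "\<lambda>a b. cnj (pmat p $$ (a, b)) * pmat q $$ (a, b)"
  let ?F = "\<lambda>a b i j. ?P a b * (cnj (pe v i j) * pe w i j)"
  let ?S = "\<Sum>i<?N. \<Sum>j<?N. cnj (pe v i j) * pe w i j"
  have "(\<Sum>i<2 ^ length (p # v). \<Sum>j<2 ^ length (p # v). cnj (pe (p # v) i j) * pe (q # w) i j)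
     = (\<Sum>i<2 * ?N. \<Sum>j<2 * ?N. ?F (i div ?N) (j div ?N) (i mod ?N) (j mod ?N))"
  proof (intro sum.cong)
    fix i j assume "i \<in> {..<2 * ?N}" "j \<in> {..<2 * ?N}"
    then show "cnj (pe (p # v) i j) * pe (q # w) i j = ?F (i div ?N) (j div ?N) (i mod ?N) (j mod ?N)"
      using Cons(1) by (simp add: pe_Cons del: pstring.simps)
  qed simp_all
  also have "\<dots> = (?P 0 0 + ?P 0 (Suc 0) + (?P (Suc 0) 0 + ?P (Suc 0) (Suc 0))) * ?S"
    by (subst sum_split22) (simp add: sum_distrib_left distrib_right sum.distrib)
  also have "\<dots> = (if p = q then 2 else 0) * ?S"
    by (cases p; cases q) simp_all
  also have "\<dots> = (if p # v = q # w then 2 ^ length (p # v) else 0)"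
    using Cons(2) by simp
  finally show ?case .
qed simp

lemma pe_complete:
  "i < 2 ^ n \<Longrightarrow> j < 2 ^ n \<Longrightarrow> k < 2 ^ n \<Longrightarrow> l < 2 ^ n \<Longrightarrow>
   (\<Sum>v\<in>strs n. cnj (pe v i j) * pe v k l) = (if i = k \<and> j = l then 2 ^ n else 0)"
proof (induct n arbitrary: i j k l)
  case 0
  then show ?case by (simp add: strs_0)
next
  case (Suc n)
  let ?N = "2 ^ n :: nat"
  let ?P = "\<lambda>p. cnj (pmat p $$ (i div ?N, j div ?N)) * pmat p $$ (k div ?N, l div ?N)"
  let ?S = "\<Sum>v\<in>strs n. cnj (pe v (i mod ?N) (j mod ?N)) * pe v (k mod ?N) (l mod ?N)"
  have lt: "i < 2 * ?N" "j < 2 * ?N" "k < 2 * ?N" "l < 2 * ?N" using Suc by auto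
  have eq: "x = y \<longleftrightarrow> x div ?N = y div ?N \<and> x mod ?N = y mod ?N" for x y
    by (metis div_mult_mod_eq)
  have "(\<Sum>v\<in>strs (Suc n). cnj (pe v i j) * pe v k l)
      = (\<Sum>p\<in>UNIV. \<Sum>v\<in>strs n. ?P p * (cnj (pe v (i mod ?N) (j mod ?N)) * pe v (k mod ?N) (l mod ?N)))"
    unfolding sum_strs_Suc using lt by (intro sum.cong) (auto simp: pe_Cons simp del: pstring.simps)
  also have "\<dots> = (\<Sum>p\<in>UNIV. ?P p) * ?S"
    by (simp add: sum_product)
  also have "(\<Sum>p\<in>UNIV. ?P p) = (if i div ?N = k div ?N \<and> j div ?N = l div ?N then 2 else 0)"
    using lt[THEN div_less_two] by (elim disjE) (simp_all add: sum_pauli)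
  also have "?S = (if i mod ?N = k mod ?N \<and> j mod ?N = l mod ?N then 2 ^ n else 0)"
    by (rule Suc(1)) auto
  finally show ?case by (subst eq[of i k], subst eq[of j l]) auto
qed

section \<open>Real spans and isomorphisms\<close>

definition lc :: "nat \<Rightarrow> ('i \<Rightarrow> complex mat) \<Rightarrow> 'i set \<Rightarrow> ('i \<Rightarrow> real) \<Rightarrow> complex mat" where
  "lc N b I r = mat N N (\<lambda>(x, y). \<Sum>i\<in>I. complex_of_real (r i) * b i $$ (x, y))"

definition rspan :: "nat \<Rightarrow> ('i \<Rightarrow> complex mat) \<Rightarrow> 'i set \<Rightarrow> complex mat set" where
  "rspan N b I = range (lc N b I)"

definition indep :: "nat \<Rightarrow> ('i \<Rightarrow> complex mat) \<Rightarrow> 'i set \<Rightarrow> bool" where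
  "indep N b I \<longleftrightarrow> (\<forall>r. lc N b I r = 0\<^sub>m N N \<longrightarrow> (\<forall>i\<in>I. r i = 0))"

lemma lc_carrier [simp, intro]: "lc N b I r \<in> carrier_mat N N"
  by (simp add: lc_def)

lemma lc_dim [simp]: "dim_row (lc N b I r) = N" "dim_col (lc N b I r) = N"
  by (simp_all add: lc_def)

lemma lc_entry: "x < N \<Longrightarrow> y < N \<Longrightarrow> lc N b I r $$ (x, y) = (\<Sum>i\<in>I. complex_of_real (r i) * b i $$ (x, y))"
  by (simp add: lc_def)

lemma lc_in_rspan [simp, intro]: "lc N b I r \<in> rspan N b I"
  by (simp add: rspan_def)

lemma rspan_carrier: "A \<in> rspan N b I \<Longrightarrow> A \<in> carrier_mat N N"
  by (auto simp: rspan_def)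

lemma lc_cong: "(\<And>i. i \<in> I \<Longrightarrow> r i = s i) \<Longrightarrow> lc N b I r = lc N b I s"
  by (simp add: lc_def cong: sum.cong)

lemma lc_add: "lc N b I r + lc N b I s = lc N b I (\<lambda>i. r i + s i)"
  by (rule eq_matI) (auto simp: lc_entry sum.distrib algebra_simps)

lemma lc_smult: "complex_of_real c \<cdot>\<^sub>m lc N b I r = lc N b I (\<lambda>i. c * r i)"
  by (rule eq_matI) (auto simp: lc_entry sum_distrib_left algebra_simps)

lemma lc_zero: "lc N b I (\<lambda>i. 0) = 0\<^sub>m N N"
  by (rule eq_matI) (auto simp: lc_entry)

lemma lc_single: "finite I \<Longrightarrow> i \<in> I \<Longrightarrow> b i \<in> carrier_mat N N \<Longrightarrow> lc N b I (\<lambda>j. if j = i then 1 else 0) = b i"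
proof (rule eq_matI)
  fix x y assume *: "finite I" "i \<in> I" "b i \<in> carrier_mat N N" "x < dim_row (b i)" "y < dim_col (b i)"
  have "(\<Sum>j\<in>I. complex_of_real (if j = i then 1 else 0) * b j $$ (x, y)) = (\<Sum>j\<in>I. if j = i then b j $$ (x, y) else 0)"
    by (intro sum.cong) auto
  then show "lc N b I (\<lambda>j. if j = i then 1 else 0) $$ (x, y) = b i $$ (x, y)"
    using * by (simp add: lc_entry)
qed auto

lemma indep_unique:
  assumes "indep N b I" "lc N b I r = lc N b I s" "i \<in> I"
  shows "r i = s i"
proof -
  have "lc N b I (\<lambda>i. r i + - 1 * s i) = lc N b I r + complex_of_real (- 1) \<cdot>\<^sub>m lc N b I s"
    by (simp only: lc_smult lc_add)
  also have "\<dots> = 0\<^sub>m N N" unfolding assms(2) by (rule eq_matI) auto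
  finally have "r i + - 1 * s i = 0" using assms(1,3) unfolding indep_def by blast
  then show ?thesis by simp
qed

lemma comm_carrier [simp, intro]: "A \<in> carrier_mat N N \<Longrightarrow> B \<in> carrier_mat N N \<Longrightarrow> comm A B \<in> carrier_mat N N"
  by (auto simp: comm_def)

lemma comm_entry:
  assumes "A \<in> carrier_mat N N" "B \<in> carrier_mat N N" "x < N" "y < N"
  shows "comm A B $$ (x, y) = (\<Sum>z<N. A $$ (x, z) * B $$ (z, y)) - (\<Sum>z<N. B $$ (x, z) * A $$ (z, y))"
  using assms by (auto simp: comm_def scalar_prod_def lessThan_atLeast0)

lemma lc_mult_entry:
  assumes "x < N" "y < N"
  shows "(\<Sum>z<N. lc N b I r $$ (x, z) * lc N b J s $$ (z, y))
       = (\<Sum>i\<in>I. \<Sum>j\<in>J. complex_of_real (r i * s j) * (\<Sum>z<N. b i $$ (x, z) * b j $$ (z, y)))"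
proof -
  have "(\<Sum>z<N. lc N b I r $$ (x, z) * lc N b J s $$ (z, y))
      = (\<Sum>z<N. \<Sum>i\<in>I. \<Sum>j\<in>J. complex_of_real (r i * s j) * (b i $$ (x, z) * b j $$ (z, y)))"
    using assms by (intro sum.cong) (auto simp: lc_entry sum_product algebra_simps)
  also have "\<dots> = (\<Sum>i\<in>I. \<Sum>z<N. \<Sum>j\<in>J. complex_of_real (r i * s j) * (b i $$ (x, z) * b j $$ (z, y)))"
    by (rule sum.swap)
  also have "\<dots> = (\<Sum>i\<in>I. \<Sum>j\<in>J. \<Sum>z<N. complex_of_real (r i * s j) * (b i $$ (x, z) * b j $$ (z, y)))"
    by (intro sum.cong sum.swap) simp
  finally show ?thesis by (simp add: sum_distrib_left)
qed

lemma lc_comm_entry: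
  assumes "x < N" "y < N" "\<And>i. i \<in> I \<Longrightarrow> b i \<in> carrier_mat N N" "\<And>j. j \<in> J \<Longrightarrow> b j \<in> carrier_mat N N"
  shows "comm (lc N b I r) (lc N b J s) $$ (x, y)
       = (\<Sum>i\<in>I. \<Sum>j\<in>J. complex_of_real (r i * s j) * comm (b i) (b j) $$ (x, y))"
proof -
  have "comm (lc N b I r) (lc N b J s) $$ (x, y)
      = (\<Sum>i\<in>I. \<Sum>j\<in>J. complex_of_real (r i * s j) * (\<Sum>z<N. b i $$ (x, z) * b j $$ (z, y)))
      - (\<Sum>j\<in>J. \<Sum>i\<in>I. complex_of_real (s j * r i) * (\<Sum>z<N. b j $$ (x, z) * b i $$ (z, y)))"
    using assms(1,2) by (simp add: comm_entry[where N = N] lc_mult_entry del: of_real_mult)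
  also have "(\<Sum>j\<in>J. \<Sum>i\<in>I. complex_of_real (s j * r i) * (\<Sum>z<N. b j $$ (x, z) * b i $$ (z, y)))
     = (\<Sum>i\<in>I. \<Sum>j\<in>J. complex_of_real (r i * s j) * (\<Sum>z<N. b j $$ (x, z) * b i $$ (z, y)))"
    by (subst sum.swap) (simp add: mult.commute)
  finally show ?thesis
    using assms by (simp add: comm_entry[where N = N] right_diff_distrib sum_subtractf)
qed

definition structure_constants ::
  "nat \<Rightarrow> ('i \<Rightarrow> complex mat) \<Rightarrow> 'i set \<Rightarrow> ('i \<Rightarrow> 'i \<Rightarrow> 'i) \<Rightarrow> ('i \<Rightarrow> 'i \<Rightarrow> real) \<Rightarrow> bool" where
  "structure_constants N b I u k \<longleftrightarrow> finite I \<and> (\<forall>i\<in>I. b i \<in> carrier_mat N N) \<and>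
     (\<forall>i\<in>I. \<forall>j\<in>I. comm (b i) (b j) = complex_of_real (k i j) \<cdot>\<^sub>m b (u i j) \<and> (k i j = 0 \<or> u i j \<in> I))"

lemma lc_comm:
  assumes "structure_constants N b I u k"
  shows "comm (lc N b I r) (lc N b I s)
     = lc N b I (\<lambda>l. \<Sum>i\<in>I. \<Sum>j\<in>I. if u i j = l then r i * s j * k i j else 0)"
proof (rule eq_matI)
  fix x y assume "x < dim_row (lc N b I (\<lambda>l. \<Sum>i\<in>I. \<Sum>j\<in>I. if u i j = l then r i * s j * k i j else 0))"
    "y < dim_col (lc N b I (\<lambda>l. \<Sum>i\<in>I. \<Sum>j\<in>I. if u i j = l then r i * s j * k i j else 0))"
  then have xy: "x < N" "y < N" by auto
  have fin: "finite I" and car: "\<And>i. i \<in> I \<Longrightarrow> b i \<in> carrier_mat N N"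
    and sc: "\<And>i j. i \<in> I \<Longrightarrow> j \<in> I \<Longrightarrow> comm (b i) (b j) = complex_of_real (k i j) \<cdot>\<^sub>m b (u i j)"
    and u: "\<And>i j. i \<in> I \<Longrightarrow> j \<in> I \<Longrightarrow> k i j = 0 \<or> u i j \<in> I"
    using assms by (auto simp: structure_constants_def)
  have ent: "comm (b i) (b j) $$ (x, y) = complex_of_real (k i j) * b (u i j) $$ (x, y)" if "i \<in> I" "j \<in> I" for i j
  proof -
    have "comm (b i) (b j) \<in> carrier_mat N N" using car that by auto
    then have "dim_row (b (u i j)) = N" "dim_col (b (u i j)) = N" using sc[OF that] by auto
    then show ?thesis using sc[OF that] xy by simp
  qed
  have "comm (lc N b I r) (lc N b I s) $$ (x, y)
      = (\<Sum>i\<in>I. \<Sum>j\<in>I. complex_of_real (r i * s j * k i j) * b (u i j) $$ (x, y))"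
    using xy car by (subst lc_comm_entry) (auto simp: ent mult.assoc intro!: sum.cong)
  also have "\<dots> = (\<Sum>i\<in>I. \<Sum>j\<in>I. \<Sum>l\<in>I. complex_of_real (if u i j = l then r i * s j * k i j else 0) * b l $$ (x, y))"
  proof (intro sum.cong refl)
    fix i j assume ij: "i \<in> I" "j \<in> I"
    have "(\<Sum>l\<in>I. complex_of_real (if u i j = l then r i * s j * k i j else 0) * b l $$ (x, y))
        = (\<Sum>l\<in>I. if u i j = l then complex_of_real (r i * s j * k i j) * b l $$ (x, y) else 0)"
      by (intro sum.cong) auto
    also have "\<dots> = complex_of_real (r i * s j * k i j) * b (u i j) $$ (x, y)"
      using fin u[OF ij] by auto
    finally show "complex_of_real (r i * s j * k i j) * b (u i j) $$ (x, y)
      = (\<Sum>l\<in>I. complex_of_real (if u i j = l then r i * s j * k i j else 0) * b l $$ (x, y))" ..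
  qed
  also have "\<dots> = (\<Sum>i\<in>I. \<Sum>l\<in>I. \<Sum>j\<in>I. complex_of_real (if u i j = l then r i * s j * k i j else 0) * b l $$ (x, y))"
    by (intro sum.cong refl sum.swap)
  also have "\<dots> = (\<Sum>l\<in>I. \<Sum>i\<in>I. \<Sum>j\<in>I. complex_of_real (if u i j = l then r i * s j * k i j else 0) * b l $$ (x, y))"
    by (rule sum.swap)
  also have "\<dots> = lc N b I (\<lambda>l. \<Sum>i\<in>I. \<Sum>j\<in>I. if u i j = l then r i * s j * k i j else 0) $$ (x, y)"
    using xy by (simp add: lc_entry sum_distrib_right)
  finally show "comm (lc N b I r) (lc N b I s) $$ (x, y) = \<dots>" .
qed (auto simp: comm_def)

lemma rspan_closed:
  assumes "A \<in> rspan N b I" "B \<in> rspan N b I"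
  shows "A + B \<in> rspan N b I" "complex_of_real c \<cdot>\<^sub>m A \<in> rspan N b I"
  using assms by (auto simp: rspan_def lc_add lc_smult)

lemma rspan_comm: "structure_constants N b I u k \<Longrightarrow> A \<in> rspan N b I \<Longrightarrow> B \<in> rspan N b I \<Longrightarrow> comm A B \<in> rspan N b I"
  by (auto simp: rspan_def lc_comm)

lemma rspan_subalg: "structure_constants N b I u k \<Longrightarrow> real_lie_subalg N (rspan N b I)"
  unfolding real_lie_subalg_def
  using rspan_closed rspan_comm rspan_carrier lc_in_rspan[of N b I "\<lambda>i. 0"] by (auto simp: lc_zero)

lemma lie_iso_basis:
  assumes "structure_constants N b I u k" "structure_constants M d I u k" "indep N b I" "indep M d I"
  shows "rspan N b I \<cong>\<^sub>L rspan M d I"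
proof -
  define f where "f X = lc M d I (SOME r. lc N b I r = X)" for X
  have f: "f (lc N b I r) = lc M d I r" for r
    unfolding f_def
  proof (rule lc_cong)
    fix i assume "i \<in> I"
    have "lc N b I (SOME r'. lc N b I r' = lc N b I r) = lc N b I r"
      by (rule someI[of "\<lambda>r'. lc N b I r' = lc N b I r", OF refl])
    from indep_unique[OF assms(3) this \<open>i \<in> I\<close>] show "(SOME r'. lc N b I r' = lc N b I r) i = r i" .
  qed
  have "inj_on f (rspan N b I)"
  proof (rule inj_onI)
    fix X Y assume "X \<in> rspan N b I" "Y \<in> rspan N b I" "f X = f Y"
    then obtain r s where rs: "X = lc N b I r" "Y = lc N b I s" "lc M d I r = lc M d I s"
      by (auto simp: rspan_def f)
    show "X = Y" unfolding rs(1,2) by (rule lc_cong) (rule indep_unique[OF assms(4) rs(3)])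
  qed
  moreover have "f ` rspan N b I = rspan M d I"
    by (auto simp: rspan_def f image_image)
  ultimately have "bij_betw f (rspan N b I) (rspan M d I)" by (simp add: bij_betw_def)
  then show ?thesis
    unfolding lie_iso_def
    by (intro exI[of _ f]) (auto simp: rspan_def f lc_add lc_smult lc_comm[OF assms(1)] lc_comm[OF assms(2)])
qed

lemma lie_iso_trans: "L1 \<cong>\<^sub>L L2 \<Longrightarrow> L2 \<cong>\<^sub>L L3 \<Longrightarrow> L1 \<cong>\<^sub>L L3"
proof -
  assume "L1 \<cong>\<^sub>L L2" "L2 \<cong>\<^sub>L L3"
  then obtain f g where f: "bij_betw f L1 L2" "\<And>A B. A \<in> L1 \<Longrightarrow> B \<in> L1 \<Longrightarrow> f (A + B) = f A + f B \<and> f (comm A B) = comm (f A) (f B)"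
      "\<And>A r. A \<in> L1 \<Longrightarrow> f (complex_of_real r \<cdot>\<^sub>m A) = complex_of_real r \<cdot>\<^sub>m f A"
    and g: "bij_betw g L2 L3" "\<And>A B. A \<in> L2 \<Longrightarrow> B \<in> L2 \<Longrightarrow> g (A + B) = g A + g B \<and> g (comm A B) = comm (g A) (g B)"
      "\<And>A r. A \<in> L2 \<Longrightarrow> g (complex_of_real r \<cdot>\<^sub>m A) = complex_of_real r \<cdot>\<^sub>m g A"
    unfolding lie_iso_def by metis
  have "f A \<in> L2" if "A \<in> L1" for A using that f(1) by (auto simp: bij_betw_def)
  then show ?thesis unfolding lie_iso_def
    using f g bij_betw_trans[OF f(1) g(1)] by (intro exI[of _ "g \<circ> f"]) auto
qed

lemma lie_iso_sym:
  assumes "real_lie_subalg N L1" "L1 \<cong>\<^sub>L L2"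
  shows "L2 \<cong>\<^sub>L L1"
proof -
  obtain f where f: "bij_betw f L1 L2" "\<And>A B. A \<in> L1 \<Longrightarrow> B \<in> L1 \<Longrightarrow> f (A + B) = f A + f B \<and> f (comm A B) = comm (f A) (f B)"
      "\<And>A r. A \<in> L1 \<Longrightarrow> f (complex_of_real r \<cdot>\<^sub>m A) = complex_of_real r \<cdot>\<^sub>m f A"
    using assms(2) unfolding lie_iso_def by metis
  define g where "g = the_inv_into L1 f"
  have g: "bij_betw g L2 L1" using f(1) by (simp add: g_def bij_betw_the_inv_into)
  have gf: "g (f A) = A" if "A \<in> L1" for A
    using f(1) that by (simp add: g_def bij_betw_def the_inv_into_f_f)
  have im: "\<exists>A\<in>L1. X = f A" if "X \<in> L2" for X using f(1) that by (auto simp: bij_betw_def)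
  show ?thesis unfolding lie_iso_def
  proof (intro exI[of _ g] conjI ballI allI)
    fix X Y assume "X \<in> L2" "Y \<in> L2"
    then obtain A B where AB: "A \<in> L1" "B \<in> L1" "X = f A" "Y = f B" using im by blast
    then have "A + B \<in> L1" "comm A B \<in> L1" using assms(1) by (auto simp: real_lie_subalg_def)
    then show "g (X + Y) = g X + g Y" "g (comm X Y) = comm (g X) (g Y)"
      using AB f(2)[of A B] gf by metis+
  next
    fix X r assume "X \<in> L2"
    then obtain A where A: "A \<in> L1" "X = f A" using im by blast
    then have "complex_of_real r \<cdot>\<^sub>m A \<in> L1" using assms(1) by (auto simp: real_lie_subalg_def)
    then show "g (complex_of_real r \<cdot>\<^sub>m X) = complex_of_real r \<cdot>\<^sub>m g X"
      using A f(3)[of A r] gf by metis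
  qed (rule g)
qed

lemma lc_reindex:
  assumes "bij_betw g I J" "\<And>i. i \<in> I \<Longrightarrow> b i = complex_of_real (t i) \<cdot>\<^sub>m d (g i)" "\<And>i. i \<in> I \<Longrightarrow> d (g i) \<in> carrier_mat N N"
  shows "lc N b I (\<lambda>i. r (g i)) = lc N d J (\<lambda>j. r j * t (the_inv_into I g j))"
proof (rule eq_matI)
  fix x y assume "x < dim_row (lc N d J (\<lambda>j. r j * t (the_inv_into I g j)))" "y < dim_col (lc N d J (\<lambda>j. r j * t (the_inv_into I g j)))"
  then have xy: "x < N" "y < N" by auto
  have inv: "the_inv_into I g (g i) = i" if "i \<in> I" for i
    using that assms(1) by (simp add: bij_betw_def the_inv_into_f_f)
  have "lc N d J (\<lambda>j. r j * t (the_inv_into I g j)) $$ (x, y)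
      = (\<Sum>i\<in>I. complex_of_real (r (g i) * t i) * d (g i) $$ (x, y))"
    using xy by (simp add: lc_entry sum.reindex_bij_betw[OF assms(1), symmetric] inv cong: sum.cong)
  also have "\<dots> = lc N b I (\<lambda>i. r (g i)) $$ (x, y)"
  proof -
    have "b i $$ (x, y) = complex_of_real (t i) * d (g i) $$ (x, y)" if "i \<in> I" for i
      using assms(2)[OF that] assms(3)[OF that] xy by simp
    then show ?thesis using xy by (simp add: lc_entry mult.assoc cong: sum.cong)
  qed
  finally show "lc N b I (\<lambda>i. r (g i)) $$ (x, y) = lc N d J (\<lambda>j. r j * t (the_inv_into I g j)) $$ (x, y)" ..
qed auto

lemma
  assumes "bij_betw g I J" "\<And>i. i \<in> I \<Longrightarrow> b i = complex_of_real (t i) \<cdot>\<^sub>m d (g i)"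
    "\<And>i. i \<in> I \<Longrightarrow> d (g i) \<in> carrier_mat N N" "\<And>i. i \<in> I \<Longrightarrow> t i \<noteq> 0"
  shows rspan_reindex: "rspan N b I = rspan N d J"
    and indep_reindex: "indep N d J \<Longrightarrow> indep N b I"
proof -
  let ?h = "the_inv_into I g"
  have inv: "?h (g i) = i" if "i \<in> I" for i
    using that assms(1) by (simp add: bij_betw_def the_inv_into_f_f)
  have inv': "g (?h j) = j" "?h j \<in> I" if "j \<in> J" for j
    using that assms(1) by (auto simp: bij_betw_def f_the_inv_into_f the_inv_into_into)
  have 1: "lc N b I r = lc N d J (\<lambda>j. r (?h j) * t (?h j))" for r
  proof -
    have "lc N b I r = lc N b I (\<lambda>i. r (?h (g i)))" by (rule lc_cong) (simp add: inv)
    also have "\<dots> = lc N d J (\<lambda>j. r (?h j) * t (?h j))" by (rule lc_reindex[of g I J b t d N "\<lambda>j. r (?h j)"]) (use assms in auto)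
    finally show ?thesis .
  qed
  have 2: "lc N d J r = lc N b I (\<lambda>i. r (g i) / t i)" for r
    unfolding 1 by (rule lc_cong) (simp add: inv' assms(4))
  show "rspan N b I = rspan N d J"
  proof
    show "rspan N b I \<subseteq> rspan N d J" unfolding rspan_def using 1 by auto
    show "rspan N d J \<subseteq> rspan N b I" unfolding rspan_def using 2 by auto
  qed
  show "indep N b I" if "indep N d J"
    unfolding indep_def
  proof (intro allI impI ballI)
    fix r i assume "lc N b I r = 0\<^sub>m N N" "i \<in> I"
    then have "lc N d J (\<lambda>j. r (?h j) * t (?h j)) = 0\<^sub>m N N" using 1 by metis
    then have "\<forall>j\<in>J. r (?h j) * t (?h j) = 0" using that unfolding indep_def by blast
    moreover have "g i \<in> J" using \<open>i \<in> I\<close> assms(1) by (auto simp: bij_betw_def)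
    ultimately have "r (?h (g i)) * t (?h (g i)) = 0" by blast
    then show "r i = 0" using inv \<open>i \<in> I\<close> assms(4) by simp
  qed
qed

section \<open>Lie algebras spanned by Pauli strings\<close>

definition pb :: "pauli list \<Rightarrow> complex mat" where
  "pb v = \<i> \<cdot>\<^sub>m pstring v"

definition LA :: "nat \<Rightarrow> pauli list set \<Rightarrow> complex mat set" where
  "LA n S = rspan (2 ^ n) pb S"

lemma pb_dim [simp]: "dim_row (pb v) = 2 ^ length v" "dim_col (pb v) = 2 ^ length v"
  by (simp_all add: pb_def)

lemma pb_carrier [simp, intro]: "length v = n \<Longrightarrow> pb v \<in> carrier_mat (2 ^ n) (2 ^ n)"
  by (intro carrier_matI) simp_all

lemma pb_entry: "i < 2 ^ length v \<Longrightarrow> j < 2 ^ length v \<Longrightarrow> pb v $$ (i, j) = \<i> * pe v i j"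
  by (simp add: pb_def)

lemma pb_mult:
  assumes "length v = n" "length w = n"
  shows "pb v * pb w = (- phs v w) \<cdot>\<^sub>m pstring (vadd v w)"
proof -
  have c: "pstring v \<in> carrier_mat (2 ^ n) (2 ^ n)" "pstring w \<in> carrier_mat (2 ^ n) (2 ^ n)"
    using assms by auto
  have "pb v * pb w = \<i> \<cdot>\<^sub>m (pstring v * (\<i> \<cdot>\<^sub>m pstring w))"
    unfolding pb_def by (rule mult_smult_assoc_mat[OF c(1) smult_carrier_mat[OF c(2)]])
  also have "pstring v * (\<i> \<cdot>\<^sub>m pstring w) = \<i> \<cdot>\<^sub>m (pstring v * pstring w)"
    by (rule mult_smult_distrib[OF c])
  also have "\<i> \<cdot>\<^sub>m (\<i> \<cdot>\<^sub>m (pstring v * pstring w)) = (- phs v w) \<cdot>\<^sub>m pstring (vadd v w)"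
    unfolding pstring_mult[OF assms] by (rule eq_matI) auto
  finally show ?thesis .
qed

definition kap :: "pauli list \<Rightarrow> pauli list \<Rightarrow> real" where
  "kap v w = (if anti v w then - 2 * Im (phs v w) else 0)"

lemma comm_pb:
  assumes "length v = n" "length w = n"
  shows "comm (pb v) (pb w) = complex_of_real (kap v w) \<cdot>\<^sub>m pb (vadd v w)"
proof -
  have "comm (pb v) (pb w) = (- phs v w) \<cdot>\<^sub>m pstring (vadd v w) - (- phs w v) \<cdot>\<^sub>m pstring (vadd v w)"
    unfolding comm_def pb_mult[OF assms] pb_mult[OF assms(2,1)] vadd_comm[of w v] ..
  also have "\<dots> = complex_of_real (kap v w) \<cdot>\<^sub>m pb (vadd v w)"
  proof (rule eq_matI)
    fix i j assume "i < dim_row (complex_of_real (kap v w) \<cdot>\<^sub>m pb (vadd v w))" "j < dim_col (complex_of_real (kap v w) \<cdot>\<^sub>m pb (vadd v w))"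
    then have ij: "i < 2 ^ n" "j < 2 ^ n" using assms by auto
    show "((- phs v w) \<cdot>\<^sub>m pstring (vadd v w) - (- phs w v) \<cdot>\<^sub>m pstring (vadd v w)) $$ (i, j)
      = (complex_of_real (kap v w) \<cdot>\<^sub>m pb (vadd v w)) $$ (i, j)"
    proof (cases "anti v w")
      case True
      then have "phs w v = - phs v w" using phs_swap[of v w] assms by simp
      moreover have "phs v w = complex_of_real (Im (phs v w)) * \<i>" using phs_anti True assms by simp
      ultimately show ?thesis using ij assms True by (simp add: pb_entry kap_def)
    next
      case False
      then have "phs w v = phs v w" using phs_swap[of v w] assms by simp
      then show ?thesis using ij assms False by (simp add: pb_entry kap_def)
    qed
  qed (use assms in auto)
  finally show ?thesis .
qed

lemma pb_structure:
  assumes "S \<subseteq> strs n" "aclosed S"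
  shows "structure_constants (2 ^ n) pb S vadd kap"
  unfolding structure_constants_def
proof (intro conjI ballI)
  show "finite S" using assms(1) finite_subset by blast
  fix v w assume vw: "v \<in> S" "w \<in> S"
  then have l: "length v = n" "length w = n" using assms(1) by auto
  show "comm (pb v) (pb w) = complex_of_real (kap v w) \<cdot>\<^sub>m pb (vadd v w)" by (rule comm_pb[OF l])
  show "kap v w = 0 \<or> vadd v w \<in> S" using vw assms(2) by (auto simp: kap_def aclosed_def)
qed (use assms in auto)

definition coef :: "nat \<Rightarrow> complex mat \<Rightarrow> pauli list \<Rightarrow> complex" where
  "coef n M v = (\<Sum>i<2 ^ n. \<Sum>j<2 ^ n. cnj (pe v i j) * M $$ (i, j))"

lemma coef_lc:
  assumes "S \<subseteq> strs n" "length w = n"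
  shows "coef n (lc (2 ^ n) pb S r) w = (if w \<in> S then 2 ^ n * \<i> * complex_of_real (r w) else 0)"
proof -
  have fin: "finite S" using assms(1) finite_subset by blast
  have "coef n (lc (2 ^ n) pb S r) w
     = (\<Sum>i<2 ^ n. \<Sum>j<2 ^ n. \<Sum>v\<in>S. complex_of_real (r v) * \<i> * (cnj (pe w i j) * pe v i j))"
    unfolding coef_def using assms(1)
    by (intro sum.cong refl) (auto simp: lc_entry sum_distrib_left pb_entry intro!: sum.cong)
  also have "\<dots> = (\<Sum>i<2 ^ n. \<Sum>v\<in>S. \<Sum>j<2 ^ n. complex_of_real (r v) * \<i> * (cnj (pe w i j) * pe v i j))"
    by (intro sum.cong refl sum.swap)
  also have "\<dots> = (\<Sum>v\<in>S. \<Sum>i<2 ^ n. \<Sum>j<2 ^ n. complex_of_real (r v) * \<i> * (cnj (pe w i j) * pe v i j))"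
    by (rule sum.swap)
  also have "\<dots> = (\<Sum>v\<in>S. complex_of_real (r v) * \<i> * (\<Sum>i<2 ^ n. \<Sum>j<2 ^ n. cnj (pe w i j) * pe v i j))"
    by (simp add: sum_distrib_left)
  also have "\<dots> = (\<Sum>v\<in>S. if w = v then 2 ^ n * \<i> * complex_of_real (r w) else 0)"
  proof (intro sum.cong refl)
    fix v assume "v \<in> S"
    then have "length v = n" using assms(1) by auto
    then show "complex_of_real (r v) * \<i> * (\<Sum>i<2 ^ n. \<Sum>j<2 ^ n. cnj (pe w i j) * pe v i j)
      = (if w = v then 2 ^ n * \<i> * complex_of_real (r w) else 0)"
      using pe_orthogonal[of w v] assms(2) by simp
  qed
  also have "\<dots> = (if w \<in> S then 2 ^ n * \<i> * complex_of_real (r w) else 0)"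
    using fin by simp
  finally show ?thesis .
qed

lemma indep_pb:
  assumes "S \<subseteq> strs n"
  shows "indep (2 ^ n) pb S"
  unfolding indep_def
proof (intro allI impI ballI)
  fix r w assume 0: "lc (2 ^ n) pb S r = 0\<^sub>m (2 ^ n) (2 ^ n)" and w: "w \<in> S"
  have "coef n (0\<^sub>m (2 ^ n) (2 ^ n)) w = 0" by (simp add: coef_def)
  moreover have "coef n (lc (2 ^ n) pb S r) w = 2 ^ n * \<i> * complex_of_real (r w)"
    using coef_lc[OF assms, of w r] w assms by auto
  ultimately show "r w = 0" unfolding 0 by simp
qed

lemma coef_expand:
  assumes "k < 2 ^ n" "l < 2 ^ n"
  shows "2 ^ n * M $$ (k, l) = (\<Sum>v\<in>strs n. coef n M v * pe v k l)"
proof -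
  have "(\<Sum>v\<in>strs n. coef n M v * pe v k l)
      = (\<Sum>v\<in>strs n. \<Sum>i<2 ^ n. \<Sum>j<2 ^ n. M $$ (i, j) * (cnj (pe v i j) * pe v k l))"
    unfolding coef_def by (simp add: sum_distrib_left sum_distrib_right mult_ac)
  also have "\<dots> = (\<Sum>i<2 ^ n. \<Sum>v\<in>strs n. \<Sum>j<2 ^ n. M $$ (i, j) * (cnj (pe v i j) * pe v k l))"
    by (rule sum.swap)
  also have "\<dots> = (\<Sum>i<2 ^ n. \<Sum>j<2 ^ n. \<Sum>v\<in>strs n. M $$ (i, j) * (cnj (pe v i j) * pe v k l))"
    by (intro sum.cong refl sum.swap)
  also have "\<dots> = (\<Sum>i<2 ^ n. \<Sum>j<2 ^ n. M $$ (i, j) * (\<Sum>v\<in>strs n. cnj (pe v i j) * pe v k l))"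
    by (simp add: sum_distrib_left)
  also have "\<dots> = (\<Sum>i<2 ^ n. \<Sum>j<2 ^ n. if k = i then (if l = j then 2 ^ n * M $$ (k, l) else 0) else 0)"
    using assms by (intro sum.cong refl) (auto simp: pe_complete)
  also have "\<dots> = 2 ^ n * M $$ (k, l)"
  proof -
    have "(\<Sum>j<2 ^ n. if k = i then (if l = j then 2 ^ n * M $$ (k, l) else 0) else 0) = (if k = i then 2 ^ n * M $$ (k, l) else 0)" for i
      using assms by simp
    then show ?thesis using assms by simp
  qed
  finally show ?thesis ..
qed

lemma LA_memI:
  assumes "M \<in> carrier_mat (2 ^ n) (2 ^ n)" "S \<subseteq> strs n"
    "\<And>v. v \<in> S \<Longrightarrow> Re (coef n M v) = 0" "\<And>v. length v = n \<Longrightarrow> v \<notin> S \<Longrightarrow> coef n M v = 0"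
  shows "M \<in> LA n S"
proof -
  have "M = lc (2 ^ n) pb S (\<lambda>v. Im (coef n M v) / 2 ^ n)"
  proof (rule eq_matI)
    fix k l assume "k < dim_row (lc (2 ^ n) pb S (\<lambda>v. Im (coef n M v) / 2 ^ n))" "l < dim_col (lc (2 ^ n) pb S (\<lambda>v. Im (coef n M v) / 2 ^ n))"
    then have kl: "k < 2 ^ n" "l < 2 ^ n" by auto
    have "2 ^ n * M $$ (k, l) = (\<Sum>v\<in>strs n. coef n M v * pe v k l)" by (rule coef_expand[OF kl])
    also have "\<dots> = (\<Sum>v\<in>S. coef n M v * pe v k l)"
      by (rule sum.mono_neutral_right) (use assms in auto)
    also have "\<dots> = (\<Sum>v\<in>S. 2 ^ n * (complex_of_real (Im (coef n M v) / 2 ^ n) * pb v $$ (k, l)))"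
    proof (intro sum.cong refl)
      fix v assume v: "v \<in> S"
      then have "coef n M v = complex_of_real (Im (coef n M v)) * \<i>" using assms(3) by (auto simp: complex_eq_iff)
      moreover have "pb v $$ (k, l) = \<i> * pe v k l" using v assms(2) kl by (intro pb_entry) auto
      ultimately show "coef n M v * pe v k l = 2 ^ n * (complex_of_real (Im (coef n M v) / 2 ^ n) * pb v $$ (k, l))"
        by simp
    qed
    also have "\<dots> = 2 ^ n * lc (2 ^ n) pb S (\<lambda>v. Im (coef n M v) / 2 ^ n) $$ (k, l)"
      using kl by (simp add: lc_entry sum_distrib_left)
    finally show "M $$ (k, l) = lc (2 ^ n) pb S (\<lambda>v. Im (coef n M v) / 2 ^ n) $$ (k, l)" by simp
  qed (use assms in auto)
  then show ?thesis unfolding LA_def by (metis lc_in_rspan)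
qed

lemma lie_subalg_lc:
  assumes "real_lie_subalg N L" "finite I" "\<And>i. i \<in> I \<Longrightarrow> b i \<in> L"
  shows "lc N b I r \<in> L"
  using assms(2,3)
proof (induct I rule: finite_induct)
  case empty
  have "lc N b {} r = 0\<^sub>m N N" by (rule eq_matI) (auto simp: lc_entry)
  then show ?case using assms(1) by (simp add: real_lie_subalg_def)
next
  case (insert i I)
  have "b i \<in> carrier_mat N N" using insert assms(1) by (auto simp: real_lie_subalg_def)
  then have "lc N b (insert i I) r = complex_of_real (r i) \<cdot>\<^sub>m b i + lc N b I r"
    using insert by (intro eq_matI) (auto simp: lc_entry)
  then show ?case using insert assms(1) by (auto simp: real_lie_subalg_def)
qed

lemma LA_subalg: "S \<subseteq> strs n \<Longrightarrow> aclosed S \<Longrightarrow> real_lie_subalg (2 ^ n) (LA n S)"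
  unfolding LA_def by (rule rspan_subalg[OF pb_structure])

lemma lie_gen_pb:
  assumes "G \<subseteq> strs n"
  shows "lie_gen (2 ^ n) (pb ` G) = LA n (cl G)"
proof
  have cls: "cl G \<subseteq> strs n" using assms by (rule cl_strs)
  then have fin: "finite (cl G)" using finite_subset by blast
  have "pb v \<in> LA n (cl G)" if "v \<in> G" for v
  proof -
    have "v \<in> cl G" "length v = n" using that assms by (auto intro: cl.base)
    then have "lc (2 ^ n) pb (cl G) (\<lambda>j. if j = v then 1 else 0) = pb v"
      using fin by (intro lc_single) auto
    then show ?thesis unfolding LA_def by (metis lc_in_rspan)
  qed
  then show "lie_gen (2 ^ n) (pb ` G) \<subseteq> LA n (cl G)"
    unfolding lie_gen_def using LA_subalg[OF cls] by auto
  show "LA n (cl G) \<subseteq> lie_gen (2 ^ n) (pb ` G)"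
    unfolding lie_gen_def
  proof (intro Inter_greatest subsetI)
    fix L M assume "L \<in> {L. real_lie_subalg (2 ^ n) L \<and> pb ` G \<subseteq> L}" and M: "M \<in> LA n (cl G)"
    then have L: "real_lie_subalg (2 ^ n) L" "pb ` G \<subseteq> L" by auto
    have "pb v \<in> L" if "v \<in> cl G" for v
      using that
    proof (induct rule: cl.induct)
      case (step v w)
      have len: "length v = n" "length w = n" using step cls by auto
      have "complex_of_real (1 / kap v w) \<cdot>\<^sub>m comm (pb v) (pb w) \<in> L"
        using step L(1) unfolding real_lie_subalg_def by blast
      moreover have "kap v w \<noteq> 0" using step phs_anti(2)[of v w] len by (simp add: kap_def)
      then have "complex_of_real (1 / kap v w) \<cdot>\<^sub>m comm (pb v) (pb w) = pb (vadd v w)"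
        unfolding comm_pb[OF len] by (intro eq_matI) auto
      ultimately show ?case by simp
    qed (use L in auto)
    then show "M \<in> L" using M lie_subalg_lc[OF L(1) fin] unfolding LA_def rspan_def by auto
  qed
qed

subsection \<open>Isometries lift to isomorphisms\<close>

text \<open>A symmetric two-cocycle on an elementary abelian 2-group that vanishes on the diagonal
  splits; a splitting on a maximal subgroup extends to one more coset.\<close>

lemma cocycle_splits:
  fixes d :: "pauli list \<Rightarrow> pauli list \<Rightarrow> bool"
  assumes V: "V \<subseteq> strs n" "pzero n \<in> V" "\<And>v w. v \<in> V \<Longrightarrow> w \<in> V \<Longrightarrow> vadd v w \<in> V"
    and sym: "\<And>v w. v \<in> V \<Longrightarrow> w \<in> V \<Longrightarrow> d v w = d w v"
    and diag: "\<And>v. v \<in> V \<Longrightarrow> \<not> d v v"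
    and zero: "\<And>v. v \<in> V \<Longrightarrow> \<not> d (pzero n) v"
    and cocycle: "\<And>u v w. u \<in> V \<Longrightarrow> v \<in> V \<Longrightarrow> w \<in> V \<Longrightarrow> (d u v \<noteq> d (vadd u v) w) = (d v w \<noteq> d u (vadd v w))"
  shows "\<exists>\<epsilon>. \<forall>v\<in>V. \<forall>w\<in>V. \<epsilon> (vadd v w) = (d v w \<noteq> (\<epsilon> v \<noteq> \<epsilon> w))"
proof -
  define good where "good \<epsilon> v w \<longleftrightarrow> \<epsilon> (vadd v w) = (d v w \<noteq> (\<epsilon> v \<noteq> \<epsilon> w))" for \<epsilon> v w
  define P where "P U \<longleftrightarrow> U \<subseteq> V \<and> pzero n \<in> U \<and> (\<forall>v\<in>U. \<forall>w\<in>U. vadd v w \<in> U) \<and>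
    (\<exists>\<epsilon>. \<forall>v\<in>U. \<forall>w\<in>U. good \<epsilon> v w)" for U
  have "P {pzero n}"
    unfolding P_def good_def using V(2) zero by (auto intro!: exI[of _ "\<lambda>_. False"])
  moreover have "finite {U. P U}"
    by (rule finite_subset[of _ "Pow V"]) (use V(1) finite_subset[OF V(1)] in \<open>auto simp: P_def\<close>)
  ultimately obtain U where U: "P U" and max: "\<And>W. P W \<Longrightarrow> U \<subseteq> W \<Longrightarrow> W = U"
    using finite_has_maximal[of "{U. P U}"] by blast
  obtain \<epsilon> where good: "\<And>v w. v \<in> U \<Longrightarrow> w \<in> U \<Longrightarrow> good \<epsilon> v w"
    using U unfolding P_def by blast
  have UV: "v \<in> V" if "v \<in> U" for v using U that by (auto simp: P_def)
  have Ucl: "vadd v w \<in> U" if "v \<in> U" "w \<in> U" for v w using U that by (auto simp: P_def)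
  have "U = V"
  proof (rule ccontr)
    assume "U \<noteq> V"
    then obtain u where u: "u \<in> V" "u \<notin> U" using U by (auto simp: P_def)
    have len: "length x = n" if "x \<in> V" for x using that V(1) by auto
    define W where "W = U \<union> vadd u ` U"
    define \<delta> where "\<delta> x = (if x \<in> U then \<epsilon> x else (d u (vadd u x) \<noteq> \<epsilon> (vadd u x)))" for x
    have uu: "vadd u (vadd u x) = x" if "x \<in> V" for x using that len u by (simp add: vadd_cancel)
    have nU: "vadd u x \<notin> U" if "x \<in> U" for x
    proof
      assume "vadd u x \<in> U"
      then have "vadd (vadd u x) x \<in> U" using that by (rule Ucl)
      moreover have "vadd (vadd u x) x = u" using len u UV[OF that] by (simp add: vadd_cancel_right)
      ultimately show False using u by simp
    qed
    have \<delta>1: "\<delta> x = \<epsilon> x" and \<delta>2: "\<delta> (vadd u x) = (d u x \<noteq> \<epsilon> x)" if "x \<in> U" for x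
      using that nU[OF that] UV uu by (simp_all add: \<delta>_def)
    have four: "vadd x y \<in> W \<and> vadd (vadd u x) y \<in> W \<and> vadd x (vadd u y) \<in> W \<and> vadd (vadd u x) (vadd u y) \<in> W \<and>
      good \<delta> x y \<and> good \<delta> (vadd u x) y \<and> good \<delta> x (vadd u y) \<and> good \<delta> (vadd u x) (vadd u y)"
      if xy: "x \<in> U" "y \<in> U" for x y
    proof -
      have xyV: "x \<in> V" "y \<in> V" "vadd x y \<in> U" "vadd u x \<in> V" "vadd u y \<in> V" "vadd x y \<in> V"
        using xy UV Ucl V(3) u by auto
      have e1: "vadd (vadd u x) y = vadd u (vadd x y)" by (rule vadd_assoc)
      have e2: "vadd x (vadd u y) = vadd u (vadd x y)" by (rule vadd_left_comm)
      have e3: "vadd (vadd u x) (vadd u y) = vadd x y"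
        using uu[OF xyV(6)] by (simp add: vadd_assoc vadd_left_comm[of x])
      have c1: "(d u x \<noteq> d (vadd u x) y) = (d x y \<noteq> d u (vadd x y))" by (rule cocycle) (use u xyV in auto)
      have c2: "(d u y \<noteq> d (vadd u y) x) = (d y x \<noteq> d u (vadd y x))" by (rule cocycle) (use u xyV in auto)
      have c3: "(d x u \<noteq> d (vadd x u) (vadd u y)) = (d u (vadd u y) \<noteq> d x (vadd u (vadd u y)))"
        by (rule cocycle) (use u xyV in auto)
      have c4: "(d u u \<noteq> d (vadd u u) y) = (d u y \<noteq> d u (vadd u y))" by (rule cocycle) (use u xyV in auto)
      have z: "\<not> d u u" "vadd u u = pzero n" "\<not> d (pzero n) y" using u len xyV diag zero by auto
      have s: "d y x = d x y" "d (vadd u y) x = d x (vadd u y)" "d x u = d u x" "vadd y x = vadd x y" "vadd x u = vadd u x"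
        using sym xyV u by (auto simp: vadd_comm)
      have a: "\<delta> (vadd x y) = (d x y \<noteq> (\<epsilon> x \<noteq> \<epsilon> y))" "\<delta> (vadd u (vadd x y)) = (d u (vadd x y) \<noteq> (d x y \<noteq> (\<epsilon> x \<noteq> \<epsilon> y)))"
        using \<delta>1[OF xyV(3)] \<delta>2[OF xyV(3)] good[OF xy] by (auto simp: good_def)
      have c3': "(d u x \<noteq> d (vadd u x) (vadd u y)) = (d u (vadd u y) \<noteq> d x y)"
        using c3 s uu[OF xyV(2)] by simp
      have c4': "d u (vadd u y) = d u y" using c4 z by auto
      have "vadd x y \<in> W" "vadd u (vadd x y) \<in> W" using xyV by (auto simp: W_def)
      then show ?thesis
        unfolding good_def e1 e2 e3 a \<delta>1[OF xy(1)] \<delta>1[OF xy(2)] \<delta>2[OF xy(1)] \<delta>2[OF xy(2)]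
        using c1 c2 c3' c4' s(1,2,4) by auto
    qed
    have "P W"
      unfolding P_def
    proof (intro conjI)
      show "W \<subseteq> V" using UV V(3) u by (auto simp: W_def)
      show "pzero n \<in> W" using U by (auto simp: W_def P_def)
      show "\<forall>v\<in>W. \<forall>w\<in>W. vadd v w \<in> W" using four unfolding W_def by blast
      have "\<forall>v\<in>W. \<forall>w\<in>W. good \<delta> v w"
        using four unfolding W_def by blast
      then show "\<exists>\<epsilon>. \<forall>v\<in>W. \<forall>w\<in>W. good \<epsilon> v w" by blast
    qed
    then have "W = U" using max by (auto simp: W_def)
    moreover have "u \<in> W"
    proof -
      have "vadd u (pzero n) = u" using u len by (simp add: vadd_zero)
      then show ?thesis using U unfolding W_def P_def by (metis UnI2 image_eqI)
    qed
    ultimately show False using u by simp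
  qed
  then have "\<exists>\<epsilon>. \<forall>v\<in>V. \<forall>w\<in>V. good \<epsilon> v w" using good by blast
  then show ?thesis unfolding good_def .
qed

text \<open>The map on strings is only required to be injective on \<open>S\<close>, so it may kill central elements.\<close>

theorem LA_iso:
  assumes V: "V \<subseteq> strs n" "pzero n \<in> V" "\<And>v w. v \<in> V \<Longrightarrow> w \<in> V \<Longrightarrow> vadd v w \<in> V"
    and \<phi>: "\<And>v. v \<in> V \<Longrightarrow> length (\<phi> v) = m"
      "\<And>v w. v \<in> V \<Longrightarrow> w \<in> V \<Longrightarrow> \<phi> (vadd v w) = vadd (\<phi> v) (\<phi> w)"
      "\<And>v w. v \<in> V \<Longrightarrow> w \<in> V \<Longrightarrow> anti (\<phi> v) (\<phi> w) = anti v w"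
    and S: "S \<subseteq> V" "inj_on \<phi> S" "aclosed S"
  shows "LA n S \<cong>\<^sub>L LA m (\<phi> ` S)"
proof -
  define d where "d v w \<longleftrightarrow> phs v w \<noteq> phs (\<phi> v) (\<phi> w)" for v w
  have len: "length v = n" if "v \<in> V" for v using V(1) that by auto
  have phs: "phs v w = (if d v w then - phs (\<phi> v) (\<phi> w) else phs (\<phi> v) (\<phi> w))" if "v \<in> V" "w \<in> V" for v w
  proof -
    have "phs v w * phs v w = phs (\<phi> v) (\<phi> w) * phs (\<phi> v) (\<phi> w)"
      using that len \<phi> by (simp add: phs_square)
    then show ?thesis unfolding d_def by (metis square_eq_iff)
  qed
  have nz: "phs (\<phi> v) (\<phi> w) \<noteq> 0" if "v \<in> V" "w \<in> V" for v w using that \<phi> by (intro phs_nonzero) auto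
  have \<phi>0: "\<phi> (pzero n) = pzero m"
  proof -
    have "\<phi> (pzero n) = \<phi> (vadd (pzero n) (pzero n))" by simp
    also have "\<dots> = pzero m" unfolding \<phi>(2)[OF V(2,2)] using \<phi>(1)[OF V(2)] by simp
    finally show ?thesis .
  qed
  have "\<exists>\<epsilon>. \<forall>v\<in>V. \<forall>w\<in>V. \<epsilon> (vadd v w) = (d v w \<noteq> (\<epsilon> v \<noteq> \<epsilon> w))"
  proof (rule cocycle_splits[OF V])
    fix v w assume vw: "v \<in> V" "w \<in> V"
    then show "d v w = d w v"
      using phs_swap[of v w] phs_swap[of "\<phi> v" "\<phi> w"] len \<phi> nz unfolding d_def by auto
  next
    fix v assume "v \<in> V" then show "\<not> d v v" by (simp add: d_def)
  next
    fix v assume "v \<in> V" then show "\<not> d (pzero n) v" by (simp add: d_def \<phi>0)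
  next
    fix u v w assume u: "u \<in> V" "v \<in> V" "w \<in> V"
    have 1: "phs u v * phs (vadd u v) w = phs v w * phs u (vadd v w)"
      by (rule phs_cocycle) (use u len in auto)
    have 2: "phs (\<phi> u) (\<phi> v) * phs (\<phi> (vadd u v)) (\<phi> w) = phs (\<phi> v) (\<phi> w) * phs (\<phi> u) (\<phi> (vadd v w))"
      using u \<phi> by (simp add: phs_cocycle)
    have 3: "phs (\<phi> u) (\<phi> v) * phs (\<phi> (vadd u v)) (\<phi> w) \<noteq> 0" using u V(3) nz by simp
    show "(d u v \<noteq> d (vadd u v) w) = (d v w \<noteq> d u (vadd v w))"
      using 1 2 3 phs[OF u(1,2)] phs[OF V(3)[OF u(1,2)] u(3)] phs[OF u(2,3)] phs[OF u(1) V(3)[OF u(2,3)]]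
      by (auto split: if_splits)
  qed
  then obtain \<epsilon> where \<epsilon>': "\<forall>v\<in>V. \<forall>w\<in>V. \<epsilon> (vadd v w) = (d v w \<noteq> (\<epsilon> v \<noteq> \<epsilon> w))" by (rule exE)
  have \<epsilon>: "\<epsilon> (vadd v w) = (d v w \<noteq> (\<epsilon> v \<noteq> \<epsilon> w))" if "v \<in> V" "w \<in> V" for v w
    by (rule \<epsilon>'[THEN bspec, THEN bspec, OF that])
  define e :: "pauli list \<Rightarrow> real" where "e v = (if \<epsilon> v then - 1 else 1)" for v
  define b where "b v = complex_of_real (e v) \<cdot>\<^sub>m pb (\<phi> v)" for v
  have bij: "bij_betw \<phi> S (\<phi> ` S)" using S(2) by (simp add: bij_betw_def)
  have im: "\<phi> ` S \<subseteq> strs m"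
  proof
    fix x assume "x \<in> \<phi> ` S"
    then obtain v where "v \<in> S" "x = \<phi> v" by (rule imageE)
    then show "x \<in> strs m" using \<phi>(1)[of v] S(1) by (simp add: subset_iff)
  qed
  have lS: "length (\<phi> v) = m" "length v = n" if "v \<in> S" for v using subsetD[OF S(1) that] by (simp_all add: \<phi>(1) len)
  have "structure_constants (2 ^ m) b S vadd kap"
    unfolding structure_constants_def
  proof (intro conjI ballI)
    show "finite S" by (rule finite_subset[OF subset_trans[OF S(1) V(1)]]) simp
    fix v assume v: "v \<in> S"
    show "b v \<in> carrier_mat (2 ^ m) (2 ^ m)" unfolding b_def using lS(1)[OF v] by simp
    fix w assume w: "w \<in> S"
    have vw: "v \<in> V" "w \<in> V" using v w S(1) by auto
    show "kap v w = 0 \<or> vadd v w \<in> S" using v w S(3) by (auto simp: kap_def aclosed_def)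
    have c: "pb (\<phi> v) \<in> carrier_mat (2 ^ m) (2 ^ m)" "pb (\<phi> w) \<in> carrier_mat (2 ^ m) (2 ^ m)"
      using lS v w by auto
    have "comm (b v) (b w) = complex_of_real (e v * e w) \<cdot>\<^sub>m comm (pb (\<phi> v)) (pb (\<phi> w))"
    proof (rule eq_matI)
      fix i j assume "i < dim_row (complex_of_real (e v * e w) \<cdot>\<^sub>m comm (pb (\<phi> v)) (pb (\<phi> w)))"
        "j < dim_col (complex_of_real (e v * e w) \<cdot>\<^sub>m comm (pb (\<phi> v)) (pb (\<phi> w)))"
      then have ij: "i < 2 ^ m" "j < 2 ^ m" using c by (auto simp: comm_def)
      have bc: "b v \<in> carrier_mat (2 ^ m) (2 ^ m)" "b w \<in> carrier_mat (2 ^ m) (2 ^ m)" using c by (auto simp: b_def)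
      have be: "b v $$ (x, y) = complex_of_real (e v) * pb (\<phi> v) $$ (x, y)"
        "b w $$ (x, y) = complex_of_real (e w) * pb (\<phi> w) $$ (x, y)" if "x < 2 ^ m" "y < 2 ^ m" for x y
        using that lS v w by (auto simp: b_def)
      have "comm (pb (\<phi> v)) (pb (\<phi> w)) \<in> carrier_mat (2 ^ m) (2 ^ m)" using c by auto
      then show "comm (b v) (b w) $$ (i, j) = (complex_of_real (e v * e w) \<cdot>\<^sub>m comm (pb (\<phi> v)) (pb (\<phi> w))) $$ (i, j)"
        using ij by (simp add: comm_entry[OF bc ij] comm_entry[OF c ij] be sum_distrib_left right_diff_distrib algebra_simps)
    qed (use c in \<open>auto simp: comm_def b_def\<close>)
    also have "\<dots> = complex_of_real (e v * e w * kap (\<phi> v) (\<phi> w)) \<cdot>\<^sub>m pb (\<phi> (vadd v w))"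
      unfolding comm_pb[OF lS(1)[OF v] lS(1)[OF w]] \<phi>(2)[OF vw] by (intro eq_matI) simp_all
    also have "e v * e w * kap (\<phi> v) (\<phi> w) = kap v w * e (vadd v w)"
    proof -
      have "kap (\<phi> v) (\<phi> w) = (if d v w then - kap v w else kap v w)"
        using phs[OF vw] unfolding kap_def \<phi>(3)[OF vw] by (cases "d v w") simp_all
      moreover have "e (vadd v w) = (if d v w then - (e v * e w) else e v * e w)"
        unfolding e_def \<epsilon>[OF vw] by (cases "d v w"; cases "\<epsilon> v"; cases "\<epsilon> w") simp_all
      ultimately show ?thesis by (cases "d v w") simp_all
    qed
    finally show "comm (b v) (b w) = complex_of_real (kap v w) \<cdot>\<^sub>m b (vadd v w)"
      unfolding b_def by (intro eq_matI) simp_all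
  qed
  moreover have "rspan (2 ^ m) b S = LA m (\<phi> ` S)"
    unfolding LA_def by (rule rspan_reindex[OF bij, of b e]) (simp_all add: b_def e_def lS)
  moreover have "indep (2 ^ m) b S"
    by (rule indep_reindex[OF bij, of b e pb]) (simp_all add: b_def e_def lS indep_pb[OF im])
  moreover have "structure_constants (2 ^ n) pb S vadd kap" "indep (2 ^ n) pb S"
    using pb_structure[OF subset_trans[OF S(1) V(1)] S(3)] indep_pb[OF subset_trans[OF S(1) V(1)]] .
  ultimately show ?thesis unfolding LA_def by (metis lie_iso_basis)
qed

section \<open>The classical targets as spans of Pauli strings\<close>

lemma u_alg_coef:
  assumes "M \<in> u_alg (2 ^ n)" "length v = n"
  shows "Re (coef n M v) = 0"
proof -
  have "cnj (coef n M v) = (\<Sum>i<2 ^ n. \<Sum>j<2 ^ n. - (cnj (pe v j i) * M $$ (j, i)))"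
    unfolding coef_def cnj_sum
  proof (intro sum.cong refl)
    fix i j :: nat assume "i \<in> {..<2 ^ n}" "j \<in> {..<2 ^ n}"
    then have ij: "i < 2 ^ n" "j < 2 ^ n" by auto
    have "M $$ (j, i) = - cnj (M $$ (i, j))" using assms(1) ij unfolding u_alg_def by blast
    then have "cnj (M $$ (i, j)) = - M $$ (j, i)" by simp
    moreover have "cnj (pe v j i) = pe v i j" using ij assms(2) by (intro pe_cnj) auto
    ultimately show "cnj (cnj (pe v i j) * M $$ (i, j)) = - (cnj (pe v j i) * M $$ (j, i))" by simp
  qed
  also have "\<dots> = - coef n M v"
    unfolding coef_def sum_negf by (subst sum.swap) simp
  finally show ?thesis by (simp add: complex_eq_iff)
qed

lemma LA_u_alg:
  assumes "M \<in> LA n S" "S \<subseteq> strs n"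
  shows "M \<in> u_alg (2 ^ n)"
proof -
  obtain r where M: "M = lc (2 ^ n) pb S r" using assms(1) by (auto simp: LA_def rspan_def)
  have "cnj (pb v $$ (j, i)) = - pb v $$ (i, j)" if "v \<in> S" "i < 2 ^ n" "j < 2 ^ n" for v i j
  proof -
    have "length v = n" using that assms by auto
    then show ?thesis using that by (simp add: pb_entry pe_cnj)
  qed
  then have "cnj (M $$ (j, i)) = - M $$ (i, j)" if "i < 2 ^ n" "j < 2 ^ n" for i j
    unfolding M using that by (simp add: lc_entry flip: sum_negf)
  then have "M $$ (i, j) = - cnj (M $$ (j, i))" if "i < 2 ^ n" "j < 2 ^ n" for i j
    using that by (metis minus_minus)
  moreover have "M \<in> carrier_mat (2 ^ n) (2 ^ n)" unfolding M by simp
  ultimately show ?thesis unfolding u_alg_def by blast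
qed

lemma trace_coef: "(\<Sum>i<2 ^ n. M $$ (i, i)) = coef n M (pzero n)"
proof -
  have "coef n M (pzero n) = (\<Sum>i<2 ^ n. \<Sum>j<2 ^ n. if i = j then M $$ (i, i) else 0)"
    unfolding coef_def pstring_zero by (intro sum.cong refl) auto
  then show ?thesis by simp
qed

lemma su_alg_LA: "su_alg (2 ^ n) = LA n (strs n - {pzero n})"
proof
  show "su_alg (2 ^ n) \<subseteq> LA n (strs n - {pzero n})"
  proof
    fix M assume "M \<in> su_alg (2 ^ n)"
    then have M: "M \<in> u_alg (2 ^ n)" "coef n M (pzero n) = 0"
      by (auto simp: su_alg_def trace_coef)
    have u_car: "M \<in> carrier_mat (2 ^ n) (2 ^ n)" using M(1) unfolding u_alg_def by blast
    show "M \<in> LA n (strs n - {pzero n})"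
      by (rule LA_memI) (use M(2) u_alg_coef[OF M(1)] u_car in auto)
  qed
  show "LA n (strs n - {pzero n}) \<subseteq> su_alg (2 ^ n)"
  proof
    fix M assume M: "M \<in> LA n (strs n - {pzero n})"
    then obtain r where "M = lc (2 ^ n) pb (strs n - {pzero n}) r" by (auto simp: LA_def rspan_def)
    then have "coef n M (pzero n) = 0" by (simp add: coef_lc)
    then show "M \<in> su_alg (2 ^ n)" using LA_u_alg[OF M] by (auto simp: su_alg_def trace_coef)
  qed
qed

lemma so_alg_LA: "so_alg (2 ^ n) = LA n {v \<in> strs n. oddY v}"
proof
  show "so_alg (2 ^ n) \<subseteq> LA n {v \<in> strs n. oddY v}"
  proof
    fix M assume M: "M \<in> so_alg (2 ^ n)"
    then have car: "M \<in> carrier_mat (2 ^ n) (2 ^ n)" by (simp add: so_alg_def)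
    have t: "M $$ (j, i) = - M $$ (i, j)" if "i < 2 ^ n" "j < 2 ^ n" for i j
    proof -
      have "transpose_mat M $$ (i, j) = (- M) $$ (i, j)" using M by (simp add: so_alg_def)
      then show ?thesis using that car by simp
    qed
    have "cnj (M $$ (i, j)) = M $$ (i, j)" if "i < 2 ^ n" "j < 2 ^ n" for i j
      using M that by (auto simp: so_alg_def complex_is_Real_iff complex_eq_iff)
    then have "M $$ (i, j) = - cnj (M $$ (j, i))" if "i < 2 ^ n" "j < 2 ^ n" for i j
      using t[of j i] that by simp
    then have "M \<in> u_alg (2 ^ n)" using car unfolding u_alg_def by blast
    moreover have "coef n M v = 0" if "length v = n" "\<not> oddY v" for v
    proof -
      have "coef n M v = (\<Sum>j<2 ^ n. \<Sum>i<2 ^ n. cnj (pe v i j) * M $$ (i, j))"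
        unfolding coef_def by (rule sum.swap)
      also have "\<dots> = (\<Sum>i<2 ^ n. \<Sum>j<2 ^ n. - (cnj (pe v i j) * M $$ (i, j)))"
      proof (intro sum.cong refl)
        fix i j :: nat assume "i \<in> {..<2 ^ n}" "j \<in> {..<2 ^ n}"
        then have "pe v j i = pe v i j" "M $$ (j, i) = - M $$ (i, j)"
          using pe_transpose[of i v j] t[of i j] that by auto
        then show "cnj (pe v j i) * M $$ (j, i) = - (cnj (pe v i j) * M $$ (i, j))" by simp
      qed
      also have "\<dots> = - coef n M v" by (simp add: coef_def sum_negf)
      finally show ?thesis by simp
    qed
    ultimately show "M \<in> LA n {v \<in> strs n. oddY v}"
      by (intro LA_memI car) (auto simp: u_alg_coef)
  qed
  show "LA n {v \<in> strs n. oddY v} \<subseteq> so_alg (2 ^ n)"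
  proof
    fix M assume M: "M \<in> LA n {v \<in> strs n. oddY v}"
    then obtain r where r: "M = lc (2 ^ n) pb {v \<in> strs n. oddY v} r" by (auto simp: LA_def rspan_def)
    have car: "M \<in> carrier_mat (2 ^ n) (2 ^ n)" unfolding r by simp
    have u: "cnj (M $$ (j, i)) = - M $$ (i, j)" if "i < 2 ^ n" "j < 2 ^ n" for i j
    proof -
      have "M $$ (i, j) = - cnj (M $$ (j, i))" using LA_u_alg[OF M] that unfolding u_alg_def by blast
      then show ?thesis by simp
    qed
    have t: "M $$ (j, i) = - M $$ (i, j)" if ij: "i < 2 ^ n" "j < 2 ^ n" for i j
    proof -
      have "pb v $$ (j, i) = - pb v $$ (i, j)" if "length v = n" "oddY v" for v
        using pe_transpose[of i v j] ij that by (simp add: pb_entry)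
      then show ?thesis unfolding r using ij by (auto simp: lc_entry sum_negf[symmetric] intro!: sum.cong)
    qed
    have "M $$ (i, j) \<in> \<real>" if "i < 2 ^ n" "j < 2 ^ n" for i j
      using u[OF that] t[OF that] by (simp add: complex_is_Real_iff complex_eq_iff)
    moreover have "transpose_mat M = - M"
    proof (rule eq_matI)
      fix i j assume "i < dim_row (- M)" "j < dim_col (- M)"
      then have "i < 2 ^ n" "j < 2 ^ n" using car by auto
      then show "transpose_mat M $$ (i, j) = (- M) $$ (i, j)" using car t[of i j] by simp
    qed (use car in auto)
    ultimately show "M \<in> so_alg (2 ^ n)" using car unfolding so_alg_def by blast
  qed
qed

lemma lc_mult_left:
  assumes "A \<in> carrier_mat N N" "\<And>i. i \<in> I \<Longrightarrow> b i \<in> carrier_mat N N"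
  shows "A * lc N b I r = lc N (\<lambda>i. A * b i) I r"
proof (rule eq_matI)
  fix x y assume "x < dim_row (lc N (\<lambda>i. A * b i) I r)" "y < dim_col (lc N (\<lambda>i. A * b i) I r)"
  then have xy: "x < N" "y < N" by auto
  have ent: "(A * B) $$ (x, y) = (\<Sum>z<N. A $$ (x, z) * B $$ (z, y))" if "B \<in> carrier_mat N N" for B
    using that assms(1) xy by (auto simp: scalar_prod_def lessThan_atLeast0)
  have "(A * lc N b I r) $$ (x, y) = (\<Sum>z<N. \<Sum>i\<in>I. complex_of_real (r i) * (A $$ (x, z) * b i $$ (z, y)))"
    unfolding ent[OF lc_carrier] using xy by (simp add: lc_entry sum_distrib_left mult_ac)
  also have "\<dots> = (\<Sum>i\<in>I. \<Sum>z<N. complex_of_real (r i) * (A $$ (x, z) * b i $$ (z, y)))" by (rule sum.swap)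
  also have "\<dots> = lc N (\<lambda>i. A * b i) I r $$ (x, y)"
    unfolding lc_entry[OF xy] by (intro sum.cong refl) (simp add: ent assms(2) sum_distrib_left)
  finally show "(A * lc N b I r) $$ (x, y) = lc N (\<lambda>i. A * b i) I r $$ (x, y)" .
qed (use assms in auto)

lemma lc_mult_right:
  assumes "A \<in> carrier_mat N N" "\<And>i. i \<in> I \<Longrightarrow> b i \<in> carrier_mat N N"
  shows "lc N b I r * A = lc N (\<lambda>i. b i * A) I r"
proof (rule eq_matI)
  fix x y assume "x < dim_row (lc N (\<lambda>i. b i * A) I r)" "y < dim_col (lc N (\<lambda>i. b i * A) I r)"
  then have xy: "x < N" "y < N" by auto
  have ent: "(B * A) $$ (x, y) = (\<Sum>z<N. B $$ (x, z) * A $$ (z, y))" if "B \<in> carrier_mat N N" for B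
    using that assms(1) xy by (auto simp: scalar_prod_def lessThan_atLeast0)
  have "(lc N b I r * A) $$ (x, y) = (\<Sum>z<N. \<Sum>i\<in>I. complex_of_real (r i) * (b i $$ (x, z) * A $$ (z, y)))"
    unfolding ent[OF lc_carrier] using xy by (simp add: lc_entry sum_distrib_left mult_ac)
  also have "\<dots> = (\<Sum>i\<in>I. \<Sum>z<N. complex_of_real (r i) * (b i $$ (x, z) * A $$ (z, y)))" by (rule sum.swap)
  also have "\<dots> = lc N (\<lambda>i. b i * A) I r $$ (x, y)"
    unfolding lc_entry[OF xy] by (intro sum.cong refl) (simp add: ent assms(2) sum_distrib_left)
  finally show "(lc N b I r * A) $$ (x, y) = lc N (\<lambda>i. b i * A) I r $$ (x, y)" .
qed (use assms in auto)

lemma lc_scale: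
  assumes "\<And>i. i \<in> I \<Longrightarrow> b i = complex_of_real (t i) \<cdot>\<^sub>m d i" "\<And>i. i \<in> I \<Longrightarrow> d i \<in> carrier_mat N N"
  shows "lc N b I r = lc N d I (\<lambda>i. t i * r i)"
proof (rule eq_matI)
  fix x y assume "x < dim_row (lc N d I (\<lambda>i. t i * r i))" "y < dim_col (lc N d I (\<lambda>i. t i * r i))"
  then have xy: "x < N" "y < N" by auto
  have "b i $$ (x, y) = complex_of_real (t i) * d i $$ (x, y)" if "i \<in> I" for i
    using assms(1)[OF that] assms(2)[OF that] xy by simp
  then show "lc N b I r $$ (x, y) = lc N d I (\<lambda>i. t i * r i) $$ (x, y)"
    unfolding lc_entry[OF xy] by (intro sum.cong refl) simp
qed auto

lemma lc_subset:
  assumes "finite I" "J \<subseteq> I" "\<And>i. i \<in> I - J \<Longrightarrow> r i = 0"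
  shows "lc N b I r = lc N b J r"
  by (rule eq_matI) (use assms in \<open>auto simp: lc_entry intro!: sum.mono_neutral_right\<close>)

lemma lc_transpose:
  assumes "\<And>i. i \<in> I \<Longrightarrow> b i \<in> carrier_mat N N"
  shows "transpose_mat (lc N b I r) = lc N (\<lambda>i. transpose_mat (b i)) I r"
  by (rule eq_matI) (use assms[THEN carrier_matD(1)] assms[THEN carrier_matD(2)] in \<open>auto simp: lc_entry intro!: sum.cong\<close>)

lemma rspan_mono: "finite J \<Longrightarrow> I \<subseteq> J \<Longrightarrow> rspan N b I \<subseteq> rspan N b J"
proof
  fix A assume fin: "finite J" "I \<subseteq> J" "A \<in> rspan N b I"
  then obtain r where "A = lc N b I r" by (auto simp: rspan_def)
  also have "\<dots> = lc N b I (\<lambda>i. if i \<in> I then r i else 0)" by (rule lc_cong) simp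
  also have "\<dots> = lc N b J (\<lambda>i. if i \<in> I then r i else 0)" by (rule lc_subset[symmetric]) (use fin in auto)
  finally show "A \<in> rspan N b J" by simp
qed

lemma Jmat_pb: "Jmat (2 ^ n) = pb (PY # pzero n)"
proof (rule eq_matI)
  fix i j assume "i < dim_row (pb (PY # pzero n))" "j < dim_col (pb (PY # pzero n))"
  then have ij: "i < 2 * 2 ^ n" "j < 2 * 2 ^ n" by auto
  have d: "k div 2 ^ n = (if k < 2 ^ n then 0 else Suc 0) \<and> k mod 2 ^ n = (if k < 2 ^ n then k else k - 2 ^ n)"
    if "k < 2 * 2 ^ n" for k :: nat
    using that by (auto simp: div_if mod_if)
  show "Jmat (2 ^ n) $$ (i, j) = pb (PY # pzero n) $$ (i, j)"
    using ij d[OF ij(1)] d[OF ij(2)] by (auto simp: Jmat_def pb_entry pe_Cons pstring_zero simp del: pstring.simps)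
qed (auto simp: Jmat_def)

lemma sp_alg_LA: "sp_alg (2 ^ n) = LA (Suc n) {v \<in> strs (Suc n). oddY v \<noteq> anti v (PY # pzero n)}"
proof -
  let ?N = "2 ^ Suc n :: nat"
  let ?j = "PY # pzero n"
  let ?J = "pb ?j"
  let ?T = "{v \<in> strs (Suc n). oddY v \<noteq> anti v ?j}"
  let ?s = "\<lambda>v. if oddY v then - 1 else 1 :: real"
  let ?a = "\<lambda>v. if anti v ?j then 1 else - 1 :: real"
  have nz: "pzero (Suc n) \<notin> ?T"
  proof -
    have "\<not> oddY (pzero k)" for k by (induct k) auto
    then show ?thesis by (simp del: replicate.simps)
  qed
  have J: "?J \<in> carrier_mat ?N ?N" by (rule pb_carrier) simp
  have JJ: "?J * ?J = - 1\<^sub>m ?N"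
  proof -
    have "?J * ?J = (- phs ?j ?j) \<cdot>\<^sub>m pstring (vadd ?j ?j)" by (rule pb_mult[where n = "Suc n"]) simp_all
    also have "\<dots> = (- 1) \<cdot>\<^sub>m pstring (pzero (Suc n))" by (simp only: phs_self vadd_self) simp
    also have "\<dots> = - 1\<^sub>m ?N" unfolding pstring_zero by (intro eq_matI) auto
    finally show ?thesis .
  qed
  define c where "c = (\<lambda>v. pb v * ?J)"
  have car: "pb v \<in> carrier_mat ?N ?N" "c v \<in> carrier_mat ?N ?N" if "v \<in> strs (Suc n)" for v
    using that J by (auto simp: c_def)
  have sym: "transpose_mat (lc ?N pb S r) * ?J = - (?J * lc ?N pb S r)
      \<longleftrightarrow> lc ?N c S (\<lambda>v. ?s v * r v) = lc ?N c S (\<lambda>v. ?a v * r v)" if S: "S \<subseteq> strs (Suc n)" for S r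
  proof -
    have "transpose_mat (lc ?N pb S r) = lc ?N pb S (\<lambda>v. ?s v * r v)"
    proof (subst lc_transpose)
      show "lc ?N (\<lambda>v. transpose_mat (pb v)) S r = lc ?N pb S (\<lambda>v. ?s v * r v)"
      proof (rule lc_scale)
        fix v assume "v \<in> S"
        then have v: "length v = Suc n" using S by auto
        show "transpose_mat (pb v) = complex_of_real (?s v) \<cdot>\<^sub>m pb v"
        proof (rule eq_matI)
          fix i j assume "i < dim_row (complex_of_real (?s v) \<cdot>\<^sub>m pb v)" "j < dim_col (complex_of_real (?s v) \<cdot>\<^sub>m pb v)"
          then show "transpose_mat (pb v) $$ (i, j) = (complex_of_real (?s v) \<cdot>\<^sub>m pb v) $$ (i, j)"
            using pe_transpose[of i v j] by (simp add: pb_entry)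
        qed simp_all
      qed (use S car in auto)
    qed (use S car in auto)
    then have 1: "transpose_mat (lc ?N pb S r) * ?J = lc ?N c S (\<lambda>v. ?s v * r v)"
      using S car J by (simp add: c_def lc_mult_right subset_iff)
    have "- (?J * lc ?N pb S r) = complex_of_real (- 1) \<cdot>\<^sub>m lc ?N (\<lambda>v. ?J * pb v) S r"
      using S car J by (subst lc_mult_left) (auto intro!: eq_matI)
    also have "\<dots> = lc ?N (\<lambda>v. ?J * pb v) S (\<lambda>v. - 1 * r v)" by (rule lc_smult)
    also have "\<dots> = lc ?N c S (\<lambda>v. - ?a v * (- 1 * r v))"
    proof (rule lc_scale)
      fix v assume "v \<in> S"
      then have v: "length v = Suc n" using S by auto
      have "?J * pb v = (- phs ?j v) \<cdot>\<^sub>m pstring (vadd v ?j)"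
        using pb_mult[of ?j "Suc n" v] v by (simp add: vadd_comm)
      also have "\<dots> = complex_of_real (- ?a v) \<cdot>\<^sub>m ((- phs v ?j) \<cdot>\<^sub>m pstring (vadd v ?j))"
        using phs_swap[of v ?j] v by (intro eq_matI) auto
      also have "\<dots> = complex_of_real (- ?a v) \<cdot>\<^sub>m c v"
        using pb_mult[of v "Suc n" ?j] v by (simp add: c_def)
      finally show "?J * pb v = complex_of_real (- ?a v) \<cdot>\<^sub>m c v" .
    qed (use S car in auto)
    finally have 2: "- (?J * lc ?N pb S r) = lc ?N c S (\<lambda>v. ?a v * r v)" by simp
    show ?thesis unfolding 1 2 ..
  qed
  have indep: "indep ?N c S" if S: "S \<subseteq> strs (Suc n)" for S
    unfolding indep_def
  proof (intro allI impI ballI)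
    fix r v assume 0: "lc ?N c S r = 0\<^sub>m ?N ?N" and v: "v \<in> S"
    let ?L = "lc ?N pb S r"
    have "?L * ?J = 0\<^sub>m ?N ?N"
      using 0 S car J by (simp add: c_def lc_mult_right subset_iff)
    then have "(?L * ?J) * ?J = 0\<^sub>m ?N ?N" using J by simp
    moreover have "(?L * ?J) * ?J = ?L * (?J * ?J)" using J by (intro assoc_mult_mat) auto
    moreover have "?L * (- 1\<^sub>m ?N) = - ?L"
      by (metis lc_carrier one_carrier_mat right_mult_one_mat uminus_mult_right_mat carrier_matD)
    ultimately have "- ?L = 0\<^sub>m ?N ?N" by (simp add: JJ)
    then have "?L = - 0\<^sub>m ?N ?N" by (metis uminus_uminus_mat)
    also have "\<dots> = 0\<^sub>m ?N ?N" by (rule eq_matI) auto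
    finally have "?L = 0\<^sub>m ?N ?N" .
    then show "r v = 0" using indep_pb[OF S] v unfolding indep_def by blast
  qed
  let ?S = "strs (Suc n) - {pzero (Suc n)}"
  have TS: "?T \<subseteq> ?S" using nz by auto
  have su: "su_alg (2 * 2 ^ n) = LA (Suc n) ?S" using su_alg_LA[of "Suc n"] by simp
  have J2: "Jmat (2 ^ n) = ?J" by (rule Jmat_pb)
  show ?thesis
  proof
    show "sp_alg (2 ^ n) \<subseteq> LA (Suc n) ?T"
    proof
      fix M assume M: "M \<in> sp_alg (2 ^ n)"
      then obtain r where r: "M = lc ?N pb ?S r"
        unfolding sp_alg_def su LA_def rspan_def by auto
      have "transpose_mat M * ?J = - (?J * M)" using M by (simp add: sp_alg_def J2)
      then have eq0: "lc ?N c ?S (\<lambda>v. ?s v * r v) = lc ?N c ?S (\<lambda>v. ?a v * r v)"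
        unfolding r by (subst (asm) sym) auto
      have eq: "?s v * r v = ?a v * r v" if "v \<in> ?S" for v
        using indep_unique[OF indep[OF Diff_subset] eq0 that] .
      have "r v = 0" if "v \<in> ?S - ?T" for v
        using eq[of v] that by (auto split: if_splits)
      then have "M = lc ?N pb ?T r" unfolding r by (intro lc_subset TS) auto
      then show "M \<in> LA (Suc n) ?T" by (simp add: LA_def)
    qed
    show "LA (Suc n) ?T \<subseteq> sp_alg (2 ^ n)"
    proof
      fix M assume M: "M \<in> LA (Suc n) ?T"
      then obtain r where r: "M = lc ?N pb ?T r" unfolding LA_def rspan_def by auto
      have "M \<in> LA (Suc n) ?S" using M rspan_mono[of ?S ?T] TS unfolding LA_def by auto
      moreover have "lc ?N c ?T (\<lambda>v. ?s v * r v) = lc ?N c ?T (\<lambda>v. ?a v * r v)"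
        by (rule lc_cong) auto
      then have "transpose_mat M * ?J = - (?J * M)" unfolding r by (subst sym) auto
      ultimately show "M \<in> sp_alg (2 ^ n)" by (simp add: sp_alg_def J2 su)
    qed
  qed
qed

section \<open>Direct sums\<close>

abbreviation bd :: "complex mat \<Rightarrow> complex mat \<Rightarrow> complex mat" where
  "bd A B \<equiv> four_block_mat A (0\<^sub>m (dim_row A) (dim_col B)) (0\<^sub>m (dim_row B) (dim_col A)) B"

lemma bd_entry:
  assumes "A \<in> carrier_mat a a" "B \<in> carrier_mat b b" "i < a + b" "j < a + b"
  shows "bd A B $$ (i, j) = (if i < a then if j < a then A $$ (i, j) else 0
    else if j < a then 0 else B $$ (i - a, j - a))"
  using assms by auto

lemma bd_carrier [intro]: "A \<in> carrier_mat a a \<Longrightarrow> B \<in> carrier_mat b b \<Longrightarrow> bd A B \<in> carrier_mat (a + b) (a + b)"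
  by auto

lemma bd_inj:
  assumes "A \<in> carrier_mat a a" "B \<in> carrier_mat b b" "A' \<in> carrier_mat a a" "B' \<in> carrier_mat b b" "bd A B = bd A' B'"
  shows "A = A' \<and> B = B'"
proof
  have *: "bd A B $$ (i, j) = bd A' B' $$ (i, j)" for i j using assms(5) by simp
  show "A = A'"
  proof (rule eq_matI)
    fix i j assume "i < dim_row A'" "j < dim_col A'"
    then show "A $$ (i, j) = A' $$ (i, j)"
      using *[of i j] assms by (simp add: bd_entry[OF assms(1,2)] bd_entry[OF assms(3,4)])
  qed (use assms in auto)
  show "B = B'"
  proof (rule eq_matI)
    fix i j assume "i < dim_row B'" "j < dim_col B'"
    then show "B $$ (i, j) = B' $$ (i, j)"
      using *[of "a + i" "a + j"] assms by (simp add: bd_entry[OF assms(1,2)] bd_entry[OF assms(3,4)])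
  qed (use assms in auto)
qed

lemma bd_add:
  assumes "A \<in> carrier_mat a a" "B \<in> carrier_mat b b" "A' \<in> carrier_mat a a" "B' \<in> carrier_mat b b"
  shows "bd A B + bd A' B' = bd (A + A') (B + B')"
  by (rule eq_matI) (use assms in auto)

lemma bd_smult:
  assumes "A \<in> carrier_mat a a" "B \<in> carrier_mat b b"
  shows "c \<cdot>\<^sub>m bd A B = bd (c \<cdot>\<^sub>m A) (c \<cdot>\<^sub>m B)"
  by (rule eq_matI) (use assms in auto)

lemma bd_comm:
  assumes "A \<in> carrier_mat a a" "B \<in> carrier_mat b b" "A' \<in> carrier_mat a a" "B' \<in> carrier_mat b b"
  shows "comm (bd A B) (bd A' B') = bd (comm A A') (comm B B')"
proof -
  have m: "bd X Y * bd X' Y' = bd (X * X') (Y * Y')"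
    if "X \<in> carrier_mat a a" "Y \<in> carrier_mat b b" "X' \<in> carrier_mat a a" "Y' \<in> carrier_mat b b" for X Y X' Y' :: "complex mat"
  proof -
    have "bd X Y * bd X' Y' = four_block_mat (X * X' + 0\<^sub>m a b * 0\<^sub>m b a) (X * 0\<^sub>m a b + 0\<^sub>m a b * Y')
        (0\<^sub>m b a * X' + Y * 0\<^sub>m b a) (0\<^sub>m b a * 0\<^sub>m a b + Y * Y')"
      using that by (simp add: mult_four_block_mat[where ?nr1.0 = a and ?n1.0 = a and ?n2.0 = b and ?nr2.0 = b and ?nc1.0 = a and ?nc2.0 = b])
    then show ?thesis using that by simp
  qed
  show ?thesis
    unfolding comm_def m[OF assms] m[OF assms(3,4,1,2)]
    by (rule eq_matI) (use assms in auto)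
qed

lemma dsum_carrier: "L1 \<subseteq> carrier_mat a a \<Longrightarrow> L2 \<subseteq> carrier_mat b b \<Longrightarrow> L1 \<oplus>\<^sub>L L2 \<subseteq> carrier_mat (a + b) (a + b)"
  unfolding dsum_def by auto

lemma dsum_assoc:
  assumes "L1 \<subseteq> carrier_mat a a" "L2 \<subseteq> carrier_mat b b" "L3 \<subseteq> carrier_mat c c"
  shows "(L1 \<oplus>\<^sub>L L2) \<oplus>\<^sub>L L3 = L1 \<oplus>\<^sub>L L2 \<oplus>\<^sub>L L3"
proof -
  have "bd (bd A B) C = bd A (bd B C)" if "A \<in> L1" "B \<in> L2" "C \<in> L3" for A B C
  proof -
    have "A \<in> carrier_mat a a" "B \<in> carrier_mat b b" "C \<in> carrier_mat c c" using that assms by auto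
    then show ?thesis by (intro eq_matI) auto
  qed
  note eq = this
  show ?thesis
  proof
    show "(L1 \<oplus>\<^sub>L L2) \<oplus>\<^sub>L L3 \<subseteq> L1 \<oplus>\<^sub>L L2 \<oplus>\<^sub>L L3"
    proof
      fix X assume "X \<in> (L1 \<oplus>\<^sub>L L2) \<oplus>\<^sub>L L3"
      then obtain A B C where X: "X = bd (bd A B) C" "A \<in> L1" "B \<in> L2" "C \<in> L3" unfolding dsum_def by blast
      then show "X \<in> L1 \<oplus>\<^sub>L L2 \<oplus>\<^sub>L L3" unfolding X(1) eq[OF X(2-4)] unfolding dsum_def by blast
    qed
    show "L1 \<oplus>\<^sub>L L2 \<oplus>\<^sub>L L3 \<subseteq> (L1 \<oplus>\<^sub>L L2) \<oplus>\<^sub>L L3"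
    proof
      fix X assume "X \<in> L1 \<oplus>\<^sub>L L2 \<oplus>\<^sub>L L3"
      then obtain A B C where X: "X = bd A (bd B C)" "A \<in> L1" "B \<in> L2" "C \<in> L3" unfolding dsum_def by blast
      then show "X \<in> (L1 \<oplus>\<^sub>L L2) \<oplus>\<^sub>L L3" unfolding X(1) eq[OF X(2-4), symmetric] unfolding dsum_def by blast
    qed
  qed
qed

lemma ptag_sum:
  fixes f :: "pauli list \<Rightarrow> complex"
  assumes "finite S"
  shows "sum f ((\<lambda>(p, v). p # v) ` ({PI, PZ} \<times> S)) = (\<Sum>v\<in>S. f (PI # v) + f (PZ # v))"
proof -
  have "sum f ((\<lambda>(p, v). p # v) ` ({PI, PZ} \<times> S)) = (\<Sum>x\<in>{PI, PZ} \<times> S. f (fst x # snd x))"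
    by (subst sum.reindex) (auto simp: inj_on_def case_prod_beta)
  also have "\<dots> = (\<Sum>p\<in>{PI, PZ}. \<Sum>v\<in>S. f (p # v))" by (simp add: sum.cartesian_product case_prod_beta)
  finally show ?thesis by (simp add: sum.distrib)
qed

text \<open>\<open>(I \<plusminus> Z) / 2\<close> are the projections to the two diagonal blocks.\<close>

definition ptag :: "pauli list set \<Rightarrow> pauli list set" where
  "ptag S = (\<lambda>(p, v). p # v) ` ({PI, PZ} \<times> S)"

lemma LA_ptag:
  assumes "S \<subseteq> strs n"
  shows "LA (Suc n) (ptag S) = LA n S \<oplus>\<^sub>L LA n S"
proof -
  let ?N = "2 ^ n :: nat"
  have fin: "finite S" using assms finite_subset by blast
  have key: "lc (2 ^ Suc n) pb (ptag S) r
    = bd (lc ?N pb S (\<lambda>v. r (PI # v) + r (PZ # v))) (lc ?N pb S (\<lambda>v. r (PI # v) - r (PZ # v)))" for r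
  proof (rule eq_matI)
    fix i j assume "i < dim_row (bd (lc ?N pb S (\<lambda>v. r (PI # v) + r (PZ # v))) (lc ?N pb S (\<lambda>v. r (PI # v) - r (PZ # v))))"
      "j < dim_col (bd (lc ?N pb S (\<lambda>v. r (PI # v) + r (PZ # v))) (lc ?N pb S (\<lambda>v. r (PI # v) - r (PZ # v))))"
    then have ij: "i < 2 * ?N" "j < 2 * ?N" by auto
    have d: "k div 2 ^ n = (if k < 2 ^ n then 0 else Suc 0) \<and> k mod 2 ^ n = (if k < 2 ^ n then k else k - 2 ^ n)"
      if "k < 2 * 2 ^ n" for k :: nat
      using that by (auto simp: div_if mod_if)
    have p: "pb (p # v) $$ (i, j) = \<i> * (pmat p $$ (i div ?N, j div ?N) * pe v (i mod ?N) (j mod ?N))" if "v \<in> S" for p v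
    proof -
      have "length v = n" using that assms by auto
      then show ?thesis using ij by (simp add: pb_entry pe_Cons del: pstring.simps)
    qed
    have q: "pb v $$ (i', j') = \<i> * pe v i' j'" if "v \<in> S" "i' < ?N" "j' < ?N" for v i' j'
      using that assms by (intro pb_entry) auto
    have "lc (2 ^ Suc n) pb (ptag S) r $$ (i, j)
        = (\<Sum>v\<in>S. complex_of_real (r (PI # v)) * pb (PI # v) $$ (i, j) + complex_of_real (r (PZ # v)) * pb (PZ # v) $$ (i, j))"
      using ij by (simp add: lc_entry ptag_def ptag_sum[OF fin])
    also have "\<dots> = (\<Sum>v\<in>S. \<i> * (complex_of_real (r (PI # v)) * pmat PI $$ (i div ?N, j div ?N)
        + complex_of_real (r (PZ # v)) * pmat PZ $$ (i div ?N, j div ?N)) * pe v (i mod ?N) (j mod ?N))"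
      by (intro sum.cong refl) (simp add: p algebra_simps)
    also have "\<dots> = bd (lc ?N pb S (\<lambda>v. r (PI # v) + r (PZ # v))) (lc ?N pb S (\<lambda>v. r (PI # v) - r (PZ # v))) $$ (i, j)"
      using ij d[OF ij(1)] d[OF ij(2)]
      by (subst bd_entry[where a = ?N and b = ?N]) (auto simp: lc_entry q algebra_simps intro!: sum.cong)
    finally show "lc (2 ^ Suc n) pb (ptag S) r $$ (i, j)
      = bd (lc ?N pb S (\<lambda>v. r (PI # v) + r (PZ # v))) (lc ?N pb S (\<lambda>v. r (PI # v) - r (PZ # v))) $$ (i, j)" .
  qed auto
  show ?thesis
  proof
    show "LA (Suc n) (ptag S) \<subseteq> LA n S \<oplus>\<^sub>L LA n S"
    proof
      fix X assume "X \<in> LA (Suc n) (ptag S)"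
      then obtain r where "X = lc (2 ^ Suc n) pb (ptag S) r" unfolding LA_def rspan_def by blast
      then show "X \<in> LA n S \<oplus>\<^sub>L LA n S" unfolding key dsum_def LA_def by blast
    qed
    show "LA n S \<oplus>\<^sub>L LA n S \<subseteq> LA (Suc n) (ptag S)"
    proof
      fix X assume "X \<in> LA n S \<oplus>\<^sub>L LA n S"
      then obtain r s where X: "X = bd (lc ?N pb S r) (lc ?N pb S s)"
        unfolding dsum_def LA_def rspan_def by auto
      define t where "t w = (if hd w = PI then (r (tl w) + s (tl w)) / 2 else (r (tl w) - s (tl w)) / 2)" for w
      have "r = (\<lambda>v. t (PI # v) + t (PZ # v))" "s = (\<lambda>v. t (PI # v) - t (PZ # v))"
        by (auto simp: t_def fun_eq_iff field_simps)
      then have "X = lc (2 ^ Suc n) pb (ptag S) t" unfolding key X by simp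
      then show "X \<in> LA (Suc n) (ptag S)" by (simp add: LA_def)
    qed
  qed
qed

lemma LA_carrier: "LA n S \<subseteq> carrier_mat (2 ^ n) (2 ^ n)"
  unfolding LA_def using rspan_carrier by auto

lemma LA_ptag2:
  assumes "S \<subseteq> strs n"
  shows "LA (Suc (Suc n)) (ptag (ptag S)) = dpow (LA n S) 4"
proof -
  have "ptag S \<subseteq> strs (Suc n)" using assms by (auto simp: ptag_def)
  then show ?thesis
    using LA_carrier[of n S] dsum_carrier[OF LA_carrier[of n S] LA_carrier[of n S]]
    by (simp add: LA_ptag assms numeral_eq_Suc dsum_assoc[where a = "2 ^ n" and b = "2 ^ n" and c = "2 ^ n + 2 ^ n"])
qed

lemma lie_iso_dsum:
  assumes iso: "rspan N b I \<cong>\<^sub>L L1" "rspan N b J \<cong>\<^sub>L L2"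
    and IJ: "I \<inter> J = {}" "indep N b (I \<union> J)"
    and sc: "structure_constants N b I u k" "structure_constants N b J u' k'"
    and com: "\<And>i j. i \<in> I \<Longrightarrow> j \<in> J \<Longrightarrow> comm (b i) (b j) = 0\<^sub>m N N"
    and L: "L1 \<subseteq> carrier_mat n1 n1" "L2 \<subseteq> carrier_mat n2 n2"
  shows "rspan N b (I \<union> J) \<cong>\<^sub>L L1 \<oplus>\<^sub>L L2"
proof -
  obtain f where f: "bij_betw f (rspan N b I) L1" "\<And>A B. A \<in> rspan N b I \<Longrightarrow> B \<in> rspan N b I \<Longrightarrow> f (A + B) = f A + f B \<and> f (comm A B) = comm (f A) (f B)"
      "\<And>A r. A \<in> rspan N b I \<Longrightarrow> f (complex_of_real r \<cdot>\<^sub>m A) = complex_of_real r \<cdot>\<^sub>m f A"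
    using iso(1) unfolding lie_iso_def by metis
  obtain g where g: "bij_betw g (rspan N b J) L2" "\<And>A B. A \<in> rspan N b J \<Longrightarrow> B \<in> rspan N b J \<Longrightarrow> g (A + B) = g A + g B \<and> g (comm A B) = comm (g A) (g B)"
      "\<And>A r. A \<in> rspan N b J \<Longrightarrow> g (complex_of_real r \<cdot>\<^sub>m A) = complex_of_real r \<cdot>\<^sub>m g A"
    using iso(2) unfolding lie_iso_def by metis
  have fin: "finite I" "finite J" and car: "\<And>i. i \<in> I \<Longrightarrow> b i \<in> carrier_mat N N" "\<And>i. i \<in> J \<Longrightarrow> b i \<in> carrier_mat N N"
    using sc by (auto simp: structure_constants_def)
  have fL: "f (lc N b I r) \<in> carrier_mat n1 n1" and gL: "g (lc N b J r) \<in> carrier_mat n2 n2" for r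
    using f(1) g(1) L lc_in_rspan[of N b I r] lc_in_rspan[of N b J r] unfolding bij_betw_def by blast+
  define h where "h X = (let r = SOME r. lc N b (I \<union> J) r = X in bd (f (lc N b I r)) (g (lc N b J r)))" for X
  have h: "h (lc N b (I \<union> J) r) = bd (f (lc N b I r)) (g (lc N b J r))" for r
  proof -
    define s where "s = (SOME s. lc N b (I \<union> J) s = lc N b (I \<union> J) r)"
    have "lc N b (I \<union> J) s = lc N b (I \<union> J) r" unfolding s_def
      by (rule someI[of "\<lambda>s. lc N b (I \<union> J) s = lc N b (I \<union> J) r", OF refl])
    from indep_unique[OF IJ(2) this] have "\<And>i. i \<in> I \<union> J \<Longrightarrow> s i = r i" .
    then have "lc N b I s = lc N b I r" "lc N b J s = lc N b J r" by (auto intro!: lc_cong)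
    then show ?thesis unfolding h_def Let_def s_def[symmetric] by simp
  qed
  have com': "comm (b j) (b i) = 0\<^sub>m N N" if "i \<in> I" "j \<in> J" for i j
  proof -
    have "comm (b j) (b i) = - comm (b i) (b j)"
      unfolding comm_def using car(1)[OF that(1)] car(2)[OF that(2)] by (intro eq_matI) auto
    also have "\<dots> = 0\<^sub>m N N" unfolding com[OF that] by (intro eq_matI) auto
    finally show ?thesis .
  qed
  have comm_lc: "comm (lc N b (I \<union> J) r) (lc N b (I \<union> J) s)
    = comm (lc N b I r) (lc N b I s) + comm (lc N b J r) (lc N b J s)" for r s
  proof (rule eq_matI)
    fix x y assume "x < dim_row (comm (lc N b I r) (lc N b I s) + comm (lc N b J r) (lc N b J s))"
      "y < dim_col (comm (lc N b I r) (lc N b I s) + comm (lc N b J r) (lc N b J s))"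
    then have xy: "x < N" "y < N" by (auto simp: comm_def)
    have c: "comm (lc N b J r) (lc N b J s) \<in> carrier_mat N N" by auto
    have 1: "(\<Sum>j\<in>I \<union> J. complex_of_real (r i * s j) * comm (b i) (b j) $$ (x, y))
        = (\<Sum>j\<in>I. complex_of_real (r i * s j) * comm (b i) (b j) $$ (x, y))" if "i \<in> I" for i
      by (rule sum.mono_neutral_right) (use fin that com xy IJ in auto)
    have 2: "(\<Sum>j\<in>I \<union> J. complex_of_real (r i * s j) * comm (b i) (b j) $$ (x, y))
        = (\<Sum>j\<in>J. complex_of_real (r i * s j) * comm (b i) (b j) $$ (x, y))" if "i \<in> J" for i
      by (rule sum.mono_neutral_right) (use fin that com' xy IJ in auto)
    have "comm (lc N b (I \<union> J) r) (lc N b (I \<union> J) s) $$ (x, y)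
      = (\<Sum>i\<in>I \<union> J. \<Sum>j\<in>I \<union> J. complex_of_real (r i * s j) * comm (b i) (b j) $$ (x, y))"
      by (rule lc_comm_entry[OF xy]) (use car in auto)
    also have "\<dots> = (\<Sum>i\<in>I. \<Sum>j\<in>I. complex_of_real (r i * s j) * comm (b i) (b j) $$ (x, y))
        + (\<Sum>i\<in>J. \<Sum>j\<in>J. complex_of_real (r i * s j) * comm (b i) (b j) $$ (x, y))"
      by (subst sum.union_disjoint[OF fin IJ(1)]) (simp only: 1 2 cong: sum.cong)
    also have "\<dots> = (comm (lc N b I r) (lc N b I s) + comm (lc N b J r) (lc N b J s)) $$ (x, y)"
      using xy lc_comm_entry[where r = r and s = s, OF xy car(1) car(1)] lc_comm_entry[where r = r and s = s, OF xy car(2) car(2)]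
      by (simp add: carrier_matD[OF c])
    finally show "comm (lc N b (I \<union> J) r) (lc N b (I \<union> J) s) $$ (x, y)
      = (comm (lc N b I r) (lc N b I s) + comm (lc N b J r) (lc N b J s)) $$ (x, y)" .
  qed (auto simp: comm_def)
  have split: "lc N b (I \<union> J) (\<lambda>i. if i \<in> I then r i else s i) = lc N b I r + lc N b J s" for r s
  proof (rule eq_matI)
    fix x y assume "x < dim_row (lc N b I r + lc N b J s)" "y < dim_col (lc N b I r + lc N b J s)"
    then have xy: "x < N" "y < N" by auto
    have "(\<Sum>i\<in>J. complex_of_real (if i \<in> I then r i else s i) * b i $$ (x, y)) = (\<Sum>i\<in>J. complex_of_real (s i) * b i $$ (x, y))"
      by (intro sum.cong) (use IJ in auto)
    then show "lc N b (I \<union> J) (\<lambda>i. if i \<in> I then r i else s i) $$ (x, y) = (lc N b I r + lc N b J s) $$ (x, y)"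
      using xy by (simp add: lc_entry sum.union_disjoint[OF fin IJ(1)])
  qed auto
  have mix: "lc N b I (\<lambda>i. if i \<in> I then r i else s i) = lc N b I r"
    "lc N b J (\<lambda>i. if i \<in> I then r i else s i) = lc N b J s" for r s
    using IJ by (auto intro!: lc_cong)
  show ?thesis
    unfolding lie_iso_def
  proof (intro exI[of _ h] conjI ballI allI)
    show "bij_betw h (rspan N b (I \<union> J)) (L1 \<oplus>\<^sub>L L2)"
      unfolding bij_betw_def
    proof
      show "inj_on h (rspan N b (I \<union> J))"
      proof (rule inj_onI)
        fix X Y assume "X \<in> rspan N b (I \<union> J)" "Y \<in> rspan N b (I \<union> J)" "h X = h Y"
        then obtain r s where rs: "X = lc N b (I \<union> J) r" "Y = lc N b (I \<union> J) s"
          and eq: "bd (f (lc N b I r)) (g (lc N b J r)) = bd (f (lc N b I s)) (g (lc N b J s))"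
          by (auto simp: rspan_def h)
        have "f (lc N b I r) = f (lc N b I s)" "g (lc N b J r) = g (lc N b J s)"
          using bd_inj[OF fL gL fL gL eq] by auto
        then have "lc N b I r = lc N b I s" "lc N b J r = lc N b J s"
          using f(1) g(1) by (auto simp: bij_betw_def inj_on_def)
        moreover have "lc N b (I \<union> J) t = lc N b I t + lc N b J t" for t
          using split[of t t] by simp
        ultimately show "X = Y" unfolding rs by simp
      qed
      show "h ` rspan N b (I \<union> J) = L1 \<oplus>\<^sub>L L2"
      proof
        show "h ` rspan N b (I \<union> J) \<subseteq> L1 \<oplus>\<^sub>L L2"
        proof
          fix X assume "X \<in> h ` rspan N b (I \<union> J)"
          then obtain r where "X = bd (f (lc N b I r)) (g (lc N b J r))" unfolding rspan_def using h by blast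
          moreover have "f (lc N b I r) \<in> L1" "g (lc N b J r) \<in> L2" for r
            using f(1) g(1) lc_in_rspan unfolding bij_betw_def by blast+
          ultimately show "X \<in> L1 \<oplus>\<^sub>L L2" unfolding dsum_def by blast
        qed
        show "L1 \<oplus>\<^sub>L L2 \<subseteq> h ` rspan N b (I \<union> J)"
        proof
          fix X assume "X \<in> L1 \<oplus>\<^sub>L L2"
          then obtain A B where X: "X = bd A B" "A \<in> L1" "B \<in> L2" by (auto simp: dsum_def)
          then obtain r s where "A = f (lc N b I r)" "B = g (lc N b J s)"
            using f(1) g(1) unfolding bij_betw_def rspan_def by blast
          then have "X = h (lc N b (I \<union> J) (\<lambda>i. if i \<in> I then r i else s i))"
            unfolding h mix X(1) by simp
          then show "X \<in> h ` rspan N b (I \<union> J)" by blast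
        qed
      qed
    qed
  next
    fix X Y assume "X \<in> rspan N b (I \<union> J)" "Y \<in> rspan N b (I \<union> J)"
    then obtain r s where rs: "X = lc N b (I \<union> J) r" "Y = lc N b (I \<union> J) s" by (auto simp: rspan_def)
    have fadd: "f (lc N b I r + lc N b I s) = f (lc N b I r) + f (lc N b I s)"
      "g (lc N b J r + lc N b J s) = g (lc N b J r) + g (lc N b J s)"
      and fcom: "f (comm (lc N b I r) (lc N b I s)) = comm (f (lc N b I r)) (f (lc N b I s))"
      "g (comm (lc N b J r) (lc N b J s)) = comm (g (lc N b J r)) (g (lc N b J s))"
      using f(2) g(2) lc_in_rspan by blast+
    show "h (X + Y) = h X + h Y"
      unfolding rs lc_add h fadd[unfolded lc_add] bd_add[OF fL gL fL gL] ..
    obtain t t' where t: "comm (lc N b I r) (lc N b I s) = lc N b I t" "comm (lc N b J r) (lc N b J s) = lc N b J t'"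
      by (rule that[OF lc_comm[OF sc(1)] lc_comm[OF sc(2)]])
    have "h (comm X Y) = bd (f (lc N b I t)) (g (lc N b J t'))"
      unfolding rs comm_lc t split[symmetric] h mix ..
    also have "\<dots> = comm (h X) (h Y)"
      unfolding rs h bd_comm[OF fL gL fL gL] fcom[symmetric] t ..
    finally show "h (comm X Y) = comm (h X) (h Y)" .
  next
    fix X c assume "X \<in> rspan N b (I \<union> J)"
    then obtain r where r: "X = lc N b (I \<union> J) r" by (auto simp: rspan_def)
    have "f (complex_of_real c \<cdot>\<^sub>m lc N b I r) = complex_of_real c \<cdot>\<^sub>m f (lc N b I r)"
      "g (complex_of_real c \<cdot>\<^sub>m lc N b J r) = complex_of_real c \<cdot>\<^sub>m g (lc N b J r)"
      using f(3) g(3) lc_in_rspan by blast+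
    then show "h (complex_of_real c \<cdot>\<^sub>m X) = complex_of_real c \<cdot>\<^sub>m h X"
      unfolding r lc_smult h bd_smult[OF fL gL] by simp
  qed
qed

lemma LA_union:
  assumes "S \<subseteq> strs n" "T \<subseteq> strs n" "aclosed S" "aclosed T" "S \<inter> T = {}"
    "\<And>v w. v \<in> S \<Longrightarrow> w \<in> T \<Longrightarrow> \<not> anti v w" "LA n S \<cong>\<^sub>L L1" "LA n T \<cong>\<^sub>L L2"
    "L1 \<subseteq> carrier_mat a a" "L2 \<subseteq> carrier_mat b b"
  shows "LA n (S \<union> T) \<cong>\<^sub>L L1 \<oplus>\<^sub>L L2"
  unfolding LA_def
proof (rule lie_iso_dsum)
  show "comm (pb v) (pb w) = 0\<^sub>m (2 ^ n) (2 ^ n)" if vw: "v \<in> S" "w \<in> T" for v w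
  proof -
    have "length v = n" "length w = n" using vw assms(1,2) by auto
    then show ?thesis using assms(6)[OF vw] by (subst comm_pb[where n = n]) (auto simp: kap_def intro!: eq_matI)
  qed
  show "structure_constants (2 ^ n) pb S vadd kap" "structure_constants (2 ^ n) pb T vadd kap"
    using assms by (auto intro: pb_structure)
  show "indep (2 ^ n) pb (S \<union> T)" by (rule indep_pb) (use assms in auto)
qed (use assms in \<open>auto simp: LA_def\<close>)

lemma u1_carrier: "u1 \<subseteq> carrier_mat 1 1"
  unfolding u1_def u_alg_def by blast

lemma LA_single:
  assumes "length v = n"
  shows "LA n {v} \<cong>\<^sub>L u1"
proof -
  let ?d = "\<lambda>_ :: pauli list. \<i> \<cdot>\<^sub>m 1\<^sub>m 1 :: complex mat"
  have "rspan 1 ?d {v} = u1"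
  proof
    show "rspan 1 ?d {v} \<subseteq> u1"
      by (auto simp: rspan_def u1_def u_alg_def lc_entry)
    show "u1 \<subseteq> rspan 1 ?d {v}"
    proof
      fix A assume A: "A \<in> u1"
      then have "A $$ (0, 0) = - cnj (A $$ (0, 0))" unfolding u1_def u_alg_def by simp
      then have "A $$ (0, 0) = complex_of_real (Im (A $$ (0, 0))) * \<i>" by (simp add: complex_eq_iff)
      then have "A = lc 1 ?d {v} (\<lambda>_. Im (A $$ (0, 0)))"
        using A u1_carrier by (intro eq_matI) (auto simp: lc_entry)
      then show "A \<in> rspan 1 ?d {v}" by (metis lc_in_rspan)
    qed
  qed
  moreover have "rspan (2 ^ n) pb {v} \<cong>\<^sub>L rspan 1 ?d {v}"
  proof (rule lie_iso_basis)
    show "structure_constants (2 ^ n) pb {v} vadd kap"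
      by (rule pb_structure) (use assms in \<open>simp_all add: aclosed_def\<close>)
    show "indep (2 ^ n) pb {v}" by (rule indep_pb) (use assms in auto)
    show "structure_constants 1 ?d {v} vadd kap"
      by (auto simp: structure_constants_def comm_def kap_def intro!: eq_matI)
    show "indep 1 ?d {v}"
      unfolding indep_def
    proof (intro allI impI ballI)
      fix r i assume "lc 1 ?d {v} r = 0\<^sub>m 1 1" "i \<in> {v}"
      then have "lc 1 ?d {v} r $$ (0, 0) = 0" "i = v" by auto
      then show "r i = 0" by (simp add: lc_entry)
    qed
  qed
  ultimately show ?thesis by (simp add: LA_def)
qed

lemma dpow_carrier: "L \<subseteq> carrier_mat a a \<Longrightarrow> dpow L k \<subseteq> carrier_mat (k * a) (k * a)"
proof (induct L k rule: dpow.induct)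
  case (3 L m)
  then show ?case using dsum_carrier[OF 3(2) 3(1)] by simp
qed simp_all

lemma LA_commuting:
  "finite S \<Longrightarrow> S \<noteq> {} \<Longrightarrow> S \<subseteq> strs n \<Longrightarrow> (\<And>v w. v \<in> S \<Longrightarrow> w \<in> S \<Longrightarrow> \<not> anti v w) \<Longrightarrow> LA n S \<cong>\<^sub>L dpow u1 (card S)"
proof (induct S rule: finite_ne_induct)
  case (singleton x)
  then show ?case by (simp add: LA_single)
next
  case (insert x F)
  have "LA n ({x} \<union> F) \<cong>\<^sub>L u1 \<oplus>\<^sub>L dpow u1 (card F)"
    by (rule LA_union[OF _ _ _ _ _ _ _ _ u1_carrier dpow_carrier[OF u1_carrier]])
      (use insert in \<open>auto simp: aclosed_def LA_single\<close>)
  moreover have "dpow u1 (card (insert x F)) = u1 \<oplus>\<^sub>L dpow u1 (card F)"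
    using insert by (cases "card F") auto
  ultimately show ?case by simp
qed

section \<open>Orthogonal algebras from anticommuting families\<close>

definition pairs :: "nat \<Rightarrow> (nat \<times> nat) set" where
  "pairs N = {(i, j). i < j \<and> j < N}"

definition so_u :: "nat \<times> nat \<Rightarrow> nat \<times> nat \<Rightarrow> nat \<times> nat" where
  "so_u = (\<lambda>(i, j) (k, l). if j = k then (i, l) else if i = l then (k, j)
     else if i = k then (min j l, max j l) else (min i k, max i k))"

definition so_k :: "nat \<times> nat \<Rightarrow> nat \<times> nat \<Rightarrow> real" where
  "so_k = (\<lambda>(i, j) (k, l). if (i, j) = (k, l) then 0 else if j = k then 1 else if i = l then - 1
     else if i = k then (if j < l then - 1 else 1) else if j = l then (if i < k then - 1 else 1) else 0)"

lemma finite_pairs [simp, intro]: "finite (pairs N)"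
  by (rule finite_subset[of _ "{..<N} \<times> {..<N}"]) (auto simp: pairs_def)

lemma comm_self: "A \<in> carrier_mat N N \<Longrightarrow> comm A A = 0\<^sub>m N N"
  by (auto simp: comm_def intro!: eq_matI)

lemma so_structure:
  assumes car: "\<And>i j. i < N \<Longrightarrow> j < N \<Longrightarrow> F i j \<in> carrier_mat M M"
    and neg: "\<And>i j. i < N \<Longrightarrow> j < N \<Longrightarrow> i \<noteq> j \<Longrightarrow> F j i = - F i j"
    and chain: "\<And>i j k. i < N \<Longrightarrow> j < N \<Longrightarrow> k < N \<Longrightarrow> i \<noteq> j \<Longrightarrow> j \<noteq> k \<Longrightarrow> i \<noteq> k \<Longrightarrow> comm (F i j) (F j k) = F i k"
    and disj: "\<And>i j k l. i < N \<Longrightarrow> j < N \<Longrightarrow> k < N \<Longrightarrow> l < N \<Longrightarrow> i \<noteq> j \<Longrightarrow> k \<noteq> l \<Longrightarrow> i \<notin> {k, l} \<Longrightarrow> j \<notin> {k, l} \<Longrightarrow>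
      comm (F i j) (F k l) = 0\<^sub>m M M"
  shows "structure_constants M (\<lambda>(i, j). F i j) (pairs N) so_u so_k"
  unfolding structure_constants_def
proof (intro conjI ballI finite_pairs)
  fix s t assume "s \<in> pairs N" "t \<in> pairs N"
  then obtain i j k l where st: "s = (i, j)" "t = (k, l)" and lt: "i < j" "j < N" "k < l" "l < N"
    by (auto simp: pairs_def)
  have lt': "i < N" "k < N" using lt by auto
  have z: "0\<^sub>m M M = complex_of_real 0 \<cdot>\<^sub>m A" if "A \<in> carrier_mat M M" for A
    using that by (intro eq_matI) auto
  have m: "- A = complex_of_real (- 1) \<cdot>\<^sub>m A" for A by (intro eq_matI) auto
  have o: "A = complex_of_real 1 \<cdot>\<^sub>m A" for A by (intro eq_matI) auto
  have swap: "comm A B = - comm B A" if "A \<in> carrier_mat M M" "B \<in> carrier_mat M M" for A B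
    using that by (intro eq_matI) (auto simp: comm_def)
  have negl: "comm (- A) B = - comm A B" "comm A (- B) = - comm A B" if "A \<in> carrier_mat M M" "B \<in> carrier_mat M M" for A B
    using that by (intro eq_matI; auto simp: comm_def)+
  show "comm (case s of (i, j) \<Rightarrow> F i j) (case t of (i, j) \<Rightarrow> F i j)
    = complex_of_real (so_k s t) \<cdot>\<^sub>m (case so_u s t of (i, j) \<Rightarrow> F i j)"
  proof -
    consider (eq) "i = k" "j = l" | (jk) "j = k" | (il) "i = l" | (ik) "i = k" "j \<noteq> l" | (jl) "j = l" "i \<noteq> k"
      | (dis) "i \<notin> {k, l}" "j \<notin> {k, l}" by auto
    then have "comm (F i j) (F k l) = complex_of_real (so_k (i, j) (k, l)) \<cdot>\<^sub>m (case so_u (i, j) (k, l) of (i, j) \<Rightarrow> F i j)"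
    proof cases
      case eq
      then show ?thesis using lt lt' comm_self[OF car[of i j]] z[OF car] by (simp add: so_k_def so_u_def)
    next
      case jk
      then show ?thesis using chain[of i j l] lt lt' o by (simp add: so_k_def so_u_def)
    next
      case il
      have "comm (F i j) (F k l) = - comm (F k l) (F i j)" by (rule swap) (use car lt lt' in auto)
      also have "comm (F k l) (F i j) = F k j" using chain[of k i j] il lt lt' by simp
      finally show ?thesis using il lt m by (simp add: so_k_def so_u_def)
    next
      case ik
      have "comm (F i j) (F k l) = comm (- F j i) (F i l)" using neg[of j i] ik lt lt' by simp
      also have "\<dots> = - comm (F j i) (F i l)" by (rule negl) (use car lt lt' in auto)
      also have "comm (F j i) (F i l) = F j l" using chain[of j i l] ik lt lt' by simp
      finally have 1: "comm (F i j) (F k l) = - F j l" .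
      then have 2: "comm (F i j) (F k l) = F l j" using neg[of j l] ik lt by simp
      show ?thesis
      proof (cases "j < l")
        case True
        then show ?thesis using 1 ik lt m by (simp add: so_k_def so_u_def)
      next
        case False
        then show ?thesis using 2 ik lt o by (simp add: so_k_def so_u_def)
      qed
    next
      case jl
      have "comm (F i j) (F k l) = comm (F i j) (- F j k)" using neg[of j k] jl lt lt' by simp
      also have "\<dots> = - comm (F i j) (F j k)" by (rule negl) (use car lt lt' in auto)
      also have "comm (F i j) (F j k) = F i k" using chain[of i j k] jl lt lt' by simp
      finally have 1: "comm (F i j) (F k l) = - F i k" .
      then have 2: "comm (F i j) (F k l) = F k i" using neg[of i k] jl lt' by simp
      show ?thesis
      proof (cases "i < k")
        case True
        then show ?thesis using 1 jl lt m by (simp add: so_k_def so_u_def)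
      next
        case False
        then show ?thesis using 2 jl lt o by (simp add: so_k_def so_u_def)
      qed
    next
      case dis
      have "comm (F i j) (F k l) = 0\<^sub>m M M" using disj[of i j k l] dis lt lt' by simp
      also have "\<dots> = complex_of_real 0 \<cdot>\<^sub>m F (min i k) (max i k)" by (rule z, rule car) (use lt lt' in auto)
      finally show ?thesis using dis by (auto simp: so_k_def so_u_def)
    qed
    then show ?thesis by (simp add: st)
  qed
  show "so_k s t = 0 \<or> so_u s t \<in> pairs N"
    using lt lt' by (auto simp: st so_k_def so_u_def pairs_def min_def max_def)
qed (use car in \<open>auto simp: pairs_def\<close>)

definition Eso :: "nat \<Rightarrow> nat \<Rightarrow> nat \<Rightarrow> complex mat" where
  "Eso N i j = mat N N (\<lambda>(x, y). if x = i \<and> y = j then 1 else if x = j \<and> y = i then - 1 else 0)"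

lemma Eso_carrier [simp, intro]: "Eso N i j \<in> carrier_mat N N"
  by (simp add: Eso_def)

lemma Eso_mult:
  assumes "i < N" "j < N" "i \<noteq> j" "x < N"
  shows "(\<Sum>z<N. Eso N i j $$ (x, z) * g z) = (if x = i then g j else if x = j then - g i else 0)"
proof -
  have "(\<Sum>z<N. Eso N i j $$ (x, z) * g z)
      = (\<Sum>z<N. (if z = j then (if x = i then g j else 0) else 0) + (if z = i then (if x = j then - g i else 0) else 0))"
    using assms by (intro sum.cong refl) (auto simp: Eso_def)
  also have "\<dots> = (if x = i then g j else if x = j then - g i else 0)"
    using assms by (simp add: sum.distrib)
  finally show ?thesis .
qed

lemma Eso_comm_entry:
  assumes "i < N" "j < N" "i \<noteq> j" "k < N" "l < N" "k \<noteq> l" "x < N" "y < N"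
  shows "comm (Eso N i j) (Eso N k l) $$ (x, y)
    = (if x = i then Eso N k l $$ (j, y) else if x = j then - Eso N k l $$ (i, y) else 0)
    - (if x = k then Eso N i j $$ (l, y) else if x = l then - Eso N i j $$ (k, y) else 0)"
  using assms by (simp add: comm_entry[where N = N] Eso_mult)

lemma Eso_structure: "structure_constants N (\<lambda>(i, j). Eso N i j) (pairs N) so_u so_k"
proof (rule so_structure)
  fix i j assume "i < N" "j < N" "i \<noteq> j"
  then show "Eso N j i = - Eso N i j" by (intro eq_matI) (auto simp: Eso_def)
next
  fix i j k assume *: "i < N" "j < N" "k < N" "i \<noteq> j" "j \<noteq> k" "i \<noteq> k"
  show "comm (Eso N i j) (Eso N j k) = Eso N i k"
  proof (rule eq_matI)
    fix x y assume "x < dim_row (Eso N i k)" "y < dim_col (Eso N i k)"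
    then have "x < N" "y < N" by (auto simp: Eso_def)
    then show "comm (Eso N i j) (Eso N j k) $$ (x, y) = Eso N i k $$ (x, y)"
      using * by (subst Eso_comm_entry) (auto simp: Eso_def)
  qed (auto simp: comm_def Eso_def)
next
  fix i j k l assume *: "i < N" "j < N" "k < N" "l < N" "i \<noteq> j" "k \<noteq> l" "i \<notin> {k, l}" "j \<notin> {k, l}"
  show "comm (Eso N i j) (Eso N k l) = 0\<^sub>m N N"
  proof (rule eq_matI)
    fix x y assume "x < dim_row (0\<^sub>m N N :: complex mat)" "y < dim_col (0\<^sub>m N N :: complex mat)"
    then have "x < N" "y < N" by auto
    then show "comm (Eso N i j) (Eso N k l) $$ (x, y) = 0\<^sub>m N N $$ (x, y)"
      using * by (subst Eso_comm_entry) (auto simp: Eso_def)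
  qed (auto simp: comm_def Eso_def)
qed auto

lemma Eso_lc_entry:
  assumes "x < N" "y < N"
  shows "lc N (\<lambda>(i, j). Eso N i j) (pairs N) r $$ (x, y)
    = (if x < y then complex_of_real (r (x, y)) else if y < x then - complex_of_real (r (y, x)) else 0)"
proof -
  have "lc N (\<lambda>(i, j). Eso N i j) (pairs N) r $$ (x, y)
    = (\<Sum>p\<in>pairs N. (if p = (x, y) then complex_of_real (r (x, y)) else 0)
        + (if p = (y, x) then - complex_of_real (r (y, x)) else 0))"
    unfolding lc_entry[OF assms]
  proof (intro sum.cong refl)
    fix p assume "p \<in> pairs N"
    then obtain i j where p: "p = (i, j)" "i < j" "j < N" by (auto simp: pairs_def)
    then show "complex_of_real (r p) * (case p of (i, j) \<Rightarrow> Eso N i j) $$ (x, y)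
      = (if p = (x, y) then complex_of_real (r (x, y)) else 0) + (if p = (y, x) then - complex_of_real (r (y, x)) else 0)"
      using assms by (cases "x = i"; cases "y = j"; cases "x = j"; cases "y = i") (simp_all add: Eso_def)
  qed
  also have "\<dots> = (if (x, y) \<in> pairs N then complex_of_real (r (x, y)) else 0)
      + (if (y, x) \<in> pairs N then - complex_of_real (r (y, x)) else 0)"
    by (simp add: sum.distrib)
  finally show ?thesis using assms by (auto simp: pairs_def)
qed

lemma so_alg_Eso: "so_alg N = rspan N (\<lambda>(i, j). Eso N i j) (pairs N)"
proof
  show "so_alg N \<subseteq> rspan N (\<lambda>(i, j). Eso N i j) (pairs N)"
  proof
    fix M assume M: "M \<in> so_alg N"
    then have car: "M \<in> carrier_mat N N" by (simp add: so_alg_def)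
    have t: "M $$ (j, i) = - M $$ (i, j)" if "i < N" "j < N" for i j
    proof -
      have "transpose_mat M $$ (i, j) = (- M) $$ (i, j)" using M by (simp add: so_alg_def)
      then show ?thesis using that car by simp
    qed
    have "M = lc N (\<lambda>(i, j). Eso N i j) (pairs N) (\<lambda>(i, j). Re (M $$ (i, j)))"
    proof (rule eq_matI)
      fix x y assume "x < dim_row (lc N (\<lambda>(i, j). Eso N i j) (pairs N) (\<lambda>(i, j). Re (M $$ (i, j))))"
        "y < dim_col (lc N (\<lambda>(i, j). Eso N i j) (pairs N) (\<lambda>(i, j). Re (M $$ (i, j))))"
      then have xy: "x < N" "y < N" by auto
      have re: "complex_of_real (Re (M $$ (x, y))) = M $$ (x, y)" "complex_of_real (Re (M $$ (y, x))) = M $$ (y, x)"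
        using M xy by (auto simp: so_alg_def)
      have "M $$ (x, y) = 0" if "x = y" using t[of x x] xy that by simp
      then show "M $$ (x, y) = lc N (\<lambda>(i, j). Eso N i j) (pairs N) (\<lambda>(i, j). Re (M $$ (i, j))) $$ (x, y)"
        using re t[OF xy] by (simp add: Eso_lc_entry[OF xy])
    qed (use car in auto)
    then show "M \<in> rspan N (\<lambda>(i, j). Eso N i j) (pairs N)" by (metis lc_in_rspan)
  qed
  show "rspan N (\<lambda>(i, j). Eso N i j) (pairs N) \<subseteq> so_alg N"
  proof
    fix M assume "M \<in> rspan N (\<lambda>(i, j). Eso N i j) (pairs N)"
    then obtain r where r: "M = lc N (\<lambda>(i, j). Eso N i j) (pairs N) r" unfolding rspan_def by blast
    have "M $$ (i, j) \<in> \<real>" if "i < N" "j < N" for i j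
      unfolding r Eso_lc_entry[OF that] by simp
    moreover have "transpose_mat M = - M"
      unfolding r by (rule eq_matI) (simp_all add: Eso_lc_entry)
    ultimately show "M \<in> so_alg N" unfolding so_alg_def r by simp
  qed
qed

lemma so_alg_carrier: "so_alg N \<subseteq> carrier_mat N N"
  by (auto simp: so_alg_def)

lemma Eso_indep: "indep N (\<lambda>(i, j). Eso N i j) (pairs N)"
  unfolding indep_def
proof (intro allI impI ballI)
  fix r p assume 0: "lc N (\<lambda>(i, j). Eso N i j) (pairs N) r = 0\<^sub>m N N" and "p \<in> pairs N"
  then obtain i j where p: "p = (i, j)" "i < j" "j < N" by (auto simp: pairs_def)
  have "lc N (\<lambda>(i, j). Eso N i j) (pairs N) r $$ (i, j) = 0" unfolding 0 using p by simp
  then show "r p = 0" using p Eso_lc_entry[of i N j r] by simp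
qed

definition majorana :: "nat \<Rightarrow> nat \<Rightarrow> (nat \<Rightarrow> pauli list) \<Rightarrow> bool" where
  "majorana n N \<gamma> \<longleftrightarrow> (\<forall>i<N. length (\<gamma> i) = n) \<and> (\<forall>i<N. \<forall>j<N. i \<noteq> j \<longrightarrow> anti (\<gamma> i) (\<gamma> j))"

definition bilin :: "nat \<Rightarrow> (nat \<Rightarrow> pauli list) \<Rightarrow> pauli list set" where
  "bilin N \<gamma> = (\<lambda>(i, j). vadd (\<gamma> i) (\<gamma> j)) ` pairs N"

lemma majorana_anti:
  assumes "majorana n N \<gamma>" "i < N" "j < N" "m < N" "i \<noteq> j"
  shows "anti (\<gamma> m) (vadd (\<gamma> i) (\<gamma> j)) \<longleftrightarrow> m = i \<or> m = j"
proof -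
  have l: "length (\<gamma> x) = n" if "x < N" for x using assms(1) that by (auto simp: majorana_def)
  have a: "anti (\<gamma> m) (\<gamma> x) \<longleftrightarrow> m \<noteq> x" if "x < N" for x
    using assms(1,4) that by (cases "m = x") (auto simp: majorana_def)
  show ?thesis using assms(2-5) by (subst anti_vadd2) (auto simp: l a)
qed

lemma majorana_anti2:
  assumes "majorana n N \<gamma>" "i < N" "j < N" "k < N" "l < N" "i \<noteq> j" "k \<noteq> l"
  shows "anti (vadd (\<gamma> i) (\<gamma> j)) (vadd (\<gamma> k) (\<gamma> l)) \<longleftrightarrow> ((i = k \<or> i = l) \<noteq> (j = k \<or> j = l))"
proof -
  have l: "length (\<gamma> x) = n" if "x < N" for x using assms(1) that by (auto simp: majorana_def)
  show ?thesis using assms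
    by (subst anti_vadd) (auto simp: l majorana_anti[OF assms(1)])
qed

lemma vadd_merge: "length a = n \<Longrightarrow> length b = n \<Longrightarrow> length c = n \<Longrightarrow> vadd (vadd a b) (vadd b c) = vadd a c"
  by (simp add: vadd_assoc vadd_cancel)

lemma phs_merge:
  assumes "length a = n" "length b = n" "length c = n"
  shows "phs a b * phs b c * phs (vadd a b) (vadd b c) = phs a c"
proof -
  have 1: "phs a b * phs (vadd a b) (vadd b c) = phs b (vadd b c) * phs a (vadd b (vadd b c))"
    by (rule phs_cocycle) (use assms in auto)
  have 2: "phs b b * phs (vadd b b) c = phs b c * phs b (vadd b c)"
    by (rule phs_cocycle) (use assms in auto)
  have 3: "vadd b (vadd b c) = c" using assms by (simp add: vadd_cancel)
  have "phs a b * phs b c * phs (vadd a b) (vadd b c) = phs b c * (phs a b * phs (vadd a b) (vadd b c))" by simp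
  also have "\<dots> = (phs b c * phs b (vadd b c)) * phs a c" unfolding 1 3 by simp
  also have "\<dots> = phs a c" unfolding 2[symmetric] by simp
  finally show ?thesis .
qed

text \<open>The spin representation.\<close>

theorem LA_bilin:
  assumes \<gamma>: "majorana n N \<gamma>"
  shows "LA n (bilin N \<gamma>) \<cong>\<^sub>L so_alg N"
proof -
  define t where "t i j = Im (phs (\<gamma> i) (\<gamma> j)) / 2" for i j
  define F where "F i j = complex_of_real (t i j) \<cdot>\<^sub>m pb (vadd (\<gamma> i) (\<gamma> j))" for i j
  have l: "length (\<gamma> x) = n" if "x < N" for x using \<gamma> that by (auto simp: majorana_def)
  have l2: "length (vadd (\<gamma> x) (\<gamma> y)) = n" if "x < N" "y < N" for x y using l that by simp
  have a: "anti (\<gamma> x) (\<gamma> y)" if "x < N" "y < N" "x \<noteq> y" for x y using \<gamma> that by (auto simp: majorana_def)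
  have comF: "comm (F i j) (F k l) = complex_of_real (t i j * t k l * kap (vadd (\<gamma> i) (\<gamma> j)) (vadd (\<gamma> k) (\<gamma> l)))
      \<cdot>\<^sub>m pb (vadd (vadd (\<gamma> i) (\<gamma> j)) (vadd (\<gamma> k) (\<gamma> l)))" if "i < N" "j < N" "k < N" "l < N" for i j k l
  proof -
    let ?v = "vadd (\<gamma> i) (\<gamma> j)" and ?w = "vadd (\<gamma> k) (\<gamma> l)"
    have c: "pb ?v \<in> carrier_mat (2 ^ n) (2 ^ n)" "pb ?w \<in> carrier_mat (2 ^ n) (2 ^ n)"
      using l2 that by (auto intro!: pb_carrier simp: l)
    have "comm (F i j) (F k l) = complex_of_real (t i j * t k l) \<cdot>\<^sub>m comm (pb ?v) (pb ?w)"
    proof (rule eq_matI)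
      fix x y assume "x < dim_row (complex_of_real (t i j * t k l) \<cdot>\<^sub>m comm (pb ?v) (pb ?w))"
        "y < dim_col (complex_of_real (t i j * t k l) \<cdot>\<^sub>m comm (pb ?v) (pb ?w))"
      then have xy: "x < 2 ^ n" "y < 2 ^ n" using c by (auto simp: comm_def)
      have Fc: "F i j \<in> carrier_mat (2 ^ n) (2 ^ n)" "F k l \<in> carrier_mat (2 ^ n) (2 ^ n)"
        using c by (auto simp: F_def)
      have Fe: "F i j $$ (x, y) = complex_of_real (t i j) * pb ?v $$ (x, y)"
        "F k l $$ (x, y) = complex_of_real (t k l) * pb ?w $$ (x, y)" if "x < 2 ^ n" "y < 2 ^ n" for x y
        using that carrier_matD[OF c(1)] carrier_matD[OF c(2)] by (simp_all add: F_def del: pb_dim)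
      have "comm (pb ?v) (pb ?w) \<in> carrier_mat (2 ^ n) (2 ^ n)" using c by auto
      then show "comm (F i j) (F k l) $$ (x, y) = (complex_of_real (t i j * t k l) \<cdot>\<^sub>m comm (pb ?v) (pb ?w)) $$ (x, y)"
        using xy by (simp add: comm_entry[OF Fc xy] comm_entry[OF c xy] Fe sum_distrib_left right_diff_distrib algebra_simps)
    qed (use c in \<open>auto simp: comm_def F_def\<close>)
    also have "\<dots> = complex_of_real (t i j * t k l * kap ?v ?w) \<cdot>\<^sub>m pb (vadd ?v ?w)"
      unfolding comm_pb[OF l2[OF that(1,2)] l2[OF that(3,4)]] by (intro eq_matI) simp_all
    finally show ?thesis .
  qed
  have Fstruct: "structure_constants (2 ^ n) (\<lambda>(i, j). F i j) (pairs N) so_u so_k"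
  proof (rule so_structure)
    fix i j assume ij: "i < N" "j < N"
    then show "F i j \<in> carrier_mat (2 ^ n) (2 ^ n)" using l2 by (auto simp: F_def intro!: smult_carrier_mat pb_carrier)
    assume "i \<noteq> j"
    then have "phs (\<gamma> j) (\<gamma> i) = - phs (\<gamma> i) (\<gamma> j)" using phs_swap[of "\<gamma> i" "\<gamma> j"] a[OF ij] l ij by simp
    then have "t j i = - t i j" by (simp add: t_def)
    then show "F j i = - F i j" unfolding F_def vadd_comm[of "\<gamma> j"] by (intro eq_matI) simp_all
  next
    fix i j k assume *: "i < N" "j < N" "k < N" "i \<noteq> j" "j \<noteq> k" "i \<noteq> k"
    let ?v = "vadd (\<gamma> i) (\<gamma> j)" and ?w = "vadd (\<gamma> j) (\<gamma> k)"
    have an: "anti ?v ?w" using majorana_anti2[OF \<gamma>, of i j j k] * by auto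
    have p: "phs (\<gamma> i) (\<gamma> j) = complex_of_real (Im (phs (\<gamma> i) (\<gamma> j))) * \<i>"
      "phs (\<gamma> j) (\<gamma> k) = complex_of_real (Im (phs (\<gamma> j) (\<gamma> k))) * \<i>"
      "phs (\<gamma> i) (\<gamma> k) = complex_of_real (Im (phs (\<gamma> i) (\<gamma> k))) * \<i>"
      "phs ?v ?w = complex_of_real (Im (phs ?v ?w)) * \<i>"
      using phs_anti(1) a l l2 an * by simp_all
    have "phs (\<gamma> i) (\<gamma> j) * phs (\<gamma> j) (\<gamma> k) * phs ?v ?w = phs (\<gamma> i) (\<gamma> k)"
      by (rule phs_merge) (use l * in auto)
    then have "Im (phs (\<gamma> i) (\<gamma> k)) = Im ((complex_of_real (Im (phs (\<gamma> i) (\<gamma> j))) * \<i>)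
        * (complex_of_real (Im (phs (\<gamma> j) (\<gamma> k))) * \<i>) * (complex_of_real (Im (phs ?v ?w)) * \<i>))"
      using p by metis
    then have "Im (phs (\<gamma> i) (\<gamma> k)) = - (Im (phs (\<gamma> i) (\<gamma> j)) * Im (phs (\<gamma> j) (\<gamma> k)) * Im (phs ?v ?w))"
      by simp
    then have "t i j * t j k * kap ?v ?w = t i k"
      using an by (simp add: t_def kap_def)
    moreover have "vadd ?v ?w = vadd (\<gamma> i) (\<gamma> k)" by (rule vadd_merge) (use l * in auto)
    ultimately show "comm (F i j) (F j k) = F i k"
      using comF[of i j j k] * by (simp add: F_def)
  next
    fix i j k m assume *: "i < N" "j < N" "k < N" "m < N" "i \<noteq> j" "k \<noteq> m" "i \<notin> {k, m}" "j \<notin> {k, m}"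
    then have "kap (vadd (\<gamma> i) (\<gamma> j)) (vadd (\<gamma> k) (\<gamma> m)) = 0"
      using majorana_anti2[OF \<gamma>, of i j k m] by (auto simp: kap_def)
    then show "comm (F i j) (F k m) = 0\<^sub>m (2 ^ n) (2 ^ n)"
      using comF[of i j k m] * l by (auto intro!: eq_matI)
  qed
  let ?s = "\<lambda>(i, j). vadd (\<gamma> i) (\<gamma> j)"
  have inj: "inj_on ?s (pairs N)"
  proof (rule inj_onI)
    fix p q assume "p \<in> pairs N" "q \<in> pairs N" and eq: "?s p = ?s q"
    then obtain i j k m where p: "p = (i, j)" "q = (k, m)" "i < j" "j < N" "k < m" "m < N"
      by (auto simp: pairs_def)
    have "x = i \<or> x = j \<longleftrightarrow> x = k \<or> x = m" if "x < N" for x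
      using majorana_anti[OF \<gamma>, of i j x] majorana_anti[OF \<gamma>, of k m x] eq p that by simp
    from this[of i] this[of j] this[of k] this[of m] show "p = q" using p by auto
  qed
  then have bij: "bij_betw ?s (pairs N) (bilin N \<gamma>)" by (simp add: bij_betw_def bilin_def)
  have sub: "bilin N \<gamma> \<subseteq> strs n" using l by (auto simp: bilin_def pairs_def)
  have facts: "(case p of (i, j) \<Rightarrow> F i j) = complex_of_real (case p of (i, j) \<Rightarrow> t i j) \<cdot>\<^sub>m pb (?s p)"
    "pb (?s p) \<in> carrier_mat (2 ^ n) (2 ^ n)" "(case p of (i, j) \<Rightarrow> t i j) \<noteq> 0" if "p \<in> pairs N" for p
    using that l2 phs_anti(2) a l by (auto simp: F_def pairs_def t_def intro!: pb_carrier)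
  have "rspan (2 ^ n) (\<lambda>(i, j). F i j) (pairs N) = LA n (bilin N \<gamma>)"
    unfolding LA_def 
    by (rule rspan_reindex[of ?s "pairs N" "bilin N \<gamma>" "\<lambda>(i, j). F i j" "\<lambda>(i, j). t i j" pb, OF bij facts])
  moreover have "indep (2 ^ n) (\<lambda>(i, j). F i j) (pairs N)"
    
    by (rule indep_reindex[of ?s "pairs N" "bilin N \<gamma>" "\<lambda>(i, j). F i j" "\<lambda>(i, j). t i j" pb, OF bij facts indep_pb[OF sub]])
  ultimately show ?thesis
    using lie_iso_basis[OF Fstruct Eso_structure _ Eso_indep] by (simp add: so_alg_Eso)
qed

lemma bilin_mem:
  assumes "i < N" "j < N" "i \<noteq> j"
  shows "vadd (\<gamma> i) (\<gamma> j) \<in> bilin N \<gamma>"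
proof (cases "i < j")
  case True
  then show ?thesis using assms unfolding bilin_def pairs_def by force
next
  case False
  then have "(j, i) \<in> pairs N" using assms by (simp add: pairs_def)
  then show ?thesis unfolding bilin_def vadd_comm[of "\<gamma> i"] by force
qed

lemma bilin_aclosed:
  assumes \<gamma>: "majorana n N \<gamma>"
  shows "aclosed (bilin N \<gamma>)"
  unfolding aclosed_def
proof (intro ballI impI)
  fix v w assume "v \<in> bilin N \<gamma>" "w \<in> bilin N \<gamma>" and a: "anti v w"
  then obtain i j k m where p: "v = vadd (\<gamma> i) (\<gamma> j)" "w = vadd (\<gamma> k) (\<gamma> m)" "i < j" "j < N" "k < m" "m < N"
    by (auto simp: bilin_def pairs_def)
  have l: "length (\<gamma> x) = n" if "x < N" for x using \<gamma> that by (auto simp: majorana_def)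
  have lt: "i < N" "k < N" using p by auto
  have "(i = k \<or> i = m) \<noteq> (j = k \<or> j = m)" using a majorana_anti2[OF \<gamma>, of i j k m] p by simp
  then consider "i = k" "j \<noteq> m" | "i = m" "j \<noteq> k" | "j = k" "i \<noteq> m" | "j = m" "i \<noteq> k" using p by auto
  then show "vadd v w \<in> bilin N \<gamma>"
  proof cases
    case 1
    then have "vadd v w = vadd (\<gamma> j) (\<gamma> m)" unfolding p vadd_comm[of "\<gamma> i" "\<gamma> j"]
      by (simp add: vadd_merge[where n = n] l lt p)
    then show ?thesis using bilin_mem[of j N m] 1 p by simp
  next
    case 2
    then have "vadd v w = vadd (\<gamma> j) (\<gamma> k)" unfolding p vadd_comm[of "\<gamma> i" "\<gamma> j"] vadd_comm[of "\<gamma> k" "\<gamma> m"]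
      by (simp add: vadd_merge[where n = n] l lt p)
    then show ?thesis using bilin_mem[of j N k] 2 p lt by simp
  next
    case 3
    then have "vadd v w = vadd (\<gamma> i) (\<gamma> m)" unfolding p
      by (simp add: vadd_merge[where n = n] l lt p)
    then show ?thesis using bilin_mem[of i N m] 3 p lt by simp
  next
    case 4
    then have "vadd v w = vadd (\<gamma> i) (\<gamma> k)" unfolding p vadd_comm[of "\<gamma> k" "\<gamma> m"]
      by (simp add: vadd_merge[where n = n] l lt p)
    then show ?thesis using bilin_mem[of i N k] 4 p lt by simp
  qed
qed

lemma cl_path:
  assumes \<gamma>: "majorana n N \<gamma>"
  shows "cl {vadd (\<gamma> i) (\<gamma> (Suc i)) |i. Suc i < N} = bilin N \<gamma>"
proof
  show "cl {vadd (\<gamma> i) (\<gamma> (Suc i)) |i. Suc i < N} \<subseteq> bilin N \<gamma>"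
    by (rule cl_least[OF _ bilin_aclosed[OF \<gamma>]]) (auto intro: bilin_mem)
  have l: "length (\<gamma> x) = n" if "x < N" for x using \<gamma> that by (auto simp: majorana_def)
  have "vadd (\<gamma> i) (\<gamma> (Suc (i + d))) \<in> cl {vadd (\<gamma> i) (\<gamma> (Suc i)) |i. Suc i < N}" if "Suc (i + d) < N" for i d
    using that
  proof (induct d)
    case 0
    then show ?case by (auto intro: cl.base)
  next
    case (Suc d)
    let ?m = "Suc (i + d)"
    have g: "vadd (\<gamma> ?m) (\<gamma> (Suc ?m)) \<in> cl {vadd (\<gamma> i) (\<gamma> (Suc i)) |i. Suc i < N}"
      using Suc(2) by (intro cl.base) auto
    have "anti (vadd (\<gamma> i) (\<gamma> ?m)) (vadd (\<gamma> ?m) (\<gamma> (Suc ?m)))"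
      using majorana_anti2[OF \<gamma>, of i ?m ?m "Suc ?m"] Suc(2) by simp
    then have "vadd (vadd (\<gamma> i) (\<gamma> ?m)) (vadd (\<gamma> ?m) (\<gamma> (Suc ?m))) \<in> cl {vadd (\<gamma> i) (\<gamma> (Suc i)) |i. Suc i < N}"
      using Suc by (intro cl.step[OF _ g]) auto
    moreover have "vadd (vadd (\<gamma> i) (\<gamma> ?m)) (vadd (\<gamma> ?m) (\<gamma> (Suc ?m))) = vadd (\<gamma> i) (\<gamma> (Suc ?m))"
      by (rule vadd_merge) (use l Suc(2) in auto)
    ultimately show ?case by simp
  qed
  then have *: "vadd (\<gamma> i) (\<gamma> j) \<in> cl {vadd (\<gamma> i) (\<gamma> (Suc i)) |i. Suc i < N}" if "i < j" "j < N" for i j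
    using that less_imp_Suc_add[of i j] by auto
  show "bilin N \<gamma> \<subseteq> cl {vadd (\<gamma> i) (\<gamma> (Suc i)) |i. Suc i < N}"
    using * by (auto simp: bilin_def pairs_def)
qed

section \<open>Orbits of strings under the generators of a chain\<close>

fun bonds :: "(pauli \<times> pauli) list \<Rightarrow> nat \<Rightarrow> pauli list list" where
  "bonds G (Suc (Suc k)) = map (\<lambda>(a, b). a # b # pzero k) G @ map ((#) PI) (bonds G (Suc k))"
| "bonds G _ = []"

lemma set_bonds: "set (bonds G n) = {pzero j @ A # B # pzero k |j k A B. (A, B) \<in> set G \<and> j + k + 2 = n}"
proof (induct G n rule: bonds.induct)
  case (1 G k)
  show ?case
  proof
    show "set (bonds G (Suc (Suc k))) \<subseteq> {pzero j @ A # B # pzero k' |j k' A B. (A, B) \<in> set G \<and> j + k' + 2 = Suc (Suc k)}"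
    proof
      fix v assume "v \<in> set (bonds G (Suc (Suc k)))"
      then consider (a) A B where "(A, B) \<in> set G" "v = A # B # pzero k" | (b) w where "w \<in> set (bonds G (Suc k))" "v = PI # w"
        by auto
      then show "v \<in> {pzero j @ A # B # pzero k' |j k' A B. (A, B) \<in> set G \<and> j + k' + 2 = Suc (Suc k)}"
      proof cases
        case a
        then have "v = pzero 0 @ A # B # pzero k" by simp
        then show ?thesis using a by (metis (mono_tags, lifting) add_2_eq_Suc' add_0 mem_Collect_eq)
      next
        case b
        then obtain j k' A B where "w = pzero j @ A # B # pzero k'" "(A, B) \<in> set G" "j + k' + 2 = Suc k"
          using 1 by auto
        then have "v = pzero (Suc j) @ A # B # pzero k'" "(A, B) \<in> set G" "Suc j + k' + 2 = Suc (Suc k)" using b by auto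
        then show ?thesis by blast
      qed
    qed
    show "{pzero j @ A # B # pzero k' |j k' A B. (A, B) \<in> set G \<and> j + k' + 2 = Suc (Suc k)} \<subseteq> set (bonds G (Suc (Suc k)))"
    proof
      fix v assume "v \<in> {pzero j @ A # B # pzero k' |j k' A B. (A, B) \<in> set G \<and> j + k' + 2 = Suc (Suc k)}"
      then obtain j k' A B where v: "v = pzero j @ A # B # pzero k'" "(A, B) \<in> set G" "j + k' = k" by auto
      show "v \<in> set (bonds G (Suc (Suc k)))"
      proof (cases j)
        case 0
        then show ?thesis using v by force
      next
        case (Suc i)
        then have "pzero i @ A # B # pzero k' \<in> set (bonds G (Suc k))" using v 1 by auto
        then show ?thesis using v Suc by auto
      qed
    qed
  qed
qed auto

lemma length_bonds: "g \<in> set (bonds G n) \<Longrightarrow> length g = n"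
  by (auto simp: set_bonds)

lemma bonds_strs: "set (bonds G n) \<subseteq> strs n"
  using length_bonds by auto

lemma bonds_embed:
  assumes "g \<in> set (bonds G m)"
  shows "pzero a @ g @ pzero c \<in> set (bonds G (a + m + c))"
proof -
  obtain j k A B where "g = pzero j @ A # B # pzero k" "(A, B) \<in> set G" "j + k + 2 = m"
    using assms by (auto simp: set_bonds)
  then have "pzero a @ g @ pzero c = pzero (a + j) @ A # B # pzero (k + c)" "(A, B) \<in> set G" "(a + j) + (k + c) + 2 = a + m + c"
    by (auto simp: replicate_add)
  then show ?thesis unfolding set_bonds by blast
qed

lemma placed_eq:
  assumes "j + k + 2 = n"
  shows "placed n (Suc j) A (Suc j + 1) B = pzero j @ A # B # pzero k"
proof -
  have "pzero n = pzero j @ PI # PI # pzero k"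
    using assms by (metis add_2_eq_Suc' add_Suc_right replicate_Suc replicate_add)
  then show ?thesis by (simp add: placed_def list_update_append)
qed

lemma chain_alg_LA: "chain_alg (set G) n = LA n (cl (set (bonds G n)))"
proof -
  have "{\<i> \<cdot>\<^sub>m pstring (placed n j A (j + 1) B) |A B j. (A, B) \<in> set G \<and> 1 \<le> j \<and> j \<le> n - 1} = pb ` set (bonds G n)"
    (is "?L = ?R")
  proof
    show "?L \<subseteq> ?R"
    proof
      fix X assume "X \<in> ?L"
      then obtain A B j where X: "X = pb (placed n j A (j + 1) B)" "(A, B) \<in> set G" "1 \<le> j" "j \<le> n - 1"
        by (auto simp: pb_def)
      then have "(j - 1) + (n - 1 - j) + 2 = n" "Suc (j - 1) = j" by auto
      then have "placed n j A (j + 1) B = pzero (j - 1) @ A # B # pzero (n - 1 - j)" using placed_eq by metis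
      then show "X \<in> ?R" using X \<open>(j - 1) + (n - 1 - j) + 2 = n\<close> unfolding set_bonds by blast
    qed
    show "?R \<subseteq> ?L"
    proof
      fix X assume "X \<in> ?R"
      then obtain A B j k where X: "X = pb (pzero j @ A # B # pzero k)" "(A, B) \<in> set G" "j + k + 2 = n"
        by (auto simp: set_bonds)
      then have "X = \<i> \<cdot>\<^sub>m pstring (placed n (Suc j) A (Suc j + 1) B)" "1 \<le> Suc j" "Suc j \<le> n - 1"
        using placed_eq[OF X(3), of A B] by (auto simp: pb_def)
      then show "X \<in> ?L" using X(2) by blast
    qed
  qed
  then show ?thesis unfolding chain_alg_def by (simp add: lie_gen_pb bonds_strs)
qed

inductive orb :: "pauli list set \<Rightarrow> pauli list \<Rightarrow> pauli list \<Rightarrow> bool" for G where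
  refl: "orb G v v"
| step: "g \<in> G \<Longrightarrow> anti g v \<Longrightarrow> orb G (vadd g v) w \<Longrightarrow> orb G v w"

lemma orb_trans: "orb G u v \<Longrightarrow> orb G v w \<Longrightarrow> orb G u w"
  by (induct rule: orb.induct) (auto intro: orb.step)

lemma orb_cl:
  assumes "orb G v w" "G \<subseteq> strs n" "length v = n" "w \<in> cl G"
  shows "v \<in> cl G"
  using assms
proof (induct rule: orb.induct)
  case (step g v w)
  have l: "length g = n" using step by auto
  then have "vadd g v \<in> cl G" using step by auto
  moreover have "anti g (vadd g v)" using step l by (simp add: anti_vadd2)
  moreover have "vadd g (vadd g v) = v" using step l by (simp add: vadd_cancel)
  ultimately show ?case using cl.step[of g G "vadd g v"] cl.base[of g G] step(1) by simp
qed

lemma orb_embed: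
  assumes "orb (set (bonds G m)) t t'" "length t = m" "length a = i" "length c = k"
  shows "orb (set (bonds G (i + m + k))) (a @ t @ c) (a @ t' @ c)"
  using assms
proof (induct rule: orb.induct)
  case (step g t t')
  have l: "length g = m" using step length_bonds by auto
  let ?g = "pzero i @ g @ pzero k"
  have "?g \<in> set (bonds G (i + m + k))" using step by (intro bonds_embed)
  moreover have "anti ?g (a @ t @ c)" using step l by (simp add: anti_append)
  moreover have "vadd ?g (a @ t @ c) = a @ vadd g t @ c"
    using step l by (simp add: vadd_append vadd_zero)
  moreover have "orb (set (bonds G (i + m + k))) (a @ vadd g t @ c) (a @ t' @ c)" using step l by simp
  ultimately show ?case using orb.step[of ?g "set (bonds G (i + m + k))" "a @ t @ c"] by simp
qed (auto intro: orb.refl)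

definition nondeg :: "pauli list list \<Rightarrow> pauli list \<Rightarrow> bool" where
  "nondeg gs v \<longleftrightarrow> list_ex (\<lambda>g. anti g v) gs"

lemma nondeg_iff: "nondeg gs v \<longleftrightarrow> (\<exists>g\<in>set gs. anti g v)"
  by (simp add: nondeg_def list_ex_iff)

lemma nondeg_embed:
  assumes "nondeg (bonds G m) t" "length t = m" "length a = i" "length c = k"
  shows "nondeg (bonds G (i + m + k)) (a @ t @ c)"
proof -
  obtain g where g: "g \<in> set (bonds G m)" "anti g t" using assms(1) by (auto simp: nondeg_iff)
  then have "length g = m" using length_bonds by auto
  then have "anti (pzero i @ g @ pzero k) (a @ t @ c)" using g assms by (simp add: anti_append)
  then show ?thesis using bonds_embed[OF g(1)] by (auto simp: nondeg_iff)
qed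

text \<open>Sets of strings of a fixed length as tries, so that orbits can be saturated by rewriting.\<close>

datatype trie = Emp | Eps | Nd trie trie trie trie

fun un :: "trie \<Rightarrow> trie \<Rightarrow> trie" where
  "un Emp t = t" | "un t Emp = t"
| "un (Nd a b c d) (Nd a' b' c' d') = Nd (un a a') (un b b') (un c c') (un d d')"
| "un Eps t = Eps" | "un t Eps = t"

fun mv :: "pauli list \<Rightarrow> bool \<Rightarrow> trie \<Rightarrow> trie" where
  "mv g s Emp = Emp"
| "mv [] s Eps = (if s then Eps else Emp)"
| "mv (p # g) s Eps = Emp"
| "mv [] s (Nd i x y z) = Emp"
| "mv (PI # g) s (Nd i x y z) = Nd (mv g s i) (mv g s x) (mv g s y) (mv g s z)"
| "mv (PX # g) s (Nd i x y z) = Nd (mv g s x) (mv g s i) (mv g (\<not> s) z) (mv g (\<not> s) y)"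
| "mv (PY # g) s (Nd i x y z) = Nd (mv g s y) (mv g (\<not> s) z) (mv g s i) (mv g (\<not> s) x)"
| "mv (PZ # g) s (Nd i x y z) = Nd (mv g s z) (mv g (\<not> s) y) (mv g (\<not> s) x) (mv g s i)"

fun mem :: "trie \<Rightarrow> pauli list \<Rightarrow> bool" where
  "mem Emp v = False"
| "mem Eps v = (v = [])"
| "mem (Nd i x y z) [] = False"
| "mem (Nd i x y z) (PI # v) = mem i v"
| "mem (Nd i x y z) (PX # v) = mem x v"
| "mem (Nd i x y z) (PY # v) = mem y v"
| "mem (Nd i x y z) (PZ # v) = mem z v"

fun mk :: "nat \<Rightarrow> (pauli list \<Rightarrow> bool) \<Rightarrow> trie" where
  "mk 0 Q = (if Q [] then Eps else Emp)"
| "mk (Suc k) Q = Nd (mk k (\<lambda>v. Q (PI # v))) (mk k (\<lambda>v. Q (PX # v))) (mk k (\<lambda>v. Q (PY # v))) (mk k (\<lambda>v. Q (PZ # v)))"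

fun sub :: "trie \<Rightarrow> trie \<Rightarrow> bool" where
  "sub Emp t = True"
| "sub Eps Eps = True"
| "sub (Nd a b c d) (Nd a' b' c' d') = (sub a a' \<and> sub b b' \<and> sub c c' \<and> sub d d')"
| "sub _ _ = False"

fun sweep :: "pauli list list \<Rightarrow> trie \<Rightarrow> trie" where
  "sweep [] t = t" | "sweep (g # gs) t = sweep gs (un t (mv g False t))"

fun sweeps :: "nat \<Rightarrow> pauli list list \<Rightarrow> trie \<Rightarrow> trie" where
  "sweeps 0 gs t = t" | "sweeps (Suc d) gs t = sweeps d gs (sweep gs t)"

fun child :: "trie \<Rightarrow> pauli \<Rightarrow> trie" where
  "child (Nd i x y z) PI = i" | "child (Nd i x y z) PX = x" | "child (Nd i x y z) PY = y" | "child (Nd i x y z) PZ = z"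
| "child _ _ = Emp"

lemma mem_Nd: "mem (Nd i x y z) v \<longleftrightarrow> (\<exists>q w. v = q # w \<and> mem (child (Nd i x y z) q) w)"
proof (cases v)
  case (Cons q w)
  then show ?thesis by (cases q) auto
qed simp

lemma mem_un: "mem (un a b) v \<Longrightarrow> mem a v \<or> mem b v"
proof (induct a b arbitrary: v rule: un.induct)
  case (3 a b c d a' b' c' d')
  then obtain q w where v: "v = q # w" "mem (child (Nd (un a a') (un b b') (un c c') (un d d')) q) w"
    unfolding un.simps mem_Nd by blast
  then show ?case using 3(1-4)[of w] by (cases q) simp_all
qed auto

lemma child_mv: "child (mv (p # g) s (Nd i x y z)) q = mv g (s \<noteq> an p q) (child (Nd i x y z) (pm p q))"
  by (cases p; cases q) simp_all

lemma mem_mv: "mem (mv g s T) v \<Longrightarrow> \<exists>t. mem T t \<and> v = vadd g t \<and> anti g t \<noteq> s \<and> length t = length g"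
proof (induct g arbitrary: s T v)
  case Nil
  then show ?case by (cases T) (auto split: if_splits)
next
  case (Cons p g)
  then obtain i x y z where T: "T = Nd i x y z" by (cases T) auto
  have "\<exists>i' x' y' z'. mv (p # g) s T = Nd i' x' y' z'" unfolding T by (cases p) auto
  then obtain q w where v: "v = q # w" "mem (child (mv (p # g) s T) q) w"
    using Cons(2) mem_Nd by auto
  then have "mem (mv g (s \<noteq> an p q) (child T (pm p q))) w" unfolding T child_mv by simp
  from Cons(1)[OF this] obtain t where t: "mem (child T (pm p q)) t" "w = vadd g t" "anti g t \<noteq> (s \<noteq> an p q)" "length t = length g"
    by blast
  have "mem T (pm p q # t)" using t(1) unfolding T mem_Nd by blast
  moreover have "an p (pm p q) = an p q" by (cases p; cases q) simp_all
  ultimately show ?case using t v by (intro exI[of _ "pm p q # t"]) auto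
qed

lemma mem_mk: "mem (mk k Q) v \<longleftrightarrow> length v = k \<and> Q v"
proof (induct k arbitrary: Q v)
  case (Suc k)
  show ?case
  proof (cases v)
    case (Cons p w)
    then show ?thesis using Suc by (cases p) auto
  qed simp
qed auto

lemma sub_mem: "sub a b \<Longrightarrow> mem a v \<Longrightarrow> mem b v"
proof (induct a b arbitrary: v rule: sub.induct)
  case (3 a b c d a' b' c' d')
  show ?case
  proof (cases v)
    case (Cons p w)
    then show ?thesis using 3 by (cases p) auto
  qed (use 3 in simp)
qed auto

lemma mem_sweep: "mem (sweep gs T) v \<Longrightarrow> set gs \<subseteq> set hs \<Longrightarrow> \<exists>t. mem T t \<and> orb (set hs) v t"
proof (induct gs arbitrary: T v)
  case (Cons g gs)
  then obtain u where u: "mem (un T (mv g False T)) u" "orb (set hs) v u" by force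
  show ?case
  proof (cases "mem T u")
    case False
    then have "mem (mv g False T) u" using u mem_un by blast
    then obtain t where t: "mem T t" "u = vadd g t" "anti g t" "length t = length g" using mem_mv by blast
    then have "vadd g u = t" "anti g u" by (simp_all add: vadd_cancel anti_vadd2)
    then have "orb (set hs) u t" using Cons(3) by (auto intro: orb.intros)
    then show ?thesis using t u orb_trans by blast
  qed (use u in blast)
qed (auto intro: orb.refl)

lemma mem_sweeps: "mem (sweeps d gs T) v \<Longrightarrow> \<exists>t. mem T t \<and> orb (set gs) v t"
proof (induct d arbitrary: T)
  case (Suc d)
  then obtain u where "mem (sweep gs T) u" "orb (set gs) v u" by auto
  then show ?case using mem_sweep[of gs T u gs] orb_trans by blast
qed (auto intro: orb.refl)

definition reach_check :: "nat \<Rightarrow> nat \<Rightarrow> pauli list list \<Rightarrow> (pauli list \<Rightarrow> bool) \<Rightarrow> trie \<Rightarrow> bool" where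
  "reach_check k d gs Q T \<longleftrightarrow> sub (mk k Q) (sweeps d gs T)"

lemma reach_check: "reach_check k d gs Q T \<Longrightarrow> length v = k \<Longrightarrow> Q v \<Longrightarrow> \<exists>t. mem T t \<and> orb (set gs) v t"
  unfolding reach_check_def using sub_mem mem_mk mem_sweeps by blast

text \<open>Head reduction: a string that anticommutes with some generator can be moved by generators
  until its first letter is the identity, while the rest still anticommutes with some generator.
  Both local conditions concern windows of bounded length.\<close>

definition local_check :: "(pauli \<times> pauli) list \<Rightarrow> nat \<Rightarrow> nat \<Rightarrow> bool" where
  "local_check G k d \<longleftrightarrow>
     reach_check 3 2 (bonds G 3) (nondeg (bonds G 3)) (mk 3 (nondeg (map (\<lambda>(a, b). [a, b, PI]) G))) \<and>
     reach_check (Suc k) d (bonds G (Suc k)) (nondeg (bonds G (Suc k))) (Nd (mk k (nondeg (bonds G k))) Emp Emp Emp) \<and>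
     list_all (\<lambda>(a, b). nondeg (bonds G 3) [a, b, PI] \<and> nondeg (bonds G 3) [PI, a, b]) G \<and> 2 \<le> k"

lemma front_reduction:
  assumes "local_check G k d" "length v = n" "2 \<le> n" "nondeg (bonds G n) v"
  shows "\<exists>w. orb (set (bonds G n)) v w \<and> length w = n \<and> nondeg (bonds G 2) (take 2 w)"
  using assms(2-4)
proof (induct n arbitrary: v)
  case (Suc n)
  show ?case
  proof (cases "n = 1")
    case True
    then show ?thesis using Suc(2,4) by (intro exI[of _ v]) (auto intro: orb.refl simp: numeral_2_eq_2)
  next
    case False
    then obtain m where m: "n = Suc m" "1 \<le> m" using Suc by (cases n) auto
    obtain a u where v: "v = a # u" "length u = n" using Suc(2) by (cases v) auto
    obtain g where g: "g \<in> set (bonds G (Suc n))" "anti g v" using Suc by (auto simp: nondeg_iff)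
    then consider (first) A B where "(A, B) \<in> set G" "g = A # B # pzero m" | (rest) h where "h \<in> set (bonds G n)" "g = PI # h"
      using m by auto
    then show ?thesis
    proof cases
      case first
      obtain b c where "v = a # b # c" using v m by (cases u) auto
      then have "nondeg (bonds G 2) (take 2 v)"
        using first g by (force simp: nondeg_iff numeral_2_eq_2)
      then show ?thesis using Suc(2) by (intro exI[of _ v]) (auto intro: orb.refl)
    next
      case rest
      then have "nondeg (bonds G n) u" using g v by (auto simp: nondeg_iff)
      then obtain w where w: "orb (set (bonds G n)) u w" "length w = n" "nondeg (bonds G 2) (take 2 w)"
        using Suc(1)[of u] v m by auto
      have o1: "orb (set (bonds G (Suc n))) v (a # w)"
        using orb_embed[OF w(1) v(2), of "[a]" 1 "[]" 0] v by simp
      obtain b c r where wb: "w = b # c # r" "length r = n - 2"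
        using w(2) m by (cases w; cases "tl w") auto
      have "nondeg (bonds G 3) [a, b, c]"
        using nondeg_embed[OF w(3), of "[a]" 1 "[]" 0] wb by (simp add: eval_nat_numeral del: bonds.simps)
      moreover have "reach_check 3 2 (bonds G 3) (nondeg (bonds G 3)) (mk 3 (nondeg (map (\<lambda>(a, b). [a, b, PI]) G)))"
        using assms(1) by (simp only: local_check_def)
      ultimately obtain t where t: "mem (mk 3 (nondeg (map (\<lambda>(a, b). [a, b, PI]) G))) t" "orb (set (bonds G 3)) [a, b, c] t"
        using reach_check[of 3 2 "bonds G 3" "nondeg (bonds G 3)" _ "[a, b, c]"] by (auto simp del: bonds.simps)
      then have t3: "length t = 3" "nondeg (map (\<lambda>(a, b). [a, b, PI]) G) t" by (auto simp: mem_mk)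
      then obtain x y z where xyz: "t = [x, y, z]" by (auto simp: numeral_3_eq_3 length_Suc_conv)
      have "nondeg (bonds G 2) [x, y]"
        using t3(2) by (force simp: nondeg_iff xyz numeral_2_eq_2)
      moreover have "orb (set (bonds G (Suc n))) (a # w) (x # y # z # r)"
        using orb_embed[OF t(2), of "[]" 0 r "n - 2"] wb xyz m by (simp add: numeral_3_eq_3)
      moreover have "take 2 (x # y # z # r) = [x, y]" "length (x # y # z # r) = Suc n"
        using wb m w(2) by (simp_all add: numeral_2_eq_2)
      ultimately show ?thesis using orb_trans[OF o1] by metis
    qed
  qed
qed simp

lemma head_reduction:
  assumes loc: "local_check G k d" and "Suc k \<le> Suc n" "length v = Suc n" "nondeg (bonds G (Suc n)) v"
  shows "\<exists>u. orb (set (bonds G (Suc n))) v (PI # u) \<and> length u = n \<and> nondeg (bonds G n) u"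
proof -
  have k: "2 \<le> k" using loc by (simp add: local_check_def)
  obtain w where w: "orb (set (bonds G (Suc n))) v w" "length w = Suc n" "nondeg (bonds G 2) (take 2 w)"
    using front_reduction[OF loc assms(3) _ assms(4)] assms(2) k by auto
  let ?t = "take (Suc k) w" and ?r = "drop (Suc k) w"
  have len: "length ?t = Suc k" "length ?r = n - k" using w assms k by auto
  have "take 2 ?t = take 2 w" using k by (simp add: min_def)
  then have "?t = take 2 w @ drop 2 ?t" using append_take_drop_id[of 2 ?t] by simp
  moreover have "length (drop 2 ?t) = k - 1" using len assms k by auto
  ultimately have "nondeg (bonds G (Suc k)) ?t"
    using nondeg_embed[OF w(3), of "[]" 0 "drop 2 ?t" "k - 1"] w(2) assms k by simp
  moreover have "reach_check (Suc k) d (bonds G (Suc k)) (nondeg (bonds G (Suc k))) (Nd (mk k (nondeg (bonds G k))) Emp Emp Emp)"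
    using loc by (simp only: local_check_def)
  ultimately obtain t where t: "mem (Nd (mk k (nondeg (bonds G k))) Emp Emp Emp) t" "orb (set (bonds G (Suc k))) ?t t"
    using reach_check[OF _ len(1)] by blast
  then obtain s where s: "t = PI # s" "length s = k" "nondeg (bonds G k) s"
    by (cases t; cases "hd t") (auto simp: mem_mk)
  have "orb (set (bonds G (Suc n))) w (PI # s @ ?r)"
    using orb_embed[OF t(2), of "[]" 0 ?r "n - k"] len s assms by simp
  moreover have "nondeg (bonds G n) (s @ ?r)"
    using nondeg_embed[OF s(3), of "[]" 0 ?r "n - k"] len s assms by simp
  moreover have "length (s @ ?r) = n" using s len assms by simp
  ultimately show ?thesis using orb_trans[OF w(1)] by blast
qed

definition invariant :: "(pauli \<times> pauli) list \<Rightarrow> (pauli list \<Rightarrow> bool) \<Rightarrow> bool" where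
  "invariant G Inv \<longleftrightarrow> (\<forall>v w. length v = length w \<longrightarrow> anti v w \<longrightarrow> Inv v \<longrightarrow> Inv w \<longrightarrow> Inv (vadd v w)) \<and>
     (\<forall>n. \<forall>g\<in>set (bonds G n). Inv g) \<and> (\<forall>u. Inv (PI # u) \<longrightarrow> Inv u)"

definition base_check :: "(pauli \<times> pauli) list \<Rightarrow> (pauli list \<Rightarrow> bool) \<Rightarrow> nat \<Rightarrow> nat \<Rightarrow> bool" where
  "base_check G Inv m d \<longleftrightarrow>
     reach_check m d (bonds G m) (\<lambda>v. Inv v \<and> nondeg (bonds G m) v) (mk m (\<lambda>v. v \<in> set (bonds G m)))"

lemma base_check:
  assumes "base_check G Inv m d" "length v = m" "Inv v" "nondeg (bonds G m) v"
  shows "v \<in> cl (set (bonds G m))"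
proof -
  obtain t where "t \<in> set (bonds G m)" "orb (set (bonds G m)) v t"
    using reach_check[OF assms(1)[unfolded base_check_def] assms(2)] assms(3,4) by (auto simp: mem_mk)
  then show ?thesis using orb_cl[OF _ bonds_strs assms(2)] cl.base by metis
qed

theorem cl_bonds:
  assumes loc: "local_check G k d" and inv: "invariant G Inv" and "m \<le> n" "3 \<le> m"
    and base_chk: "\<And>l. m \<le> l \<Longrightarrow> l \<le> max k m \<Longrightarrow> base_check G Inv l e"
  shows "cl (set (bonds G n)) = {v \<in> strs n. Inv v \<and> nondeg (bonds G n) v}"
proof
  have inv_add: "\<And>v w. length v = length w \<Longrightarrow> anti v w \<Longrightarrow> Inv v \<Longrightarrow> Inv w \<Longrightarrow> Inv (vadd v w)"
    and inv_gen: "\<And>n g. g \<in> set (bonds G n) \<Longrightarrow> Inv g"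
    and inv_PI: "\<And>u. Inv (PI # u) \<Longrightarrow> Inv u"
    using inv unfolding invariant_def by blast+
  have gens: "\<And>A B. (A, B) \<in> set G \<Longrightarrow> nondeg (bonds G 3) [A, B, PI] \<and> nondeg (bonds G 3) [PI, A, B]"
    using loc unfolding local_check_def list_all_iff by blast
  have base_n: "\<And>l v. m \<le> l \<Longrightarrow> l \<le> max k m \<Longrightarrow> length v = l \<Longrightarrow> Inv v \<Longrightarrow> nondeg (bonds G l) v \<Longrightarrow> v \<in> cl (set (bonds G l))"
    using base_check[OF base_chk] by blast
  show "cl (set (bonds G n)) \<subseteq> {v \<in> strs n. Inv v \<and> nondeg (bonds G n) v}"
  proof
    fix v assume "v \<in> cl (set (bonds G n))"
    then show "v \<in> {v \<in> strs n. Inv v \<and> nondeg (bonds G n) v}"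
    proof (induct rule: cl.induct)
      case (base g)
      then obtain j i A B where g: "g = pzero j @ A # B # pzero i" "(A, B) \<in> set G" "j + i + 2 = n"
        by (auto simp: set_bonds)
      have "nondeg (bonds G n) g"
      proof (cases i)
        case 0
        then obtain j' where "j = Suc j'" using g \<open>m \<le> n\<close> \<open>3 \<le> m\<close> by (cases j) auto
        then have "g = pzero j' @ [PI, A, B] @ []" "n = j' + 3 + 0"
          using g 0 by (simp_all add: replicate_append_same[symmetric])
        then show ?thesis using nondeg_embed[of G 3 "[PI, A, B]" "pzero j'" j' "[]" 0] gens[OF g(2)]
          by (simp del: bonds.simps)
      next
        case (Suc i')
        then have "g = pzero j @ [A, B, PI] @ pzero i'" "n = j + 3 + i'" using g by simp_all
        then show ?thesis using nondeg_embed[of G 3 "[A, B, PI]" "pzero j" j "pzero i'" i'] gens[OF g(2)]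
          by (simp del: bonds.simps append.simps)
      qed
      then show ?case using base inv_gen length_bonds by auto
    next
      case (step v w)
      then have l: "length v = n" "length w = n" by auto
      have "\<exists>g\<in>set (bonds G n). anti g (vadd v w)"
      proof (rule ccontr)
        assume no: "\<not> (\<exists>g\<in>set (bonds G n). anti g (vadd v w))"
        have "\<not> anti x (vadd v w)" if "x \<in> cl (set (bonds G n))" for x
          using that
        proof (induct rule: cl.induct)
          case (step x y)
          have "length x = n" "length y = n" using step cl_strs[OF bonds_strs[of G n]] by auto
          then show ?case using step l by (simp add: anti_vadd)
        qed (use no in auto)
        then have "\<not> anti v (vadd v w)" using step by blast
        then show False using step l by (simp add: anti_vadd2)
      qed
      then show ?case using step l inv_add by (auto simp: nondeg_iff)
    qed
  qed
  have inv_orb: "Inv w" if "orb (set (bonds G l)) v w" "Inv v" "length v = l" for l v w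
    using that
  proof (induct rule: orb.induct)
    case (step g v w)
    then show ?case using inv_gen[of g l] inv_add[of g v] length_bonds[of g G l] by auto
  qed
  have "v \<in> cl (set (bonds G n))" if "length v = n" "Inv v" "nondeg (bonds G n) v" for v
    using \<open>m \<le> n\<close> that
  proof (induct n arbitrary: v rule: dec_induct)
    case base
    then show ?case using base_n[of m v] by auto
  next
    case (step n)
    show ?case
    proof (cases "Suc n \<le> max k m")
      case True
      then show ?thesis using base_n[of "Suc n" v] step by auto
    next
      case False
      then have "Suc k \<le> Suc n" by simp
      from head_reduction[OF loc this step(4,6)]
      obtain u where u: "orb (set (bonds G (Suc n))) v (PI # u)" "length u = n" "nondeg (bonds G n) u"
        by blast
      have "Inv (PI # u)" by (rule inv_orb[OF u(1)]) (use step in auto)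
      then have "u \<in> cl (set (bonds G n))" using step u inv_PI by auto
      have "(#) PI ` set (bonds G n) \<subseteq> set (bonds G (Suc n))"
      proof
        fix x assume "x \<in> (#) PI ` set (bonds G n)"
        then show "x \<in> set (bonds G (Suc n))" by (cases n) auto
      qed
      then have "cl ((#) PI ` set (bonds G n)) \<subseteq> cl (set (bonds G (Suc n)))"
        by (intro cl_mono) (auto intro: cl.base)
      moreover have "cl ((#) PI ` set (bonds G n)) = (#) PI ` cl (set (bonds G n))"
        by (rule cl_image[of _ "strs n"]) (use bonds_strs in auto)
      ultimately have "PI # u \<in> cl (set (bonds G (Suc n)))" using \<open>u \<in> cl (set (bonds G n))\<close> by auto
      then show ?thesis using orb_cl[OF u(1) bonds_strs] step by auto
    qed
  qed
  then show "{v \<in> strs n. Inv v \<and> nondeg (bonds G n) v} \<subseteq> cl (set (bonds G n))" by auto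
qed

section \<open>The strings of the exponentially large chain algebras\<close>

fun adj :: "('a \<Rightarrow> 'a \<Rightarrow> bool) \<Rightarrow> 'a list \<Rightarrow> bool" where
  "adj R (a # b # v) \<longleftrightarrow> R a b \<and> adj R (b # v)"
| "adj R _ \<longleftrightarrow> True"

lemma not_nondeg: "\<not> nondeg (bonds G (length v)) v \<longleftrightarrow> adj (\<lambda>a b. \<forall>(A, B)\<in>set G. an A a = an B b) v"
proof (induct v rule: induct_list012)
  case (3 a b v)
  have "nondeg (bonds G (length (a # b # v))) (a # b # v)
    \<longleftrightarrow> (\<exists>(A, B)\<in>set G. an A a \<noteq> an B b) \<or> nondeg (bonds G (length (b # v))) (b # v)"
    by (auto simp: nondeg_iff Bex_def split_beta)
  then show ?case using 3 by auto
qed (auto simp: nondeg_iff)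

abbreviation "G3 \<equiv> [(PX,PX),(PY,PZ)]"
abbreviation "G5 \<equiv> [(PX,PY),(PY,PZ)]"
abbreviation "G7 \<equiv> [(PX,PX),(PY,PY),(PZ,PZ)]"
abbreviation "G11 \<equiv> [(PX,PY),(PY,PX),(PY,PZ)]"
abbreviation "G12 \<equiv> [(PX,PX),(PX,PY),(PY,PZ)]"
abbreviation "G13 \<equiv> [(PX,PX),(PY,PY),(PY,PZ)]"
abbreviation "G17 \<equiv> [(PX,PX),(PX,PY),(PZ,PX)]"
abbreviation "G18 \<equiv> [(PX,PX),(PX,PZ),(PY,PY),(PZ,PY)]"
abbreviation "G22 \<equiv> [(PX,PX),(PX,PY),(PX,PZ),(PY,PX)]"

text \<open>The sets of generators number 15 and 9, read from right to left.\<close>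

abbreviation "G15 \<equiv> [(PX,PX),(PY,PX),(PZ,PX)]"
abbreviation "G9 \<equiv> [(PY,PX),(PZ,PX)]"

lemma local_checks:
  "local_check G3 3 3" "local_check G5 4 4" "local_check G7 3 2" "local_check G11 3 3"
  "local_check G12 2 3" "local_check G13 2 3" "local_check G17 2 3" "local_check G18 2 2" "local_check G22 2 3"
  "local_check G15 2 2" "local_check G9 3 4"
  by code_simp+

lemma cl_bonds3:
  assumes "local_check G k d" "k \<le> m" "invariant G Inv" "3 \<le> m" "m \<le> n" "base_check G Inv m e"
  shows "cl (set (bonds G n)) = {v \<in> strs n. Inv v \<and> nondeg (bonds G n) v}"
proof (rule cl_bonds[OF assms(1,3,5,4)])
  fix l assume "m \<le> l" "l \<le> max k m"
  then have "l = m" using assms(2) by auto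
  then show "base_check G Inv l e" using assms(6) by simp
qed

lemma adj_const:
  assumes "adj R (a # v)" "\<And>b. R a b \<Longrightarrow> b = a"
  shows "a # v = replicate (Suc (length v)) a"
  using assms
proof (induct v)
  case (Cons x v)
  then have "x = a" by simp
  then show ?case using Cons by auto
qed simp

lemma nondeg_nonzero: "nondeg (bonds G n) v \<Longrightarrow> v \<noteq> pzero n"
  by (auto simp: nondeg_iff)

lemma deg_zero:
  assumes "length v = n" "3 \<le> n" "a \<noteq> PI" "b \<noteq> PI" "b \<noteq> a" "\<not> nondeg (bonds G n) v"
    "\<And>x y. (\<forall>(A, B)\<in>set G. an A x = an B y) \<Longrightarrow> (x, y) = (PI, PI) \<or> (x, y) = (a, b)"
  shows "v = pzero n"
proof -
  have adj: "adj (\<lambda>a b. \<forall>(A, B)\<in>set G. an A a = an B b) v"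
    using not_nondeg assms(1,6) by blast
  have "Suc (Suc (Suc 0)) \<le> length v" using assms(1,2) by simp
  then obtain x y z w where w: "v = x # y # z # w" by (auto simp: Suc_le_length_iff)
  have x: "x = PI" using adj assms(7)[of x y] assms(7)[of y z] assms(4,5) unfolding w by auto
  have "x # y # z # w = replicate (Suc (length (y # z # w))) x"
  proof (rule adj_const)
    fix u assume "\<forall>(A, B)\<in>set G. an A x = an B u"
    from assms(7)[OF this] x show "u = x" using assms(3) by auto
  qed (use adj w in simp)
  moreover have "n = Suc (Suc (Suc (length w)))" using assms(1) w by simp
  ultimately show ?thesis using w x by simp
qed

lemma cl_full:
  assumes "G \<in> {G12, G17, G18, G22}" "4 \<le> n"
  shows "cl (set (bonds G n)) = strs n - {pzero n}"
proof -
  have nz: "nondeg (bonds G n) v \<longleftrightarrow> v \<noteq> pzero n" if "length v = n" for v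
  proof
    assume v: "v \<noteq> pzero n"
    show "nondeg (bonds G n) v"
    proof (rule ccontr)
      assume "\<not> nondeg (bonds G n) v"
      then have "v = pzero n"
      proof (rule deg_zero[OF that _ _ _ _, of PY PZ, rotated -2])
        fix x y assume "\<forall>(A, B)\<in>set G. an A x = an B y"
        then show "(x, y) = (PI, PI) \<or> (x, y) = (PY, PZ)"
          using assms(1) by (elim insertE; cases x; cases y) simp_all
      qed (use assms in simp_all)
      then show False using v by simp
    qed
  qed (rule nondeg_nonzero)
  have inv: "invariant G (\<lambda>_. True)" by (simp add: invariant_def)
  have "\<exists>k d e. local_check G k d \<and> k \<le> 4 \<and> base_check G (\<lambda>_. True) 4 e"
    using assms(1)
  proof (elim insertE)
    assume "G = G12"
    moreover have "base_check G12 (\<lambda>_. True) 4 4" by code_simp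
    ultimately show ?thesis using local_checks(5) by auto
  next
    assume "G = G17"
    moreover have "base_check G17 (\<lambda>_. True) 4 4" by code_simp
    ultimately show ?thesis using local_checks(7) by auto
  next
    assume "G = G18"
    moreover have "base_check G18 (\<lambda>_. True) 4 4" by code_simp
    ultimately show ?thesis using local_checks(8) by auto
  next
    assume "G = G22"
    moreover have "base_check G22 (\<lambda>_. True) 4 4" by code_simp
    ultimately show ?thesis using local_checks(9) by auto
  qed simp
  then obtain k d e where "local_check G k d" "k \<le> 4" "base_check G (\<lambda>_. True) 4 e" by blast
  from cl_bonds3[OF this(1,2) inv _ assms(2) this(3)] show ?thesis using nz by auto
qed

lemma bonds_mono: "set G \<subseteq> set H \<Longrightarrow> set (bonds G n) \<subseteq> set (bonds H n)"
  unfolding set_bonds by blast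

text \<open>The first argument records for each site one of the four quadratic forms that polarise to
  \<open>an\<close>: the anisotropic one for \<open>PI\<close>, and for \<open>c \<noteq> PI\<close> the one that is nonzero exactly at \<open>c\<close>.\<close>

fun qf :: "pauli list \<Rightarrow> pauli list \<Rightarrow> bool" where
  "qf (c # cs) (p # v) \<longleftrightarrow> ((p \<noteq> PI) \<noteq> an p c) \<noteq> qf cs v"
| "qf _ _ \<longleftrightarrow> False"

lemma qf_letter: "(pm p q \<noteq> PI) = (((p \<noteq> PI) \<noteq> (q \<noteq> PI)) \<noteq> an p q)"
  by (cases p; cases q) simp_all

lemma qf_vadd: "length c = length v \<Longrightarrow> length v = length w \<Longrightarrow>
   qf c (vadd v w) = ((qf c v \<noteq> qf c w) \<noteq> anti v w)"
proof (induct c v w rule: list_induct3)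
  case (Cons c cs p v q w)
  then show ?case using qf_letter[of p q] by (simp add: an_pm del: pm_eq_PI) blast
qed simp

lemma qf_zero [simp]: "\<not> qf c (pzero n)"
proof (induct n arbitrary: c)
  case (Suc n)
  then show ?case by (cases c) auto
qed (cases c; simp)

lemma oddY_qf: "oddY v = qf (replicate (length v) PY) v"
proof (induct v)
  case (Cons p v)
  then show ?case by (cases p) auto
qed simp

lemma oddY_append [simp]: "oddY (v @ w) = (oddY v \<noteq> oddY w)"
  by (induct v) auto

lemma oddY_zero [simp]: "\<not> oddY (pzero n)"
  by (induct n) auto

lemma oddY_vadd: "length v = length w \<Longrightarrow> oddY (vadd v w) = ((oddY v \<noteq> oddY w) \<noteq> anti v w)"
  by (simp add: oddY_qf qf_vadd)

lemma cl_odd: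
  assumes "4 \<le> n"
  shows "cl (set (bonds G11 n)) = {v \<in> strs n. oddY v}"
proof -
  have inv: "invariant G11 oddY"
    unfolding invariant_def by (auto simp: oddY_vadd set_bonds)
  have "base_check G11 oddY 4 4" by code_simp
  from cl_bonds3[OF local_checks(4) _ inv _ assms this]
  have "cl (set (bonds G11 n)) = {v \<in> strs n. oddY v \<and> nondeg (bonds G11 n) v}" by simp
  moreover have "nondeg (bonds G11 n) v" if "length v = n" "oddY v" for v
  proof (rule ccontr)
    assume "\<not> nondeg (bonds G11 n) v"
    then have "v = pzero n"
    proof (rule deg_zero[OF that(1) _ _ _ _, of PX PY, rotated -2])
      fix x y assume "\<forall>(A, B)\<in>set G11. an A x = an B y"
      then show "(x, y) = (PI, PI) \<or> (x, y) = (PX, PY)"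
        by (cases x; cases y) simp_all
    qed (use assms in simp_all)
    then show False using that by simp
  qed
  ultimately show ?thesis by auto
qed

fun psum :: "pauli list \<Rightarrow> pauli" where
  "psum [] = PI" | "psum (p # v) = pm p (psum v)"

lemma psum_vadd: "length v = length w \<Longrightarrow> psum (vadd v w) = pm (psum v) (psum w)"
  by (induct v w rule: list_induct2) (auto simp: pm_ac)

lemma psum_append [simp]: "psum (v @ w) = pm (psum v) (psum w)"
  by (induct v) (auto simp: pm_assoc)

lemma psum_zero [simp]: "psum (pzero n) = PI"
  by (induct n) auto

lemma an_psum: "anti v (replicate (length v) p) = an (psum v) p"
  by (induct v) (auto simp: an_pm)

lemma deg_const:
  assumes "v \<noteq> []" "\<not> nondeg (bonds G (length v)) v"
    "\<And>x y. (\<forall>(A, B)\<in>set G. an A x = an B y) \<Longrightarrow> x = y"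
  shows "v = replicate (length v) (hd v)"
proof -
  have "adj (\<lambda>a b. \<forall>(A, B)\<in>set G. an A a = an B b) v"
    using not_nondeg assms(2) by blast
  moreover obtain a w where "v = a # w" using assms(1) by (cases v) auto
  ultimately show ?thesis using adj_const[of _ a w] assms(3) by force
qed

lemma deg_constI:
  assumes "\<forall>(A, B)\<in>set G. an A p = an B p"
  shows "\<not> nondeg (bonds G n) (replicate n p)"
proof -
  have "adj (\<lambda>a b. \<forall>(A, B)\<in>set G. an A a = an B b) (replicate n p)"
    using assms by (induct n rule: induct_nat_012) auto
  then show ?thesis using not_nondeg[of G "replicate n p"] by simp
qed

lemma cl_7:
  assumes "3 \<le> n"
  shows "cl (set (bonds G7 n)) = {v \<in> strs n. psum v = PI \<and> (\<forall>p. v \<noteq> replicate n p)}"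
proof -
  have inv: "invariant G7 (\<lambda>v. psum v = PI)"
    unfolding invariant_def by (auto simp: psum_vadd set_bonds)
  have "base_check G7 (\<lambda>v. psum v = PI) 3 4" by code_simp
  from cl_bonds3[OF local_checks(3) _ inv _ assms this]
  have "cl (set (bonds G7 n)) = {v \<in> strs n. psum v = PI \<and> nondeg (bonds G7 n) v}" by simp
  moreover have "nondeg (bonds G7 n) v \<longleftrightarrow> (\<forall>p. v \<noteq> replicate n p)" if "length v = n" for v
  proof
    assume "nondeg (bonds G7 n) v"
    then show "\<forall>p. v \<noteq> replicate n p" using deg_constI[of G7 _ n] by auto
  next
    assume *: "\<forall>p. v \<noteq> replicate n p"
    show "nondeg (bonds G7 n) v"
    proof (rule ccontr)
      assume "\<not> nondeg (bonds G7 n) v"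
      then have "v = replicate (length v) (hd v)"
      proof (intro deg_const)
        fix x y assume "\<forall>(A, B)\<in>set G7. an A x = an B y"
        then show "x = y" by (cases x; cases y) simp_all
      qed (use that assms in auto)
      then show False using * unfolding that by blast
    qed
  qed
  ultimately show ?thesis by auto
qed

lemma cl_13:
  assumes "3 \<le> n"
  shows "cl (set (bonds G13 n)) = {v \<in> strs n. \<not> an (psum v) PX \<and> v \<noteq> pzero n \<and> v \<noteq> replicate n PX}"
proof -
  have inv: "invariant G13 (\<lambda>v. \<not> an (psum v) PX)"
    unfolding invariant_def by (auto simp: psum_vadd set_bonds an_pm)
  have "base_check G13 (\<lambda>v. \<not> an (psum v) PX) 3 4" by code_simp
  from cl_bonds3[OF local_checks(6) _ inv _ assms this]
  have "cl (set (bonds G13 n)) = {v \<in> strs n. \<not> an (psum v) PX \<and> nondeg (bonds G13 n) v}" by simp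
  moreover have "nondeg (bonds G13 n) v \<longleftrightarrow> v \<noteq> pzero n \<and> v \<noteq> replicate n PX" if "length v = n" for v
  proof
    assume "nondeg (bonds G13 n) v"
    then show "v \<noteq> pzero n \<and> v \<noteq> replicate n PX"
      using deg_constI[of G13 PX n] nondeg_nonzero by auto
  next
    assume *: "v \<noteq> pzero n \<and> v \<noteq> replicate n PX"
    show "nondeg (bonds G13 n) v"
    proof (rule ccontr)
      assume deg: "\<not> nondeg (bonds G13 n) v"
      have R: "x = y \<and> (x = PI \<or> x = PX)" if "\<forall>(A, B)\<in>set G13. an A x = an B y" for x y
        using that by (cases x; cases y) simp_all
      have v0: "v = replicate (length v) (hd v)"
      proof (rule deg_const)
        show "v \<noteq> []" using that assms by auto
        show "\<not> nondeg (bonds G13 (length v)) v" using deg unfolding that .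
        show "x = y" if "\<forall>(A, B)\<in>set G13. an A x = an B y" for x y using R[OF that] by blast
      qed
      define p where "p = hd v"
      have v: "v = replicate n p" using v0 unfolding that p_def .
      obtain m where n: "n = Suc (Suc m)" using assms by (cases n; cases "n - 1") auto
      have "adj (\<lambda>a b. \<forall>(A, B)\<in>set G13. an A a = an B b) v"
        using not_nondeg deg that by blast
      then have "\<forall>(A, B)\<in>set G13. an A p = an B p" unfolding v n replicate_Suc adj.simps by (rule conjunct1)
      then have "p = PI \<or> p = PX" using R by blast
      then show False using * v by auto
    qed
  qed
  ultimately show ?thesis by auto
qed

lemma cl_20:
  "cl (set (bonds [(PX,PX),(PY,PY),(PZ,PZ),(PZ,PY)] n)) = cl (set (bonds G13 n))" if "3 \<le> n"
proof (intro equalityI cl_mono subsetI)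
  fix g assume "g \<in> set (bonds [(PX,PX),(PY,PY),(PZ,PZ),(PZ,PY)] n)"
  then obtain j k A B where g: "g = pzero j @ A # B # pzero k" "(A, B) \<in> set [(PX,PX),(PY,PY),(PZ,PZ),(PZ,PY)]" "j + k + 2 = n"
    by (auto simp: set_bonds)
  have "PI \<in> set g" using g that by (cases j; cases k) auto
  then have "g \<noteq> replicate n PX" by auto
  moreover have "g \<noteq> pzero n"
  proof
    assume "g = pzero n"
    then have "A = PI" using g by (metis in_set_conv_decomp in_set_replicate)
    then show False using g by auto
  qed
  ultimately show "g \<in> cl (set (bonds G13 n))"
    using g by (auto simp: cl_13[OF that])
next
  fix g assume "g \<in> set (bonds G13 n)"
  then obtain j k A B where g: "g = pzero j @ A # B # pzero k" "(A, B) \<in> set G13" "j + k + 2 = n"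
    by (auto simp: set_bonds)
  let ?H = "[(PX,PX),(PY,PY),(PZ,PZ),(PZ,PY)]"
  let ?C = "cl (set (bonds ?H n))"
  have b: "pzero j @ C # D # pzero k \<in> ?C" if "(C, D) \<in> set ?H" for C D
    using that g(3) by (intro cl.base) (auto simp: set_bonds)
  have va: "vadd (pzero j @ C # D # pzero k) (pzero j @ C' # D' # pzero k) = pzero j @ pm C C' # pm D D' # pzero k" for C D C' D'
    by (simp add: vadd_append vadd_zero)
  have an: "anti (pzero j @ C # D # pzero k) (pzero j @ C' # D' # pzero k) = (an C C' \<noteq> an D D')" for C D C' D'
    by (simp add: anti_append)
  have "pzero j @ PI # PX # pzero k \<in> ?C"
    using cl.step[OF b[of PZ PZ] b[of PZ PY]] by (simp add: va an)
  from cl.step[OF this b[of PY PY]] have "pzero j @ PY # PZ # pzero k \<in> ?C"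
    by (simp add: va an)
  then show "g \<in> ?C" using g b by auto
qed

lemma cl_15:
  assumes "3 \<le> n"
  shows "cl (set (bonds G15 n)) = {v \<in> strs n. \<not> an (last v) PX \<and> butlast v \<noteq> pzero (n - 1)}"
proof -
  let ?I = "\<lambda>v. v = [] \<or> \<not> an (last v) PX"
  have last_vadd: "last (vadd v w) = pm (last v) (last w)" if "length v = length w" "v \<noteq> []" for v w
    using that
  proof (induct v w rule: list_induct2)
    case (Cons x xs y ys)
    have "vadd xs ys = [] \<longleftrightarrow> xs = []" using Cons(1) by (cases xs; cases ys) auto
    then show ?case using Cons by (cases "xs = []") auto
  qed simp
  have inv: "invariant G15 ?I"
    unfolding invariant_def
  proof (intro conjI allI impI ballI)
    fix v w assume "length v = length w" "anti v w" "?I v" "?I w"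
    then show "?I (vadd v w)" by (cases "v = []") (auto simp: last_vadd an_pm)
  next
    fix n g assume "g \<in> set (bonds G15 n)"
    then obtain j k A B where "g = pzero j @ A # B # pzero k" "(A, B) \<in> set G15" by (auto simp: set_bonds)
    then show "?I g" by (cases k) (auto simp: last_append)
  qed (auto split: if_splits)
  have "base_check G15 ?I 3 4" by code_simp
  from cl_bonds3[OF local_checks(10) _ inv _ assms this]
  have "cl (set (bonds G15 n)) = {v \<in> strs n. ?I v \<and> nondeg (bonds G15 n) v}" by simp
  moreover have "nondeg (bonds G15 n) v \<longleftrightarrow> butlast v \<noteq> pzero (n - 1)"
    if "length v = n" "\<not> an (last v) PX" for v
  proof -
    have R: "(\<forall>(A, B)\<in>set G15. an A x = an B y) \<longleftrightarrow> x = PI \<and> \<not> an y PX" for x y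
      by (cases x; cases y) simp_all
    have "adj (\<lambda>a b. a = PI \<and> \<not> an b PX) v \<longleftrightarrow> butlast v = pzero (length v - 1) \<and> (length v \<ge> 2 \<longrightarrow> \<not> an (last v) PX)" for v
    proof (induct v rule: induct_list012)
      case (3 a b v)
      show ?case using 3(2) by (cases v) auto
    qed auto
    then show ?thesis using not_nondeg[of G15 v] that unfolding R by auto
  qed
  ultimately show ?thesis using assms by auto
qed

lemma qf_append: "length c = length v \<Longrightarrow> qf (c @ d) (v @ w) = (qf c v \<noteq> qf d w)"
  by (induct c v rule: list_induct2) auto

lemma butlast_vadd: "length v = length w \<Longrightarrow> butlast (vadd v w) = vadd (butlast v) (butlast w)"
proof (induct v w rule: list_induct2)
  case (Cons x xs y ys)
  have "vadd xs ys = [] \<longleftrightarrow> xs = []" "xs = [] \<longleftrightarrow> ys = []" using Cons(1) by (cases xs; cases ys; auto)+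
  then show ?case using Cons by auto
qed simp

lemma last_vadd: "length v = length w \<Longrightarrow> v \<noteq> [] \<Longrightarrow> last (vadd v w) = pm (last v) (last w)"
proof (induct v w rule: list_induct2)
  case (Cons x xs y ys)
  have "vadd xs ys = [] \<longleftrightarrow> xs = []" using Cons(1) by (cases xs; cases ys) auto
  then show ?case using Cons by (cases "xs = []") auto
qed simp

lemma anti_butlast_last:
  assumes "length v = length w" "v \<noteq> []"
  shows "anti v w = (anti (butlast v) (butlast w) \<noteq> an (last v) (last w))"
proof -
  have "w \<noteq> []" using assms by auto
  then have "anti (butlast v @ [last v]) (butlast w @ [last w]) = (anti (butlast v) (butlast w) \<noteq> an (last v) (last w))"
    using assms by (subst anti_append) auto
  then show ?thesis using assms \<open>w \<noteq> []\<close> by simp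
qed

definition c9 :: "nat \<Rightarrow> pauli list" where
  "c9 m = replicate (m - 1) PX @ [PI]"

definition inv9 :: "pauli list \<Rightarrow> bool" where
  "inv9 v \<longleftrightarrow> qf (c9 (length v - 1)) (butlast v) \<and> last v = (if an (last (butlast v)) PX then PX else PI)"

lemma inv9_vadd:
  assumes "length v = length w" "anti v w" "inv9 v" "inv9 w"
  shows "inv9 (vadd v w)"
proof -
  have ne: "length v \<ge> 2"
  proof (rule ccontr)
    assume "\<not> 2 \<le> length v"
    then have "butlast v = []" by (cases v; cases "tl v") auto
    then show False using assms(3) by (simp add: inv9_def c9_def)
  qed
  then have ne': "v \<noteq> []" "butlast v \<noteq> []" "length (butlast v) = length (butlast w)"
    using assms(1) by (cases v; cases "tl v"; auto)+
  have l: "last v = (if an (last (butlast v)) PX then PX else PI)" "last w = (if an (last (butlast w)) PX then PX else PI)"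
    using assms by (auto simp: inv9_def)
  have "anti (butlast v) (butlast w)" using assms(2) anti_butlast_last[OF assms(1) ne'(1)] l by auto
  moreover have "length (c9 (length v - 1)) = length (butlast v)" using ne by (simp add: c9_def)
  ultimately have "qf (c9 (length v - 1)) (vadd (butlast v) (butlast w))"
    using assms ne' by (subst qf_vadd) (auto simp: inv9_def)
  then show ?thesis
    using assms(1) ne' l by (simp add: inv9_def butlast_vadd last_vadd an_pm)
qed

lemma invariant_9: "invariant G9 inv9"
  unfolding invariant_def
proof (intro conjI allI impI ballI)
  fix n g assume "g \<in> set (bonds G9 n)"
  then obtain j k A where g: "g = pzero j @ A # PX # pzero k" "A = PY \<or> A = PZ" by (auto simp: set_bonds)
  show "inv9 g"
  proof (cases k)
    case 0
    then have "butlast g = pzero j @ [A]" "last g = PX" "length g - 1 = Suc j" using g by (auto simp: butlast_append)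
    then show ?thesis using g(2) by (auto simp: inv9_def c9_def qf_append)
  next
    case (Suc i)
    then have b: "butlast g = pzero j @ A # PX # pzero i" "last g = PI" "length g - 1 = j + 2 + i"
      using g by (auto simp: butlast_append replicate_append_same[symmetric])
    have "qf (c9 (j + 2 + i)) (pzero j @ A # PX # pzero i)"
    proof (cases i)
      case 0
      have "c9 (j + 2 + i) = replicate j PX @ [PX, PI]"
        unfolding c9_def 0 by (simp flip: replicate_append_same)
      then show ?thesis using g(2) 0 by (auto simp: qf_append)
    next
      case (Suc i')
      have "c9 (j + 2 + i) = replicate j PX @ PX # PX # (replicate i' PX @ [PI])"
      proof -
        have "j + 2 + i - 1 = j + Suc (Suc i')" using Suc by simp
        then show ?thesis unfolding c9_def by (simp only: replicate_add) simp
      qed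
      then show ?thesis using g(2) by (auto simp: qf_append)
    qed
    moreover have "last (butlast g) = PX \<or> last (butlast g) = PI" unfolding b by (cases i) auto
    ultimately show ?thesis using b by (auto simp: inv9_def)
  qed
next
  fix u assume *: "inv9 (PI # u)"
  show "inv9 u"
  proof (cases "length u < 2")
    case True
    then have "u = [] \<or> (\<exists>a. u = [a])" by (cases u; cases "tl u") auto
    then show ?thesis using * by (auto simp: inv9_def c9_def)
  next
    case False
    then have "c9 (length u) = PX # c9 (length u - 1)" "u \<noteq> []" "butlast u \<noteq> []"
      by (cases u; cases "tl u"; auto simp: c9_def)+
    then show ?thesis using * by (auto simp: inv9_def)
  qed
qed (rule inv9_vadd)

lemma cl_9:
  assumes "3 \<le> n"
  shows "cl (set (bonds G9 n)) = {v \<in> strs n. inv9 v}"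
proof -
  have "base_check G9 inv9 3 4" by code_simp
  from cl_bonds3[OF local_checks(11) _ invariant_9 _ assms this]
  have "cl (set (bonds G9 n)) = {v \<in> strs n. inv9 v \<and> nondeg (bonds G9 n) v}" by simp
  moreover have "nondeg (bonds G9 n) v" if "length v = n" "inv9 v" for v
  proof (rule ccontr)
    assume "\<not> nondeg (bonds G9 n) v"
    then have adj: "adj (\<lambda>a b. \<forall>(A, B)\<in>set G9. an A a = an B b) v" using not_nondeg that by blast
    have R: "(x = PI \<and> (y = PI \<or> y = PX)) \<or> (x = PX \<and> (y = PY \<or> y = PZ))" if "\<forall>(A, B)\<in>set G9. an A x = an B y" for x y
      using that by (cases x; cases y) simp_all
    have "butlast w = pzero (length w - 1)"
      if "adj (\<lambda>a b. \<forall>(A, B)\<in>set G9. an A a = an B b) w" "last w = PI \<or> last w = PX" for w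
      using that
    proof (induct w rule: induct_list012)
      case (3 a b w)
      then have IH: "butlast (b # w) = pzero (length w)" and ab: "\<forall>(A, B)\<in>set G9. an A a = an B b" by auto
      have "b = PI \<or> b = PX" using IH 3(4) by (cases w) auto
      then have "a = PI" using R[OF ab] by auto
      then show ?case using IH by simp
    qed auto
    from this[OF adj] have "butlast v = pzero (length v - 1)" using that by (auto simp: inv9_def)
    then show False using that by (simp add: inv9_def)
  qed
  ultimately show ?thesis by auto
qed

subsection \<open>Site-dependent relabelling\<close>

definition autom :: "(pauli \<Rightarrow> pauli) \<Rightarrow> bool" where
  "autom \<sigma> \<longleftrightarrow> (\<forall>p q. \<sigma> (pm p q) = pm (\<sigma> p) (\<sigma> q)) \<and> (\<forall>p q. an (\<sigma> p) (\<sigma> q) = an p q)"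

lemma autom_funpow: "autom \<sigma> \<Longrightarrow> autom (\<sigma> ^^ k)"
  by (induct k) (auto simp: autom_def)

lemma autom_PI [simp]: "autom \<sigma> \<Longrightarrow> \<sigma> PI = PI"
  unfolding autom_def by (metis pm_self)

lemma an_ex: "p \<noteq> PI \<Longrightarrow> \<exists>r. an p r"
  by (cases p) (use an_simps in blast)+

lemma autom_inj: "autom \<sigma> \<Longrightarrow> inj \<sigma>"
proof (rule injI)
  fix p q assume a: "autom \<sigma>" "\<sigma> p = \<sigma> q"
  then have z: "\<sigma> (pm p q) = PI" by (simp add: autom_def)
  show "p = q"
  proof (rule ccontr)
    assume "p \<noteq> q"
    then have "pm p q \<noteq> PI" by simp
    then obtain r where "an (pm p q) r" using an_ex by blast
    then have "an PI (\<sigma> r)" using a(1) z unfolding autom_def by metis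
    then show False by simp
  qed
qed

fun sw :: "(pauli \<Rightarrow> pauli) \<Rightarrow> pauli list \<Rightarrow> pauli list" where
  "sw \<sigma> [] = []"
| "sw \<sigma> (p # v) = (\<sigma> ^^ length v) p # sw \<sigma> v"

lemma length_sw [simp]: "length (sw \<sigma> v) = length v"
  by (induct v) auto

lemma sw_vadd: "length v = length w \<Longrightarrow> autom \<sigma> \<Longrightarrow> sw \<sigma> (vadd v w) = vadd (sw \<sigma> v) (sw \<sigma> w)"
proof (induct v w rule: list_induct2)
  case (Cons x xs y ys)
  then show ?case using autom_funpow[OF Cons(3), of "length ys"] by (simp add: autom_def)
qed simp

lemma sw_anti: "length v = length w \<Longrightarrow> autom \<sigma> \<Longrightarrow> anti (sw \<sigma> v) (sw \<sigma> w) = anti v w"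
proof (induct v w rule: list_induct2)
  case (Cons x xs y ys)
  then show ?case using autom_funpow[OF Cons(3), of "length ys"] by (simp add: autom_def)
qed simp

lemma sw_inj: "length v = length w \<Longrightarrow> autom \<sigma> \<Longrightarrow> sw \<sigma> v = sw \<sigma> w \<Longrightarrow> v = w"
proof (induct v w rule: list_induct2)
  case (Cons x xs y ys)
  then show ?case using autom_inj[OF autom_funpow[OF Cons(3), of "length ys"]] by (auto dest: injD)
qed simp

lemma sw_inj_on: "autom \<sigma> \<Longrightarrow> inj_on (sw \<sigma>) (strs n)"
  by (auto simp: inj_on_def intro: sw_inj)

lemma sw_surj: "autom \<sigma> \<Longrightarrow> sw \<sigma> ` strs n = strs n"
  by (rule endo_inj_surj) (auto simp: sw_inj_on)

lemma sw_zero [simp]: "autom \<sigma> \<Longrightarrow> sw \<sigma> (pzero k) = pzero k"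
  by (induct k) (auto simp: autom_funpow)

lemma sw_zero_append [simp]: "autom \<sigma> \<Longrightarrow> sw \<sigma> (pzero j @ v) = pzero j @ sw \<sigma> v"
  by (induct j) (auto simp: autom_funpow)

lemma sw_iso:
  assumes "autom \<sigma>" "S \<subseteq> strs n" "aclosed S"
  shows "LA n S \<cong>\<^sub>L LA n (sw \<sigma> ` S)"
  by (rule LA_iso[where V = "strs n"])
    (use assms sw_inj_on in \<open>auto simp: sw_vadd sw_anti intro: inj_on_subset\<close>)

lemma cl_sw: "autom \<sigma> \<Longrightarrow> G \<subseteq> strs n \<Longrightarrow> cl (sw \<sigma> ` G) = sw \<sigma> ` cl G"
  by (rule cl_image[where V = "strs n"]) (auto simp: sw_vadd sw_anti)

lemma sw_bond: "autom \<sigma> \<Longrightarrow> sw \<sigma> (pzero j @ A # \<sigma> A # pzero k) = pzero j @ (\<sigma> ^^ Suc k) A # (\<sigma> ^^ Suc k) A # pzero k"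
  by (simp add: funpow_swap1)

lemma sw_bonds:
  assumes "autom \<sigma>" "\<sigma> ` set T = set T"
  shows "sw \<sigma> ` set (bonds (map (\<lambda>A. (A, \<sigma> A)) T) n) = set (bonds (map (\<lambda>A. (A, A)) T) n)"
proof -
  have im: "(\<sigma> ^^ k) ` set T = set T" for k
  proof (induct k)
    case (Suc k)
    have "(\<sigma> ^^ Suc k) ` set T = \<sigma> ` ((\<sigma> ^^ k) ` set T)" by (simp add: image_image)
    then show ?case by (simp only: Suc assms(2))
  qed simp
  have b: "set (bonds (map (\<lambda>A. (A, f A)) T) n) = {pzero j @ A # f A # pzero k |j k A. A \<in> set T \<and> j + k + 2 = n}" for f
  proof -
    have "(A, B) \<in> set (map (\<lambda>A. (A, f A)) T) \<longleftrightarrow> A \<in> set T \<and> B = f A" for A B by auto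
    then show ?thesis unfolding set_bonds by blast
  qed
  show ?thesis
  proof
    show "sw \<sigma> ` set (bonds (map (\<lambda>A. (A, \<sigma> A)) T) n) \<subseteq> set (bonds (map (\<lambda>A. (A, A)) T) n)"
    proof
      fix x assume "x \<in> sw \<sigma> ` set (bonds (map (\<lambda>A. (A, \<sigma> A)) T) n)"
      then obtain j k A where "x = sw \<sigma> (pzero j @ A # \<sigma> A # pzero k)" "A \<in> set T" "j + k + 2 = n"
        unfolding b by blast
      moreover from this have "(\<sigma> ^^ Suc k) A \<in> set T" using im[of "Suc k"] by blast
      ultimately show "x \<in> set (bonds (map (\<lambda>A. (A, A)) T) n)"
        unfolding b[of "\<lambda>A. A"] sw_bond[OF assms(1)] by blast
    qed
    show "set (bonds (map (\<lambda>A. (A, A)) T) n) \<subseteq> sw \<sigma> ` set (bonds (map (\<lambda>A. (A, \<sigma> A)) T) n)"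
    proof
      fix x assume "x \<in> set (bonds (map (\<lambda>A. (A, A)) T) n)"
      then obtain j k A where x: "x = pzero j @ A # A # pzero k" "A \<in> set T" "j + k + 2 = n"
        unfolding b[of "\<lambda>A. A"] by blast
      then obtain A' where A': "A' \<in> set T" "A = (\<sigma> ^^ Suc k) A'" using im[of "Suc k"] by blast
      then have "x = sw \<sigma> (pzero j @ A' # \<sigma> A' # pzero k)" unfolding x sw_bond[OF assms(1)] by simp
      then show "x \<in> sw \<sigma> ` set (bonds (map (\<lambda>A. (A, \<sigma> A)) T) n)" unfolding b using A' x by blast
    qed
  qed
qed

lemma sw_bonds_iso:
  assumes "autom \<sigma>" "\<sigma> ` set T = set T"
  shows "LA n (cl (set (bonds (map (\<lambda>A. (A, \<sigma> A)) T) n))) \<cong>\<^sub>L LA n (cl (set (bonds (map (\<lambda>A. (A, A)) T) n)))"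
  using sw_iso[OF assms(1) cl_strs[OF bonds_strs] aclosed_cl] cl_sw[OF assms(1) bonds_strs] sw_bonds[OF assms]
  by metis

fun tau :: "pauli \<Rightarrow> pauli" where
  "tau PI = PI" | "tau PX = PX" | "tau PY = PZ" | "tau PZ = PY"

fun rot :: "pauli \<Rightarrow> pauli" where
  "rot PI = PI" | "rot PX = PY" | "rot PY = PZ" | "rot PZ = PX"

fun kappa :: "pauli \<Rightarrow> pauli" where
  "kappa PI = PI" | "kappa PX = PY" | "kappa PY = PX" | "kappa PZ = PZ"

lemma autom_cases: "autom tau" "autom rot" "autom kappa"
proof -
  have "tau (pm p q) = pm (tau p) (tau q) \<and> an (tau p) (tau q) = an p q" for p q
    by (cases p; cases q; simp)
  then show "autom tau" by (simp add: autom_def)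
  have "rot (pm p q) = pm (rot p) (rot q) \<and> an (rot p) (rot q) = an p q" for p q
    by (cases p; cases q; simp)
  then show "autom rot" by (simp add: autom_def)
  have "kappa (pm p q) = pm (kappa p) (kappa q) \<and> an (kappa p) (kappa q) = an p q" for p q
    by (cases p; cases q; simp)
  then show "autom kappa" by (simp add: autom_def)
qed

text \<open>After relabelling, the bond with \<open>k\<close> sites to its right carries the generators \<open>P P\<close> with
  \<open>P \<noteq> \<sigma>\<^sup>k\<^sup>+\<^sup>1 Z\<close>. They all take the value \<open>1\<close> under the quadratic form of type
  \<open>cc \<sigma> (n - 1), \<dots>, cc \<sigma> 0\<close>, since consecutive types differ by the missing letter.\<close>

fun cc :: "(pauli \<Rightarrow> pauli) \<Rightarrow> nat \<Rightarrow> pauli" where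
  "cc \<sigma> 0 = PI"
| "cc \<sigma> (Suc k) = pm (cc \<sigma> k) ((\<sigma> ^^ Suc k) PZ)"

fun cs :: "(pauli \<Rightarrow> pauli) \<Rightarrow> nat \<Rightarrow> pauli list" where
  "cs \<sigma> 0 = []"
| "cs \<sigma> (Suc k) = cc \<sigma> k # cs \<sigma> k"

lemma length_cs [simp]: "length (cs \<sigma> n) = n"
  by (induct n) auto

definition invq :: "(pauli \<Rightarrow> pauli) \<Rightarrow> pauli list \<Rightarrow> bool" where
  "invq \<sigma> v \<longleftrightarrow> psum (sw \<sigma> v) = PI \<and> qf (cs \<sigma> (length v)) (sw \<sigma> v)"

lemma invariant_q:
  assumes "autom \<sigma>"
  shows "invariant [(PX, \<sigma> PX), (PY, \<sigma> PY)] (invq \<sigma>)"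
  unfolding invariant_def
proof (intro conjI allI impI ballI)
  fix v w assume "length v = length w" "anti v w" "invq \<sigma> v" "invq \<sigma> w"
  then show "invq \<sigma> (vadd v w)"
    using assms by (simp add: invq_def sw_vadd psum_vadd qf_vadd sw_anti)
next
  fix n g assume "g \<in> set (bonds [(PX, \<sigma> PX), (PY, \<sigma> PY)] n)"
  then obtain j k A where g: "g = pzero j @ A # \<sigma> A # pzero k" "A = PX \<or> A = PY" "j + k + 2 = n"
    by (auto simp: set_bonds)
  let ?P = "(\<sigma> ^^ Suc k) A"
  have s: "sw \<sigma> g = pzero j @ ?P # ?P # pzero k" unfolding g by (rule sw_bond[OF assms])
  have z: "qf (cs \<sigma> (j + m)) (pzero j @ w) = qf (cs \<sigma> m) w" for m w
    by (induct j) auto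
  have "an ?P ((\<sigma> ^^ Suc k) PZ) = an A PZ"
    using autom_funpow[OF assms, of "Suc k"] unfolding autom_def by blast
  then have "an ?P ((\<sigma> ^^ Suc k) PZ)" using g(2) by auto
  then have "qf (cs \<sigma> (Suc (Suc k))) (?P # ?P # pzero k)"
    by (auto simp: an_pm simp del: funpow.simps)
  then have "qf (cs \<sigma> (length g)) (sw \<sigma> g)"
    using z[of "Suc (Suc k)" "?P # ?P # pzero k"] unfolding s by (simp add: g(1) del: funpow.simps cs.simps)
  moreover have "psum (sw \<sigma> g) = PI" unfolding s by simp
  ultimately show "invq \<sigma> g" by (simp add: invq_def)
next
  fix u assume "invq \<sigma> (PI # u)"
  then show "invq \<sigma> u" using assms by (simp add: invq_def autom_funpow)
qed

lemma sw_const: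
  assumes "autom \<sigma>"
  shows "adj (\<lambda>x y. y = \<sigma> x) v \<longleftrightarrow> (\<exists>p. sw \<sigma> v = replicate (length v) p)"
proof (induct v rule: induct_list012)
  case (3 a b v)
  show ?case
  proof
    assume *: "adj (\<lambda>x y. y = \<sigma> x) (a # b # v)"
    then obtain p where "sw \<sigma> (b # v) = replicate (length (b # v)) p" using 3 by auto
    then show "\<exists>p. sw \<sigma> (a # b # v) = replicate (length (a # b # v)) p"
      using * by (auto simp: funpow_swap1)
  next
    assume "\<exists>p. sw \<sigma> (a # b # v) = replicate (length (a # b # v)) p"
    then obtain p where p: "sw \<sigma> (a # b # v) = replicate (length (a # b # v)) p" by blast
    then have "(\<sigma> ^^ length v) b = (\<sigma> ^^ length v) (\<sigma> a)" by (simp add: funpow_swap1)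
    then have "b = \<sigma> a" using autom_inj[OF autom_funpow[OF assms]] by (auto dest: injD)
    then show "adj (\<lambda>x y. y = \<sigma> x) (a # b # v)" using 3 p by auto
  qed
qed auto

lemma sw_cl_q:
  assumes \<sigma>: "autom \<sigma>" and cl: "cl (set (bonds G n)) = {v \<in> strs n. invq \<sigma> v \<and> nondeg (bonds G n) v}"
    and R: "\<And>x y. (\<forall>(A, B)\<in>set G. an A x = an B y) \<longleftrightarrow> y = \<sigma> x"
  shows "sw \<sigma> ` cl (set (bonds G n)) = {w \<in> strs n. psum w = PI \<and> qf (cs \<sigma> n) w \<and> (\<forall>p. w \<noteq> replicate n p)}"
proof -
  have nd: "nondeg (bonds G n) v \<longleftrightarrow> (\<forall>p. sw \<sigma> v \<noteq> replicate n p)" if "length v = n" for v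
    using not_nondeg[of G v] sw_const[OF \<sigma>, of v] that unfolding R by auto
  show ?thesis
  proof
    show "sw \<sigma> ` cl (set (bonds G n)) \<subseteq> {w \<in> strs n. psum w = PI \<and> qf (cs \<sigma> n) w \<and> (\<forall>p. w \<noteq> replicate n p)}"
    proof
      fix w assume "w \<in> sw \<sigma> ` cl (set (bonds G n))"
      then obtain v where "length v = n" "invq \<sigma> v" "nondeg (bonds G n) v" "w = sw \<sigma> v" unfolding cl by auto
      then show "w \<in> {w \<in> strs n. psum w = PI \<and> qf (cs \<sigma> n) w \<and> (\<forall>p. w \<noteq> replicate n p)}"
        using nd[of v] by (simp add: invq_def)
    qed
    show "{w \<in> strs n. psum w = PI \<and> qf (cs \<sigma> n) w \<and> (\<forall>p. w \<noteq> replicate n p)} \<subseteq> sw \<sigma> ` cl (set (bonds G n))"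
    proof
      fix w assume w: "w \<in> {w \<in> strs n. psum w = PI \<and> qf (cs \<sigma> n) w \<and> (\<forall>p. w \<noteq> replicate n p)}"
      then obtain v where "v \<in> strs n" "w = sw \<sigma> v" using sw_surj[OF \<sigma>, of n] by blast
      moreover from this have "length v = n" by simp
      ultimately have "v \<in> {v \<in> strs n. invq \<sigma> v \<and> nondeg (bonds G n) v}" using w nd[of v] by (simp add: invq_def)
      then show "w \<in> sw \<sigma> ` cl (set (bonds G n))" using \<open>w = sw \<sigma> v\<close> unfolding cl by blast
    qed
  qed
qed

definition Sq :: "(pauli \<Rightarrow> pauli) \<Rightarrow> nat \<Rightarrow> pauli list set" where
  "Sq \<sigma> n = {w \<in> strs n. psum w = PI \<and> qf (cs \<sigma> n) w \<and> (\<forall>p. w \<noteq> replicate n p)}"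

lemma LA_Sq:
  assumes \<sigma>: "autom \<sigma>" and cl: "cl (set (bonds G n)) = {v \<in> strs n. invq \<sigma> v \<and> nondeg (bonds G n) v}"
    and R: "\<And>x y. (\<forall>(A, B)\<in>set G. an A x = an B y) \<longleftrightarrow> y = \<sigma> x"
  shows "LA n (cl (set (bonds G n))) \<cong>\<^sub>L LA n (Sq \<sigma> n)" "aclosed (Sq \<sigma> n)"
proof -
  show "LA n (cl (set (bonds G n))) \<cong>\<^sub>L LA n (Sq \<sigma> n)"
    using sw_iso[OF \<sigma> cl_strs[OF bonds_strs[of G n]] aclosed_cl] unfolding sw_cl_q[OF assms] Sq_def .
  have "cl (sw \<sigma> ` set (bonds G n)) = Sq \<sigma> n"
    unfolding cl_sw[OF \<sigma> bonds_strs] sw_cl_q[OF assms] Sq_def ..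
  then show "aclosed (Sq \<sigma> n)" by (metis aclosed_cl)
qed

lemma LA_3:
  assumes "3 \<le> n"
  shows "LA n (cl (set (bonds G3 n))) \<cong>\<^sub>L LA n (Sq tau n)" "aclosed (Sq tau n)"
proof -
  have "base_check G3 (invq tau) 3 4" by code_simp
  from cl_bonds3[OF local_checks(1) _ _ _ assms this] invariant_q[OF autom_cases(1)]
  have cl: "cl (set (bonds G3 n)) = {v \<in> strs n. invq tau v \<and> nondeg (bonds G3 n) v}" by simp
  have R: "(\<forall>(A, B)\<in>set G3. an A x = an B y) \<longleftrightarrow> y = tau x" for x y by (cases x; cases y) simp_all
  show "LA n (cl (set (bonds G3 n))) \<cong>\<^sub>L LA n (Sq tau n)" "aclosed (Sq tau n)"
    by (rule LA_Sq[OF autom_cases(1) cl R])+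
qed

lemma LA_5:
  assumes "3 \<le> n"
  shows "LA n (cl (set (bonds G5 n))) \<cong>\<^sub>L LA n (Sq rot n)" "aclosed (Sq rot n)"
proof -
  have b: "base_check G5 (invq rot) 3 4" "base_check G5 (invq rot) 4 4" by code_simp+
  have inv: "invariant G5 (invq rot)" using invariant_q[OF autom_cases(2)] by simp
  have cl: "cl (set (bonds G5 n)) = {v \<in> strs n. invq rot v \<and> nondeg (bonds G5 n) v}"
  proof (rule cl_bonds[OF local_checks(2) inv assms])
    fix l :: nat assume "3 \<le> l" "l \<le> max 4 3"
    then have "l = 3 \<or> l = 4" by auto
    then show "base_check G5 (invq rot) l 4" using b by blast
  qed simp
  have R: "(\<forall>(A, B)\<in>set G5. an A x = an B y) \<longleftrightarrow> y = rot x" for x y by (cases x; cases y) simp_all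
  show "LA n (cl (set (bonds G5 n))) \<cong>\<^sub>L LA n (Sq rot n)" "aclosed (Sq rot n)"
    by (rule LA_Sq[OF autom_cases(2) cl R])+
qed

section \<open>Quadratic forms and the Arf invariant\<close>

fun pc :: "('a \<Rightarrow> bool) \<Rightarrow> 'a list \<Rightarrow> bool" where
  "pc P [] \<longleftrightarrow> False"
| "pc P (x # xs) \<longleftrightarrow> P x \<noteq> pc P xs"

lemma pc_append [simp]: "pc P (xs @ ys) = (pc P xs \<noteq> pc P ys)"
  by (induct xs) auto

lemma pc_cong: "length xs = length ys \<Longrightarrow> (\<And>j. j < length xs \<Longrightarrow> P (xs ! j) = P' (ys ! j)) \<Longrightarrow> pc P xs = pc P' ys"
proof (induct xs ys rule: list_induct2)
  case (Cons x xs y ys)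
  have "P x = P' y" using Cons(3)[of 0] by simp
  moreover have "pc P xs = pc P' ys" by (rule Cons(2)) (use Cons(3)[of "Suc _"] in auto)
  ultimately show ?case by simp
qed simp

definition sg :: "nat \<Rightarrow> nat \<Rightarrow> pauli \<Rightarrow> pauli list" where
  "sg n j p = pzero j @ p # pzero (n - Suc j)"

lemma length_sg [simp]: "j < n \<Longrightarrow> length (sg n j p) = n"
  by (simp add: sg_def)

lemma sg_0 [simp]: "sg (Suc n) 0 p = p # pzero n"
  by (simp add: sg_def)

lemma sg_Suc [simp]: "sg (Suc n) (Suc j) p = PI # sg n j p"
  by (simp add: sg_def)

lemma qf_sg: "j < length c \<Longrightarrow> qf c (sg (length c) j p) = ((p \<noteq> PI) \<noteq> an p (c ! j))"
proof (induct c arbitrary: j)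
  case (Cons a c)
  then show ?case by (cases j) auto
qed simp

lemma qf_const: "qf c (replicate (length c) p) = ((p \<noteq> PI \<and> odd (length c)) \<noteq> an p (psum c))"
  by (induct c) (auto simp: an_pm)

lemma psum_sg [simp]: "psum (sg n j p) = p"
  by (simp add: sg_def)

lemma anti_sg: "i < n \<Longrightarrow> j < n \<Longrightarrow> i \<noteq> j \<Longrightarrow> \<not> anti (sg n i p) (sg n j q)"
proof (induct n arbitrary: i j)
  case (Suc n)
  then show ?case by (cases i; cases j) auto
qed simp

definition quad :: "nat \<Rightarrow> (pauli list \<Rightarrow> bool) \<Rightarrow> bool" where
  "quad m Q \<longleftrightarrow> (\<forall>v w. length v = m \<longrightarrow> length w = m \<longrightarrow> Q (vadd v w) = ((Q v \<noteq> Q w) \<noteq> anti v w))"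

lemma quad_zero: "quad m Q \<Longrightarrow> \<not> Q (pzero m)"
  unfolding quad_def by (metis anti_self length_replicate vadd_self)

lemma quad_qf:
  assumes "quad m Q"
  shows "\<exists>c. length c = m \<and> (\<forall>v. length v = m \<longrightarrow> Q v = qf c v) \<and>
     (\<forall>j<m. c ! j = PI \<longleftrightarrow> Q (sg m j PX) \<and> Q (sg m j PZ))"
  using assms
proof (induct m arbitrary: Q)
  case 0
  then show ?case using quad_zero[of 0 Q] by auto
next
  case (Suc m)
  have z: "\<not> Q (pzero (Suc m))" by (rule quad_zero[OF Suc(2)])
  have add: "Q (vadd v w) = ((Q v \<noteq> Q w) \<noteq> anti v w)" if "length v = Suc m" "length w = Suc m" for v w
    using Suc(2) that unfolding quad_def by blast
  have "quad m (\<lambda>v. Q (PI # v))"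
    unfolding quad_def
  proof (intro allI impI)
    fix v w :: "pauli list" assume "length v = m" "length w = m"
    then show "Q (PI # vadd v w) = ((Q (PI # v) \<noteq> Q (PI # w)) \<noteq> anti v w)"
      using add[of "PI # v" "PI # w"] by simp
  qed
  then obtain c where c: "length c = m" "\<And>v. length v = m \<Longrightarrow> Q (PI # v) = qf c v"
    "\<And>j. j < m \<Longrightarrow> c ! j = PI \<longleftrightarrow> Q (PI # sg m j PX) \<and> Q (PI # sg m j PZ)"
    using Suc(1) by blast
  define d where "d = (if Q (PX # pzero m) then if Q (PZ # pzero m) then PI else PX
    else if Q (PZ # pzero m) then PZ else PY)"
  have Y: "Q (PY # pzero m) = ((Q (PX # pzero m) \<noteq> Q (PZ # pzero m)) \<noteq> True)"
    using add[of "PX # pzero m" "PZ # pzero m"] by simp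
  have one: "Q (p # pzero m) = ((p \<noteq> PI) \<noteq> an p d)" for p
    using Y z by (cases p) (auto simp: d_def)
  have "Q v = qf (d # c) v" if v: "length v = Suc m" for v
  proof -
    obtain p w where w: "v = p # w" "length w = m" using v by (cases v) auto
    have "vadd (p # pzero m) (PI # w) = v" using w by (simp add: vadd_zero)
    then show ?thesis using add[of "p # pzero m" "PI # w"] one[of p] c(2) w by auto
  qed
  moreover have "(d # c) ! j = PI \<longleftrightarrow> Q (sg (Suc m) j PX) \<and> Q (sg (Suc m) j PZ)" if "j < Suc m" for j
    using that c(3) by (cases j) (auto simp: d_def)
  ultimately show ?case using c(1) by (intro exI[of _ "d # c"]) auto
qed

definition isometry :: "nat \<Rightarrow> (pauli list \<Rightarrow> pauli list) \<Rightarrow> bool" where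
  "isometry m \<phi> \<longleftrightarrow> (\<forall>v. length v = m \<longrightarrow> length (\<phi> v) = m) \<and>
     (\<forall>v w. length v = m \<longrightarrow> length w = m \<longrightarrow> \<phi> (vadd v w) = vadd (\<phi> v) (\<phi> w) \<and> anti (\<phi> v) (\<phi> w) = anti v w)"

lemma anti_nondegenerate: "(\<And>u. length u = length v \<Longrightarrow> \<not> anti v u) \<Longrightarrow> v = pzero (length v)"
proof (induct v)
  case (Cons p v)
  have "p = PI"
  proof (rule ccontr)
    assume "p \<noteq> PI"
    then obtain r where "an p r" using an_ex by blast
    then show False using Cons(2)[of "r # pzero (length v)"] by simp
  qed
  moreover have "v = pzero (length v)"
  proof (rule Cons(1))
    fix u :: "pauli list" assume "length u = length v"
    then show "\<not> anti v u" using Cons(2)[of "PI # u"] by simp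
  qed
  ultimately show ?case by simp
qed simp

lemma isometry_inj:
  assumes "isometry m \<phi>"
  shows "inj_on \<phi> (strs m)"
proof (rule inj_onI)
  fix v w assume vw: "v \<in> strs m" "w \<in> strs m" "\<phi> v = \<phi> w"
  then have l: "length v = m" "length w = m" by auto
  have "vadd v w = pzero (length (vadd v w))"
  proof (rule anti_nondegenerate)
    fix u :: "pauli list" assume "length u = length (vadd v w)"
    then have u: "length u = m" using l by simp
    have "anti (vadd v w) u = (anti v u \<noteq> anti w u)" using l u by (intro anti_vadd) auto
    also have "\<dots> = (anti (\<phi> v) (\<phi> u) \<noteq> anti (\<phi> w) (\<phi> u))" using assms l u unfolding isometry_def by blast
    finally show "\<not> anti (vadd v w) u" using vw(3) by simp
  qed
  then show "v = w" using vadd_eq_zero[of v w] l by simp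
qed

lemma isometry_image:
  assumes "isometry m \<phi>" "\<And>v. length v = m \<Longrightarrow> P v = P' (\<phi> v)"
  shows "\<phi> ` {v \<in> strs m. P v} = {v \<in> strs m. P' v}"
proof -
  have surj: "\<phi> ` strs m = strs m"
    by (rule endo_inj_surj) (use assms(1) isometry_inj in \<open>auto simp: isometry_def\<close>)
  show ?thesis
  proof
    show "\<phi> ` {v \<in> strs m. P v} \<subseteq> {v \<in> strs m. P' v}"
      using assms by (auto simp: isometry_def)
    show "{v \<in> strs m. P' v} \<subseteq> \<phi> ` {v \<in> strs m. P v}"
    proof
      fix w assume "w \<in> {v \<in> strs m. P' v}"
      then have "w \<in> strs m" "P' w" by auto
      then obtain v where "v \<in> strs m" "w = \<phi> v" using surj by blast
      then show "w \<in> \<phi> ` {v \<in> strs m. P v}" using \<open>P' w\<close> assms(2) by auto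
    qed
  qed
qed

lemma LA_isometry:
  assumes "isometry m \<phi>" "\<And>v. length v = m \<Longrightarrow> P v = P' (\<phi> v)" "aclosed {v \<in> strs m. P v}"
  shows "LA m {v \<in> strs m. P v} \<cong>\<^sub>L LA m {v \<in> strs m. P' v}"
proof -
  have "LA m {v \<in> strs m. P v} \<cong>\<^sub>L LA m (\<phi> ` {v \<in> strs m. P v})"
    by (rule LA_iso[where V = "strs m"])
      (use assms isometry_inj[OF assms(1)] in \<open>auto simp: isometry_def intro: inj_on_subset\<close>)
  then show ?thesis using isometry_image[where P = P and P' = P', OF assms(1,2)] by metis
qed

lemma aclosed_qf: "length c = m \<Longrightarrow> aclosed {v \<in> strs m. qf c v}"
  by (auto simp: aclosed_def qf_vadd)

definition arf_type :: "bool \<Rightarrow> nat \<Rightarrow> pauli list" where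
  "arf_type a m = (if a then PI # replicate (m - 1) PY else replicate m PY)"

fun beta :: "pauli \<Rightarrow> pauli" where
  "beta PI = PI" | "beta PX = PI" | "beta PY = PY" | "beta PZ = PY"

text \<open>Two sites on which the form is anisotropic are isometric to two hyperbolic ones.\<close>

lemma two_sites:
  "an (pm (rot p) (beta r)) (pm (rot p') (beta r')) \<noteq> an (pm (beta p) (rot r)) (pm (beta p') (rot r')) \<longleftrightarrow> an p p' \<noteq> an r r'"
  "((pm (rot p) (beta r) \<noteq> PI) \<noteq> an (pm (rot p) (beta r)) PY) \<noteq> ((pm (beta p) (rot r) \<noteq> PI) \<noteq> an (pm (beta p) (rot r)) PY)
    \<longleftrightarrow> (p \<noteq> PI) \<noteq> (r \<noteq> PI)"
  by (cases p; cases r; cases p'; cases r'; simp)+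

lemma beta_pm: "beta (pm p q) = pm (beta p) (beta q)" "rot (pm p q) = pm (rot p) (rot q)"
  by (cases p; cases q; simp)+

lemma type_autom: "d \<noteq> PI \<Longrightarrow> \<exists>\<pi>. autom \<pi> \<and> \<pi> d = PY"
proof (cases d)
  case PX then show ?thesis using autom_cases(3) by (intro exI[of _ kappa]) auto
next
  case PY then show ?thesis by (intro exI[of _ id]) (auto simp: autom_def)
next
  case PZ then show ?thesis using autom_cases(1) by (intro exI[of _ tau]) auto
qed simp

lemma arf_normal_form:
  assumes "c \<noteq> []"
  shows "\<exists>\<phi>. isometry (length c) \<phi> \<and> (\<forall>v. length v = length c \<longrightarrow> qf c v = qf (arf_type (pc (\<lambda>d. d = PI) c) (length c)) (\<phi> v))"
  using assms
proof (induct c rule: list_nonempty_induct)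
  case (single d)
  show ?case
  proof (cases "d = PI")
    case True
    then show ?thesis by (intro exI[of _ id]) (auto simp: isometry_def arf_type_def)
  next
    case False
    then obtain \<pi> where \<pi>: "autom \<pi>" "\<pi> d = PY" using type_autom by blast
    have an: "an (\<pi> p) (\<pi> q) = an p q" "\<pi> (pm p q) = pm (\<pi> p) (\<pi> q)" for p q using \<pi>(1) by (auto simp: autom_def)
    have "an (\<pi> p) PY = an p d" "\<pi> p = PI \<longleftrightarrow> p = PI" for p
      using an(1)[of p d] \<pi>(2) injD[OF autom_inj[OF \<pi>(1)], of p PI] autom_PI[OF \<pi>(1)] by auto
    then show ?thesis using False an
      by (intro exI[of _ "map \<pi>"]) (auto simp: isometry_def arf_type_def length_Suc_conv)
  qed
next
  case (cons d c)
  let ?m = "length c" and ?a = "pc (\<lambda>d. d = PI) c"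
  obtain \<phi> where iso: "isometry ?m \<phi>" and q: "\<And>v. length v = ?m \<Longrightarrow> qf c v = qf (arf_type ?a ?m) (\<phi> v)"
    using cons by blast
  have len: "length (\<phi> v) = ?m" if "length v = ?m" for v using iso that by (auto simp: isometry_def)
  have add: "\<phi> (vadd v w) = vadd (\<phi> v) (\<phi> w)" "anti (\<phi> v) (\<phi> w) = anti v w" if "length v = ?m" "length w = ?m" for v w
    using iso that by (auto simp: isometry_def)
  obtain k where k: "?m = Suc k" using cons by (cases c) auto
  have ht: "\<exists>r u. \<phi> v = r # u \<and> length u = k" if "length v = ?m" for v
    using len[OF that] k by (cases "\<phi> v") auto
  show ?case
  proof (cases "d = PI")
    case True
    show ?thesis
    proof (cases ?a)
      case False
      have "isometry (Suc ?m) (\<lambda>v. hd v # \<phi> (tl v))"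
        unfolding isometry_def by (auto simp: length_Suc_conv len add)
      moreover have "qf (d # c) v = qf (arf_type True (Suc ?m)) (hd v # \<phi> (tl v))" if "length v = Suc ?m" for v
        using that q True False by (auto simp: length_Suc_conv arf_type_def)
      ultimately show ?thesis using True False by (intro exI[of _ "\<lambda>v. hd v # \<phi> (tl v)"]) auto
    next
      case a: True
      let ?f = "\<lambda>v. pm (rot (hd v)) (beta (hd (\<phi> (tl v)))) # pm (beta (hd v)) (rot (hd (\<phi> (tl v)))) # tl (\<phi> (tl v))"
      have "isometry (Suc ?m) ?f"
        unfolding isometry_def
      proof (intro conjI allI impI)
        fix v :: "pauli list" assume v: "length v = Suc ?m"
        then show "length (?f v) = Suc ?m" using k len[of "tl v"] by simp
        fix w :: "pauli list" assume w: "length w = Suc ?m"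
        obtain p v' p' w' where vw: "v = p # v'" "w = p' # w'" "length v' = ?m" "length w' = ?m"
          using v w by (auto simp: length_Suc_conv)
        obtain r u r' u' where ru: "\<phi> v' = r # u" "\<phi> w' = r' # u'" "length u = k" "length u' = k"
          using ht vw by blast
        show "?f (vadd v w) = vadd (?f v) (?f w)"
          using vw ru by (simp add: add beta_pm pm_ac)
        have "anti v' w' = (an r r' \<noteq> anti u u')" using add(2)[OF vw(3,4)] ru by simp
        then show "anti (?f v) (?f w) = anti v w"
          using two_sites(1)[of p r p' r'] vw ru by auto
      qed
      moreover have "qf (d # c) v = qf (arf_type False (Suc ?m)) (?f v)" if "length v = Suc ?m" for v
      proof -
        obtain p v' where v: "v = p # v'" "length v' = ?m" using \<open>length v = Suc ?m\<close> by (auto simp: length_Suc_conv)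
        obtain r u where ru: "\<phi> v' = r # u" "length u = k" using ht v by blast
        have "qf c v' = ((r \<noteq> PI) \<noteq> qf (replicate k PY) u)"
          using q[OF v(2)] ru a k by (simp add: arf_type_def)
        then show ?thesis using two_sites(2)[of p r] v ru True k by (auto simp: arf_type_def)
      qed
      ultimately show ?thesis using True a by (intro exI[of _ ?f]) auto
    qed
  next
    case False
    then obtain \<pi> where \<pi>: "autom \<pi>" "\<pi> d = PY" using type_autom by blast
    have an: "an (\<pi> p) (\<pi> q) = an p q" "\<pi> (pm p q) = pm (\<pi> p) (\<pi> q)" for p q using \<pi>(1) by (auto simp: autom_def)
    have ty: "an (\<pi> p) PY = an p d" "\<pi> p = PI \<longleftrightarrow> p = PI" for p
      using an(1)[of p d] \<pi>(2) injD[OF autom_inj[OF \<pi>(1)], of p PI] autom_PI[OF \<pi>(1)] by auto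
    show ?thesis
    proof (cases ?a)
      case a: False
      have "isometry (Suc ?m) (\<lambda>v. \<pi> (hd v) # \<phi> (tl v))"
        unfolding isometry_def by (auto simp: length_Suc_conv len add an)
      moreover have "qf (d # c) v = qf (arf_type False (Suc ?m)) (\<pi> (hd v) # \<phi> (tl v))" if "length v = Suc ?m" for v
        using that q a ty by (auto simp: length_Suc_conv arf_type_def)
      ultimately show ?thesis using False a by (intro exI[of _ "\<lambda>v. \<pi> (hd v) # \<phi> (tl v)"]) auto
    next
      case a: True
      let ?f = "\<lambda>v. hd (\<phi> (tl v)) # \<pi> (hd v) # tl (\<phi> (tl v))"
      have "isometry (Suc ?m) ?f"
        unfolding isometry_def
      proof (intro conjI allI impI)
        fix v :: "pauli list" assume v: "length v = Suc ?m"
        then show "length (?f v) = Suc ?m" using k len[of "tl v"] by simp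
        fix w :: "pauli list" assume w: "length w = Suc ?m"
        obtain p v' p' w' where vw: "v = p # v'" "w = p' # w'" "length v' = ?m" "length w' = ?m"
          using v w by (auto simp: length_Suc_conv)
        obtain r u r' u' where ru: "\<phi> v' = r # u" "\<phi> w' = r' # u'" "length u = k" "length u' = k"
          using ht vw by blast
        show "?f (vadd v w) = vadd (?f v) (?f w)"
          using vw ru by (simp add: add an)
        have "anti v' w' = (an r r' \<noteq> anti u u')" using add(2)[OF vw(3,4)] ru by simp
        then show "anti (?f v) (?f w) = anti v w" using vw ru by (auto simp: an)
      qed
      moreover have "qf (d # c) v = qf (arf_type True (Suc ?m)) (?f v)" if "length v = Suc ?m" for v
      proof -
        obtain p v' where v: "v = p # v'" "length v' = ?m" using \<open>length v = Suc ?m\<close> by (auto simp: length_Suc_conv)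
        obtain r u where ru: "\<phi> v' = r # u" "length u = k" using ht v by blast
        have "qf c v' = ((r \<noteq> PI) \<noteq> qf (replicate k PY) u)"
          using q[OF v(2)] ru a k by (simp add: arf_type_def)
        then show ?thesis using v ru k ty[of p] by (auto simp: arf_type_def)
      qed
      ultimately show ?thesis using False a by (intro exI[of _ ?f]) auto
    qed
  qed
qed

lemma so_alg_qf: "LA m {v \<in> strs m. qf (arf_type False m) v} = so_alg (2 ^ m)"
  unfolding so_alg_LA by (intro arg_cong[where f = "LA m"]) (auto simp: oddY_qf arf_type_def)

lemma sp_alg_qf: "LA (Suc m) {v \<in> strs (Suc m). qf (arf_type True (Suc m)) v} = sp_alg (2 ^ m)"
proof -
  have "qf (PI # replicate m PY) v = (oddY v \<noteq> anti v (PY # pzero m))" if "length v = Suc m" for v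
  proof -
    obtain p w where v: "v = p # w" "length w = m" using \<open>length v = Suc m\<close> by (cases v) auto
    then show ?thesis using oddY_qf[of w] by (cases p) auto
  qed
  then show ?thesis unfolding sp_alg_LA
    by (intro arg_cong[where f = "LA (Suc m)"]) (auto simp: arf_type_def)
qed

lemma LA_qf:
  assumes "length c = Suc m"
  shows "LA (Suc m) {v \<in> strs (Suc m). qf c v} \<cong>\<^sub>L (if pc (\<lambda>d. d = PI) c then sp_alg (2 ^ m) else so_alg (2 ^ Suc m))"
proof -
  have "c \<noteq> []" using assms by auto
  then obtain \<phi> where \<phi>: "isometry (Suc m) \<phi>"
    "\<And>v. length v = Suc m \<Longrightarrow> qf c v = qf (arf_type (pc (\<lambda>d. d = PI) c) (Suc m)) (\<phi> v)"
    using arf_normal_form assms by metis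
  have "LA (Suc m) {v \<in> strs (Suc m). qf c v} \<cong>\<^sub>L LA (Suc m) {v \<in> strs (Suc m). qf (arf_type (pc (\<lambda>d. d = PI) c) (Suc m)) v}"
    by (rule LA_isometry[OF \<phi> aclosed_qf[OF assms]])
  then show ?thesis using so_alg_qf[of "Suc m"] sp_alg_qf[of m] by (cases "pc (\<lambda>d. d = PI) c") simp_all
qed

lemma isometry_Cons:
  assumes "isometry k \<phi>"
  shows "isometry (Suc k) (\<lambda>v. hd v # \<phi> (tl v))"
  unfolding isometry_def
proof (intro conjI allI impI)
  fix v :: "pauli list" assume "length v = Suc k"
  then obtain p x where v: "v = p # x" "length x = k" by (cases v) auto
  then show "length (hd v # \<phi> (tl v)) = Suc k" using assms by (simp add: isometry_def)
  fix w :: "pauli list" assume "length w = Suc k"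
  then obtain q y where w: "w = q # y" "length y = k" by (cases w) auto
  have "\<phi> (vadd x y) = vadd (\<phi> x) (\<phi> y)" "anti (\<phi> x) (\<phi> y) = anti x y"
    using assms v(2) w(2) unfolding isometry_def by blast+
  then show "hd (vadd v w) # \<phi> (tl (vadd v w)) = vadd (hd v # \<phi> (tl v)) (hd w # \<phi> (tl w))"
    "anti (hd v # \<phi> (tl v)) (hd w # \<phi> (tl w)) = anti v w"
    by (simp_all add: v(1) w(1))
qed

lemma aclosed_ptag: "aclosed S \<Longrightarrow> aclosed (ptag S)"
  unfolding aclosed_def ptag_def by auto

lemma LA_qf4:
  assumes "length c = Suc m"
  shows "LA (Suc (Suc (Suc m))) (ptag (ptag {v \<in> strs (Suc m). qf c v}))
    \<cong>\<^sub>L dpow (if pc (\<lambda>d. d = PI) c then sp_alg (2 ^ m) else so_alg (2 ^ Suc m)) 4"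
proof -
  let ?T = "\<lambda>a. {v \<in> strs (Suc m). qf (arf_type a (Suc m)) v}"
  have "c \<noteq> []" using assms by auto
  then obtain \<phi> where \<phi>: "isometry (Suc m) \<phi>"
    "\<And>v. length v = Suc m \<Longrightarrow> qf c v = qf (arf_type (pc (\<lambda>d. d = PI) c) (Suc m)) (\<phi> v)"
    using arf_normal_form assms by metis
  let ?P = "\<lambda>c v. hd v \<in> {PI, PZ} \<and> hd (tl v) \<in> {PI, PZ} \<and> qf c (tl (tl v))"
  have tag: "ptag (ptag {v \<in> strs (Suc m). qf c v}) = {v \<in> strs (Suc (Suc (Suc m))). ?P c v}" for c
    unfolding ptag_def by (force simp: length_Suc_conv image_iff)
  let ?f = "\<lambda>v. hd v # hd (tl v) # \<phi> (tl (tl v))"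
  have f: "isometry (Suc (Suc (Suc m))) ?f"
    using isometry_Cons[OF isometry_Cons[OF \<phi>(1)]] by simp
  have "aclosed {v \<in> strs (Suc (Suc (Suc m))). ?P c v}"
    unfolding tag[symmetric] by (intro aclosed_ptag aclosed_qf assms)
  then have "LA (Suc (Suc (Suc m))) (ptag (ptag {v \<in> strs (Suc m). qf c v}))
    \<cong>\<^sub>L LA (Suc (Suc (Suc m))) (ptag (ptag (?T (pc (\<lambda>d. d = PI) c))))"
    unfolding tag by (intro LA_isometry[OF f]) (auto simp: length_Suc_conv \<phi>(2))
  moreover have "LA (Suc (Suc (Suc m))) (ptag (ptag (?T a))) = dpow (LA (Suc m) (?T a)) 4" for a
    by (rule LA_ptag2) auto
  ultimately show ?thesis
    using so_alg_qf[of "Suc m"] sp_alg_qf[of m] by (cases "pc (\<lambda>d. d = PI) c") simp_all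
qed

section \<open>Folding away the constraints\<close>

abbreviation shift :: "pauli \<Rightarrow> pauli list \<Rightarrow> pauli list" where
  "shift c v \<equiv> map (pm c) v"

definition xp :: "pauli \<Rightarrow> pauli" where "xp p = (if an p PZ then PX else PI)"
definition zp :: "pauli \<Rightarrow> pauli" where "zp p = (if an p PX then PZ else PI)"
definition tg :: "bool \<Rightarrow> pauli" where "tg b = (if b then PZ else PI)"

lemma xp_simps [simp]: "xp PI = PI" "xp PX = PX" "xp PY = PX" "xp PZ = PI"
  "zp PI = PI" "zp PX = PI" "zp PY = PZ" "zp PZ = PZ"
  by (simp_all add: xp_def zp_def)

lemma xp_pm: "xp (pm p q) = pm (xp p) (xp q)" "zp (pm p q) = pm (zp p) (zp q)"
  by (cases p; cases q; simp)+

lemma xp_zp [simp]: "xp (xp p) = xp p" "zp (zp p) = zp p" "xp (zp p) = PI" "zp (xp p) = PI" "pm (xp p) (zp p) = p"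
  by (cases p; simp)+

lemma tg_simps [simp]: "pm (tg a) (tg b) = tg (a \<noteq> b)" "\<not> an (tg a) (tg b)" "tg a = tg b \<longleftrightarrow> a = b"
  by (auto simp: tg_def)

lemma shift_vadd: "length v = length w \<Longrightarrow> vadd (shift c v) (shift d w) = shift (pm c d) (vadd v w)"
  by (induct v w rule: list_induct2) (auto simp: pm_ac)

lemma psum_shift: "psum (shift c v) = (if odd (length v) then pm c (psum v) else psum v)"
  by (induct v) (auto simp: pm_ac)

lemma shift_shift [simp]: "shift c (shift d v) = shift (pm c d) v"
  by (simp add: pm_assoc comp_def)

lemma shift_PI [simp]: "shift PI v = v"
  by (induct v) auto

lemma anti_shift: "length v = length w \<Longrightarrow> anti (shift c v) (shift d w)
   = ((anti v w \<noteq> an c (psum w)) \<noteq> (an (psum v) d \<noteq> (odd (length v) \<and> an c d)))"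
proof (induct v w rule: list_induct2)
  case (Cons x xs y ys)
  then show ?case
    by (cases "an c d"; cases "an x y"; cases "an c y"; cases "an x d"; cases "an c (psum ys)"; cases "an (psum xs) d")
      (simp_all add: an_pm)
qed simp

lemma ptagI: "u \<in> S \<Longrightarrow> tg b # u \<in> ptag S"
  unfolding ptag_def tg_def by force

lemma ptagE: assumes "x \<in> ptag S" obtains b u where "x = tg b # u" "u \<in> S"
proof -
  obtain p u where "x = p # u" "p = PI \<or> p = PZ" "u \<in> S" using assms by (auto simp: ptag_def)
  then show ?thesis using that[of False u] that[of True u] by (auto simp: tg_def)
qed

lemma LA_su_su: "LA (Suc m) (ptag (strs m - {pzero m})) = su_alg (2 ^ m) \<oplus>\<^sub>L su_alg (2 ^ m)"
  by (subst LA_ptag) (auto simp: su_alg_LA)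

lemma LA_13:
  assumes "3 \<le> n"
  shows "LA n (cl (set (bonds G13 n))) \<cong>\<^sub>L su_alg (2 ^ (n - 1)) \<oplus>\<^sub>L su_alg (2 ^ (n - 1))"
proof -
  obtain m where n: "n = Suc m" using assms by (cases n) auto
  let ?V = "{v \<in> strs n. \<not> an (psum v) PX}"
  let ?S = "cl (set (bonds G13 n))"
  have S: "?S = {v \<in> strs n. \<not> an (psum v) PX \<and> v \<noteq> pzero n \<and> v \<noteq> replicate n PX}"
    by (rule cl_13[OF assms])
  define \<phi> where "\<phi> v = tg (an (hd v) PZ) # shift (xp (hd v)) (tl v)" for v
  have \<phi>: "\<phi> (p # v) = tg (an p PZ) # shift (xp p) v" for p v by (simp add: \<phi>_def)
  have Vs: "\<exists>p u. v = p # u \<and> length u = m \<and> \<not> an (pm p (psum u)) PX" if "v \<in> ?V" for v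
    using that n by (cases v) auto
  have "LA n ?S \<cong>\<^sub>L LA (Suc m) (\<phi> ` ?S)"
  proof (rule LA_iso[where V = ?V])
    fix v w assume v: "v \<in> ?V" and w: "w \<in> ?V"
    then show "vadd v w \<in> ?V" by (simp add: psum_vadd an_pm)
    obtain p u q x where vw: "v = p # u" "length u = m" "w = q # x" "length x = m"
      and a: "\<not> an (pm p (psum u)) PX" "\<not> an (pm q (psum x)) PX" using Vs[OF v] Vs[OF w] by blast
    show "\<phi> (vadd v w) = vadd (\<phi> v) (\<phi> w)"
      by (simp add: vw \<phi> shift_vadd xp_pm an_pm)
    have "an p q = (an (xp p) (psum x) \<noteq> an (psum u) (xp q))"
      using a by (cases p; cases q; cases "psum u"; cases "psum x"; simp)
    moreover have "\<not> an (xp p) (xp q)" by (cases p; cases q; simp)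
    ultimately show "anti (\<phi> v) (\<phi> w) = anti v w"
      by (auto simp: vw \<phi> anti_shift)
  next
    fix v assume "v \<in> ?V" then show "length (\<phi> v) = Suc m" using n by (simp add: \<phi>_def)
  next
    show "inj_on \<phi> ?S"
    proof (rule inj_onI)
      fix v w assume "v \<in> ?S" "w \<in> ?S" and eq: "\<phi> v = \<phi> w"
      then obtain p u q x where vw: "v = p # u" "length u = m" "w = q # x" "length x = m"
        and a: "\<not> an (pm p (psum u)) PX" "\<not> an (pm q (psum x)) PX" using Vs unfolding S by blast
      have e: "an p PZ = an q PZ" "shift (xp p) u = shift (xp q) x" using eq by (auto simp: vw \<phi>)
      then have "xp p = xp q" by (simp add: xp_def)
      then have "shift (xp p) (shift (xp p) u) = shift (xp p) (shift (xp p) x)" using e by simp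
      then have "u = x" by (simp only: shift_shift pm_self shift_PI)
      then have "p = q" using a e(1) by (cases p; cases q; cases "psum x"; simp)
      then show "v = w" using vw \<open>u = x\<close> by simp
    qed
  next
    show "?S \<subseteq> ?V" unfolding S by blast
  qed auto
  moreover have "\<phi> ` ?S = ptag (strs m - {pzero m})"
  proof
    show "\<phi> ` ?S \<subseteq> ptag (strs m - {pzero m})"
    proof
      fix y assume "y \<in> \<phi> ` ?S"
      then obtain v where v: "v \<in> ?S" "y = \<phi> v" by blast
      then obtain p u where vw: "v = p # u" "length u = m" "\<not> an (pm p (psum u)) PX" using Vs unfolding S by blast
      have "shift (xp p) u \<noteq> pzero m"
      proof
        assume "shift (xp p) u = pzero m"
        then have "shift (xp p) (shift (xp p) u) = shift (xp p) (pzero m)" by simp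
        then have u: "u = replicate m (xp p)" by (simp only: shift_shift pm_self shift_PI) simp
        have "\<not> an (psum u) PX" unfolding u by (induct m) (auto simp: an_pm xp_def)
        then have "p = xp p" using vw(3) by (cases p) (auto simp: an_pm)
        then have "v = replicate n (xp p)" using vw u n by simp
        then show False using v(1) unfolding S xp_def by (auto split: if_splits)
      qed
      then show "y \<in> ptag (strs m - {pzero m})" using v vw by (auto simp: \<phi> intro!: ptagI)
    qed
    show "ptag (strs m - {pzero m}) \<subseteq> \<phi> ` ?S"
    proof
      fix y assume "y \<in> ptag (strs m - {pzero m})"
      then obtain b u where y: "y = tg b # u" "length u = m" "u \<noteq> pzero m" by (rule ptagE) simp
      define c where "c = (if b then PX else PI)"
      define v where "v = pm c (zp (psum (shift c u))) # shift c u"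
      have "psum v = pm c (pm (zp (psum (shift c u))) (psum (shift c u)))" by (simp add: v_def pm_assoc)
      then have "\<not> an (psum v) PX" by (cases "psum (shift c u)") (simp_all add: c_def)
      moreover have "xp (pm c (zp (psum (shift c u)))) = c" "an (pm c (zp (psum (shift c u)))) PZ = b"
        by (cases "psum (shift c u)"; simp add: c_def)+
      then have \<phi>v: "\<phi> v = y" using y by (simp add: v_def \<phi> comp_def)
      moreover have "v \<noteq> pzero n" "v \<noteq> replicate n PX"
      proof -
        have "\<phi> (pzero n) = tg False # pzero m" "\<phi> (replicate n PX) = tg True # pzero m"
          using n by (simp_all add: \<phi>)
        then show "v \<noteq> pzero n" "v \<noteq> replicate n PX" using \<open>\<phi> v = y\<close> y by auto
      qed
      moreover have "length v = n" using y n by (simp add: v_def)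
      ultimately have "v \<in> ?S" unfolding S by simp
      then show "y \<in> \<phi> ` ?S" using \<phi>v by (metis imageI)
    qed
  qed
  ultimately show ?thesis using LA_su_su[of m] n by simp
qed

lemma bonds_rev: "rev ` set (bonds G n) = set (bonds (map (\<lambda>(a, b). (b, a)) G) n)"
proof -
  have sub: "rev ` set (bonds G n) \<subseteq> set (bonds (map (\<lambda>(a, b). (b, a)) G) n)" for G
  proof
    fix x assume "x \<in> rev ` set (bonds G n)"
    then obtain j k A B where x: "x = rev (pzero j @ A # B # pzero k)" "(A, B) \<in> set G" "j + k + 2 = n"
      by (auto simp: set_bonds)
    then have "x = pzero k @ B # A # pzero j" "(B, A) \<in> set (map (\<lambda>(a, b). (b, a)) G)" "k + j + 2 = n"
      by force+
    then show "x \<in> set (bonds (map (\<lambda>(a, b). (b, a)) G) n)" unfolding set_bonds by blast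
  qed
  have "map (\<lambda>(a, b). (b, a)) (map (\<lambda>(a, b). (b, a)) G) = G" for G :: "(pauli \<times> pauli) list"
    by (induct G) auto
  then have "rev ` set (bonds (map (\<lambda>(a, b). (b, a)) G) n) \<subseteq> set (bonds G n)"
    using sub[of "map (\<lambda>(a, b). (b, a)) G"] by simp
  then have "rev ` rev ` set (bonds (map (\<lambda>(a, b). (b, a)) G) n) \<subseteq> rev ` set (bonds G n)" by (rule image_mono)
  then have "set (bonds (map (\<lambda>(a, b). (b, a)) G) n) \<subseteq> rev ` set (bonds G n)" by (simp add: image_image)
  then show ?thesis using sub by blast
qed

lemma isometry_rev: "isometry n rev"
proof -
  have "vadd (rev v) (rev w) = rev (vadd v w) \<and> anti (rev v) (rev w) = anti v w" if "length v = length w" for v w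
    using that
  proof (induct v w rule: list_induct2)
    case (Cons x xs y ys)
    have "vadd (rev xs @ [x]) (rev ys @ [y]) = vadd (rev xs) (rev ys) @ [pm x y]"
      using Cons(1) by (simp add: vadd_append)
    moreover have "anti (rev xs @ [x]) (rev ys @ [y]) = (anti (rev xs) (rev ys) \<noteq> an x y)"
      using Cons(1) by (simp add: anti_append)
    ultimately show ?case using Cons(2) by auto
  qed simp
  then show ?thesis by (simp add: isometry_def)
qed

lemma LA_rev:
  "LA n (cl (set (bonds G n))) \<cong>\<^sub>L LA n (cl (set (bonds (map (\<lambda>(a, b). (b, a)) G) n)))"
proof -
  have "LA n (cl (set (bonds G n))) \<cong>\<^sub>L LA n (rev ` cl (set (bonds G n)))"
    by (rule LA_iso[where V = "strs n"])
      (use isometry_rev[of n] cl_strs[OF bonds_strs[of G n]] in \<open>auto simp: isometry_def\<close>)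
  moreover have "rev ` cl (set (bonds G n)) = cl (rev ` set (bonds G n))"
    by (rule cl_image[symmetric, where V = "strs n"]) (use isometry_rev[of n] bonds_strs in \<open>auto simp: isometry_def\<close>)
  ultimately show ?thesis by (simp add: bonds_rev)
qed

lemma butlast_last_ex: "length v = Suc m \<Longrightarrow> \<exists>u p. v = u @ [p] \<and> length u = m"
  by (metis append_butlast_last_id diff_Suc_1 length_butlast length_greater_0_conv zero_less_Suc)

lemma LA_15:
  assumes "3 \<le> n"
  shows "LA n (cl (set (bonds [(PX,PX),(PX,PY),(PX,PZ)] n))) \<cong>\<^sub>L su_alg (2 ^ (n - 1)) \<oplus>\<^sub>L su_alg (2 ^ (n - 1))"
proof -
  obtain m where n: "n = Suc m" using assms by (cases n) auto
  let ?S = "cl (set (bonds G15 n))"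
  let ?V = "{v \<in> strs n. \<not> an (last v) PX}"
  have S: "?S = {v \<in> strs n. \<not> an (last v) PX \<and> butlast v \<noteq> pzero m}"
    using cl_15[OF assms] n by simp
  define \<phi> where "\<phi> v = tg (last v = PX) # butlast v" for v
  have Vs: "\<exists>p u. v = u @ [p] \<and> length u = m \<and> (p = PI \<or> p = PX)" if "v \<in> ?V" for v
  proof -
    obtain u p where v: "v = u @ [p]" "length u = m" using butlast_last_ex[of v m] \<open>v \<in> ?V\<close> n by auto
    then have "p = PI \<or> p = PX" using \<open>v \<in> ?V\<close> by (cases p) auto
    then show ?thesis using v by blast
  qed
  have "LA n ?S \<cong>\<^sub>L LA (Suc m) (\<phi> ` ?S)"
  proof (rule LA_iso[where V = ?V])
    fix v w assume v: "v \<in> ?V" and w: "w \<in> ?V"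
    obtain p u q x where vw: "v = u @ [p]" "length u = m" "p = PI \<or> p = PX" "w = x @ [q]" "length x = m" "q = PI \<or> q = PX"
      using Vs[OF v] Vs[OF w] by blast
    then have sum: "vadd v w = vadd u x @ [pm p q]" by (simp add: vadd_append)
    then show "vadd v w \<in> ?V" using vw n by auto
    show "\<phi> (vadd v w) = vadd (\<phi> v) (\<phi> w)" unfolding sum using vw by (auto simp: \<phi>_def tg_def)
    show "anti (\<phi> v) (\<phi> w) = anti v w" using vw by (auto simp: \<phi>_def anti_append)
  next
    fix v assume "v \<in> ?V" then show "length (\<phi> v) = Suc m" using n by (simp add: \<phi>_def)
  next
    show "inj_on \<phi> ?S"
    proof (rule inj_onI)
      fix v w assume "v \<in> ?S" "w \<in> ?S" and eq: "\<phi> v = \<phi> w"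
      then obtain p u q x where vw: "v = u @ [p]" "p = PI \<or> p = PX" "w = x @ [q]" "q = PI \<or> q = PX"
        using Vs unfolding S by blast
      then show "v = w" using eq by (auto simp: \<phi>_def)
    qed
  next
    show "?S \<subseteq> ?V" unfolding S by blast
  qed (use n in auto)
  moreover have "\<phi> ` ?S = ptag (strs m - {pzero m})"
  proof
    show "\<phi> ` ?S \<subseteq> ptag (strs m - {pzero m})"
      unfolding S using n by (auto simp: \<phi>_def intro!: ptagI)
    show "ptag (strs m - {pzero m}) \<subseteq> \<phi> ` ?S"
    proof
      fix y assume "y \<in> ptag (strs m - {pzero m})"
      then obtain b u where y: "y = tg b # u" "length u = m" "u \<noteq> pzero m" by (rule ptagE) simp
      then have "y = \<phi> (u @ [if b then PX else PI])" "u @ [if b then PX else PI] \<in> ?S"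
        using n unfolding S by (auto simp: \<phi>_def)
      then show "y \<in> \<phi> ` ?S" by blast
    qed
  qed
  ultimately have "LA n ?S \<cong>\<^sub>L su_alg (2 ^ m) \<oplus>\<^sub>L su_alg (2 ^ m)" using LA_su_su[of m] by simp
  then show ?thesis
    using lie_iso_trans[OF LA_rev[of n "[(PX,PX),(PX,PY),(PX,PZ)]"]] n by simp
qed

lemma LA_9:
  assumes "3 \<le> n"
  shows "LA n (cl (set (bonds [(PX,PY),(PX,PZ)] n))) \<cong>\<^sub>L sp_alg (2 ^ (n - 2))"
proof -
  obtain m where n: "n = Suc (Suc m)" using assms by (cases n; cases "n - 1") auto
  let ?S = "cl (set (bonds G9 n))"
  let ?V = "{v \<in> strs n. \<not> an (last v) PX}"
  have S: "?S = {v \<in> strs n. inv9 v}" by (rule cl_9[OF assms])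
  have lc9: "length (c9 (Suc m)) = Suc m" by (simp add: c9_def)
  have "LA n ?S \<cong>\<^sub>L LA (Suc m) (butlast ` ?S)"
  proof (rule LA_iso[where V = ?V])
    fix v w assume v: "v \<in> ?V" and w: "w \<in> ?V"
    then have l: "length v = length w" "v \<noteq> []" using n by auto
    show "vadd v w \<in> ?V" using v w l by (simp add: last_vadd an_pm)
    show "butlast (vadd v w) = vadd (butlast v) (butlast w)" by (rule butlast_vadd[OF l(1)])
    have "\<not> an (last v) (last w)" using v w by (cases "last v"; cases "last w") auto
    then show "anti (butlast v) (butlast w) = anti v w" using anti_butlast_last[OF l] by simp
  next
    show "?S \<subseteq> ?V" unfolding S inv9_def by auto
    show "inj_on butlast ?S"
    proof (rule inj_onI)
      fix v w assume v: "v \<in> ?S" and w: "w \<in> ?S" and eq: "butlast v = butlast w"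
      have "last v = (if an (last (butlast v)) PX then PX else PI)" using v unfolding S inv9_def by blast
      also have "\<dots> = last w" using w unfolding S inv9_def eq by simp
      finally have "last v = last w" .
      moreover have "v \<noteq> []" "w \<noteq> []" using v w n unfolding S by force+
      ultimately show "v = w" using eq by (metis append_butlast_last_id)
    qed
  qed (use n in auto)
  moreover have "butlast ` ?S = {u \<in> strs (Suc m). qf (c9 (Suc m)) u}"
  proof
    show "butlast ` ?S \<subseteq> {u \<in> strs (Suc m). qf (c9 (Suc m)) u}"
      unfolding S using n by (auto simp: inv9_def)
    show "{u \<in> strs (Suc m). qf (c9 (Suc m)) u} \<subseteq> butlast ` ?S"
    proof
      fix u assume "u \<in> {u \<in> strs (Suc m). qf (c9 (Suc m)) u}"
      then have "u @ [if an (last u) PX then PX else PI] \<in> ?S" using n unfolding S by (auto simp: inv9_def)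
      then show "u \<in> butlast ` ?S" by (metis butlast_snoc image_eqI)
    qed
  qed
  moreover have "pc (\<lambda>d. d = PI) (c9 (Suc m))"
  proof -
    have "\<not> pc (\<lambda>d. d = PI) (replicate k PX)" for k by (induct k) auto
    then show ?thesis by (simp add: c9_def)
  qed
  ultimately have "LA n ?S \<cong>\<^sub>L sp_alg (2 ^ m)"
    using LA_qf[OF lc9] lie_iso_trans by simp
  then show ?thesis
    using lie_iso_trans[OF LA_rev[of n "[(PX,PY),(PX,PZ)]"]] n by simp
qed

subsection \<open>Strings of trivial total letter\<close>

definition Vs :: "nat \<Rightarrow> pauli list set" where
  "Vs n = {v \<in> strs n. psum v = PI}"

lemma Vs_props: "Vs n \<subseteq> strs n" "pzero n \<in> Vs n" "v \<in> Vs n \<Longrightarrow> w \<in> Vs n \<Longrightarrow> vadd v w \<in> Vs n"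
  by (auto simp: Vs_def psum_vadd)

definition fold_odd :: "pauli list \<Rightarrow> pauli list" where
  "fold_odd v = shift (xp (hd v)) (tl v)"

definition unfold_odd :: "pauli list \<Rightarrow> pauli list" where
  "unfold_odd u = psum u # shift (xp (psum u)) u"

lemma Vs_Cons: "v \<in> Vs (Suc m) \<longleftrightarrow> (\<exists>u. v = psum u # u \<and> length u = m)"
  by (cases v) (auto simp: Vs_def)

lemma fold_odd:
  assumes "even m"
  shows "v \<in> Vs (Suc m) \<Longrightarrow> length (fold_odd v) = m" "v \<in> Vs (Suc m) \<Longrightarrow> unfold_odd (fold_odd v) = v"
    "length u = m \<Longrightarrow> unfold_odd u \<in> Vs (Suc m)" "length u = m \<Longrightarrow> fold_odd (unfold_odd u) = u"
    "v \<in> Vs (Suc m) \<Longrightarrow> w \<in> Vs (Suc m) \<Longrightarrow> fold_odd (vadd v w) = vadd (fold_odd v) (fold_odd w)"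
    "v \<in> Vs (Suc m) \<Longrightarrow> w \<in> Vs (Suc m) \<Longrightarrow> anti (fold_odd v) (fold_odd w) = anti v w"
proof -
  show "length (fold_odd v) = m" if "v \<in> Vs (Suc m)" using that by (auto simp: fold_odd_def Vs_def)
  show "unfold_odd (fold_odd v) = v" if "v \<in> Vs (Suc m)"
    using that assms by (auto simp: Vs_Cons fold_odd_def unfold_odd_def psum_shift comp_def)
  show "unfold_odd u \<in> Vs (Suc m)" if "length u = m" using that assms by (simp add: Vs_def unfold_odd_def psum_shift)
  show "fold_odd (unfold_odd u) = u" if "length u = m" by (simp add: fold_odd_def unfold_odd_def comp_def)
  show "fold_odd (vadd v w) = vadd (fold_odd v) (fold_odd w)" if "v \<in> Vs (Suc m)" "w \<in> Vs (Suc m)"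
    using that by (auto simp: Vs_Cons fold_odd_def shift_vadd xp_pm)
  show "anti (fold_odd v) (fold_odd w) = anti v w" if vw: "v \<in> Vs (Suc m)" "w \<in> Vs (Suc m)"
  proof -
    obtain u x where "v = psum u # u" "length u = m" "w = psum x # x" "length x = m" using vw unfolding Vs_Cons by blast
    moreover have "an (psum u) (psum x) = (an (xp (psum u)) (psum x) \<noteq> an (psum u) (xp (psum x)))"
      by (cases "psum u"; cases "psum x"; simp)
    ultimately show ?thesis using assms by (simp add: fold_odd_def anti_shift) blast
  qed
qed

lemma LA_fold_odd:
  assumes "even m" "aclosed {v \<in> Vs (Suc m). P v}"
  shows "LA (Suc m) {v \<in> Vs (Suc m). P v} \<cong>\<^sub>L LA m {u \<in> strs m. P (unfold_odd u)}"
proof -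
  let ?S = "{v \<in> Vs (Suc m). P v}"
  have "LA (Suc m) ?S \<cong>\<^sub>L LA m (fold_odd ` ?S)"
  proof (rule LA_iso[where V = "Vs (Suc m)"])
    show "inj_on fold_odd ?S" by (rule inj_on_inverseI[of _ unfold_odd]) (use fold_odd(2)[OF assms(1)] in auto)
  qed (use Vs_props fold_odd[OF assms(1)] assms(2) in \<open>auto simp del: replicate.simps\<close>)
  moreover have "fold_odd ` ?S = {u \<in> strs m. P (unfold_odd u)}"
  proof
    show "fold_odd ` ?S \<subseteq> {u \<in> strs m. P (unfold_odd u)}" using fold_odd(1,2)[OF assms(1)] by auto
    show "{u \<in> strs m. P (unfold_odd u)} \<subseteq> fold_odd ` ?S"
    proof
      fix u assume "u \<in> {u \<in> strs m. P (unfold_odd u)}"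
      then have "unfold_odd u \<in> ?S" "fold_odd (unfold_odd u) = u" using fold_odd(3,4)[OF assms(1), of u] by auto
      then show "u \<in> fold_odd ` ?S" by (metis image_eqI)
    qed
  qed
  ultimately show ?thesis by simp
qed

definition fold_t :: "pauli list \<Rightarrow> pauli" where
  "fold_t v = pm (xp (hd v)) (zp (hd (tl v)))"

definition fold_b :: "pauli list \<Rightarrow> pauli list" where
  "fold_b v = shift (fold_t v) (tl (tl v))"

definition unfold_even :: "pauli \<Rightarrow> pauli list \<Rightarrow> pauli list" where
  "unfold_even t b = pm (xp t) (zp (pm t (psum b))) # pm (xp (pm t (psum b))) (zp t) # shift t b"

lemma Vs_Cons2: "v \<in> Vs (Suc (Suc m)) \<longleftrightarrow> (\<exists>p r u. v = p # r # u \<and> length u = m \<and> pm p r = psum u)"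
proof
  assume "v \<in> Vs (Suc (Suc m))"
  then obtain p r u where v: "v = p # r # u" "length u = m" by (auto simp: Vs_def length_Suc_conv)
  have "psum v = PI" using \<open>v \<in> Vs (Suc (Suc m))\<close> by (simp add: Vs_def)
  then have "pm p (pm r (psum u)) = PI" unfolding v by (simp only: psum.simps)
  then have "pm p r = psum u" by (cases p; cases r; cases "psum u"; simp)
  then show "\<exists>p r u. v = p # r # u \<and> length u = m \<and> pm p r = psum u" using v by blast
next
  assume "\<exists>p r u. v = p # r # u \<and> length u = m \<and> pm p r = psum u"
  then obtain p r u where v: "v = p # r # u" "length u = m" "pm p r = psum u" by blast
  then show "v \<in> Vs (Suc (Suc m))" by (simp add: Vs_def pm_left_comm[of r p] flip: v(3))
qed

lemma fold_even:
  assumes "even m"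
  shows "v \<in> Vs (Suc (Suc m)) \<Longrightarrow> length (fold_b v) = m"
    "v \<in> Vs (Suc (Suc m)) \<Longrightarrow> unfold_even (fold_t v) (fold_b v) = v"
    "length b = m \<Longrightarrow> unfold_even t b \<in> Vs (Suc (Suc m))"
    "length b = m \<Longrightarrow> fold_t (unfold_even t b) = t" "length b = m \<Longrightarrow> fold_b (unfold_even t b) = b"
    "v \<in> Vs (Suc (Suc m)) \<Longrightarrow> w \<in> Vs (Suc (Suc m)) \<Longrightarrow> fold_t (vadd v w) = pm (fold_t v) (fold_t w)"
    "v \<in> Vs (Suc (Suc m)) \<Longrightarrow> w \<in> Vs (Suc (Suc m)) \<Longrightarrow> fold_b (vadd v w) = vadd (fold_b v) (fold_b w)"
    "v \<in> Vs (Suc (Suc m)) \<Longrightarrow> w \<in> Vs (Suc (Suc m)) \<Longrightarrow> anti (fold_b v) (fold_b w) = anti v w"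
proof -
  show "length (fold_b v) = m" if "v \<in> Vs (Suc (Suc m))" using that by (auto simp: fold_b_def Vs_def)
  show "unfold_even (fold_t v) (fold_b v) = v" if v0: "v \<in> Vs (Suc (Suc m))"
  proof -
    obtain p r u where v: "v = p # r # u" "length u = m" "pm p r = psum u" using v0 unfolding Vs_Cons2 by blast
    define t where "t = pm (xp p) (zp r)"
    have "psum (shift t u) = pm p r" using v assms by (simp add: psum_shift)
    moreover have "pm (xp t) (zp (pm t (pm p r))) = p" "pm (xp (pm t (pm p r))) (zp t) = r"
      by (cases p; cases r; simp add: t_def)+
    ultimately show ?thesis by (simp add: v(1) fold_t_def fold_b_def unfold_even_def t_def[symmetric] comp_def)
  qed
  show "unfold_even t b \<in> Vs (Suc (Suc m))" if "length b = m"
  proof -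
    have "pm (pm (xp t) (zp (pm t s))) (pm (xp (pm t s)) (zp t)) = s" for s by (cases t; cases s; simp)
    then show ?thesis unfolding Vs_Cons2 unfold_even_def using that assms
      by (auto simp: psum_shift)
  qed
  show t: "fold_t (unfold_even t b) = t" if "length b = m"
    by (cases t; cases "psum b"; simp add: fold_t_def unfold_even_def)
  show "fold_b (unfold_even t b) = b" if "length b = m"
    using t[OF that] by (simp add: fold_b_def) (simp add: unfold_even_def comp_def)
  show "fold_t (vadd v w) = pm (fold_t v) (fold_t w)" if "v \<in> Vs (Suc (Suc m))" "w \<in> Vs (Suc (Suc m))"
    using that unfolding Vs_Cons2 by (auto simp: fold_t_def xp_pm pm_ac)
  then show "fold_b (vadd v w) = vadd (fold_b v) (fold_b w)" if "v \<in> Vs (Suc (Suc m))" "w \<in> Vs (Suc (Suc m))"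
    using that unfolding Vs_Cons2 by (auto simp: fold_b_def shift_vadd)
  show "anti (fold_b v) (fold_b w) = anti v w" if vw: "v \<in> Vs (Suc (Suc m))" "w \<in> Vs (Suc (Suc m))"
  proof -
    obtain p r u q s x where v: "v = p # r # u" "length u = m" "pm p r = psum u"
      and w: "w = q # s # x" "length x = m" "pm q s = psum x" using vw unfolding Vs_Cons2 by blast
    have "(an p q \<noteq> an r s) = (an (pm (xp p) (zp r)) (pm q s) \<noteq> an (pm p r) (pm (xp q) (zp s)))"
      by (cases p; cases r; cases q; cases s; simp)
    then show ?thesis using v w assms by (auto simp: fold_b_def fold_t_def anti_shift)
  qed
qed

lemma unfold_even_const: "even m \<Longrightarrow> unfold_even p (pzero m) = replicate (Suc (Suc m)) p"
  by (cases p) (simp_all add: unfold_even_def)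

lemma unfold_even_split:
  assumes "even m" "length b = m"
  shows "unfold_even t b = vadd (replicate (Suc (Suc m)) t) (unfold_even PI b)"
proof -
  have "pm (xp t) (zp (pm t s)) = pm t (zp s)" "pm (xp (pm t s)) (zp t) = pm t (xp s)" for s
    by (cases t; cases s; simp)+
  moreover have "vadd (replicate (length b) t) b = shift t b" by (induct b) auto
  ultimately show ?thesis using assms by (simp add: unfold_even_def)
qed

lemma fold_even_const:
  assumes "even m" "v \<in> Vs (Suc (Suc m))"
  shows "fold_b v = pzero m \<longleftrightarrow> (\<exists>p. v = replicate (Suc (Suc m)) p)"
proof
  assume "fold_b v = pzero m"
  then have "v = unfold_even (fold_t v) (pzero m)" using fold_even(2)[OF assms] by simp
  then show "\<exists>p. v = replicate (Suc (Suc m)) p" using unfold_even_const[OF assms(1)] by metis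
next
  assume "\<exists>p. v = replicate (Suc (Suc m)) p"
  then obtain p where "v = unfold_even p (pzero m)" using unfold_even_const[OF assms(1)] by metis
  then show "fold_b v = pzero m" using fold_even(5)[OF assms(1), of "pzero m"] by simp
qed

definition fold4 :: "pauli list \<Rightarrow> pauli list" where
  "fold4 v = tg (an (fold_t v) PZ) # tg (an (fold_t v) PX) # fold_b v"

lemma LA_fold4:
  assumes m: "even m" and "aclosed {v \<in> Vs (Suc (Suc m)). P v}"
    and P: "\<And>v. v \<in> Vs (Suc (Suc m)) \<Longrightarrow> P v = Q (fold_b v)"
  shows "LA (Suc (Suc m)) {v \<in> Vs (Suc (Suc m)). P v} \<cong>\<^sub>L LA (Suc (Suc m)) (ptag (ptag {b \<in> strs m. Q b}))"
proof -
  let ?S = "{v \<in> Vs (Suc (Suc m)). P v}"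
  have inj: "an t PZ = an t' PZ \<Longrightarrow> an t PX = an t' PX \<Longrightarrow> t = t'" for t t' by (cases t; cases t'; simp)
  have "LA (Suc (Suc m)) ?S \<cong>\<^sub>L LA (Suc (Suc m)) (fold4 ` ?S)"
  proof (rule LA_iso[where V = "Vs (Suc (Suc m))"])
    show "inj_on fold4 ?S"
    proof (rule inj_onI)
      fix v w assume vw: "v \<in> ?S" "w \<in> ?S" "fold4 v = fold4 w"
      then have V: "v \<in> Vs (Suc (Suc m))" "w \<in> Vs (Suc (Suc m))" by simp_all
      have "fold_t v = fold_t w" "fold_b v = fold_b w" using vw(3) inj by (auto simp: fold4_def)
      then show "v = w" using fold_even(2)[OF m V(1)] fold_even(2)[OF m V(2)] by metis
    qed
    fix v w assume vw: "v \<in> Vs (Suc (Suc m))" "w \<in> Vs (Suc (Suc m))"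
    show "fold4 (vadd v w) = vadd (fold4 v) (fold4 w)"
      using fold_even(6,7)[OF m vw] by (simp add: fold4_def an_pm)
    show "anti (fold4 v) (fold4 w) = anti v w"
      using fold_even(8)[OF m vw] by (simp add: fold4_def)
  qed (use Vs_props fold_even(1)[OF m] assms(2) in \<open>auto simp: fold4_def simp del: replicate.simps\<close>)
  moreover have "fold4 ` ?S = ptag (ptag {b \<in> strs m. Q b})"
  proof
    show "fold4 ` ?S \<subseteq> ptag (ptag {b \<in> strs m. Q b})"
      using P fold_even(1)[OF m] by (auto simp: fold4_def intro!: ptagI)
    show "ptag (ptag {b \<in> strs m. Q b}) \<subseteq> fold4 ` ?S"
    proof
      fix y assume "y \<in> ptag (ptag {b \<in> strs m. Q b})"
      then obtain e w where w: "y = tg e # w" "w \<in> ptag {b \<in> strs m. Q b}" by (rule ptagE)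
      from w(2) obtain f b where "w = tg f # b" "b \<in> {b \<in> strs m. Q b}" by (rule ptagE)
      then have y: "y = tg e # tg f # b" "length b = m" "Q b" using w by simp_all
      define t where "t = pm (if e then PX else PI) (if f then PZ else PI)"
      have "an t PZ = e" "an t PX = f" by (auto simp: t_def)
      then have "fold4 (unfold_even t b) = y" using fold_even(4,5)[OF m y(2)] y by (simp add: fold4_def)
      moreover have "unfold_even t b \<in> ?S" using fold_even(3,5)[OF m y(2)] P y by auto
      ultimately show "y \<in> fold4 ` ?S" by blast
    qed
  qed
  ultimately show ?thesis by simp
qed

lemma cl7_Vs: "3 \<le> n \<Longrightarrow> cl (set (bonds G7 n)) = {v \<in> Vs n. \<forall>p. v \<noteq> replicate n p}"
  by (auto simp: cl_7 Vs_def)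

lemma LA_7_odd:
  assumes "3 \<le> n" "odd n"
  shows "LA n (cl (set (bonds G7 n))) \<cong>\<^sub>L su_alg (2 ^ (n - 1))"
proof -
  obtain m where n: "n = Suc m" "even m" using assms by (cases n) auto
  have "aclosed {v \<in> Vs n. \<forall>p. v \<noteq> replicate n p}"
    unfolding cl7_Vs[OF assms(1), symmetric] by (rule aclosed_cl)
  then have ac: "aclosed {v \<in> Vs (Suc m). \<forall>p. v \<noteq> replicate (Suc m) p}" unfolding n(1) .
  have const: "(\<forall>p. unfold_odd u \<noteq> replicate (Suc m) p) \<longleftrightarrow> u \<noteq> pzero m" if u: "length u = m" for u
  proof
    assume *: "\<forall>p. unfold_odd u \<noteq> replicate (Suc m) p"
    have "unfold_odd (pzero m) = replicate (Suc m) PI" by (simp add: unfold_odd_def)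
    then show "u \<noteq> pzero m" using * by metis
  next
    assume *: "u \<noteq> pzero m"
    show "\<forall>p. unfold_odd u \<noteq> replicate (Suc m) p"
    proof (intro allI notI)
      fix p assume p: "unfold_odd u = replicate (Suc m) p"
      then have "replicate (Suc m) p \<in> Vs (Suc m)" using fold_odd(3)[OF n(2) u] by simp
      moreover have "psum (replicate (Suc m) p) = p"
        using n(2) qf_const[of "replicate (Suc m) p" PX] by (induct m rule: nat_induct2) (auto simp: pm_ac)
      ultimately have "p = PI" by (simp add: Vs_def)
      then have "u = fold_odd (replicate (Suc m) PI)" using fold_odd(4)[OF n(2) u] p by simp
      then show False using * by (simp add: fold_odd_def)
    qed
  qed
  have "LA n (cl (set (bonds G7 n))) \<cong>\<^sub>L LA m {u \<in> strs m. \<forall>p. unfold_odd u \<noteq> replicate (Suc m) p}"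
    unfolding cl7_Vs[OF assms(1)] unfolding n(1) by (rule LA_fold_odd[OF n(2) ac])
  also have "{u \<in> strs m. \<forall>p. unfold_odd u \<noteq> replicate (Suc m) p} = strs m - {pzero m}"
  proof (rule Set.set_eqI)
    fix u show "u \<in> {u \<in> strs m. \<forall>p. unfold_odd u \<noteq> replicate (Suc m) p} \<longleftrightarrow> u \<in> strs m - {pzero m}"
      by (cases "length u = m") (simp_all add: const del: replicate.simps)
  qed
  finally show ?thesis by (simp add: n su_alg_LA)
qed

lemma LA_7_even:
  assumes "3 \<le> n" "even n"
  shows "LA n (cl (set (bonds G7 n))) \<cong>\<^sub>L dpow (su_alg (2 ^ (n - 2))) 4"
proof -
  obtain m where n: "n = Suc (Suc m)" "even m" using assms by (cases n; cases "n - 1") auto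
  have "aclosed {v \<in> Vs n. \<forall>p. v \<noteq> replicate n p}"
    unfolding cl7_Vs[OF assms(1), symmetric] by (rule aclosed_cl)
  then have ac: "aclosed {v \<in> Vs (Suc (Suc m)). \<forall>p. v \<noteq> replicate (Suc (Suc m)) p}" unfolding n(1) .
  have "LA n (cl (set (bonds G7 n))) \<cong>\<^sub>L LA (Suc (Suc m)) (ptag (ptag {b \<in> strs m. b \<noteq> pzero m}))"
    unfolding cl7_Vs[OF assms(1)] unfolding n(1)
    by (rule LA_fold4[OF n(2) ac]) (use fold_even_const[OF n(2)] in metis)
  also have "LA (Suc (Suc m)) (ptag (ptag {b \<in> strs m. b \<noteq> pzero m})) = dpow (LA m {b \<in> strs m. b \<noteq> pzero m}) 4"
    by (rule LA_ptag2) auto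
  also have "{b \<in> strs m. b \<noteq> pzero m} = strs m - {pzero m}" by auto
  finally show ?thesis by (simp add: n su_alg_LA)
qed

lemma Sq_Vs: "Sq \<sigma> n = {v \<in> Vs n. qf (cs \<sigma> n) v \<and> (\<forall>p. v \<noteq> replicate n p)}"
  by (auto simp: Sq_def Vs_def)

text \<open>The pairing that decides the Arf invariant.\<close>

definition arf_count :: "pauli \<Rightarrow> pauli \<Rightarrow> pauli list \<Rightarrow> bool" where
  "arf_count C c0 c = pc (\<lambda>d. an PX (pm C d) \<and> an PZ (pm c0 d)) c"

lemma LA_Sq_odd:
  assumes ac: "aclosed (Sq \<sigma> n)" and n: "n = Suc (Suc m)" "odd n"
    and c: "cs \<sigma> n = c0 # ct"
  shows "LA n (Sq \<sigma> n) \<cong>\<^sub>L (if arf_count (psum (cs \<sigma> n)) c0 (cs \<sigma> n) then sp_alg (2 ^ m) else so_alg (2 ^ Suc m))"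
proof -
  define d where "d = cs \<sigma> n"
  have m: "even (Suc m)" using n by simp
  have dc: "d = c0 # ct" using c by (simp add: d_def)
  have lc: "length d = n" "length ct = Suc m" using dc n length_cs[of \<sigma> n] by (simp_all add: d_def)
  have noconst: "\<not> (\<exists>p. v = replicate n p)" if v: "v \<in> Vs n" "qf d v" for v
  proof
    assume "\<exists>p. v = replicate n p"
    then obtain p where p: "v = replicate n p" by blast
    have "psum (replicate n p) = (if odd n then p else PI)" by (induct n) auto
    then have "p = PI" using v(1) p n by (simp add: Vs_def)
    then show False using v(2) p by simp
  qed
  have S: "Sq \<sigma> n = {v \<in> Vs n. qf d v}" using noconst unfolding Sq_Vs d_def[symmetric] by blast
  define Q where "Q u = qf d (unfold_odd u)" for u
  have inV: "unfold_odd u \<in> Vs n" if "length u = Suc m" for u using fold_odd(3)[OF m that] n by simp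
  have uadd: "unfold_odd (vadd u w) = vadd (unfold_odd u) (unfold_odd w)" "anti (unfold_odd u) (unfold_odd w) = anti u w"
    if uw: "length u = Suc m" "length w = Suc m" for u w
  proof -
    have "unfold_odd (fold_odd (vadd (unfold_odd u) (unfold_odd w))) = vadd (unfold_odd u) (unfold_odd w)"
      using fold_odd(2)[OF m] Vs_props(3)[OF inV[OF uw(1)] inV[OF uw(2)]] n by simp
    moreover have "fold_odd (vadd (unfold_odd u) (unfold_odd w)) = vadd u w"
      using fold_odd(4,5)[OF m] inV uw n by simp
    ultimately show "unfold_odd (vadd u w) = vadd (unfold_odd u) (unfold_odd w)" by simp
    show "anti (unfold_odd u) (unfold_odd w) = anti u w"
      using fold_odd(6)[OF m, of "unfold_odd u" "unfold_odd w"] fold_odd(4)[OF m] inV uw n by simp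
  qed
  have len: "length (unfold_odd u) = n" if "length u = Suc m" for u using inV[OF that] by (simp add: Vs_def)
  have "quad (Suc m) Q"
    unfolding quad_def Q_def by (auto simp: uadd qf_vadd lc len)
  then obtain c' where c': "length c' = Suc m" "\<And>v. length v = Suc m \<Longrightarrow> Q v = qf c' v"
    "\<And>j. j < Suc m \<Longrightarrow> c' ! j = PI \<longleftrightarrow> Q (sg (Suc m) j PX) \<and> Q (sg (Suc m) j PZ)"
    using quad_qf[of "Suc m" Q] by blast
  have "LA n (Sq \<sigma> n) \<cong>\<^sub>L LA (Suc m) {u \<in> strs (Suc m). qf d (unfold_odd u)}"
    unfolding S unfolding n(1) using LA_fold_odd[OF m, of "qf d"] ac S n by simp
  also have "{u \<in> strs (Suc m). qf d (unfold_odd u)} = {u \<in> strs (Suc m). qf c' u}"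
    using c'(2) by (auto simp: Q_def)
  finally have 1: "LA n (Sq \<sigma> n) \<cong>\<^sub>L LA (Suc m) {u \<in> strs (Suc m). qf c' u}" .
  have QX: "Q (sg (Suc m) j PX) = an PX (pm (psum d) (ct ! j))" if j: "j < Suc m" for j
  proof -
    have vs: "vadd (replicate k PX) v = shift PX v" if "length v = k" for k v using that by (induct v arbitrary: k) auto
    have "unfold_odd (sg (Suc m) j PX) = vadd (replicate n PX) (sg n (Suc j) PX)"
      using vs[of "sg (Suc m) j PX" "Suc m"] j n by (simp add: unfold_odd_def)
    then have "Q (sg (Suc m) j PX) = ((qf d (replicate n PX) \<noteq> qf d (sg n (Suc j) PX)) \<noteq> anti (replicate n PX) (sg n (Suc j) PX))"
      unfolding Q_def using qf_vadd[of d "replicate n PX" "sg n (Suc j) PX"] lc(1) j n(1) by (simp del: replicate.simps)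
    moreover have "\<not> anti (replicate n PX) (sg n (Suc j) PX)"
      using an_psum[of "sg n (Suc j) PX" PX] j n(1) by (simp add: anti_sym del: replicate.simps)
    moreover have "qf d (replicate n PX) = (True \<noteq> an PX (psum d))"
      using qf_const[of d PX] lc(1) n(2) by simp
    moreover have "qf d (sg n (Suc j) PX) = (True \<noteq> an PX (ct ! j))"
      using qf_sg[of "Suc j" d PX] lc(1) j n(1) dc by simp
    ultimately show ?thesis by (simp add: an_pm)
  qed
  have QZ: "Q (sg (Suc m) j PZ) = an PZ (pm c0 (ct ! j))" if j: "j < Suc m" for j
  proof -
    have "unfold_odd (sg (Suc m) j PZ) = vadd (sg n 0 PZ) (sg n (Suc j) PZ)"
      using j n vadd_zero(2)[of "sg (Suc m) j PZ" "Suc m"] by (simp add: unfold_odd_def)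
    then have "Q (sg (Suc m) j PZ) = ((qf d (sg n 0 PZ) \<noteq> qf d (sg n (Suc j) PZ)) \<noteq> anti (sg n 0 PZ) (sg n (Suc j) PZ))"
      unfolding Q_def using qf_vadd[of d "sg n 0 PZ" "sg n (Suc j) PZ"] lc(1) j n(1) by (simp del: sg_0 sg_Suc)
    moreover have "\<not> anti (sg n 0 PZ) (sg n (Suc j) PZ)" using j n by (intro anti_sg) auto
    moreover have "qf d (sg n 0 PZ) = (True \<noteq> an PZ c0)"
      using qf_sg[of 0 d PZ] lc(1) n(1) dc by (simp del: replicate.simps)
    moreover have "qf d (sg n (Suc j) PZ) = (True \<noteq> an PZ (ct ! j))"
      using qf_sg[of "Suc j" d PZ] lc(1) j n(1) dc by simp
    ultimately show ?thesis by (simp add: an_pm)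
  qed
  have "pc (\<lambda>d. d = PI) c' = pc (\<lambda>x. an PX (pm (psum d) x) \<and> an PZ (pm c0 x)) ct"
    by (rule pc_cong) (use c' lc QX QZ in auto)
  also have "\<dots> = arf_count (psum d) c0 d" by (simp add: arf_count_def dc)
  finally have "pc (\<lambda>d. d = PI) c' = arf_count (psum d) c0 d" .
  then show ?thesis using lie_iso_trans[OF 1 LA_qf[OF c'(1)]] by (simp add: d_def)
qed

lemma qf_unfold_even:
  assumes "even m" "length b = m" "length c = Suc (Suc m)"
  shows "qf c (unfold_even t b) = (an t (psum c) \<noteq> qf c (unfold_even PI b))"
proof -
  let ?n = "Suc (Suc m)"
  have V: "unfold_even PI b \<in> Vs ?n" by (rule fold_even(3)[OF assms(1,2)])
  then have l: "length (unfold_even PI b) = ?n" by (simp add: Vs_def)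
  have "\<not> anti (replicate ?n t) (unfold_even PI b)"
    using an_psum[of "unfold_even PI b" t] V l by (simp add: Vs_def anti_sym)
  moreover have "qf c (replicate ?n t) = an t (psum c)" using qf_const[of c t] assms by simp
  ultimately show ?thesis
    using qf_vadd[of c "replicate ?n t" "unfold_even PI b"] l assms(3)
    by (subst unfold_even_split[OF assms(1,2), of t]) simp
qed

lemma unfold_even_PI_add:
  assumes "even m" "length b = m" "length b' = m"
  shows "unfold_even PI (vadd b b') = vadd (unfold_even PI b) (unfold_even PI b')"
    "anti (unfold_even PI b) (unfold_even PI b') = anti b b'"
proof -
  note u = fold_even[OF assms(1)]
  have V: "unfold_even PI b \<in> Vs (Suc (Suc m))" "unfold_even PI b' \<in> Vs (Suc (Suc m))" using u(3) assms by auto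
  let ?s = "vadd (unfold_even PI b) (unfold_even PI b')"
  have "unfold_even (fold_t ?s) (fold_b ?s) = ?s" by (rule u(2)[OF Vs_props(3)[OF V]])
  then show "unfold_even PI (vadd b b') = ?s"
    using u(6,7)[OF V] u(4,5)[OF assms(2), of PI] u(4,5)[OF assms(3), of PI] by simp
  show "anti (unfold_even PI b) (unfold_even PI b') = anti b b'"
    using u(8)[OF V] u(5)[OF assms(2), of PI] u(5)[OF assms(3), of PI] by simp
qed

lemma LA_Sq_even:
  assumes ac: "aclosed (Sq \<sigma> n)" and n: "n = Suc (Suc (Suc m))" "even n"
    and c: "cs \<sigma> n = c0 # c1 # ct" and C: "psum (cs \<sigma> n) = PI"
  shows "LA n (Sq \<sigma> n) \<cong>\<^sub>L dpow (if arf_count c1 c0 (cs \<sigma> n) then sp_alg (2 ^ m) else so_alg (2 ^ Suc m)) 4"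
proof -
  define d where "d = cs \<sigma> n"
  have m: "even (Suc m)" using n by simp
  have dc: "d = c0 # c1 # ct" "psum d = PI" using c C by (simp_all add: d_def)
  have lc: "length d = Suc (Suc (Suc m))" "length ct = Suc m" using dc n length_cs[of \<sigma> n] by (simp_all add: d_def)
  define Q where "Q b = qf d (unfold_even PI b)" for b
  have q: "qf d v = Q (fold_b v)" if v: "v \<in> Vs (Suc (Suc (Suc m)))" for v
    using qf_unfold_even[OF m fold_even(1)[OF m v] lc(1), of "fold_t v"] fold_even(2)[OF m v] dc(2) by (simp add: Q_def)
  have noconst: "\<not> (\<exists>p. v = replicate n p)" if v: "v \<in> Vs n" "qf d v" for v
  proof
    assume "\<exists>p. v = replicate n p"
    then obtain p where "v = replicate n p" by blast
    then show False using v(2) qf_const[of d p] lc(1) dc(2) n by (simp del: replicate.simps)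
  qed
  have S: "Sq \<sigma> n = {v \<in> Vs n. qf d v}" using noconst unfolding Sq_Vs d_def[symmetric] by blast
  have len: "length (unfold_even PI b) = n" if "length b = Suc m" for b
    using fold_even(3)[OF m that, of PI] n by (simp add: Vs_def)
  have "quad (Suc m) Q"
    unfolding quad_def Q_def using n by (auto simp: unfold_even_PI_add[OF m] qf_vadd lc len)
  then obtain c' where c': "length c' = Suc m" "\<And>v. length v = Suc m \<Longrightarrow> Q v = qf c' v"
    "\<And>j. j < Suc m \<Longrightarrow> c' ! j = PI \<longleftrightarrow> Q (sg (Suc m) j PX) \<and> Q (sg (Suc m) j PZ)"
    using quad_qf[of "Suc m" Q] by blast
  have "LA n (Sq \<sigma> n) \<cong>\<^sub>L LA n (ptag (ptag {b \<in> strs (Suc m). Q b}))"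
    unfolding S unfolding n(1) by (rule LA_fold4[OF m]) (use q ac S n in auto)
  also have "{b \<in> strs (Suc m). Q b} = {b \<in> strs (Suc m). qf c' b}" using c'(2) by auto
  finally have 1: "LA n (Sq \<sigma> n) \<cong>\<^sub>L LA (Suc (Suc (Suc m))) (ptag (ptag {b \<in> strs (Suc m). qf c' b}))"
    unfolding n(1) .
  have qsum: "qf d (vadd (sg n i p) (sg n k p)) = an p (pm (d ! i) (d ! k))" if "i < n" "k < n" "i \<noteq> k" for i k p
  proof -
    have l: "length d = n" using lc(1) n(1) by simp
    have "qf d (vadd (sg n i p) (sg n k p)) = ((qf d (sg n i p) \<noteq> qf d (sg n k p)) \<noteq> anti (sg n i p) (sg n k p))"
      using that l by (intro qf_vadd) auto
    then show ?thesis using anti_sg[OF that] qf_sg[of i d p] qf_sg[of k d p] that unfolding l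
      by (cases "p = PI") (simp_all add: an_pm)
  qed
  have QX: "Q (sg (Suc m) j PX) = an PX (pm c1 (ct ! j))" if j: "j < Suc m" for j
  proof -
    have "unfold_even PI (sg (Suc m) j PX) = vadd (sg n (Suc 0) PX) (sg n (Suc (Suc j)) PX)"
      using j n vadd_zero(2)[of "sg (Suc m) j PX" "Suc m"] by (simp add: unfold_even_def)
    then show ?thesis using qsum[of "Suc 0" "Suc (Suc j)" PX] j n(1) dc(1) by (simp add: Q_def del: sg_0 sg_Suc)
  qed
  have QZ: "Q (sg (Suc m) j PZ) = an PZ (pm c0 (ct ! j))" if j: "j < Suc m" for j
  proof -
    have "unfold_even PI (sg (Suc m) j PZ) = vadd (sg n 0 PZ) (sg n (Suc (Suc j)) PZ)"
      using j n vadd_zero(2)[of "sg (Suc m) j PZ" "Suc m"] by (simp add: unfold_even_def)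
    then show ?thesis using qsum[of 0 "Suc (Suc j)" PZ] j n(1) dc(1) by (simp add: Q_def del: sg_0 sg_Suc)
  qed
  have "pc (\<lambda>d. d = PI) c' = pc (\<lambda>x. an PX (pm c1 x) \<and> an PZ (pm c0 x)) ct"
    by (rule pc_cong) (use c' lc QX QZ in auto)
  also have "\<dots> = arf_count c1 c0 d" by (simp add: arf_count_def dc(1))
  finally have "pc (\<lambda>d. d = PI) c' = arf_count c1 c0 d" .
  then show ?thesis using lie_iso_trans[OF 1 LA_qf4[OF c'(1)]] by (simp add: d_def)
qed

text \<open>If the form is not trivial on the radical, it cuts a radical line out of the radical.\<close>

lemma LA_Sq_even_su:
  assumes ac: "aclosed (Sq \<sigma> n)" and n: "n = Suc (Suc m)" "even n" and C: "psum (cs \<sigma> n) \<noteq> PI"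
  shows "LA n (Sq \<sigma> n) \<cong>\<^sub>L dpow (su_alg (2 ^ m)) 2"
proof -
  define d where "d = cs \<sigma> n"
  define D where "D = psum d"
  have m: "even m" using n by simp
  have lc: "length d = Suc (Suc m)" using n length_cs[of \<sigma> n] by (simp add: d_def)
  obtain R where R: "an D R" using an_ex[OF C] by (auto simp: d_def D_def)
  define Q where "Q b = qf d (unfold_even PI b)" for b
  have q: "qf d v = (an (fold_t v) D \<noteq> Q (fold_b v))" if v: "v \<in> Vs (Suc (Suc m))" for v
    using qf_unfold_even[OF m fold_even(1)[OF m v] lc, of "fold_t v"] fold_even(2)[OF m v] by (simp add: Q_def D_def)
  have S: "Sq \<sigma> n = {v \<in> Vs (Suc (Suc m)). qf d v \<and> fold_b v \<noteq> pzero m}"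
    using fold_even_const[OF m] unfolding Sq_Vs d_def[symmetric] unfolding n(1) by blast
  define \<phi> where "\<phi> v = tg (an (fold_t v) R) # fold_b v" for v
  have inj: "t = t'" if "an t R = an t' R" "an t D = an t' D" for t t'
  proof -
    have "s = PI" if "an c R" "\<not> an s R" "\<not> an s c" for c s using that by (cases s; cases c; cases R; simp)
    from this[OF R, of "pm t t'"] show ?thesis using that by (simp add: an_pm)
  qed
  have surj: "\<exists>t. an t R = e \<and> an t D = f" for e f
  proof -
    have "an (if e then D else PI) R = e" "\<not> an (if e then D else PI) D" "an (if f then R else PI) D = f"
      "\<not> an (if f then R else PI) R" using R by (auto simp: an_sym)
    then show ?thesis by (intro exI[of _ "pm (if e then D else PI) (if f then R else PI)"]) (auto simp: an_pm)
  qed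
  have "LA n (Sq \<sigma> n) \<cong>\<^sub>L LA (Suc m) (\<phi> ` Sq \<sigma> n)"
  proof (rule LA_iso[where V = "Vs n"])
    show "inj_on \<phi> (Sq \<sigma> n)"
    proof (rule inj_onI)
      fix v w assume vw: "v \<in> Sq \<sigma> n" "w \<in> Sq \<sigma> n" "\<phi> v = \<phi> w"
      then have V: "v \<in> Vs (Suc (Suc m))" "w \<in> Vs (Suc (Suc m))" and "fold_b v = fold_b w" "an (fold_t v) R = an (fold_t w) R"
        "an (fold_t v) D = an (fold_t w) D"
        using q unfolding S by (auto simp: \<phi>_def)
      then show "v = w" using inj fold_even(2)[OF m V(1)] fold_even(2)[OF m V(2)] by metis
    qed
    fix v w assume vw: "v \<in> Vs n" "w \<in> Vs n"
    then show "vadd v w \<in> Vs n" by (rule Vs_props(3))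
    show "\<phi> (vadd v w) = vadd (\<phi> v) (\<phi> w)"
      using fold_even(6,7)[OF m] vw n by (simp add: \<phi>_def an_pm)
    show "anti (\<phi> v) (\<phi> w) = anti v w"
      using fold_even(8)[OF m] vw n by (simp add: \<phi>_def)
  qed (use Vs_props fold_even(1)[OF m] ac n S in \<open>auto simp: \<phi>_def simp del: replicate.simps\<close>)
  moreover have "\<phi> ` Sq \<sigma> n = ptag (strs m - {pzero m})"
  proof
    show "\<phi> ` Sq \<sigma> n \<subseteq> ptag (strs m - {pzero m})"
      unfolding S using fold_even(1)[OF m] by (auto simp: \<phi>_def intro!: ptagI)
    show "ptag (strs m - {pzero m}) \<subseteq> \<phi> ` Sq \<sigma> n"
    proof
      fix y assume "y \<in> ptag (strs m - {pzero m})"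
      then obtain e b where y: "y = tg e # b" "length b = m" "b \<noteq> pzero m" by (rule ptagE) simp
      obtain t where t: "an t R = e" "an t D = (\<not> Q b)" using surj by blast
      note u = fold_even(3)[OF m y(2), of t] fold_even(4)[OF m y(2), of t] fold_even(5)[OF m y(2), of t]
      have "unfold_even t b \<in> Sq \<sigma> n" unfolding S using u y t q by auto
      moreover have "\<phi> (unfold_even t b) = y" using u y t by (simp add: \<phi>_def)
      ultimately show "y \<in> \<phi> ` Sq \<sigma> n" by blast
    qed
  qed
  ultimately show ?thesis using LA_su_su[of m] by (simp add: numeral_2_eq_2)
qed

section \<open>Periodicity of the types\<close>

lemma tau_tau [simp]: "tau (tau x) = x" by (cases x) auto
lemma rot_rot [simp]: "rot (rot (rot x)) = x" by (cases x) auto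

lemma cc_tau: "cc tau (k + 4) = cc tau k"
proof -
  have "pm (pm (pm (pm c (tau x)) x) (tau x)) x = c" for c x by (cases c; cases x; simp)
  then show ?thesis by (simp add: eval_nat_numeral)
qed

lemma cc_rot: "cc rot (k + 3) = cc rot k"
proof -
  have "pm (pm (pm c (rot x)) (rot (rot x))) x = c" for c x by (cases c; cases x; simp)
  then show ?thesis by (simp add: eval_nat_numeral)
qed

lemma cs_tau: "\<exists>w. cs tau (n + 8) = w @ w @ cs tau n"
proof -
  have "cs tau (n + 8) = [cc tau (n + 3 + 4), cc tau (n + 2 + 4), cc tau (n + 1 + 4), cc tau (n + 4)]
      @ [cc tau (n + 3), cc tau (n + 2), cc tau (n + 1), cc tau n] @ cs tau n"
    by (simp add: eval_nat_numeral del: cc.simps)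
  then show ?thesis unfolding cc_tau by blast
qed

lemma cs_rot: "\<exists>w. cs rot (n + 6) = w @ w @ cs rot n"
proof -
  have "cs rot (n + 6) = [cc rot (n + 2 + 3), cc rot (n + 1 + 3), cc rot (n + 3)]
      @ [cc rot (n + 2), cc rot (n + 1), cc rot n] @ cs rot n"
    by (simp add: eval_nat_numeral del: cc.simps)
  then show ?thesis unfolding cc_rot by blast
qed

definition arf_data :: "(pauli \<Rightarrow> pauli) \<Rightarrow> nat \<Rightarrow> pauli \<times> bool \<times> bool" where
  "arf_data \<sigma> n = (psum (cs \<sigma> n), arf_count (psum (cs \<sigma> n)) (cc \<sigma> (n - 1)) (cs \<sigma> n), arf_count (cc \<sigma> (n - 2)) (cc \<sigma> (n - 1)) (cs \<sigma> n))"

lemma arf_data_period: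
  assumes "\<exists>w. cs \<sigma> (n + q) = w @ w @ cs \<sigma> n" "\<And>k. cc \<sigma> (k + q) = cc \<sigma> k" "2 \<le> n"
  shows "arf_data \<sigma> (n + q) = arf_data \<sigma> n"
proof -
  obtain w where w: "cs \<sigma> (n + q) = w @ w @ cs \<sigma> n" using assms(1) by blast
  have "n + q - 1 = (n - 1) + q" "n + q - 2 = (n - 2) + q" using assms(3) by auto
  then have "cc \<sigma> (n + q - 1) = cc \<sigma> (n - 1)" "cc \<sigma> (n + q - 2) = cc \<sigma> (n - 2)" by (simp_all only: assms(2))
  then show ?thesis unfolding arf_data_def arf_count_def w by (auto simp: pc_append)
qed

lemma arf_data_tau: "2 \<le> n \<Longrightarrow> arf_data tau (n + 8) = arf_data tau n"
proof (rule arf_data_period[OF cs_tau])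
  show "cc tau (k + 8) = cc tau k" for k using cc_tau[of "k + 4"] cc_tau[of k] by (simp add: add.assoc)
qed

lemma arf_data_rot: "2 \<le> n \<Longrightarrow> arf_data rot (n + 6) = arf_data rot n"
proof (rule arf_data_period[OF cs_rot])
  show "cc rot (k + 6) = cc rot k" for k using cc_rot[of "k + 3"] cc_rot[of k] by (simp add: add.assoc)
qed

lemma arf_tau_base: "list_all (\<lambda>n. (n mod 8 \<in> {1, 7} \<longrightarrow> \<not> fst (snd (arf_data tau n))) \<and> (n mod 8 \<in> {3, 5} \<longrightarrow> fst (snd (arf_data tau n)))
    \<and> (n mod 8 \<in> {2, 6} \<longrightarrow> fst (arf_data tau n) \<noteq> PI)
    \<and> (n mod 8 = 0 \<longrightarrow> fst (arf_data tau n) = PI \<and> \<not> snd (snd (arf_data tau n)))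
    \<and> (n mod 8 = 4 \<longrightarrow> fst (arf_data tau n) = PI \<and> snd (snd (arf_data tau n)))) [3, 4, 5, 6, 7, 8, 9, 10]"
  by code_simp

lemma arf_tau:
  assumes "3 \<le> n"
  shows "(n mod 8 \<in> {1, 7} \<longrightarrow> \<not> fst (snd (arf_data tau n))) \<and> (n mod 8 \<in> {3, 5} \<longrightarrow> fst (snd (arf_data tau n)))
    \<and> (n mod 8 \<in> {2, 6} \<longrightarrow> fst (arf_data tau n) \<noteq> PI)
    \<and> (n mod 8 = 0 \<longrightarrow> fst (arf_data tau n) = PI \<and> \<not> snd (snd (arf_data tau n)))
    \<and> (n mod 8 = 4 \<longrightarrow> fst (arf_data tau n) = PI \<and> snd (snd (arf_data tau n)))"
  using assms
proof (induct n rule: less_induct)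
  case (less n)
  show ?case
  proof (cases "n < 11")
    case True
    then have "n \<in> set [3, 4, 5, 6, 7, 8, 9, 10]" using less by auto
    then show ?thesis by (rule bspec[OF arf_tau_base[unfolded list_all_iff]])
  next
    case False
    define m where "m = n - 8"
    have m: "n = m + 8" "3 \<le> m" "m < n" using False by (simp_all add: m_def)
    show ?thesis using less(1)[OF m(3,2)] arf_data_tau[of m] m by simp
  qed
qed

lemma arf_rot_base: "list_all (\<lambda>n. (n mod 6 \<in> {1, 5} \<longrightarrow> \<not> fst (snd (arf_data rot n))) \<and> (n mod 6 = 3 \<longrightarrow> fst (snd (arf_data rot n)))
    \<and> (n mod 6 \<in> {2, 4} \<longrightarrow> fst (arf_data rot n) \<noteq> PI)
    \<and> (n mod 6 = 0 \<longrightarrow> fst (arf_data rot n) = PI \<and> \<not> snd (snd (arf_data rot n)))) [3, 4, 5, 6, 7, 8]"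
  by code_simp

lemma arf_rot:
  assumes "3 \<le> n"
  shows "(n mod 6 \<in> {1, 5} \<longrightarrow> \<not> fst (snd (arf_data rot n))) \<and> (n mod 6 = 3 \<longrightarrow> fst (snd (arf_data rot n)))
    \<and> (n mod 6 \<in> {2, 4} \<longrightarrow> fst (arf_data rot n) \<noteq> PI)
    \<and> (n mod 6 = 0 \<longrightarrow> fst (arf_data rot n) = PI \<and> \<not> snd (snd (arf_data rot n)))"
  using assms
proof (induct n rule: less_induct)
  case (less n)
  show ?case
  proof (cases "n < 9")
    case True
    then have "n \<in> set [3, 4, 5, 6, 7, 8]" using less by auto
    then show ?thesis by (rule bspec[OF arf_rot_base[unfolded list_all_iff]])
  next
    case False
    define m where "m = n - 6"
    have m: "n = m + 6" "3 \<le> m" "m < n" using False by (simp_all add: m_def)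
    show ?thesis using less(1)[OF m(3,2)] arf_data_rot[of m] m by simp
  qed
qed

lemma odd_mod: "odd n \<longleftrightarrow> odd (n mod 8)" "odd n \<longleftrightarrow> odd (n mod 6)" for n :: nat
  by presburger+

lemma LA_Sq_types:
  assumes "aclosed (Sq \<sigma> n)" "3 \<le> n"
  shows "odd n \<Longrightarrow> \<not> fst (snd (arf_data \<sigma> n)) \<Longrightarrow> LA n (Sq \<sigma> n) \<cong>\<^sub>L so_alg (2 ^ (n - 1))"
    "odd n \<Longrightarrow> fst (snd (arf_data \<sigma> n)) \<Longrightarrow> LA n (Sq \<sigma> n) \<cong>\<^sub>L sp_alg (2 ^ (n - 2))"
    "even n \<Longrightarrow> fst (arf_data \<sigma> n) \<noteq> PI \<Longrightarrow> LA n (Sq \<sigma> n) \<cong>\<^sub>L dpow (su_alg (2 ^ (n - 2))) 2"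
    "even n \<Longrightarrow> fst (arf_data \<sigma> n) = PI \<Longrightarrow> \<not> snd (snd (arf_data \<sigma> n)) \<Longrightarrow> LA n (Sq \<sigma> n) \<cong>\<^sub>L dpow (so_alg (2 ^ (n - 2))) 4"
    "even n \<Longrightarrow> fst (arf_data \<sigma> n) = PI \<Longrightarrow> snd (snd (arf_data \<sigma> n)) \<Longrightarrow> LA n (Sq \<sigma> n) \<cong>\<^sub>L dpow (sp_alg (2 ^ (n - 3))) 4"
proof -
  obtain m where n: "n = Suc (Suc (Suc m))" using assms(2) by (metis One_nat_def Suc_le_D numeral_3_eq_3 Suc_le_mono)
  have c: "cs \<sigma> n = cc \<sigma> (n - 1) # cc \<sigma> (n - 2) # cs \<sigma> (Suc m)" by (simp add: n)
  have e: "Suc m = n - 2" "Suc (Suc m) = n - 1" "m = n - 3" using n by auto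
  show "LA n (Sq \<sigma> n) \<cong>\<^sub>L so_alg (2 ^ (n - 1))" if "odd n" "\<not> fst (snd (arf_data \<sigma> n))"
    using LA_Sq_odd[OF assms(1) n that(1) c] that(2) unfolding e(2) unfolding e(1) by (simp add: arf_data_def)
  show "LA n (Sq \<sigma> n) \<cong>\<^sub>L sp_alg (2 ^ (n - 2))" if "odd n" "fst (snd (arf_data \<sigma> n))"
    using LA_Sq_odd[OF assms(1) n that(1) c] that(2) unfolding e(2) unfolding e(1) by (simp add: arf_data_def)
  show "LA n (Sq \<sigma> n) \<cong>\<^sub>L dpow (su_alg (2 ^ (n - 2))) 2" if "even n" "fst (arf_data \<sigma> n) \<noteq> PI"
    using LA_Sq_even_su[OF assms(1) n that(1)] that(2) unfolding e(1) by (simp add: arf_data_def)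
  show "LA n (Sq \<sigma> n) \<cong>\<^sub>L dpow (so_alg (2 ^ (n - 2))) 4"
    if "even n" "fst (arf_data \<sigma> n) = PI" "\<not> snd (snd (arf_data \<sigma> n))"
    using LA_Sq_even[OF assms(1) n that(1) c] that(2,3) unfolding e(1) unfolding e(3) by (simp add: arf_data_def)
  show "LA n (Sq \<sigma> n) \<cong>\<^sub>L dpow (sp_alg (2 ^ (n - 3))) 4"
    if "even n" "fst (arf_data \<sigma> n) = PI" "snd (snd (arf_data \<sigma> n))"
    using LA_Sq_even[OF assms(1) n that(1) c] that(2,3) unfolding e(1) unfolding e(3) by (simp add: arf_data_def)
qed

section \<open>Chain algebras of polynomial dimension\<close>

lemma cl_commuting: "(\<And>v w. v \<in> G \<Longrightarrow> w \<in> G \<Longrightarrow> \<not> anti v w) \<Longrightarrow> cl G = G"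
proof
  assume "\<And>v w. v \<in> G \<Longrightarrow> w \<in> G \<Longrightarrow> \<not> anti v w"
  then show "cl G \<subseteq> G" by (intro cl_least) (auto simp: aclosed_def)
qed (auto intro: cl.base)

lemma commute_cl:
  assumes "G \<subseteq> strs n" "length x = n" "\<And>v. v \<in> G \<Longrightarrow> \<not> anti x v" "v \<in> cl G"
  shows "\<not> anti x v"
  using assms(4)
proof (induct rule: cl.induct)
  case (step v w)
  then have "length v = n" "length w = n" using cl_strs[OF assms(1)] by auto
  then show ?case using step assms(2) by (simp add: anti_vadd2)
qed (rule assms(3))

lemma cl_union:
  assumes "G \<subseteq> strs n" "H \<subseteq> strs n" "\<And>v w. v \<in> G \<Longrightarrow> w \<in> H \<Longrightarrow> \<not> anti v w"
  shows "cl (G \<union> H) = cl G \<union> cl H" "\<And>v w. v \<in> cl G \<Longrightarrow> w \<in> cl H \<Longrightarrow> \<not> anti v w"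
proof -
  show com: "\<not> anti v w" if "v \<in> cl G" "w \<in> cl H" for v w
  proof (rule commute_cl[OF assms(2) _ _ that(2)])
    show "length v = n" using that cl_strs[OF assms(1)] by auto
    fix x assume x: "x \<in> H"
    have "\<not> anti x v"
      by (rule commute_cl[OF assms(1) _ _ that(1)]) (use assms x in \<open>auto simp: anti_sym\<close>)
    then show "\<not> anti v x" by (simp add: anti_sym)
  qed
  show "cl (G \<union> H) = cl G \<union> cl H"
  proof
    have "aclosed (cl G \<union> cl H)"
      using com aclosed_cl[of G] aclosed_cl[of H] unfolding aclosed_def by (metis Un_iff anti_sym)
    then show "cl (G \<union> H) \<subseteq> cl G \<union> cl H" by (intro cl_least) (auto intro: cl.base)
    show "cl G \<union> cl H \<subseteq> cl (G \<union> H)"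
      using cl_mono[of G "G \<union> H"] cl_mono[of H "G \<union> H"] by (auto intro: cl.base)
  qed
qed

lemma cl_eqI: "G \<subseteq> cl H \<Longrightarrow> H \<subseteq> cl G \<Longrightarrow> cl G = cl H"
  by (simp add: cl_mono subset_antisym)

lemma cl_anti:
  assumes "G \<subseteq> strs n" "\<And>g. g \<in> G \<Longrightarrow> \<exists>w\<in>cl G. anti g w" "v \<in> cl G"
  shows "\<exists>w\<in>cl G. anti v w"
  using assms(3)
proof (induct rule: cl.induct)
  case (step v w)
  then have "length v = n" "length w = n" using cl_strs[OF assms(1)] by auto
  then have "anti (vadd v w) w" using step by (simp add: anti_vadd)
  then show ?case using step by blast
qed (use assms in auto)

lemma prefix_zeros: "p \<noteq> PI \<Longrightarrow> q \<noteq> PI \<Longrightarrow> pzero i @ p # v = pzero j @ q # w \<Longrightarrow> i = j \<and> p = q \<and> v = w"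
proof (induct i arbitrary: j)
  case 0
  then show ?case by (cases j) auto
next
  case (Suc i)
  then show ?case by (cases j) auto
qed

lemma commuting_X: "set v \<subseteq> {PI, PX} \<Longrightarrow> set w \<subseteq> {PI, PX} \<Longrightarrow> \<not> anti v w"
  by (induct v w rule: list_induct2') auto

definition bond :: "nat \<Rightarrow> nat \<Rightarrow> pauli \<Rightarrow> pauli \<Rightarrow> pauli list" where
  "bond n j A B = pzero j @ A # B # pzero (n - 2 - j)"

lemma set_bond: "set (bonds [(A,B)] n) = (\<lambda>j. bond n j A B) ` {..<n - 1}"
proof
  show "set (bonds [(A,B)] n) \<subseteq> (\<lambda>j. bond n j A B) ` {..<n - 1}"
  proof
    fix x assume "x \<in> set (bonds [(A,B)] n)"
    then obtain j k where jk: "x = pzero j @ A # B # pzero k" "j + k + 2 = n" unfolding set_bonds by auto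
    then have "x = bond n j A B" "j < n - 1" by (auto simp: bond_def)
    then show "x \<in> (\<lambda>j. bond n j A B) ` {..<n - 1}" by blast
  qed
  show "(\<lambda>j. bond n j A B) ` {..<n - 1} \<subseteq> set (bonds [(A,B)] n)"
  proof
    fix x assume "x \<in> (\<lambda>j. bond n j A B) ` {..<n - 1}"
    then obtain j where j: "x = bond n j A B" "j + (n - 2 - j) + 2 = n" by auto
    then show "x \<in> set (bonds [(A,B)] n)" unfolding set_bonds bond_def by auto
  qed
qed

lemma LA_a0:
  assumes "3 \<le> n"
  shows "LA n (cl (set (bonds [(PX,PX)] n))) \<cong>\<^sub>L dpow u1 (n - 1)"
proof -
  let ?S = "set (bonds [(PX,PX)] n)"
  note S = set_bond[of PX PX n]
  have com': "\<not> anti v w" if "v \<in> ?S" "w \<in> ?S" for v w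
    using that by (intro commuting_X) (auto simp: set_bonds)
  have "inj_on (\<lambda>j. bond n j PX PX) {..<n - 1}"
    unfolding bond_def by (rule inj_onI) (use prefix_zeros in blast)
  then have "card ?S = n - 1" unfolding S by (simp add: card_image)
  moreover have "LA n ?S \<cong>\<^sub>L dpow u1 (card ?S)"
  proof (rule LA_commuting)
    show "?S \<noteq> {}" using \<open>card ?S = n - 1\<close> assms by auto
  qed (use com' bonds_strs in auto)
  ultimately show ?thesis using cl_commuting[of ?S] com' by simp
qed

lemma sg_inj:
  assumes "p \<noteq> PI" "q \<noteq> PI" "sg n i p = sg n j q"
  shows "i = j \<and> p = q"
  using prefix_zeros[OF assms(1,2) assms(3)[unfolded sg_def]] by simp

lemma sg_left: "sg (j + k + 2) j p = pzero j @ p # PI # pzero k"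
  by (induct j) simp_all

lemma sg_right: "sg (j + k + 2) (Suc j) p = pzero j @ PI # p # pzero k"
  by (induct j) simp_all

lemma set_singles:
  assumes "2 \<le> n"
  shows "set (bonds [(p,PI),(PI,p)] n) = (\<lambda>j. sg n j p) ` {..<n}"
proof
  show "set (bonds [(p,PI),(PI,p)] n) \<subseteq> (\<lambda>j. sg n j p) ` {..<n}"
  proof
    fix x assume "x \<in> set (bonds [(p,PI),(PI,p)] n)"
    then obtain j k where jk: "n = j + k + 2" "x = pzero j @ p # PI # pzero k \<or> x = pzero j @ PI # p # pzero k"
      by (auto simp: set_bonds)
    have "x = sg n j p \<or> x = sg n (Suc j) p" using jk(2) unfolding jk(1) sg_left sg_right .
    moreover have "j < n" "Suc j < n" using jk(1) by auto
    ultimately show "x \<in> (\<lambda>j. sg n j p) ` {..<n}" by blast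
  qed
  show "(\<lambda>j. sg n j p) ` {..<n} \<subseteq> set (bonds [(p,PI),(PI,p)] n)"
  proof
    fix x assume "x \<in> (\<lambda>j. sg n j p) ` {..<n}"
    then obtain j where j: "j < n" "x = sg n j p" by auto
    obtain i k where "n = i + k + 2" "j = i \<or> j = Suc i"
    proof (cases "Suc j < n")
      case True
      then have "n = j + (n - 2 - j) + 2" by simp
      then show ?thesis using that by blast
    next
      case False
      then have "n = (j - 1) + 0 + 2" "j = Suc (j - 1)" using j assms by auto
      then show ?thesis using that by blast
    qed
    then show "x \<in> set (bonds [(p,PI),(PI,p)] n)"
      unfolding set_bonds j(2) using sg_left[of i k p] sg_right[of i k p] by fastforce
  qed
qed

lemma LA_b0:
  assumes "3 \<le> n"
  shows "LA n (cl (set (bonds [(PX,PI),(PI,PX)] n))) \<cong>\<^sub>L dpow u1 n"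
proof -
  let ?S = "set (bonds [(PX,PI),(PI,PX)] n)"
  have S: "?S = (\<lambda>j. sg n j PX) ` {..<n}" using assms by (intro set_singles) simp
  have com: "\<not> anti v w" if "v \<in> ?S" "w \<in> ?S" for v w
    using that by (intro commuting_X) (auto simp: set_bonds)
  have "card ?S = n" unfolding S
    by (subst card_image) (use sg_inj[of PX PX] in \<open>auto simp: inj_on_def\<close>)
  moreover have "LA n ?S \<cong>\<^sub>L dpow u1 (card ?S)"
  proof (rule LA_commuting)
    show "?S \<noteq> {}" using \<open>card ?S = n\<close> assms by auto
  qed (use com bonds_strs in auto)
  ultimately show ?thesis using cl_commuting[of ?S] com by simp
qed

lemma bonds_Cons: "set (bonds (g # G) n) = set (bonds [g] n) \<union> set (bonds G n)"
  unfolding set_bonds by (simp only: list.set insert_iff Un_insert_left) blast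

lemma LA_b1:
  assumes "3 \<le> n"
  shows "LA n (cl (set (bonds [(PX,PX),(PX,PI),(PI,PX)] n))) \<cong>\<^sub>L dpow u1 (2 * n - 1)"
proof -
  let ?S = "set (bonds [(PX,PX),(PX,PI),(PI,PX)] n)"
  let ?f = "\<lambda>j. bond n j PX PX"
  note A = set_bond[of PX PX n]
  have B: "set (bonds [(PX,PI),(PI,PX)] n) = (\<lambda>j. sg n j PX) ` {..<n}" using assms by (intro set_singles) simp
  have "inj_on ?f {..<n - 1}"
    unfolding bond_def by (rule inj_onI) (use prefix_zeros in blast)
  then have cA: "card (?f ` {..<n - 1}) = n - 1" by (simp add: card_image)
  have cB: "card ((\<lambda>j. sg n j PX) ` {..<n}) = n"
    by (subst card_image) (use sg_inj[of PX PX] in \<open>auto simp: inj_on_def\<close>)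
  have dis: "?f ` {..<n - 1} \<inter> (\<lambda>j. sg n j PX) ` {..<n} = {}"
  proof -
    have "?f i \<noteq> sg n j PX" for i j
    proof
      assume "?f i = sg n j PX"
      then have "PX # pzero (n - 2 - i) = pzero (n - Suc j)"
        unfolding sg_def bond_def using prefix_zeros[of PX PX] by blast
      then show False by (cases "n - Suc j") auto
    qed
    then show ?thesis by auto
  qed
  have "card ?S = (n - 1) + n"
    unfolding bonds_Cons[of "(PX,PX)" "[(PX,PI),(PI,PX)]"] A B using dis cA cB by (subst card_Un_disjoint) auto
  then have card: "card ?S = 2 * n - 1" using assms by simp
  have com: "\<not> anti v w" if "v \<in> ?S" "w \<in> ?S" for v w
    using that by (intro commuting_X) (auto simp: set_bonds)
  moreover have "LA n ?S \<cong>\<^sub>L dpow u1 (card ?S)"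
  proof (rule LA_commuting)
    show "?S \<noteq> {}" using card assms by auto
  qed (use com bonds_strs in auto)
  ultimately show ?thesis using cl_commuting[of ?S] card by simp
qed

text \<open>Jordan--Wigner strings, with a site-dependent tail \<open>P\<close>.\<close>

definition jw :: "nat \<Rightarrow> (nat \<Rightarrow> pauli) \<Rightarrow> nat \<Rightarrow> pauli \<Rightarrow> pauli list" where
  "jw n P s L = map P [0..<s] @ L # pzero (n - Suc s)"

lemma length_jw [simp]: "s < n \<Longrightarrow> length (jw n P s L) = n"
  by (simp add: jw_def)

lemma jw_anti_eq: "anti (jw n P s L) (jw n P s L') = an L L'"
  by (simp add: jw_def anti_append)

lemma jw_split: "s < t \<Longrightarrow> t < n \<Longrightarrow> jw n P t L = map P [0..<s] @ P s # map P [Suc s..<t] @ L # pzero (n - Suc t)"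
proof -
  assume "s < t" "t < n"
  then have "[0..<t] = [0..<s] @ s # [Suc s..<t]"
    by (metis append_Cons le0 less_imp_le_nat upt_add_eq_append upt_conv_Cons le_add_diff_inverse add_0)
  then show ?thesis by (simp add: jw_def)
qed

lemma jw_anti: "s < t \<Longrightarrow> t < n \<Longrightarrow> anti (jw n P s L) (jw n P t L') = an L (P s)"
  unfolding jw_split by (simp add: jw_def anti_append)

lemma jw_anti': "s < t \<Longrightarrow> t < n \<Longrightarrow> anti (jw n P t L') (jw n P s L) = an L (P s)"
  using jw_anti anti_sym by blast

lemma jw_vadd_eq: "s < n \<Longrightarrow> vadd (jw n P s L) (jw n P s L') = sg n s (pm L L')"
  by (simp add: jw_def sg_def vadd_append map_replicate_const[symmetric] vadd_zero)

lemma jw_vadd_Suc: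
  assumes "Suc s < n"
  shows "vadd (jw n P s L) (jw n P (Suc s) L') = bond n s (pm L (P s)) L'"
proof -
  have "n - Suc s = Suc (n - 2 - s)" using assms by simp
  then have "jw n P s L = map P [0..<s] @ L # PI # pzero (n - 2 - s)"
    "jw n P (Suc s) L' = map P [0..<s] @ P s # L' # pzero (n - 2 - s)"
    by (simp_all add: jw_def)
  then show ?thesis by (simp add: vadd_append vadd_zero bond_def)
qed

lemma LA_a1: "LA n (cl (set (bonds [(PX,PY)] n))) \<cong>\<^sub>L so_alg n"
proof -
  let ?g = "\<lambda>i. jw n (\<lambda>_. PZ) i PY"
  have m: "majorana n n ?g"
    unfolding majorana_def
  proof (intro conjI allI impI)
    fix i j assume "i < n" "j < n" "i \<noteq> j"
    then show "anti (?g i) (?g j)" by (cases "i < j") (simp_all add: jw_anti jw_anti')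
  qed simp
  have "{vadd (?g i) (?g (Suc i)) |i. Suc i < n} = (\<lambda>i. vadd (?g i) (?g (Suc i))) ` {..<n - 1}" by auto
  also have "\<dots> = set (bonds [(PX,PY)] n)" unfolding set_bond by (intro image_cong) (simp_all add: jw_vadd_Suc)
  finally show ?thesis using cl_path[OF m] LA_bilin[OF m] by simp
qed

lemma length_bond [simp]: "Suc s < n \<Longrightarrow> length (bond n s A B) = n"
  by (simp add: bond_def)

lemma bond_vadd: "vadd (bond n s A B) (bond n s C D) = bond n s (pm A C) (pm B D)"
  by (simp add: bond_def vadd_append vadd_zero)

lemma bond_anti: "anti (bond n s A B) (bond n s C D) = (an A C \<noteq> an B D)"
  by (simp add: bond_def anti_append)

lemma bond_sg:
  assumes "Suc s < n"
  shows "bond n s A PI = sg n s A" "bond n s PI A = sg n (Suc s) A"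
proof -
  obtain k where "n = s + k + 2" using assms by (metis add_2_eq_Suc' add_Suc_right add_Suc less_iff_Suc_add)
  then show "bond n s A PI = sg n s A" "bond n s PI A = sg n (Suc s) A"
    using sg_left[of s k A] sg_right[of s k A] by (simp_all add: bond_def)
qed

lemma bond_eq_vadd: "Suc s < n \<Longrightarrow> bond n s A B = vadd (sg n s A) (sg n (Suc s) B)"
  unfolding bond_sg[symmetric] bond_vadd by simp

lemma cl_bond:
  assumes "bond n s A B \<in> cl G" "bond n s C D \<in> cl G" "an A C \<noteq> an B D"
  shows "bond n s (pm A C) (pm B D) \<in> cl G"
  using cl.step[OF assms(1,2)] assms(3) by (simp add: bond_anti bond_vadd)

lemma bonds_subset: "set (bonds G n) \<subseteq> S \<longleftrightarrow> (\<forall>(A, B)\<in>set G. \<forall>s. Suc s < n \<longrightarrow> bond n s A B \<in> S)"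
proof
  assume S: "set (bonds G n) \<subseteq> S"
  show "\<forall>(A, B)\<in>set G. \<forall>s. Suc s < n \<longrightarrow> bond n s A B \<in> S"
  proof (clarify)
    fix A B s assume "(A, B) \<in> set G" "Suc s < n"
    then have "(A, B) \<in> set G" "s + (n - 2 - s) + 2 = n" by auto
    then have "bond n s A B \<in> set (bonds G n)" unfolding set_bonds bond_def by blast
    then show "bond n s A B \<in> S" using S by blast
  qed
next
  assume *: "\<forall>(A, B)\<in>set G. \<forall>s. Suc s < n \<longrightarrow> bond n s A B \<in> S"
  show "set (bonds G n) \<subseteq> S"
  proof
    fix x assume "x \<in> set (bonds G n)"
    then obtain j k A B where x: "x = pzero j @ A # B # pzero k" "(A, B) \<in> set G" "j + k + 2 = n"
      unfolding set_bonds by blast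
    then have "x = bond n j A B" "Suc j < n" by (auto simp: bond_def)
    then show "x \<in> S" using * x(2) by auto
  qed
qed

lemma bond_in: "(A, B) \<in> set G \<Longrightarrow> Suc s < n \<Longrightarrow> bond n s A B \<in> set (bonds G n)"
  using bonds_subset[of G n "set (bonds G n)"] by blast

lemma anti_sg_iff: "i < n \<Longrightarrow> j < n \<Longrightarrow> anti (sg n i p) (sg n j q) \<longleftrightarrow> i = j \<and> an p q"
  by (cases "i = j") (simp_all add: anti_sg, simp add: sg_def anti_append)

lemma anti_bond_sg:
  assumes "Suc s < n" "j < n"
  shows "anti (bond n s A B) (sg n j p) = ((j = s \<and> an A p) \<noteq> (j = Suc s \<and> an B p))"
  using assms by (subst bond_eq_vadd) (auto simp: anti_vadd anti_sg_iff)

lemma anti_bond_bond: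
  assumes "Suc i < n" "Suc j < n"
  shows "anti (bond n i p p) (bond n j q q) \<longleftrightarrow> an p q \<and> (i = Suc j \<or> j = Suc i)"
  using assms unfolding bond_eq_vadd[OF assms(2)] by (auto simp: anti_vadd2 anti_bond_sg)

lemma LA_path:
  assumes "majorana n N g"
  shows "LA n (cl ((\<lambda>i. vadd (g i) (g (Suc i))) ` {..<N - 1})) \<cong>\<^sub>L so_alg N"
proof -
  have "(\<lambda>i. vadd (g i) (g (Suc i))) ` {..<N - 1} = {vadd (g i) (g (Suc i)) |i. Suc i < N}" by auto
  then show ?thesis using cl_path[OF assms] LA_bilin[OF assms] by simp
qed

text \<open>The bonds \<open>XX\<close>, \<open>YY\<close> split into two zigzags that commute with each other.\<close>

lemma LA_alternating:
  assumes "(A, B) \<in> {(PX,PY),(PY,PX)}"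
  defines "l \<equiv> \<lambda>i. if even i then A else B"
  shows "LA n (cl ((\<lambda>i. bond n i (l i) (l i)) ` {..<n - 1})) \<cong>\<^sub>L so_alg n"
proof -
  let ?P = "\<lambda>j::nat. if j = 0 then B else PZ"
  let ?g = "\<lambda>i. jw n ?P i (if i = 0 then PZ else if odd i then A else B)"
  have m: "majorana n n ?g"
    unfolding majorana_def
  proof (intro conjI allI impI)
    fix i j assume "i < n" "j < n" "i \<noteq> j"
    then show "anti (?g i) (?g j)"
      using assms(1) by (cases "i < j") (auto simp: jw_anti jw_anti')
  qed simp
  have "vadd (?g i) (?g (Suc i)) = bond n i (l i) (l i)" if "i < n - 1" for i
    using that assms(1) by (subst jw_vadd_Suc) (auto simp: l_def)
  then have "(\<lambda>i. vadd (?g i) (?g (Suc i))) ` {..<n - 1} = (\<lambda>i. bond n i (l i) (l i)) ` {..<n - 1}"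
    by (intro image_cong) simp_all
  then show ?thesis using LA_path[OF m] by simp
qed

lemma LA_a4:
  assumes "3 \<le> n"
  shows "LA n (cl (set (bonds [(PX,PX),(PY,PY)] n))) \<cong>\<^sub>L so_alg n \<oplus>\<^sub>L so_alg n"
proof -
  define l where "l A B i = (if even i then A else B)" for A B :: pauli and i :: nat
  define F where "F A B = (\<lambda>i. bond n i (l A B i) (l A B i)) ` {..<n - 1}" for A B
  have so: "LA n (cl (F PX PY)) \<cong>\<^sub>L so_alg n" "LA n (cl (F PY PX)) \<cong>\<^sub>L so_alg n"
    unfolding F_def l_def using LA_alternating[of PX PY n] LA_alternating[of PY PX n] by simp_all
  have bond: "set (bonds [(PX,PX),(PY,PY)] n) = F PX PY \<union> F PY PX"
  proof -
    have "x \<in> F PX PY \<union> F PY PX \<longleftrightarrow> (\<exists>i<n - 1. x = bond n i PX PX \<or> x = bond n i PY PY)" for x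
    proof -
      have "x \<in> F A B \<longleftrightarrow> (\<exists>i<n - 1. even i \<and> x = bond n i A A \<or> odd i \<and> x = bond n i B B)" for A B
        unfolding F_def l_def by (auto simp: image_iff Bex_def)
      then show ?thesis unfolding Un_iff by blast
    qed
    moreover have "x \<in> set (bonds [(PX,PX),(PY,PY)] n) \<longleftrightarrow> (\<exists>i<n - 1. x = bond n i PX PX \<or> x = bond n i PY PY)" for x
      unfolding bonds_Cons[of _ "[(PY,PY)]"] set_bond by blast
    ultimately show ?thesis by blast
  qed
  have S: "F A B \<subseteq> strs n" for A B by (auto simp: F_def)
  have com: "\<not> anti v w" if "v \<in> F PX PY" "w \<in> F PY PX" for v w
    using that unfolding F_def by (auto simp: anti_bond_bond l_def split: if_splits)
  have u: "cl (F PX PY \<union> F PY PX) = cl (F PX PY) \<union> cl (F PY PX)"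
    "\<And>v w. v \<in> cl (F PX PY) \<Longrightarrow> w \<in> cl (F PY PX) \<Longrightarrow> \<not> anti v w"
    using cl_union[OF S S] com by blast+
  have nb: "\<exists>w\<in>cl (F PX PY). anti g w" if "g \<in> F PX PY" for g
  proof -
    obtain i where i: "i < n - 1" "g = bond n i (l PX PY i) (l PX PY i)" using \<open>g \<in> F PX PY\<close> unfolding F_def by blast
    obtain j where j: "j < n - 1" "j = Suc i \<or> i = Suc j" using i(1) assms by (cases i) (auto, metis Suc_lessD)
    have "bond n j (l PX PY j) (l PX PY j) \<in> cl (F PX PY)" unfolding F_def using j(1) by (blast intro: cl.base)
    moreover have "anti g (bond n j (l PX PY j) (l PX PY j))"
      using i j by (auto simp: anti_bond_bond l_def)
    ultimately show ?thesis by blast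
  qed
  have "cl (F PX PY) \<inter> cl (F PY PX) = {}"
    using cl_anti[OF S nb] u(2) anti_sym by (metis disjoint_iff)
  then show ?thesis
    unfolding bond u(1) using so u(2)
    by (intro LA_union[where a = n and b = n] cl_strs S aclosed_cl so_alg_carrier)
qed

lemma LA_a8:
  assumes "3 \<le> n"
  shows "LA n (cl (set (bonds [(PX,PX),(PX,PZ)] n))) \<cong>\<^sub>L so_alg (2 * n - 1)"
proof -
  let ?N = "2 * n - 1" and ?B = "bonds [(PX,PX),(PX,PZ)] n"
  let ?g = "\<lambda>i. jw n (\<lambda>_. PY) (Suc i div 2) (if odd i then PX else PZ)"
  let ?G = "(\<lambda>i. vadd (?g i) (?g (Suc i))) ` {..<?N - 1}"
  have m: "majorana n ?N ?g"
    unfolding majorana_def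
  proof (intro conjI allI impI)
    fix i j assume ij: "i < ?N" "j < ?N" "i \<noteq> j"
    then have l: "Suc i div 2 < n" "Suc j div 2 < n" by auto
    show "anti (?g i) (?g j)"
    proof (cases "Suc i div 2" "Suc j div 2" rule: linorder_cases)
      case equal
      then have "odd i \<noteq> odd j" using ij(3) by presburger
      then show ?thesis unfolding equal by (auto simp: jw_anti_eq)
    qed (use l in \<open>simp_all add: jw_anti jw_anti'\<close>)
  qed auto
  have XX: "vadd (?g (2 * s)) (?g (Suc (2 * s))) = bond n s PX PX" if "Suc s < n" for s
    using jw_vadd_Suc[OF that] by simp
  have Y: "vadd (?g (Suc (2 * s))) (?g (Suc (Suc (2 * s)))) = bond n s PI PY" if "Suc s < n" for s
    using that by (simp add: bond_sg jw_vadd_eq)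
  have GXX: "bond n s PX PX \<in> ?G" if "Suc s < n" for s
    using that XX[OF that, symmetric] by (intro image_eqI[where x = "2 * s"]) auto
  have GY: "bond n s PI PY \<in> ?G" if "Suc s < n" for s
    using that Y[OF that, symmetric] by (intro image_eqI[where x = "Suc (2 * s)"]) auto
  have "cl ?G = cl (set ?B)"
  proof (rule cl_eqI)
    show "?G \<subseteq> cl (set ?B)"
    proof
      fix x assume "x \<in> ?G"
      then obtain i where i: "i < ?N - 1" "x = vadd (?g i) (?g (Suc i))" by blast
      define s where "s = i div 2"
      have s: "Suc s < n" using i(1) by (auto simp: s_def)
      have b: "bond n s PX PX \<in> cl (set ?B)" "bond n s PX PZ \<in> cl (set ?B)"
        using s by (auto intro!: cl.base bond_in)
      have "i = 2 * s \<or> i = Suc (2 * s)" unfolding s_def by presburger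
      then show "x \<in> cl (set ?B)"
      proof
        assume "i = 2 * s"
        then show ?thesis using i(2) XX[OF s] b(1) by simp
      next
        assume "i = Suc (2 * s)"
        then show ?thesis using i(2) Y[OF s] cl_bond[OF b] by simp
      qed
    qed
    have "bond n s PX PZ \<in> cl ?G" if "Suc s < n" for s
      using cl_bond[OF cl.base[OF GXX[OF that]] cl.base[OF GY[OF that]]] by simp
    then show "set ?B \<subseteq> cl ?G" unfolding bonds_subset using GXX by (auto intro: cl.base)
  qed
  then show ?thesis using LA_path[OF m] by simp
qed

lemma LA_a14:
  assumes "3 \<le> n"
  shows "LA n (cl (set (bonds [(PX,PX),(PY,PY),(PX,PY)] n))) \<cong>\<^sub>L so_alg (2 * n)"
proof -
  let ?N = "2 * n" and ?B = "bonds [(PX,PX),(PY,PY),(PX,PY)] n"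
  let ?g = "\<lambda>i. jw n (\<lambda>_. PZ) (i div 2) (if even i then PX else PY)"
  let ?G = "(\<lambda>i. vadd (?g i) (?g (Suc i))) ` {..<?N - 1}"
  have m: "majorana n ?N ?g"
    unfolding majorana_def
  proof (intro conjI allI impI)
    fix i j assume ij: "i < ?N" "j < ?N" "i \<noteq> j"
    then have l: "i div 2 < n" "j div 2 < n" by auto
    show "anti (?g i) (?g j)"
    proof (cases "i div 2" "j div 2" rule: linorder_cases)
      case equal
      then have "odd i \<noteq> odd j" using ij(3) by presburger
      then show ?thesis unfolding equal by (auto simp: jw_anti_eq)
    qed (use l in \<open>simp_all add: jw_anti jw_anti'\<close>)
  qed auto
  have Z: "vadd (?g (2 * s)) (?g (Suc (2 * s))) = sg n s PZ" if "s < n" for s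
    using that by (simp add: jw_vadd_eq)
  have XX: "vadd (?g (Suc (2 * s))) (?g (Suc (Suc (2 * s)))) = bond n s PX PX" if "Suc s < n" for s
    using jw_vadd_Suc[OF that] by simp
  have GXX: "bond n s PX PX \<in> cl ?G" if "Suc s < n" for s
    using that XX[OF that, symmetric] by (intro cl.base image_eqI[where x = "Suc (2 * s)"]) auto
  have GZ: "sg n s PZ \<in> cl ?G" if "s < n" for s
    using that Z[OF that, symmetric] by (intro cl.base image_eqI[where x = "2 * s"]) auto
  have "cl ?G = cl (set ?B)"
  proof (rule cl_eqI)
    have b: "bond n s PX PX \<in> cl (set ?B)" "bond n s PY PY \<in> cl (set ?B)" "bond n s PX PY \<in> cl (set ?B)" if "Suc s < n" for s
      using that by (auto intro!: cl.base bond_in)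
    have bz: "sg n s PZ \<in> cl (set ?B)" if "s < n" for s
    proof (cases "Suc s < n")
      case True
      then show ?thesis using cl_bond[OF b(3,2)[OF True]] by (simp add: bond_sg)
    next
      case False
      then obtain t where t: "s = Suc t" using assms that by (cases s) auto
      then show ?thesis using cl_bond[OF b(1,3)[of t]] that by (simp add: bond_sg)
    qed
    show "?G \<subseteq> cl (set ?B)"
    proof
      fix x assume "x \<in> ?G"
      then obtain i where i: "i < ?N - 1" "x = vadd (?g i) (?g (Suc i))" by blast
      define s where "s = i div 2"
      have "i = 2 * s \<or> i = Suc (2 * s)" unfolding s_def by presburger
      then show "x \<in> cl (set ?B)"
      proof
        assume e: "i = 2 * s"
        then show ?thesis using i Z[of s] bz[of s] by simp
      next
        assume e: "i = Suc (2 * s)"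
        then show ?thesis using i XX[of s] b(1)[of s] by simp
      qed
    qed
    have XY: "bond n s PX PY \<in> cl ?G" if "Suc s < n" for s
      using cl_bond[OF GXX[OF that], of PI PZ] GZ[of "Suc s"] that by (simp add: bond_sg)
    have "bond n s PY PY \<in> cl ?G" if "Suc s < n" for s
      using cl_bond[OF XY[OF that], of PZ PI] GZ[of s] that by (simp add: bond_sg)
    then show "set ?B \<subseteq> cl ?G" unfolding bonds_subset using GXX XY by auto
  qed
  then show ?thesis using LA_path[OF m] by simp
qed

lemma LA_b3:
  "3 \<le> n \<Longrightarrow> LA n (cl (set (bonds [(PX,PI),(PY,PI),(PI,PX),(PI,PY)] n))) \<cong>\<^sub>L dpow (su_alg 2) n"
proof -
  define T where "T n = {sg n j p |j p. j < n \<and> p \<noteq> PI}" for n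
  have sgT: "sg n j p \<in> T n" if "j < n" "p \<noteq> PI" for n j p using that unfolding T_def by blast
  have TS: "T n \<subseteq> strs n" for n by (auto simp: T_def)
  have ac: "aclosed (T n)" for n
  proof -
    have "vadd (sg n i p) (sg n j q) \<in> T n"
      if "i < n" "j < n" "anti (sg n i p) (sg n j q)" for i j p q
    proof -
      have "i = j" "an p q" using that by (simp_all add: anti_sg_iff)
      then have "vadd (sg n i p) (sg n j q) = sg n i (pm p q)" "pm p q \<noteq> PI"
        by (simp add: sg_def vadd_append vadd_zero) (use \<open>an p q\<close> in \<open>cases p; cases q; simp\<close>)
      then show ?thesis using that(1) unfolding T_def by blast
    qed
    then show ?thesis unfolding aclosed_def T_def by blast
  qed
  have one: "LA n {p # pzero k |p. p \<noteq> PI} \<cong>\<^sub>L su_alg 2" if "n = Suc k" for n k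
  proof -
    let ?V = "{p # pzero k |p. True}" and ?S = "{p # pzero k |p. p \<noteq> PI}"
    have iso: "LA n ?S \<cong>\<^sub>L LA 1 ((\<lambda>v. [hd v]) ` ?S)"
    proof (rule LA_iso[where V = ?V])
      show "aclosed ?S" by (auto simp: aclosed_def vadd_zero)
    qed (auto simp: that vadd_zero inj_on_def)
    have "(\<lambda>v. [hd v]) ` ?S = strs 1 - {pzero 1}"
    proof -
      have "?S = (\<lambda>p. p # pzero k) ` {p. p \<noteq> PI}" by auto
      then have "(\<lambda>v. [hd v]) ` ?S = (\<lambda>p. [p]) ` {p. p \<noteq> PI}" by (simp add: image_image)
      then show ?thesis by (auto simp: image_iff length_Suc_conv)
    qed
    then show ?thesis using iso su_alg_LA[of 1] by simp
  qed
  have step: "T (Suc k) = {p # pzero k |p. p \<noteq> PI} \<union> (#) PI ` T k" for k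
  proof
    show "T (Suc k) \<subseteq> {p # pzero k |p. p \<noteq> PI} \<union> (#) PI ` T k"
    proof
      fix x assume "x \<in> T (Suc k)"
      then obtain j p where "x = sg (Suc k) j p" "j < Suc k" "p \<noteq> PI" unfolding T_def by blast
      then show "x \<in> {p # pzero k |p. p \<noteq> PI} \<union> (#) PI ` T k" unfolding T_def by (cases j) auto
    qed
    show "{p # pzero k |p. p \<noteq> PI} \<union> (#) PI ` T k \<subseteq> T (Suc k)"
    proof (intro Un_least subsetI)
      fix x assume "x \<in> {p # pzero k |p. p \<noteq> PI}"
      then obtain p where "x = sg (Suc k) 0 p" "p \<noteq> PI" by auto
      then show "x \<in> T (Suc k)" unfolding T_def by blast
    next
      fix x assume "x \<in> (#) PI ` T k"
      then obtain j p where "x = sg (Suc k) (Suc j) p" "j < k" "p \<noteq> PI" unfolding T_def by auto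
      then show "x \<in> T (Suc k)" unfolding T_def by blast
    qed
  qed
  have T: "LA (Suc k) (T (Suc k)) \<cong>\<^sub>L dpow (su_alg 2) (Suc k)" for k
  proof (induct k)
    case 0
    have "T (Suc 0) = {p # pzero 0 |p. p \<noteq> PI}" unfolding step by (simp add: T_def)
    then show ?case using one[of "Suc 0" 0] by simp
  next
    case (Suc k)
    let ?n = "Suc (Suc k)"
    have su: "su_alg 2 \<subseteq> carrier_mat 2 2" by (auto simp: su_alg_def u_alg_def)
    have "LA ?n ((#) PI ` T (Suc k)) \<cong>\<^sub>L LA (Suc k) (tl ` (#) PI ` T (Suc k))"
    proof (rule LA_iso[where V = "(#) PI ` strs (Suc k)"])
      show "aclosed ((#) PI ` T (Suc k))" using ac[of "Suc k"] unfolding aclosed_def by auto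
    qed (use TS in \<open>auto simp: image_iff inj_on_def\<close>)
    then have t: "LA ?n ((#) PI ` T (Suc k)) \<cong>\<^sub>L dpow (su_alg 2) (Suc k)"
      using lie_iso_trans[OF _ Suc] by (simp add: image_image)
    have "LA ?n ({p # pzero (Suc k) |p. p \<noteq> PI} \<union> (#) PI ` T (Suc k)) \<cong>\<^sub>L su_alg 2 \<oplus>\<^sub>L dpow (su_alg 2) (Suc k)"
    proof (rule LA_union[where a = 2 and b = "Suc k * 2"])
      show "aclosed {p # pzero (Suc k) |p. p \<noteq> PI}" by (auto simp: aclosed_def vadd_zero)
      show "aclosed ((#) PI ` T (Suc k))" using ac[of "Suc k"] unfolding aclosed_def by auto
      show "dpow (su_alg 2) (Suc k) \<subseteq> carrier_mat (Suc k * 2) (Suc k * 2)" by (rule dpow_carrier[OF su])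
      show "LA ?n {p # pzero (Suc k) |p. p \<noteq> PI} \<cong>\<^sub>L su_alg 2" by (rule one) simp
    qed (use TS[of "Suc k"] t su in \<open>auto simp del: replicate.simps\<close>)
    then show ?case unfolding step[of "Suc k"] by simp
  qed
  assume n: "3 \<le> n"
  have "cl (set (bonds [(PX,PI),(PY,PI),(PI,PX),(PI,PY)] n)) = T n"
  proof
    show "cl (set (bonds [(PX,PI),(PY,PI),(PI,PX),(PI,PY)] n)) \<subseteq> T n"
      by (rule cl_least[OF _ ac]) (use sgT Suc_lessD in \<open>auto simp: bonds_subset bond_sg\<close>)
    show "T n \<subseteq> cl (set (bonds [(PX,PI),(PY,PI),(PI,PX),(PI,PY)] n))" (is "_ \<subseteq> ?C")
    proof
      fix x assume "x \<in> T n"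
      then obtain j p where x: "x = sg n j p" "j < n" "p \<noteq> PI" unfolding T_def by blast
      have b: "bond n s p PI \<in> ?C" "bond n s PI p \<in> ?C" if "p = PX \<or> p = PY" "Suc s < n" for s p
        using that by (auto intro!: cl.base bond_in)
      have b: "bond n s p PI \<in> ?C" "bond n s PI p \<in> ?C" if "p \<noteq> PI" "Suc s < n" for s p
        using that b[of p s] b[of PX s] b[of PY s] cl_bond[of n s PX PI _ PY PI] cl_bond[of n s PI PX _ PI PY]
        by (cases p; simp)+
      show "x \<in> ?C"
      proof (cases "Suc j < n")
        case True
        then show ?thesis using b(1)[of p j] x by (simp add: bond_sg)
      next
        case False
        then obtain t where "j = Suc t" using n x(2) by (cases j) auto
        then show ?thesis using b(2)[of p t] x by (simp add: bond_sg)
      qed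
    qed
  qed
  then show ?thesis using T[of "n - 1"] n by simp
qed

lemma LA_add_central:
  assumes n: "3 \<le> n" and L: "LA n (cl (set (bonds G n))) \<cong>\<^sub>L L" "L \<subseteq> carrier_mat a a"
    and G: "\<And>A B. (A, B) \<in> set G \<Longrightarrow> A = PX \<and> (\<exists>C. (PX, C) \<in> set G \<and> an B C)"
    and eq: "set G = insert (PX, PZ) R" "set H = R \<union> {(PX, PI), (PI, PX)}" "(PX, PY) \<in> R"
  shows "LA n (cl (set (bonds H n))) \<cong>\<^sub>L L \<oplus>\<^sub>L u1"
proof -
  let ?G = "set (bonds G n)" and ?H = "set (bonds H n)"
  let ?z = "sg n 0 PX"
  have z: "{?z} \<subseteq> strs n" using n by simp
  have com: "\<not> anti v w" if "v \<in> ?G" "w \<in> {?z}" for v w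
  proof -
    have "?G \<subseteq> {v. \<not> anti v ?z}" unfolding bonds_subset using n by (auto simp: anti_bond_sg dest: G)
    then show ?thesis using that by auto
  qed
  have nb: "\<exists>w\<in>cl ?G. anti g w" if "g \<in> ?G" for g
  proof -
    have "?G \<subseteq> {g. \<exists>w\<in>cl ?G. anti g w}"
      unfolding bonds_subset
    proof (clarify)
      fix A B s assume AB: "(A, B) \<in> set G" "Suc s < n"
      then obtain C where C: "A = PX" "(PX, C) \<in> set G" "an B C" using G by blast
      then have "bond n s PX C \<in> cl ?G" "anti (bond n s A B) (bond n s PX C)"
        using AB by (auto simp: bond_anti intro: cl.base bond_in)
      then show "\<exists>w\<in>cl ?G. anti (bond n s A B) w" by blast
    qed
    then show ?thesis using that by blast
  qed
  have "cl ?H = cl (?G \<union> {?z})"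
  proof (rule cl_eqI)
    have b: "bond n s A B \<in> cl (?G \<union> {?z})" if "(A, B) \<in> set G" "Suc s < n" for s A B
      using that bond_in by (auto intro: cl.base)
    have IX: "bond n s PI PX \<in> cl (?G \<union> {?z})" if "Suc s < n" for s
      using cl_bond[OF b b, of PX PY s PX PZ] that eq by simp
    have XI: "bond n s PX PI \<in> cl (?G \<union> {?z})" if s: "Suc s < n" for s
    proof (cases s)
      case 0
      then show ?thesis using s by (simp add: bond_sg cl.base)
    next
      case (Suc t)
      then show ?thesis using s IX[of t] by (simp add: bond_sg)
    qed
    show "?H \<subseteq> cl (?G \<union> {?z})" unfolding bonds_subset eq(2) using IX XI b eq(1) by auto
    have h: "bond n s A B \<in> cl ?H" if "(A, B) \<in> set H" "Suc s < n" for s A B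
      using that bond_in by (auto intro: cl.base)
    have "bond n s PX PZ \<in> cl ?H" if "Suc s < n" for s
      using cl_bond[OF h h, of PX PY s PI PX] that eq by simp
    then have "?G \<subseteq> cl ?H" unfolding bonds_subset eq(1) using h eq(2) by auto
    moreover have "?z \<in> cl ?H" using h[of PX PI 0] n eq(2) by (simp add: bond_sg)
    ultimately show "?G \<union> {?z} \<subseteq> cl ?H" by simp
  qed
  also have "\<dots> = cl ?G \<union> {?z}"
    using cl_union(1)[OF bonds_strs z com] cl_commuting[of "{?z}"] by (simp add: sg_def anti_append)
  finally have eqH: "cl ?H = cl ?G \<union> {?z}" .
  have cz: "\<not> anti v ?z" if "v \<in> cl ?G" for v
    using cl_union(2)[OF bonds_strs z com that] by (auto intro: cl.base)
  show ?thesis unfolding eqH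
  proof (rule LA_union[where a = a and b = 1])
    show "cl ?G \<inter> {?z} = {}"
      using cl_anti[OF bonds_strs nb, of ?z] cz anti_sym by blast
    show "aclosed {?z}" by (simp add: aclosed_def sg_def anti_append)
    show "LA n {?z} \<cong>\<^sub>L u1" using n by (intro LA_single) simp
  qed (use L u1_carrier z cz cl_strs[OF bonds_strs] aclosed_cl in auto)
qed

lemma LA_b2:
  assumes "3 \<le> n"
  shows "LA n (cl (set (bonds [(PX,PY),(PX,PI),(PI,PX)] n))) \<cong>\<^sub>L sp_alg (2 ^ (n - 2)) \<oplus>\<^sub>L u1"
proof (rule LA_add_central[OF assms LA_9[OF assms], where R = "{(PX, PY)}"])
  show "sp_alg (2 ^ (n - 2)) \<subseteq> carrier_mat (2 * 2 ^ (n - 2)) (2 * 2 ^ (n - 2))"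
    by (auto simp: sp_alg_def su_alg_def u_alg_def)
qed auto

lemma LA_b4:
  assumes "3 \<le> n"
  shows "LA n (cl (set (bonds [(PX,PX),(PX,PY),(PX,PI),(PI,PX)] n)))
    \<cong>\<^sub>L su_alg (2 ^ (n - 1)) \<oplus>\<^sub>L su_alg (2 ^ (n - 1)) \<oplus>\<^sub>L u1"
proof -
  let ?N = "2 ^ (n - 1) :: nat"
  have su: "su_alg ?N \<subseteq> carrier_mat ?N ?N" by (auto simp: su_alg_def u_alg_def)
  have "LA n (cl (set (bonds [(PX,PX),(PX,PY),(PX,PI),(PI,PX)] n)))
    \<cong>\<^sub>L (su_alg ?N \<oplus>\<^sub>L su_alg ?N) \<oplus>\<^sub>L u1"
    by (rule LA_add_central[OF assms LA_15[OF assms] dsum_carrier[OF su su], where R = "{(PX, PX), (PX, PY)}"])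
      auto
  then show ?thesis unfolding dsum_assoc[OF su su u1_carrier] .
qed

lemma aclosed_nonzero: "aclosed (strs n - {pzero n})"
  unfolding aclosed_def
proof (intro ballI impI)
  fix v w assume v: "v \<in> strs n - {pzero n}" "w \<in> strs n - {pzero n}" "anti v w"
  then have "anti (vadd v w) w" by (simp add: anti_vadd)
  then show "vadd v w \<in> strs n - {pzero n}" using v by auto
qed

lemma cl_full_mono:
  assumes "G \<in> {G12, G17, G18, G22}" "4 \<le> n" "set G \<subseteq> set H" "(PI, PI) \<notin> set H"
  shows "cl (set (bonds H n)) = strs n - {pzero n}"
proof
  show "strs n - {pzero n} \<subseteq> cl (set (bonds H n))"
    unfolding cl_full[OF assms(1,2), symmetric]
    using bonds_mono[OF assms(3)] by (intro cl_mono) (blast intro: cl.base)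
  have "pzero n \<notin> set (bonds H n)"
  proof
    assume "pzero n \<in> set (bonds H n)"
    then obtain j k A B where g: "pzero n = pzero j @ A # B # pzero k" "(A, B) \<in> set H"
      unfolding set_bonds by auto
    then have "A \<in> set (pzero n)" "B \<in> set (pzero n)" by simp_all
    then show False using g(2) assms(4) by auto
  qed
  then show "cl (set (bonds H n)) \<subseteq> strs n - {pzero n}"
    using bonds_strs[of H n] by (intro cl_least aclosed_nonzero) auto
qed

lemma cl_16:
  assumes "4 \<le> n"
  shows "cl (set (bonds [(PX,PY),(PY,PX),(PY,PZ),(PZ,PY)] n)) = {v \<in> strs n. oddY v}"
proof
  show "cl (set (bonds [(PX,PY),(PY,PX),(PY,PZ),(PZ,PY)] n)) \<subseteq> {v \<in> strs n. oddY v}"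
    by (rule cl_least) (auto simp: set_bonds aclosed_def oddY_vadd)
  show "{v \<in> strs n. oddY v} \<subseteq> cl (set (bonds [(PX,PY),(PY,PX),(PY,PZ),(PZ,PY)] n))"
    unfolding cl_odd[OF assms, symmetric]
    using bonds_mono[of G11 "[(PX,PY),(PY,PX),(PY,PZ),(PZ,PY)]"] by (intro cl_mono) (force intro: cl.base)
qed

lemma aa_LA: "a_gens k = set G \<Longrightarrow> aa k n = LA n (cl (set (bonds G n)))"
  by (simp add: aa_def chain_alg_LA)

lemma bb_LA: "b_gens l = set G \<Longrightarrow> bb l n = LA n (cl (set (bonds G n)))"
  by (simp add: bb_def chain_alg_LA)

lemma aa_eqs:
  "aa 0 n = LA n (cl (set (bonds [(PX,PX)] n)))"
  "aa 1 n = LA n (cl (set (bonds [(PX,PY)] n)))"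
  "aa 2 n = LA n (cl (set (bonds (map (\<lambda>A. (A, kappa A)) [PX,PY]) n)))"
  "aa 3 n = LA n (cl (set (bonds G3 n)))"
  "aa 4 n = LA n (cl (set (bonds (map (\<lambda>A. (A, A)) [PX,PY]) n)))"
  "aa 5 n = LA n (cl (set (bonds G5 n)))"
  "aa 6 n = LA n (cl (set (bonds (map (\<lambda>A. (A, tau A)) [PX,PY,PZ]) n)))"
  "aa 7 n = LA n (cl (set (bonds (map (\<lambda>A. (A, A)) [PX,PY,PZ]) n)))"
  "aa 8 n = LA n (cl (set (bonds [(PX,PX),(PX,PZ)] n)))"
  "aa 9 n = LA n (cl (set (bonds [(PX,PY),(PX,PZ)] n)))"
  "aa 10 n = LA n (cl (set (bonds (map (\<lambda>A. (A, rot A)) [PX,PY,PZ]) n)))"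
  "aa 11 n = LA n (cl (set (bonds G11 n)))"
  "aa 12 n = LA n (cl (set (bonds G12 n)))"
  "aa 13 n = LA n (cl (set (bonds G13 n)))"
  "aa 14 n = LA n (cl (set (bonds [(PX,PX),(PY,PY),(PX,PY)] n)))"
  "aa 15 n = LA n (cl (set (bonds [(PX,PX),(PX,PY),(PX,PZ)] n)))"
  "aa 16 n = LA n (cl (set (bonds [(PX,PY),(PY,PX),(PY,PZ),(PZ,PY)] n)))"
  "aa 17 n = LA n (cl (set (bonds G17 n)))"
  "aa 18 n = LA n (cl (set (bonds G18 n)))"
  "aa 19 n = LA n (cl (set (bonds [(PX,PX),(PX,PY),(PZ,PX),(PY,PZ)] n)))"
  "aa 20 n = LA n (cl (set (bonds [(PX,PX),(PY,PY),(PZ,PZ),(PZ,PY)] n)))"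
  "aa 21 n = LA n (cl (set (bonds [(PX,PX),(PY,PY),(PX,PY),(PZ,PX)] n)))"
  "aa 22 n = LA n (cl (set (bonds G22 n)))"
  by (rule aa_LA, simp add: a_gens_def)+

lemma bb_eqs:
  "bb 0 n = LA n (cl (set (bonds [(PX,PI),(PI,PX)] n)))"
  "bb 1 n = LA n (cl (set (bonds [(PX,PX),(PX,PI),(PI,PX)] n)))"
  "bb 2 n = LA n (cl (set (bonds [(PX,PY),(PX,PI),(PI,PX)] n)))"
  "bb 3 n = LA n (cl (set (bonds [(PX,PI),(PY,PI),(PI,PX),(PI,PY)] n)))"
  "bb 4 n = LA n (cl (set (bonds [(PX,PX),(PX,PY),(PX,PI),(PI,PX)] n)))"
  by (rule bb_LA, simp add: b_gens_def)+

lemma LA_cl_sym: "LA n (cl (set (bonds G n))) \<cong>\<^sub>L L \<Longrightarrow> L \<cong>\<^sub>L LA n (cl (set (bonds G n)))"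
  by (rule lie_iso_sym[OF LA_subalg[OF cl_strs[OF bonds_strs] aclosed_cl]])

theorem theorem1:
  fixes n :: nat
  assumes "n \<ge> 3"
  shows
    "aa 0 n \<cong>\<^sub>L dpow u1 (n - 1)
   \<and> aa 1 n \<cong>\<^sub>L so_alg n
   \<and> aa 2 n \<cong>\<^sub>L aa 4 n \<and> aa 2 n \<cong>\<^sub>L so_alg n \<oplus>\<^sub>L so_alg n \<and> aa 4 n \<cong>\<^sub>L so_alg n \<oplus>\<^sub>L so_alg n
   \<and> (n mod 8 = 0 \<longrightarrow> aa 3 n \<cong>\<^sub>L dpow (so_alg (2 ^ (n - 2))) 4)
   \<and> (n mod 8 \<in> {1, 7} \<longrightarrow> aa 3 n \<cong>\<^sub>L so_alg (2 ^ (n - 1)))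
   \<and> (n mod 8 \<in> {2, 6} \<longrightarrow> aa 3 n \<cong>\<^sub>L dpow (su_alg (2 ^ (n - 2))) 2)
   \<and> (n mod 8 \<in> {3, 5} \<longrightarrow> aa 3 n \<cong>\<^sub>L sp_alg (2 ^ (n - 2)))
   \<and> (n mod 8 = 4 \<longrightarrow> aa 3 n \<cong>\<^sub>L dpow (sp_alg (2 ^ (n - 3))) 4)
   \<and> (n mod 6 = 0 \<longrightarrow> aa 5 n \<cong>\<^sub>L dpow (so_alg (2 ^ (n - 2))) 4)
   \<and> (n mod 6 \<in> {1, 5} \<longrightarrow> aa 5 n \<cong>\<^sub>L so_alg (2 ^ (n - 1)))
   \<and> (n mod 6 \<in> {2, 4} \<longrightarrow> aa 5 n \<cong>\<^sub>L dpow (su_alg (2 ^ (n - 2))) 2)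
   \<and> (n mod 6 = 3 \<longrightarrow> aa 5 n \<cong>\<^sub>L sp_alg (2 ^ (n - 2)))
   \<and> aa 6 n \<cong>\<^sub>L aa 7 n \<and> aa 7 n \<cong>\<^sub>L aa 10 n
   \<and> (odd n \<longrightarrow> (\<forall>k\<in>{6, 7, 10}. aa k n \<cong>\<^sub>L su_alg (2 ^ (n - 1))))
   \<and> (even n \<and> n \<ge> 4 \<longrightarrow> (\<forall>k\<in>{6, 7, 10}. aa k n \<cong>\<^sub>L dpow (su_alg (2 ^ (n - 2))) 4))
   \<and> aa 8 n \<cong>\<^sub>L so_alg (2 * n - 1)
   \<and> aa 9 n \<cong>\<^sub>L sp_alg (2 ^ (n - 2))
   \<and> (n \<ge> 4 \<longrightarrow> aa 11 n = so_alg (2 ^ n) \<and> aa 16 n = so_alg (2 ^ n))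
   \<and> (n \<ge> 4 \<longrightarrow> (\<forall>k\<in>{12, 17, 18, 19, 21, 22}. aa k n = su_alg (2 ^ n)))
   \<and> aa 13 n = aa 20 n \<and> aa 20 n \<cong>\<^sub>L aa 15 n
   \<and> aa 13 n \<cong>\<^sub>L su_alg (2 ^ (n - 1)) \<oplus>\<^sub>L su_alg (2 ^ (n - 1))
   \<and> aa 15 n \<cong>\<^sub>L su_alg (2 ^ (n - 1)) \<oplus>\<^sub>L su_alg (2 ^ (n - 1))
   \<and> aa 14 n \<cong>\<^sub>L so_alg (2 * n)
   \<and> bb 0 n \<cong>\<^sub>L dpow u1 n
   \<and> bb 1 n \<cong>\<^sub>L dpow u1 (2 * n - 1)
   \<and> bb 2 n \<cong>\<^sub>L sp_alg (2 ^ (n - 2)) \<oplus>\<^sub>L u1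
   \<and> bb 3 n \<cong>\<^sub>L dpow (su_alg 2) n
   \<and> bb 4 n \<cong>\<^sub>L su_alg (2 ^ (n - 1)) \<oplus>\<^sub>L su_alg (2 ^ (n - 1)) \<oplus>\<^sub>L u1"
proof -
  have a24: "aa 2 n \<cong>\<^sub>L aa 4 n"
    unfolding aa_eqs by (rule sw_bonds_iso[OF autom_cases(3)]) auto
  have a4: "aa 4 n \<cong>\<^sub>L so_alg n \<oplus>\<^sub>L so_alg n"
    unfolding aa_eqs using LA_a4[OF assms] by simp
  have a67: "aa 6 n \<cong>\<^sub>L aa 7 n"
    unfolding aa_eqs by (rule sw_bonds_iso[OF autom_cases(1)]) auto
  have a107: "aa 10 n \<cong>\<^sub>L aa 7 n"
    unfolding aa_eqs by (rule sw_bonds_iso[OF autom_cases(2)]) auto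
  then have a710: "aa 7 n \<cong>\<^sub>L aa 10 n"
    unfolding aa_eqs by (rule LA_cl_sym)
  have a7: "odd n \<Longrightarrow> aa 7 n \<cong>\<^sub>L su_alg (2 ^ (n - 1))" "even n \<Longrightarrow> aa 7 n \<cong>\<^sub>L dpow (su_alg (2 ^ (n - 2))) 4"
    unfolding aa_eqs using LA_7_odd[OF assms] LA_7_even[OF assms] by simp_all
  have a6710: "\<forall>k\<in>{6, 7, 10}. aa k n \<cong>\<^sub>L L" if "aa 7 n \<cong>\<^sub>L L" for L
    using a67 a107 that lie_iso_trans by blast
  have a3: "aa 3 n \<cong>\<^sub>L L" if "LA n (Sq tau n) \<cong>\<^sub>L L" for L
    unfolding aa_eqs using lie_iso_trans[OF LA_3(1)[OF assms] that] .
  have a5: "aa 5 n \<cong>\<^sub>L L" if "LA n (Sq rot n) \<cong>\<^sub>L L" for L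
    unfolding aa_eqs using lie_iso_trans[OF LA_5(1)[OF assms] that] .
  have a3_cases: "n mod 8 = 0 \<longrightarrow> aa 3 n \<cong>\<^sub>L dpow (so_alg (2 ^ (n - 2))) 4"
    "n mod 8 \<in> {1, 7} \<longrightarrow> aa 3 n \<cong>\<^sub>L so_alg (2 ^ (n - 1))"
    "n mod 8 \<in> {2, 6} \<longrightarrow> aa 3 n \<cong>\<^sub>L dpow (su_alg (2 ^ (n - 2))) 2"
    "n mod 8 \<in> {3, 5} \<longrightarrow> aa 3 n \<cong>\<^sub>L sp_alg (2 ^ (n - 2))"
    "n mod 8 = 4 \<longrightarrow> aa 3 n \<cong>\<^sub>L dpow (sp_alg (2 ^ (n - 3))) 4"
    using arf_tau[OF assms] odd_mod(1)[of n] LA_Sq_types[OF LA_3(2)[OF assms] assms]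
    by (auto intro!: a3)
  have a5_cases: "n mod 6 = 0 \<longrightarrow> aa 5 n \<cong>\<^sub>L dpow (so_alg (2 ^ (n - 2))) 4"
    "n mod 6 \<in> {1, 5} \<longrightarrow> aa 5 n \<cong>\<^sub>L so_alg (2 ^ (n - 1))"
    "n mod 6 \<in> {2, 4} \<longrightarrow> aa 5 n \<cong>\<^sub>L dpow (su_alg (2 ^ (n - 2))) 2"
    "n mod 6 = 3 \<longrightarrow> aa 5 n \<cong>\<^sub>L sp_alg (2 ^ (n - 2))"
    using arf_rot[OF assms] odd_mod(2)[of n] LA_Sq_types[OF LA_5(2)[OF assms] assms]
    by (auto intro!: a5)
  have odd: "n \<ge> 4 \<longrightarrow> aa 11 n = so_alg (2 ^ n) \<and> aa 16 n = so_alg (2 ^ n)"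
    unfolding aa_eqs so_alg_LA using cl_odd cl_16 by simp
  have full: "n \<ge> 4 \<longrightarrow> (\<forall>k\<in>{12, 17, 18, 19, 21, 22}. aa k n = su_alg (2 ^ n))"
    using cl_full_mono[of G12 n G12] cl_full_mono[of G17 n G17] cl_full_mono[of G18 n G18] cl_full_mono[of G22 n G22]
      cl_full_mono[of G12 n "[(PX,PX),(PX,PY),(PZ,PX),(PY,PZ)]"] cl_full_mono[of G17 n "[(PX,PX),(PY,PY),(PX,PY),(PZ,PX)]"]
    by (simp add: aa_eqs su_alg_LA)
  have a13: "aa 13 n = aa 20 n" unfolding aa_eqs cl_20[OF assms] ..
  have d13: "aa 13 n \<cong>\<^sub>L su_alg (2 ^ (n - 1)) \<oplus>\<^sub>L su_alg (2 ^ (n - 1))"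
    and d15: "aa 15 n \<cong>\<^sub>L su_alg (2 ^ (n - 1)) \<oplus>\<^sub>L su_alg (2 ^ (n - 1))"
    unfolding aa_eqs by (rule LA_13[OF assms] LA_15[OF assms])+
  have "aa 20 n \<cong>\<^sub>L aa 15 n"
    using lie_iso_trans[OF d13] LA_cl_sym[OF d15[unfolded aa_eqs]] unfolding a13 aa_eqs(16) by blast
  have "aa 2 n \<cong>\<^sub>L so_alg n \<oplus>\<^sub>L so_alg n" by (rule lie_iso_trans[OF a24 a4])
  have "aa 0 n \<cong>\<^sub>L dpow u1 (n - 1)" "aa 1 n \<cong>\<^sub>L so_alg n" "aa 8 n \<cong>\<^sub>L so_alg (2 * n - 1)"
    "aa 9 n \<cong>\<^sub>L sp_alg (2 ^ (n - 2))" "aa 14 n \<cong>\<^sub>L so_alg (2 * n)"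
    unfolding aa_eqs by (rule LA_a0[OF assms] LA_a1 LA_a8[OF assms] LA_9[OF assms] LA_a14[OF assms])+
  have "bb 0 n \<cong>\<^sub>L dpow u1 n" "bb 1 n \<cong>\<^sub>L dpow u1 (2 * n - 1)" "bb 2 n \<cong>\<^sub>L sp_alg (2 ^ (n - 2)) \<oplus>\<^sub>L u1"
    "bb 3 n \<cong>\<^sub>L dpow (su_alg 2) n" "bb 4 n \<cong>\<^sub>L su_alg (2 ^ (n - 1)) \<oplus>\<^sub>L su_alg (2 ^ (n - 1)) \<oplus>\<^sub>L u1"
    unfolding bb_eqs by (rule LA_b0[OF assms] LA_b1[OF assms] LA_b2[OF assms] LA_b3[OF assms] LA_b4[OF assms])+
  have "odd n \<longrightarrow> (\<forall>k\<in>{6, 7, 10}. aa k n \<cong>\<^sub>L su_alg (2 ^ (n - 1)))"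
    "even n \<and> n \<ge> 4 \<longrightarrow> (\<forall>k\<in>{6, 7, 10}. aa k n \<cong>\<^sub>L dpow (su_alg (2 ^ (n - 2))) 4)"
    using a7 a6710 by blast+
  show ?thesis by (intro conjI; fact)
qed

end
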